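(* Suppose that the numbers $\alpha_j=\frac1\pi\int_0^\pi p_j(t)\,dt$, $j=1,\dots,m$, satisfy: (i) $\alpha_j\in\mathbb R$ for $j=1,\dots,m$; (ii) $\alpha_j\not\equiv\alpha_k \pmod 1$ for $j,k\in\{1,\dots,m\}$, $j\neq k$; (iii) $\alpha_m=0$. Then the boundary value problem $L$ has a countable set of eigenvalues, which can be numbered as $\{\lambda_{nk}\}_{(n,k)\in\mathcal I}$, counting with their multiplicities, where $$\mathcal I:=\{(n,k): n\in\mathbb Z,\ k=1,\dots,m+1\}\cup\{(n,k): n\in\mathbb Z\setminus\{0\},\ k=m+2,\dots,2m\},$$ and which satisfy $$\lambda_{nk}=2n+\beta_k+O(|n|^{-1}),\qquad |n|\to\infty,\quad k=1,\dots,2m,$$ where $\beta_k\in(-1,1)$ are distinct numbers for $k=1,\dots,2m-1$, $\beta_{2m}=0$, and $\beta_k\not\equiv\alpha_j\pmod 1$ for $k=1,\dots,2m$, $j=1,\dots,m-1$.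
   Context: Let $m\ge 2$ be an integer. The graph $G$ has vertices $v_1,\dots,v_m$ and edges $e_1,\dots,e_m$, all of length $\pi$; for $j\le m-1$ the edge $e_j$ joins the boundary vertex $v_j$ (at $x_j=0$) to the internal vertex $v_m$ (at $x_j=\pi$), and $e_m$ is a loop at $v_m$ (both $x_m=0$ and $x_m=\pi$ correspond to $v_m$). The boundary value problem $L$ is $$-y_j''(x_j)+q_j(x_j)y_j(x_j)+2\lambda p_j(x_j)y_j(x_j)=\lambda^2y_j(x_j),\quad x_j\in(0,\pi),\ j=1,\dots,m,$$ $$y_j(0)=0,\ j=1,\dots,m-1;\qquad y_m(0)=y_j(\pi),\ j=1,\dots,m;\qquad y_m'(0)=\sum_{j=1}^m y_j'(\pi).$$ Here $\lambda$ is the spectral parameter, $p_j\in AC[0,\pi]$ (absolutely continuous) and $q_j\in L(0,\pi)$ (integrable) are complex-valued, and solutions $y_j$ belong to $W_1^2[0,\pi]$ (i.e. $y_j,y_j'$ are absolutely continuous). An eigenvalue is a $\lambda\in\mathbb C$ for which $L$ has a nontrivial solution $y=[y_j]_{j=1}^m$. Let $S_j(x_j,\lambda)$, $C_j(x_j,\lambda)$ be the solutions of the $j$-th equation with $S_j(0,\lambda)=C_j'(0,\lambda)=0$, $S_j'(0,\lambda)=C_j(0,\lambda)=1$, and let $d_m(\lambda)=S_m'(\pi,\lambda)+C_m(\pi,\lambda)-2$. The eigenvalues of $L$ are counted with multiplicity as the zeros of the entire characteristic function $$\Delta(\lambda)=\sum_{j=1}^{m-1}S_j'(\pi,\lambda)\prod_{k=1,\,k\ne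 j}^m S_k(\pi,\lambda)+d_m(\lambda)\prod_{k=1}^{m-1}S_k(\pi,\lambda).$$ The notation $a\equiv b\pmod c$ means $\frac{a-b}{c}\in\mathbb Z$. *)

theory Defs
  imports "HOL-Complex_Analysis.Complex_Analysis"
begin

definition abs_cont_on :: "real \<Rightarrow> real \<Rightarrow> (real \<Rightarrow> complex) \<Rightarrow> bool" where
  "abs_cont_on a b f \<longleftrightarrow>
     (\<forall>\<epsilon>>0. \<exists>\<delta>>0. \<forall>(n::nat) u v.
        (\<forall>i<n. a \<le> u i \<and> u i \<le> v i \<and> v i \<le> b) \<longrightarrow>
        disjoint_family_on (\<lambda>i. {u i<..<v i}) {..<n} \<longrightarrow>
        (\<Sum>i<n. v i - u i) < \<delta> \<longrightarrow>
        (\<Sum>i<n. norm (f (v i) - f (u i))) < \<epsilon>)"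

(* The first derivative on [0,pi], one-sided at the two end points. *)
definition D1 :: "(real \<Rightarrow> complex) \<Rightarrow> real \<Rightarrow> complex" where
  "D1 y x = vector_derivative y (at x within {0..pi})"

definition W21 :: "(real \<Rightarrow> complex) \<Rightarrow> bool" where
  "W21 y \<longleftrightarrow> y differentiable_on {0..pi} \<and> abs_cont_on 0 pi y \<and> abs_cont_on 0 pi (D1 y)"

(* As q is only integrable, the equation is required almost everywhere on (0,pi). *)
definition solves_eq ::
    "(real \<Rightarrow> complex) \<Rightarrow> (real \<Rightarrow> complex) \<Rightarrow> complex \<Rightarrow> (real \<Rightarrow> complex) \<Rightarrow> bool" where
  "solves_eq p q l y \<longleftrightarrow> W21 y \<and>
     (AE x in lebesgue. x \<in> {0<..<pi} \<longrightarrow>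
        (\<exists>y2. (D1 y has_vector_derivative y2) (at x) \<and>
              - y2 + q x * y x + 2 * l * p x * y x = l\<^sup>2 * y x))"

(* On [0,pi] the function chosen here is unique; its values elsewhere are irrelevant. *)
definition sol_S :: "(real \<Rightarrow> complex) \<Rightarrow> (real \<Rightarrow> complex) \<Rightarrow> complex \<Rightarrow> real \<Rightarrow> complex" where
  "sol_S p q l = (SOME y. solves_eq p q l y \<and> y 0 = 0 \<and> D1 y 0 = 1)"

definition sol_C :: "(real \<Rightarrow> complex) \<Rightarrow> (real \<Rightarrow> complex) \<Rightarrow> complex \<Rightarrow> real \<Rightarrow> complex" where
  "sol_C p q l = (SOME y. solves_eq p q l y \<and> y 0 = 1 \<and> D1 y 0 = 0)"

definition solves_L ::
    "nat \<Rightarrow> (nat \<Rightarrow> real \<Rightarrow> complex) \<Rightarrow> (nat \<Rightarrow> real \<Rightarrow> complex) \<Rightarrow> complex \<Rightarrow>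
     (nat \<Rightarrow> real \<Rightarrow> complex) \<Rightarrow> bool" where
  "solves_L m p q l y \<longleftrightarrow>
     (\<forall>j\<in>{1..m}. solves_eq (p j) (q j) l (y j)) \<and>
     (\<forall>j\<in>{1..m-1}. y j 0 = 0) \<and>
     (\<forall>j\<in>{1..m}. y m 0 = y j pi) \<and>
     D1 (y m) 0 = (\<Sum>j=1..m. D1 (y j) pi)"

definition eigenvalues ::
    "nat \<Rightarrow> (nat \<Rightarrow> real \<Rightarrow> complex) \<Rightarrow> (nat \<Rightarrow> real \<Rightarrow> complex) \<Rightarrow> complex set" where
  "eigenvalues m p q =
     {l. \<exists>y. solves_L m p q l y \<and> (\<exists>j\<in>{1..m}. \<exists>x\<in>{0..pi}. y j x \<noteq> 0)}"

definition d_loop :: "(real \<Rightarrow> complex) \<Rightarrow> (real \<Rightarrow> complex) \<Rightarrow> complex \<Rightarrow> complex" where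
  "d_loop p q l = D1 (sol_S p q l) pi + sol_C p q l pi - 2"

definition char_fun ::
    "nat \<Rightarrow> (nat \<Rightarrow> real \<Rightarrow> complex) \<Rightarrow> (nat \<Rightarrow> real \<Rightarrow> complex) \<Rightarrow> complex \<Rightarrow> complex" where
  "char_fun m p q l =
     (\<Sum>j=1..m-1. D1 (sol_S (p j) (q j) l) pi * (\<Prod>k\<in>{1..m} - {j}. sol_S (p k) (q k) l pi))
     + d_loop (p m) (q m) l * (\<Prod>k=1..m-1. sol_S (p k) (q k) l pi)"

definition alpha :: "(nat \<Rightarrow> real \<Rightarrow> complex) \<Rightarrow> nat \<Rightarrow> complex" where
  "alpha p j = (1 / complex_of_real pi) * integral {0..pi} (p j)"

definition cong_mod :: "complex \<Rightarrow> complex \<Rightarrow> complex \<Rightarrow> bool" where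
  "cong_mod a b c \<longleftrightarrow> (a - b) / c \<in> \<int>"

definition index_set :: "nat \<Rightarrow> (int \<times> nat) set" where
  "index_set m = {(n, k). k \<in> {1..m+1}} \<union> {(n, k). n \<noteq> 0 \<and> k \<in> {m+2..2*m}}"

end

theory Submission
  imports Defs
begin

text \<open>
Write \<open>S\<close>, \<open>C\<close> for the fundamental solutions of an edge at the endpoint \<open>\<pi>\<close>.  As
  \<open>|\<lambda>| \<rightarrow> \<infinity>\<close>, the quantities \<open>\<lambda> S\<^sub>j\<close>, \<open>S\<^sub>j'\<close>, \<open>C\<^sub>j\<close>, \<open>C\<^sub>j' / \<lambda>\<close> approach
  \<open>sin\<close>, \<open>cos\<close>, \<open>cos\<close>, \<open>- sin\<close> of \<open>\<pi> (\<lambda> - \<alpha>\<^sub>j)\<close>, with an error of order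
  \<open>exp (\<pi> |Im \<lambda>|) / |\<lambda>|\<close> (\<open>edge_asymptotics\<close>).  Hence \<open>\<lambda> ^ (m - 1) \<Delta>(\<lambda>)\<close> is close to
  \<open>sin (\<pi> \<lambda>) T(\<lambda>) + (2 cos (\<pi> \<lambda>) - 2) W(\<lambda>) = sin (\<pi> \<lambda> / 2) E(\<lambda>)\<close>, where
  \<open>W = \<Prod>\<^sub>j sin (\<pi> (\<lambda> - \<alpha>\<^sub>j))\<close> runs over the boundary edges, \<open>\<pi> T = W'\<close>, and
  \<open>E = 2 cos (\<pi> \<lambda> / 2) T - 4 sin (\<pi> \<lambda> / 2) W\<close>.

  The factor \<open>sin (\<pi> \<lambda> / 2)\<close> gives \<open>\<beta> = 0\<close>.  The remaining numbers \<open>\<beta>\<^sub>k\<close> come from Rolle's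
  theorem: \<open>(cos (\<pi> x / 2))\<^sup>4 W(x)\<close> has the derivative \<open>\<pi>/2 (cos (\<pi> x / 2))\<^sup>3 E(x)\<close> and vanishes
  at \<open>-1\<close>, at \<open>1\<close> and at the two points of \<open>(-1, 1)\<close> congruent to each \<open>\<alpha>\<^sub>j\<close>, so \<open>E\<close> has
  \<open>2 m - 1\<close> distinct zeros in \<open>(-1, 1)\<close>, none congruent to an \<open>\<alpha>\<^sub>j\<close> (\<open>secular_zeros\<close>).
  Being a polynomial of degree at most \<open>2 m - 1\<close> in \<open>exp (\<i> \<pi> \<lambda>)\<close> up to a nonvanishing factor, \<open>E\<close> is
  a constant multiple of the product of the \<open>sin (\<pi> (\<lambda> - \<beta>\<^sub>k) / 2)\<close>
  (\<open>secular_factorization\<close>).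

  Rouche's theorem on one large disc and on small discs around the remaining points
  \<open>2 n + \<beta>\<^sub>k\<close> transfers the count of zeros to \<open>\<Delta>\<close> (\<open>numbering_of_zeros\<close>).  The factor
  \<open>\<lambda> ^ (m - 1)\<close> has a zero of order \<open>m - 1\<close> in the large disc; it accounts for the indices
  \<open>(0, k)\<close> with \<open>k \<ge> m + 2\<close> that are absent from the index set.  One of the other \<open>\<beta>\<^sub>k\<close> may also be
  \<open>0\<close>, and then the limit function has double zeros, near which an error \<open>O(1 / |\<lambda>|)\<close> would only
  locate eigenvalues up to \<open>O(|n| powr (-1/2))\<close>.  The Wronskian identity
  \<open>d\<^sub>m = C\<^sub>m' S\<^sub>m - (C\<^sub>m - 1) (S\<^sub>m' - 1)\<close> saves a power: the error is
  \<open>O((|sin (\<pi> \<lambda> / 2)| + |E(\<lambda>)|) / |\<lambda>| + 1 / |\<lambda>|\<^sup>2)\<close> near the real axis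
  (\<open>char_fun_approximation\<close>), which forces one of the two factors, each with simple zeros only, to be
  \<open>O(1 / |\<lambda>|)\<close> at an eigenvalue.

  That the eigenvalues are the zeros of \<open>\<Delta>\<close> is linear algebra (\<open>matching_iff_determinant\<close>,
  \<open>eigenvalues_eq_zeros\<close>) once the equation is rewritten as a Volterra integral equation.  This
  rewriting rests on the fundamental theorem of calculus for absolutely continuous functions
  (\<open>abs_cont_fundamental_theorem\<close>); Picard iteration then gives existence, uniqueness and
  holomorphic dependence on \<open>\<lambda>\<close> (\<open>linear_ivp_exists\<close>).
\<close>

section \<open>Absolutely continuous functions and indefinite integrals\<close>

text \<open>
  Tagged divisions are finite sets of pairs, so the definition is transferred from initial
  segments of the natural numbers to arbitrary finite index sets.
\<close>

lemma abs_cont_on_finiteD: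
  assumes "abs_cont_on a b f" "\<epsilon> > 0"
  shows "\<exists>\<delta>>0. \<forall>(I::'i set) u v. finite I \<longrightarrow> (\<forall>i\<in>I. a \<le> u i \<and> u i \<le> v i \<and> v i \<le> b) \<longrightarrow>
        disjoint_family_on (\<lambda>i. {u i<..<v i}) I \<longrightarrow> (\<Sum>i\<in>I. v i - u i) < \<delta> \<longrightarrow>
        (\<Sum>i\<in>I. norm (f (v i) - f (u i))) < \<epsilon>"
proof -
  have "\<exists>\<delta>>0. \<forall>(n::nat) u v. (\<forall>i<n. a \<le> u i \<and> u i \<le> v i \<and> v i \<le> b) \<longrightarrow>
        disjoint_family_on (\<lambda>i. {u i<..<v i}) {..<n} \<longrightarrow> (\<Sum>i<n. v i - u i) < \<delta> \<longrightarrow>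
        (\<Sum>i<n. norm (f (v i) - f (u i))) < \<epsilon>"
    using assms by (simp add: abs_cont_on_def)
  then obtain \<delta> where "\<delta> > 0" and \<delta>: "\<forall>(n::nat) u v. (\<forall>i<n. a \<le> u i \<and> u i \<le> v i \<and> v i \<le> b) \<longrightarrow>
        disjoint_family_on (\<lambda>i. {u i<..<v i}) {..<n} \<longrightarrow> (\<Sum>i<n. v i - u i) < \<delta> \<longrightarrow>
        (\<Sum>i<n. norm (f (v i) - f (u i))) < \<epsilon>" by blast
  show ?thesis
  proof (intro exI[of _ \<delta>] conjI allI impI)
    show "\<delta> > 0" by fact
    fix I :: "'i set" and u v :: "'i \<Rightarrow> real"
    assume I: "finite I" "\<forall>i\<in>I. a \<le> u i \<and> u i \<le> v i \<and> v i \<le> b"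
      "disjoint_family_on (\<lambda>i. {u i<..<v i}) I" "(\<Sum>i\<in>I. v i - u i) < \<delta>"
    obtain h where h: "bij_betw h {..<card I} I"
      using ex_bij_betw_nat_finite[OF I(1)] by (auto simp: atLeast0LessThan)
    have hI: "h i \<in> I" if "i < card I" for i
      using h that by (auto simp: bij_betw_def)
    have "(\<Sum>i<card I. norm (f ((v \<circ> h) i) - f ((u \<circ> h) i))) < \<epsilon>"
    proof (rule \<delta>[THEN spec, THEN spec, THEN spec, THEN mp, THEN mp, THEN mp])
      show "\<forall>i<card I. a \<le> (u \<circ> h) i \<and> (u \<circ> h) i \<le> (v \<circ> h) i \<and> (v \<circ> h) i \<le> b"
        using I(2) hI by auto
      show "disjoint_family_on (\<lambda>i. {(u \<circ> h) i<..<(v \<circ> h) i}) {..<card I}"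
        unfolding disjoint_family_on_def
      proof (intro ballI impI)
        fix i j assume ij: "i \<in> {..<card I}" "j \<in> {..<card I}" "i \<noteq> j"
        then have "h i \<noteq> h j" "h i \<in> I" "h j \<in> I"
          using h hI by (auto simp: bij_betw_def inj_on_def)
        then show "{(u \<circ> h) i<..<(v \<circ> h) i} \<inter> {(u \<circ> h) j<..<(v \<circ> h) j} = {}"
          using I(3) by (auto simp: disjoint_family_on_def)
      qed
      show "(\<Sum>i<card I. (v \<circ> h) i - (u \<circ> h) i) < \<delta>"
        using I(4) sum.reindex_bij_betw[OF h, of "\<lambda>i. v i - u i"] by simp
    qed
    then show "(\<Sum>i\<in>I. norm (f (v i) - f (u i))) < \<epsilon>"
      using sum.reindex_bij_betw[OF h, of "\<lambda>i. norm (f (v i) - f (u i))"] by simp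
  qed
qed

lemma abs_cont_on_pairD:
  assumes "abs_cont_on a b f" "\<epsilon> > 0"
  shows "\<exists>\<delta>>0. \<forall>x y. a \<le> x \<longrightarrow> x \<le> y \<longrightarrow> y \<le> b \<longrightarrow> y - x < \<delta> \<longrightarrow> norm (f y - f x) < \<epsilon>"
proof -
  obtain \<delta> where "\<delta> > 0" and \<delta>: "\<forall>(I::nat set) u v. finite I \<longrightarrow> (\<forall>i\<in>I. a \<le> u i \<and> u i \<le> v i \<and> v i \<le> b) \<longrightarrow>
        disjoint_family_on (\<lambda>i. {u i<..<v i}) I \<longrightarrow> (\<Sum>i\<in>I. v i - u i) < \<delta> \<longrightarrow>
        (\<Sum>i\<in>I. norm (f (v i) - f (u i))) < \<epsilon>"
    using abs_cont_on_finiteD[OF assms] by blast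
  show ?thesis
  proof (intro exI[of _ \<delta>] conjI allI impI)
    fix x y assume "a \<le> x" "x \<le> y" "y \<le> b" "y - x < \<delta>"
    then show "norm (f y - f x) < \<epsilon>"
      using \<delta>[rule_format, of "{0}" "\<lambda>_. x" "\<lambda>_. y"] by (simp add: disjoint_family_on_def)
  qed fact
qed

lemma abs_cont_on_imp_continuous:
  assumes "abs_cont_on a b f"
  shows "continuous_on {a..b} f"
  unfolding continuous_on_iff
proof (intro ballI allI impI)
  fix x and e :: real assume x: "x \<in> {a..b}" and "e > 0"
  obtain d where "d > 0" and d: "\<forall>x y. a \<le> x \<longrightarrow> x \<le> y \<longrightarrow> y \<le> b \<longrightarrow> y - x < d \<longrightarrow> norm (f y - f x) < e"
    using abs_cont_on_pairD[OF assms \<open>e > 0\<close>] by blast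
  show "\<exists>d>0. \<forall>x'\<in>{a..b}. dist x' x < d \<longrightarrow> dist (f x') (f x) < e"
  proof (intro exI conjI ballI impI)
    fix y assume "y \<in> {a..b}" "dist y x < d"
    then show "dist (f y) (f x) < e"
      using d[rule_format, of x y] d[rule_format, of y x] x by (cases "x \<le> y") (auto simp: dist_norm norm_minus_commute)
  qed (fact \<open>d > 0\<close>)
qed

text \<open>
  Integral version of the statement that an absolutely continuous function is determined by its
  almost everywhere derivative.  The gauge is chosen separately on and off the exceptional set \<open>N\<close>: off
  \<open>N\<close> the differential quotient controls the Riemann sum in the usual way, while intervals tagged in \<open>N\<close> stay
  in an open set of measure less than \<open>\<delta>\<close>, where absolute continuity bounds the total
  increment of \<open>F\<close>.
\<close>

theorem abs_cont_fundamental_theorem: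
  fixes F f :: "real \<Rightarrow> complex"
  assumes ac: "abs_cont_on a b F" and "a \<le> b" and N: "negligible N"
    and der: "\<And>x. x \<in> {a..b} - N \<Longrightarrow> (F has_vector_derivative f x) (at x within {a..b})"
  shows "(f has_integral (F b - F a)) {a..b}"
proof (cases "a = b")
  case True
  then show ?thesis using has_integral_refl(2)[of f b] by simp
next
  case False
  with \<open>a \<le> b\<close> have ab: "a < b" by simp
  \<comment> \<open>With \<open>g = 0\<close> on \<open>N\<close>, a tag in \<open>N\<close> contributes only the increment of \<open>F\<close> to the error.\<close>
  define g where "g = (\<lambda>x. if x \<in> N then 0 else f x)"
  have "(g has_integral (F b - F a)) {a..b}"
    unfolding has_integral_factor_content_real
  proof (intro allI impI)
    fix e :: real assume "e > 0"
    define e2 where "e2 = e / 2"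
    have "e2 > 0" using \<open>e > 0\<close> by (simp add: e2_def)
    have "e2 * (b - a) > 0" using \<open>e2 > 0\<close> ab by simp
    then obtain \<delta> where "\<delta> > 0" and \<delta>:
      "\<forall>(I::(real \<times> real set) set) u v. finite I \<longrightarrow> (\<forall>i\<in>I. a \<le> u i \<and> u i \<le> v i \<and> v i \<le> b) \<longrightarrow>
        disjoint_family_on (\<lambda>i. {u i<..<v i}) I \<longrightarrow> (\<Sum>i\<in>I. v i - u i) < \<delta> \<longrightarrow>
        (\<Sum>i\<in>I. norm (F (v i) - F (u i))) < e2 * (b - a)"
      using abs_cont_on_finiteD[OF ac] by blast
    have "N \<in> sets lebesgue" using N by (simp add: negligible_iff_null_sets null_sets_def)
    from sets_lebesgue_outer_open[OF this \<open>\<delta> > 0\<close>]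
    obtain U where U: "open U" "N \<subseteq> U" "U - N \<in> lmeasurable" "emeasure lebesgue (U - N) < ennreal \<delta>"
      by metis
    have Ulm: "U \<in> lmeasurable" and mU: "measure lebesgue U < \<delta>"
    proof -
      have "U = (U - N) \<union> N" using U(2) by blast
      moreover have "N \<in> lmeasurable" "measure lebesgue N = 0" using N 
        by (simp_all add: negligible_imp_measurable negligible_imp_measure0)
      ultimately show "U \<in> lmeasurable" using U(3) by (metis fmeasurable.Un)
      have "measure lebesgue (U - N) < \<delta>"
        using U(3,4) \<open>\<delta> > 0\<close> by (simp add: emeasure_eq_measure2 ennreal_less_iff)
      moreover have "measure lebesgue U = measure lebesgue (U - N)"
        using N U(3) by (metis \<open>U = U - N \<union> N\<close> measure_Un_null_set fmeasurableD negligible_iff_null_sets)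
      ultimately show "measure lebesgue U < \<delta>" by simp
    qed
    have "\<exists>r>0. (x \<in> N \<longrightarrow> ball x r \<subseteq> U) \<and>
           (x \<in> {a..b} - N \<longrightarrow> (\<forall>y\<in>{a..b}. norm (y - x) < r \<longrightarrow> norm (F y - F x - (y - x) *\<^sub>R f x) \<le> e2 * norm (y - x)))" for x
    proof (cases "x \<in> N")
      case True
      then show ?thesis using U(1,2) by (meson DiffD2 openE subsetD)
    next
      case False
      show ?thesis
      proof (cases "x \<in> {a..b}")
        case True
        with False have "(F has_derivative (\<lambda>h. h *\<^sub>R f x)) (at x within {a..b})"
          using der by (auto simp: has_vector_derivative_def)
        then obtain r where "r > 0" "\<forall>y\<in>{a..b}. norm (y - x) < r \<longrightarrow> norm (F y - F x - (y - x) *\<^sub>R f x) \<le> e2 * norm (y - x)"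
          unfolding has_derivative_within_alt using \<open>e2 > 0\<close> by blast
        then show ?thesis using False by blast
      next
        case False2: False
        then show ?thesis using False by (intro exI[of _ 1]) auto
      qed
    qed
    then obtain r where r: "\<And>x. r x > 0" "\<And>x. x \<in> N \<Longrightarrow> ball x (r x) \<subseteq> U"
      "\<And>x y. x \<in> {a..b} - N \<Longrightarrow> y \<in> {a..b} \<Longrightarrow> norm (y - x) < r x \<Longrightarrow> norm (F y - F x - (y - x) *\<^sub>R f x) \<le> e2 * norm (y - x)"
      by metis
    define d where "d = (\<lambda>x. ball x (r x))"
    show "\<exists>d. gauge d \<and> (\<forall>p. p tagged_division_of {a..b} \<and> d fine p \<longrightarrow>
            norm ((\<Sum>(x, k)\<in>p. measure lborel k *\<^sub>R g x) - (F b - F a)) \<le> e * measure lborel {a..b})"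
    proof (intro exI[of _ d] conjI allI impI; (elim conjE)?)
      show "gauge d" using r(1) by (auto simp: d_def intro: gauge_ball_dependent)
      fix p assume p: "p tagged_division_of {a..b}" and fine: "d fine p"
      have fp: "finite p" using p by blast
      have iv: "k = {Inf k..Sup k} \<and> a \<le> Inf k \<and> Inf k \<le> x \<and> x \<le> Sup k \<and> Sup k \<le> b \<and> measure lborel k = Sup k - Inf k \<and> k \<subseteq> ball x (r x) \<and> x \<in> {a..b}" if "(x, k) \<in> p" for x k
      proof -
        have "\<exists>c e. k = {c..e}" using tagged_division_ofD(4)[OF p that] by auto
        then obtain c e where k: "k = {c..e}" by blast
        have "x \<in> k" using tagged_division_ofD(2)[OF p that] .
        then have "c \<le> x" "x \<le> e" "c \<le> e" using k by auto
        moreover have "k \<subseteq> {a..b}" using tagged_division_ofD(3)[OF p that] .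
        moreover have "k \<subseteq> ball x (r x)" using fine that unfolding fine_def d_def by blast
        ultimately show ?thesis using k by auto
      qed
      define u where "u = (\<lambda>i::real \<times> real set. Inf (snd i))"
      define v where "v = (\<lambda>i::real \<times> real set. Sup (snd i))"
      define pN where "pN = {i \<in> p. fst i \<in> N}"
      have "pN \<subseteq> p" by (auto simp: pN_def)
      then have fpN: "finite pN" using fp finite_subset by blast
      have disj: "disjoint_family_on (\<lambda>i. {u i<..<v i}) p"
        unfolding disjoint_family_on_def
      proof (intro ballI impI)
        fix i j assume ij: "i \<in> p" "j \<in> p" "i \<noteq> j"
        obtain x k where i: "i = (x, k)" by (cases i)
        obtain y l where j: "j = (y, l)" by (cases j)
        have "interior k \<inter> interior l = {}"
          using tagged_division_ofD(5)[OF p] ij i j by blast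
        moreover have "interior k = {u i<..<v i}" "interior l = {u j<..<v j}"
          unfolding u_def v_def i j using iv ij i j
          by (metis interior_atLeastAtMost_real snd_conv)+
        ultimately show "{u i<..<v i} \<inter> {u j<..<v j} = {}" by simp
      qed
      have "(\<Sum>i\<in>pN. v i - u i) = (\<Sum>i\<in>pN. measure lebesgue {u i<..<v i})"
      proof (intro sum.cong refl)
        fix i assume "i \<in> pN"
        then have "u i \<le> v i" using iv[of "fst i" "snd i"] by (auto simp: pN_def u_def v_def)
        then show "v i - u i = measure lebesgue {u i<..<v i}" by simp
      qed
      also have "\<dots> = measure lebesgue (\<Union>i\<in>pN. {u i<..<v i})"
      proof (intro measure_finite_Union[symmetric] fpN)
        show "disjoint_family_on (\<lambda>i. {u i<..<v i}) pN"
          using disj \<open>pN \<subseteq> p\<close> disjoint_family_on_mono by blast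
        show "emeasure lebesgue {u i<..<v i} \<noteq> \<infinity>" if "i \<in> pN" for i
          by (cases "u i \<le> v i") auto
      qed auto
      also have "\<dots> \<le> measure lebesgue U"
      proof (rule measure_mono_fmeasurable)
        show "(\<Union>i\<in>pN. {u i<..<v i}) \<subseteq> U"
        proof
          fix t assume "t \<in> (\<Union>i\<in>pN. {u i<..<v i})"
          then obtain x k where xk: "(x, k) \<in> p" "x \<in> N" "t \<in> {Inf k<..<Sup k}"
            by (auto simp: pN_def u_def v_def)
          then have "t \<in> k" using iv[OF xk(1)] by (metis atLeastAtMost_iff greaterThanLessThan_iff less_eq_real_def)
          then show "t \<in> U" using iv[OF xk(1)] r(2)[OF xk(2)] by blast
        qed
        show "(\<Union>i\<in>pN. {u i<..<v i}) \<in> sets lebesgue" by (simp add: borel_open open_UN)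
      qed (fact Ulm)
      finally have sumN: "(\<Sum>i\<in>pN. v i - u i) < \<delta>" using mU by simp
      have badN: "(\<Sum>i\<in>pN. norm (F (v i) - F (u i))) < e2 * (b - a)"
      proof (rule \<delta>[rule_format, OF fpN _ _ sumN])
        show "a \<le> u i \<and> u i \<le> v i \<and> v i \<le> b" if "i \<in> pN" for i
          using that iv[of "fst i" "snd i"] by (auto simp: pN_def u_def v_def)
        show "disjoint_family_on (\<lambda>i. {u i<..<v i}) pN"
          using disj \<open>pN \<subseteq> p\<close> disjoint_family_on_mono by blast
      qed
      have tel: "(\<Sum>i\<in>p. F (v i) - F (u i)) = F b - F a"
        using additive_tagged_division_1[OF \<open>a \<le> b\<close> p, of F] by (simp add: u_def v_def case_prod_beta)
      have cont: "(\<Sum>i\<in>p. v i - u i) = b - a"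
        using additive_tagged_division_1[OF \<open>a \<le> b\<close> p, of "\<lambda>x. x"] by (simp add: u_def v_def case_prod_beta)
      have "(\<Sum>(x, k)\<in>p. measure lborel k *\<^sub>R g x) - (F b - F a) = (\<Sum>i\<in>p. measure lborel (snd i) *\<^sub>R g (fst i) - (F (v i) - F (u i)))"
        by (simp add: sum_subtractf tel[symmetric] case_prod_beta)
      also have "norm \<dots> \<le> (\<Sum>i\<in>p. norm (measure lborel (snd i) *\<^sub>R g (fst i) - (F (v i) - F (u i))))"
        by (rule norm_sum)
      also have "\<dots> \<le> (\<Sum>i\<in>p. (if fst i \<in> N then norm (F (v i) - F (u i)) else 0) + e2 * (v i - u i))"
      proof (rule sum_mono)
        fix i assume "i \<in> p"
        then obtain x k where i: "i = (x, k)" "(x, k) \<in> p" by (cases i) auto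
        note iv' = iv[OF i(2)]
        show "norm (measure lborel (snd i) *\<^sub>R g (fst i) - (F (v i) - F (u i))) \<le> (if fst i \<in> N then norm (F (v i) - F (u i)) else 0) + e2 * (v i - u i)"
        proof (cases "x \<in> N")
          case True
          have "u i \<le> v i" using iv' by (simp add: u_def v_def i)
          then show ?thesis using True \<open>e2 > 0\<close> by (simp add: i g_def norm_minus_commute)
        next
          case False
          have xx: "x \<in> {a..b} - N" using False iv' by auto
          have uv: "u i \<in> {a..b}" "v i \<in> {a..b}" "u i \<le> x" "x \<le> v i" using iv' by (auto simp: u_def v_def i)
          have "u i \<in> k" "v i \<in> k"
            using iv' unfolding u_def v_def i by (metis atLeastAtMost_iff order_trans order_refl snd_conv)+
          then have "norm (u i - x) < r x" "norm (v i - x) < r x"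
            using iv' by (auto simp: dist_norm norm_minus_commute subset_iff)
          then have h: "norm (F (u i) - F x - (u i - x) *\<^sub>R f x) \<le> e2 * norm (u i - x)"
             "norm (F (v i) - F x - (v i - x) *\<^sub>R f x) \<le> e2 * norm (v i - x)"
            using r(3) xx uv by blast+
          have split: "measure lborel k *\<^sub>R f x - (F (v i) - F (u i)) = 
              (F (u i) - F x - (u i - x) *\<^sub>R f x) - (F (v i) - F x - (v i - x) *\<^sub>R f x)"
            using iv' by (auto simp: u_def v_def i algebra_simps simp flip: scaleR_add_left)
          have nrm: "norm (u i - x) = x - u i" "norm (v i - x) = v i - x" using uv by auto
          have "norm (measure lborel k *\<^sub>R f x - (F (v i) - F (u i))) \<le> e2 * (x - u i) + e2 * (v i - x)"
            using norm_triangle_ineq4[of "F (u i) - F x - (u i - x) *\<^sub>R f x" "F (v i) - F x - (v i - x) *\<^sub>R f x"] h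
            unfolding split nrm by linarith
          also have "\<dots> = e2 * (v i - u i)" by (simp add: algebra_simps)
          finally show ?thesis using False by (simp add: i g_def)
        qed
      qed
      also have "\<dots> = (\<Sum>i\<in>pN. norm (F (v i) - F (u i))) + e2 * (b - a)"
        unfolding sum.distrib using cont fp
        by (simp add: pN_def sum.inter_filter sum_distrib_left[symmetric])
      also have "\<dots> \<le> e2 * (b - a) + e2 * (b - a)" using badN by simp
      also have "\<dots> = e * measure lborel {a..b}" using ab by (simp add: e2_def field_simps)
      finally show "norm ((\<Sum>(x, k)\<in>p. measure lborel k *\<^sub>R g x) - (F b - F a)) \<le> e * measure lborel {a..b}" .
    qed
  qed
  then show ?thesis
    by (rule has_integral_spike[OF N, rotated]) (auto simp: g_def)
qed

text \<open>
  Absolute continuity only depends on a bound for the increments.  This gives constants,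
  congruence on the interval and, with \<open>f\<close> the identity, all Lipschitz functions.
\<close>

lemma abs_cont_on_lipschitz_comp:
  assumes "abs_cont_on a b f" "L \<ge> 0"
    and "\<And>x y. a \<le> x \<Longrightarrow> x \<le> y \<Longrightarrow> y \<le> b \<Longrightarrow> norm (g y - g x) \<le> L * norm (f y - f x)"
  shows "abs_cont_on a b g"
  unfolding abs_cont_on_def
proof (intro allI impI)
  fix \<epsilon> :: real assume "\<epsilon> > 0"
  then have "\<epsilon> / (L + 1) > 0" using \<open>L \<ge> 0\<close> by simp
  then obtain \<delta> where "\<delta> > 0" and \<delta>: "\<forall>(n::nat) u v. (\<forall>i<n. a \<le> u i \<and> u i \<le> v i \<and> v i \<le> b) \<longrightarrow>
        disjoint_family_on (\<lambda>i. {u i<..<v i}) {..<n} \<longrightarrow> (\<Sum>i<n. v i - u i) < \<delta> \<longrightarrow>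
        (\<Sum>i<n. norm (f (v i) - f (u i))) < \<epsilon> / (L + 1)"
    using assms(1)[unfolded abs_cont_on_def] by blast
  show "\<exists>\<delta>>0. \<forall>(n::nat) u v. (\<forall>i<n. a \<le> u i \<and> u i \<le> v i \<and> v i \<le> b) \<longrightarrow>
        disjoint_family_on (\<lambda>i. {u i<..<v i}) {..<n} \<longrightarrow> (\<Sum>i<n. v i - u i) < \<delta> \<longrightarrow>
        (\<Sum>i<n. norm (g (v i) - g (u i))) < \<epsilon>"
  proof (intro exI[of _ \<delta>] conjI allI impI)
    fix n :: nat and u v
    assume uv: "\<forall>i<n. a \<le> u i \<and> u i \<le> v i \<and> v i \<le> b"
        "disjoint_family_on (\<lambda>i. {u i<..<v i}) {..<n}" "(\<Sum>i<n. v i - u i) < \<delta>"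
    then have lt: "(\<Sum>i<n. norm (f (v i) - f (u i))) < \<epsilon> / (L + 1)" using \<delta> by blast
    have "(\<Sum>i<n. norm (g (v i) - g (u i))) \<le> (\<Sum>i<n. L * norm (f (v i) - f (u i)))"
      using uv by (intro sum_mono assms(3)) auto
    also have "\<dots> = L * (\<Sum>i<n. norm (f (v i) - f (u i)))" by (simp add: sum_distrib_left)
    also have "\<dots> \<le> (L + 1) * (\<Sum>i<n. norm (f (v i) - f (u i)))"
      by (intro mult_right_mono sum_nonneg) auto
    also have "\<dots> < \<epsilon>" using lt \<open>L \<ge> 0\<close> by (simp add: field_simps)
    finally show "(\<Sum>i<n. norm (g (v i) - g (u i))) < \<epsilon>" .
  qed fact
qed

lemma abs_cont_on_of_real: "abs_cont_on a b of_real"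
  unfolding abs_cont_on_def
proof (intro allI impI)
  fix \<epsilon> :: real assume "\<epsilon> > 0"
  have "(\<Sum>i<n. norm (complex_of_real (v i) - of_real (u i))) = (\<Sum>i<n. v i - u i)"
    if "\<forall>i<n. a \<le> u i \<and> u i \<le> v i \<and> v i \<le> b" for n :: nat and u v
    using that by (intro sum.cong) (auto simp flip: of_real_diff)
  then show "\<exists>\<delta>>0. \<forall>(n::nat) u v. (\<forall>i<n. a \<le> u i \<and> u i \<le> v i \<and> v i \<le> b) \<longrightarrow>
        disjoint_family_on (\<lambda>i. {u i<..<v i}) {..<n} \<longrightarrow> (\<Sum>i<n. v i - u i) < \<delta> \<longrightarrow>
        (\<Sum>i<n. norm (complex_of_real (v i) - of_real (u i))) < \<epsilon>"
    using \<open>\<epsilon> > 0\<close> by (intro exI[of _ \<epsilon>]) auto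
qed

lemma abs_cont_on_combine:
  assumes "abs_cont_on a b f" "abs_cont_on a b g" "L \<ge> 0"
    and "\<And>x y. a \<le> x \<Longrightarrow> x \<le> y \<Longrightarrow> y \<le> b \<Longrightarrow> norm (k y - k x) \<le> L * norm (f y - f x) + L * norm (g y - g x)"
  shows "abs_cont_on a b k"
  unfolding abs_cont_on_def
proof (intro allI impI)
  fix \<epsilon> :: real assume "\<epsilon> > 0"
  define e where "e = \<epsilon> / (2 * (L + 1))"
  have "e > 0" using \<open>L \<ge> 0\<close> \<open>\<epsilon> > 0\<close> by (simp add: e_def)
  have "\<exists>\<delta>>0. \<forall>(n::nat) u v. (\<forall>i<n. a \<le> u i \<and> u i \<le> v i \<and> v i \<le> b) \<longrightarrow>
        disjoint_family_on (\<lambda>i. {u i<..<v i}) {..<n} \<longrightarrow> (\<Sum>i<n. v i - u i) < \<delta> \<longrightarrow>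
        (\<Sum>i<n. norm (f (v i) - f (u i))) < e"
    using assms(1)[unfolded abs_cont_on_def] \<open>e > 0\<close> by blast
  then obtain \<delta>1 where "\<delta>1 > 0" and \<delta>1: "\<forall>(n::nat) u v. (\<forall>i<n. a \<le> u i \<and> u i \<le> v i \<and> v i \<le> b) \<longrightarrow>
        disjoint_family_on (\<lambda>i. {u i<..<v i}) {..<n} \<longrightarrow> (\<Sum>i<n. v i - u i) < \<delta>1 \<longrightarrow>
        (\<Sum>i<n. norm (f (v i) - f (u i))) < e" by blast
  have "\<exists>\<delta>>0. \<forall>(n::nat) u v. (\<forall>i<n. a \<le> u i \<and> u i \<le> v i \<and> v i \<le> b) \<longrightarrow>
        disjoint_family_on (\<lambda>i. {u i<..<v i}) {..<n} \<longrightarrow> (\<Sum>i<n. v i - u i) < \<delta> \<longrightarrow>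
        (\<Sum>i<n. norm (g (v i) - g (u i))) < e"
    using assms(2)[unfolded abs_cont_on_def] \<open>e > 0\<close> by blast
  then obtain \<delta>2 where "\<delta>2 > 0" and \<delta>2: "\<forall>(n::nat) u v. (\<forall>i<n. a \<le> u i \<and> u i \<le> v i \<and> v i \<le> b) \<longrightarrow>
        disjoint_family_on (\<lambda>i. {u i<..<v i}) {..<n} \<longrightarrow> (\<Sum>i<n. v i - u i) < \<delta>2 \<longrightarrow>
        (\<Sum>i<n. norm (g (v i) - g (u i))) < e" by blast
  show "\<exists>\<delta>>0. \<forall>(n::nat) u v. (\<forall>i<n. a \<le> u i \<and> u i \<le> v i \<and> v i \<le> b) \<longrightarrow>
        disjoint_family_on (\<lambda>i. {u i<..<v i}) {..<n} \<longrightarrow> (\<Sum>i<n. v i - u i) < \<delta> \<longrightarrow>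
        (\<Sum>i<n. norm (k (v i) - k (u i))) < \<epsilon>"
  proof (intro exI[of _ "min \<delta>1 \<delta>2"] conjI allI impI)
    fix n :: nat and u v
    assume uv: "\<forall>i<n. a \<le> u i \<and> u i \<le> v i \<and> v i \<le> b"
        "disjoint_family_on (\<lambda>i. {u i<..<v i}) {..<n}" "(\<Sum>i<n. v i - u i) < min \<delta>1 \<delta>2"
    then have lt: "(\<Sum>i<n. norm (f (v i) - f (u i))) < e" "(\<Sum>i<n. norm (g (v i) - g (u i))) < e" 
      using \<delta>1 \<delta>2 by auto
    have "(\<Sum>i<n. norm (k (v i) - k (u i))) \<le> (\<Sum>i<n. L * norm (f (v i) - f (u i)) + L * norm (g (v i) - g (u i)))"
      using uv by (intro sum_mono assms(4)) auto
    also have "\<dots> = L * ((\<Sum>i<n. norm (f (v i) - f (u i))) + (\<Sum>i<n. norm (g (v i) - g (u i))))" 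
      by (simp add: sum_distrib_left sum.distrib algebra_simps)
    also have "\<dots> \<le> L * (e + e)"
      using lt \<open>L \<ge> 0\<close> by (intro mult_left_mono) auto
    also have "e + e = \<epsilon> / (L + 1)" using \<open>L \<ge> 0\<close> by (simp add: e_def divide_simps)
    also have "L * (\<epsilon> / (L + 1)) = \<epsilon> * (L / (L + 1))" by simp
    also have "\<dots> < \<epsilon> * 1" using \<open>\<epsilon> > 0\<close> \<open>L \<ge> 0\<close> by (intro mult_strict_left_mono) auto
    also have "\<dots> = \<epsilon>" by simp
    finally show "(\<Sum>i<n. norm (k (v i) - k (u i))) < \<epsilon>" .
  qed (use \<open>\<delta>1 > 0\<close> \<open>\<delta>2 > 0\<close> in auto)
qed

lemma abs_cont_on_add:
  assumes "abs_cont_on a b f" "abs_cont_on a b g"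
  shows "abs_cont_on a b (\<lambda>x. f x + g x)"
proof (rule abs_cont_on_combine[OF assms, where L = 1])
  show "norm (f y + g y - (f x + g x)) \<le> 1 * norm (f y - f x) + 1 * norm (g y - g x)" for x y
    using norm_triangle_ineq[of "f y - f x" "g y - g x"] by (simp add: algebra_simps)
qed auto

lemma abs_cont_on_mult:
  assumes "abs_cont_on a b f" "abs_cont_on a b g"
  shows "abs_cont_on a b (\<lambda>x. f x * g x)"
proof -
  have "bounded (f ` {a..b} \<union> g ` {a..b})"
    using assms by (intro bounded_Un[THEN iffD2] conjI compact_imp_bounded compact_continuous_image 
        abs_cont_on_imp_continuous) auto
  then obtain L where "L > 0" and L: "\<And>x. x \<in> {a..b} \<Longrightarrow> norm (f x) \<le> L" "\<And>x. x \<in> {a..b} \<Longrightarrow> norm (g x) \<le> L"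
    unfolding bounded_pos by blast
  show ?thesis
  proof (rule abs_cont_on_combine[OF assms])
    show "0 \<le> L" using \<open>L > 0\<close> by simp
    fix x y assume xy: "a \<le> x" "x \<le> y" "y \<le> b"
    have "f y * g y - f x * g x = (f y - f x) * g y + f x * (g y - g x)" by (simp add: algebra_simps)
    also have "norm \<dots> \<le> norm (f y - f x) * norm (g y) + norm (f x) * norm (g y - g x)"
      by (metis norm_mult norm_triangle_ineq)
    also have "\<dots> \<le> norm (f y - f x) * L + L * norm (g y - g x)"
      using L xy \<open>L > 0\<close> by (intro add_mono mult_mono) auto
    finally show "norm (f y * g y - f x * g x) \<le> L * norm (f y - f x) + L * norm (g y - g x)"
      by (simp add: mult.commute)
  qed
qed

lemma abs_cont_on_C1:
  fixes f f' :: "real \<Rightarrow> complex"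
  assumes "\<And>x. x \<in> {a..b} \<Longrightarrow> (f has_vector_derivative f' x) (at x within {a..b})"
    and "continuous_on {a..b} f'"
  shows "abs_cont_on a b f"
proof -
  have "bounded (f' ` {a..b})" by (intro compact_imp_bounded compact_continuous_image assms) auto
  then obtain L where "L > 0" and L: "\<And>x. x \<in> {a..b} \<Longrightarrow> norm (f' x) \<le> L"
    unfolding bounded_pos by blast
  show ?thesis
  proof (rule abs_cont_on_lipschitz_comp[OF abs_cont_on_of_real])
    show "0 \<le> L" using \<open>L > 0\<close> by simp
    fix x y assume xy: "a \<le> x" "x \<le> y" "y \<le> b"
    have "norm (f y - f x) \<le> L * norm (y - x)"
    proof (rule differentiable_bound[where S = "{a..b}" and f' = "\<lambda>x h. h *\<^sub>R f' x"])
      show "(f has_derivative (\<lambda>h. h *\<^sub>R f' t)) (at t within {a..b})" if "t \<in> {a..b}" for t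
        using assms(1)[OF that] by (simp add: has_vector_derivative_def)
      show "onorm (\<lambda>h. h *\<^sub>R f' t) \<le> L" if "t \<in> {a..b}" for t
        using L[OF that] by (simp add: onorm_scaleR_left onorm_id)
    qed (use xy in auto)
    then show "norm (f y - f x) \<le> L * norm (complex_of_real y - of_real x)"
      by (simp flip: of_real_diff)
  qed
qed

text \<open>
  Absolute continuity of the integral.  Truncating \<open>|f|\<close> at a level \<open>k\<close> leaves a
  remainder with integral below \<open>\<epsilon> / 2\<close>; the truncated part contributes at most \<open>k\<close> times the total
  length.
\<close>

lemma integral_small_on_small_intervals:
  fixes f :: "real \<Rightarrow> complex"
  assumes f: "f absolutely_integrable_on {a..b}" and "\<epsilon> > 0"
  shows "\<exists>\<delta>>0. \<forall>(n::nat) u v. (\<forall>i<n. a \<le> u i \<and> u i \<le> v i \<and> v i \<le> b) \<longrightarrow>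
        disjoint_family_on (\<lambda>i. {u i<..<v i}) {..<n} \<longrightarrow> (\<Sum>i<n. v i - u i) < \<delta> \<longrightarrow>
        (\<Sum>i<n. norm (integral {u i..v i} f)) < \<epsilon>"
proof -
  define g where "g = (\<lambda>x. norm (f x))"
  have gi: "g absolutely_integrable_on {a..b}"
    unfolding g_def by (rule absolutely_integrable_norm[unfolded o_def, OF f])
  define gK where "gK = (\<lambda>(k::nat) x. min (g x) (real k))"
  have gKi: "gK k absolutely_integrable_on {a..b}" for k
    unfolding gK_def by (rule absolutely_integrable_min_1[OF gi absolutely_integrable_continuous_real]) auto
  have "(\<lambda>k. integral {a..b} (gK k)) \<longlonglongrightarrow> integral {a..b} g"
  proof (rule dominated_convergence(2)[where h = g])
    show "(\<lambda>k. gK k x) \<longlonglongrightarrow> g x" for x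
    proof (rule tendsto_eventually)
      obtain K :: nat where "g x \<le> real K" using real_arch_simple by blast
      then show "\<forall>\<^sub>F k in sequentially. gK k x = g x"
        by (auto simp: gK_def min_def eventually_sequentially intro!: exI[of _ K])
    qed
  qed (use gKi gi set_lebesgue_integral_eq_integral(1) in \<open>auto simp: gK_def g_def\<close>)
  then have "\<forall>\<^sub>F k in sequentially. dist (integral {a..b} (gK k)) (integral {a..b} g) < \<epsilon> / 2"
    using \<open>\<epsilon> > 0\<close> by (intro tendstoD) auto
  then obtain k where k: "dist (integral {a..b} (gK k)) (integral {a..b} g) < \<epsilon> / 2"
    unfolding eventually_sequentially by blast
  define r where "r = (\<lambda>x. g x - gK k x)"
  have gi': "g integrable_on {a..b}" "gK k integrable_on {a..b}"
    using gi gKi set_lebesgue_integral_eq_integral(1) by blast+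
  have ri: "r integrable_on {a..b}" unfolding r_def by (intro integrable_diff gi')
  have r0: "r x \<ge> 0" for x by (auto simp: r_def gK_def)
  have "integral {a..b} r = integral {a..b} g - integral {a..b} (gK k)"
    unfolding r_def by (rule integral_diff[OF gi'])
  then have rs: "integral {a..b} r < \<epsilon> / 2" using k unfolding dist_real_def by linarith
  show ?thesis
  proof (intro exI[of _ "\<epsilon> / (2 * (real k + 1))"] conjI allI impI)
    show "\<epsilon> / (2 * (real k + 1)) > 0" using \<open>\<epsilon> > 0\<close> by simp
    fix n :: nat and u v
    assume uv: "\<forall>i<n. a \<le> u i \<and> u i \<le> v i \<and> v i \<le> b"
       and disj: "disjoint_family_on (\<lambda>i. {u i<..<v i}) {..<n}" 
       and sm: "(\<Sum>i<n. v i - u i) < \<epsilon> / (2 * (real k + 1))"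
    have sub: "{u i..v i} \<subseteq> {a..b}" if "i < n" for i using uv that by auto
    have "norm (integral {u i..v i} f) \<le> real k * (v i - u i) + integral {u i<..<v i} r" if i: "i < n" for i
    proof -
      have ints: "f integrable_on {u i..v i}" "g integrable_on {u i..v i}" "gK k integrable_on {u i..v i}" "r integrable_on {u i..v i}"
        using integrable_on_subinterval[OF _ sub[OF i]] gi' ri f set_lebesgue_integral_eq_integral(1) by blast+
      have "norm (integral {u i..v i} f) \<le> integral {u i..v i} g"
        by (rule integral_norm_bound_integral) (use ints in \<open>auto simp: g_def\<close>)
      also have "\<dots> = integral {u i..v i} (gK k) + integral {u i..v i} r"
        using ints by (subst integral_add[symmetric]) (auto simp: r_def)
      also have "integral {u i..v i} (gK k) \<le> integral {u i..v i} (\<lambda>_. real k)"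
        by (rule integral_le) (use ints in \<open>auto simp: gK_def\<close>)
      also have "integral {u i..v i} (\<lambda>_. real k) = real k * (v i - u i)"
        using uv i by simp
      also have "integral {u i..v i} r = integral {u i<..<v i} r"
        by (rule integral_open_interval_real)
      finally show ?thesis by simp
    qed
    then have "(\<Sum>i<n. norm (integral {u i..v i} f)) \<le> (\<Sum>i<n. real k * (v i - u i) + integral {u i<..<v i} r)"
      by (intro sum_mono) auto
    also have "\<dots> = real k * (\<Sum>i<n. v i - u i) + (\<Sum>i<n. integral {u i<..<v i} r)"
      by (simp add: sum.distrib sum_distrib_left)
    also have "(\<Sum>i<n. integral {u i<..<v i} r) \<le> integral {a..b} r"
    proof -
      have hi: "(r has_integral integral {u i<..<v i} r) {u i<..<v i}" if "i < n" for i
        using integrable_on_subinterval[OF ri sub[OF that]]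
        by (metis integrable_integral integrable_on_open_interval_real)
      have un: "(r has_integral (\<Sum>i<n. integral {u i<..<v i} r)) (\<Union>i\<in>{..<n}. {u i<..<v i})"
        by (rule has_integral_UN) (use hi disj in \<open>auto simp: disjoint_family_on_def pairwise_def\<close>)
      have "integral (\<Union>i\<in>{..<n}. {u i<..<v i}) r \<le> integral {a..b} r"
        by (rule integral_subset_le) (use un ri r0 sub in \<open>force simp: has_integral_integrable subset_iff\<close>)+
      then show ?thesis using un by (simp add: integral_unique)
    qed
    also have "real k * (\<Sum>i<n. v i - u i) \<le> (real k + 1) * (\<Sum>i<n. v i - u i)"
      using uv by (intro mult_right_mono sum_nonneg) auto
    also have "\<dots> \<le> \<epsilon> / 2" using sm by (simp add: field_simps)
    finally show "(\<Sum>i<n. norm (integral {u i..v i} f)) < \<epsilon>" using rs by simp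
  qed
qed

lemma integral_diff_left:
  fixes f :: "real \<Rightarrow> 'a::banach"
  assumes "f integrable_on {a..b}" "a \<le> x" "x \<le> y" "y \<le> b"
  shows "integral {a..y} f - integral {a..x} f = integral {x..y} f"
proof -
  have "f integrable_on {a..y}" using assms integrable_on_subinterval by fastforce
  then show ?thesis using Henstock_Kurzweil_Integration.integral_combine[OF assms(2,3)] by (metis add_diff_cancel_left')
qed

lemma abs_cont_on_indefinite_integral:
  fixes f :: "real \<Rightarrow> complex"
  assumes f: "f absolutely_integrable_on {a..b}"
  shows "abs_cont_on a b (\<lambda>x. integral {a..x} f)"
  unfolding abs_cont_on_def
proof (intro allI impI)
  fix \<epsilon> :: real assume "\<epsilon> > 0"
  have fi: "f integrable_on {a..b}" using f set_lebesgue_integral_eq_integral(1) by blast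
  have "(\<Sum>i<n. norm (integral {a..v i} f - integral {a..u i} f)) = (\<Sum>i<n. norm (integral {u i..v i} f))"
    if "\<forall>i<n. a \<le> u i \<and> u i \<le> v i \<and> v i \<le> b" for n :: nat and u v
    using that by (intro sum.cong) (auto simp: integral_diff_left[OF fi])
  then show "\<exists>\<delta>>0. \<forall>(n::nat) u v. (\<forall>i<n. a \<le> u i \<and> u i \<le> v i \<and> v i \<le> b) \<longrightarrow>
        disjoint_family_on (\<lambda>i. {u i<..<v i}) {..<n} \<longrightarrow> (\<Sum>i<n. v i - u i) < \<delta> \<longrightarrow>
        (\<Sum>i<n. norm (integral {a..v i} f - integral {a..u i} f)) < \<epsilon>"
    using integral_small_on_small_intervals[OF f \<open>\<epsilon> > 0\<close>] by simp
qed

text \<open>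
  The Lebesgue differentiation theorem supplies right-hand differential quotients of the integral; applying
  it to \<open>f\<close> and to the reflected function \<open>x \<mapsto> f (- x)\<close> gives both one-sided derivatives.
\<close>

theorem indefinite_integral_ae_derivative:
  fixes f :: "real \<Rightarrow> complex"
  assumes f: "f integrable_on {a..b}"
  shows "\<exists>N. negligible N \<and> (\<forall>x\<in>{a..b} - N. x \<in> {a<..<b} \<and> ((\<lambda>x. integral {a..x} f) has_vector_derivative f x) (at x))"
proof -
  define f0 where "f0 = (\<lambda>x. if x \<in> {a..b} then f x else 0)"
  have f0U: "f0 integrable_on UNIV" unfolding f0_def by (rule integrable_restrict_UNIV[THEN iffD2, OF f])
  have f0i: "f0 integrable_on {c..d}" for c d
    using integrable_on_subinterval[OF f0U] by simp
  obtain N1 where N1: "negligible N1" "\<And>x e. \<lbrakk>x \<notin> N1; 0 < e\<rbrakk> \<Longrightarrow> \<exists>d>0. \<forall>h. 0 < h \<and> h < d \<longrightarrow>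
                         norm(integral (cbox x (x + h *\<^sub>R One)) f0 /\<^sub>R h ^ DIM(real) - f0 x) < e"
    using integrable_ccontinuous_explicit[of f0] f0i by (metis box_real(2))
  have "(\<lambda>x. f0 (- x)) integrable_on {c..d}" for c d
    using f0i[of "-d" "-c"] Henstock_Kurzweil_Integration.integrable_reflect_real[of f0 "-c" "-d"] by simp
  then obtain N2 where N2: "negligible N2" "\<And>x e. \<lbrakk>x \<notin> N2; 0 < e\<rbrakk> \<Longrightarrow> \<exists>d>0. \<forall>h. 0 < h \<and> h < d \<longrightarrow>
                         norm(integral (cbox x (x + h *\<^sub>R One)) (\<lambda>x. f0 (- x)) /\<^sub>R h ^ DIM(real) - f0 (- x)) < e"
    using integrable_ccontinuous_explicit[of "\<lambda>x. f0 (- x)"] by (metis box_real(2))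
  define N where "N = N1 \<union> uminus ` N2 \<union> {a, b}"
  have "negligible N" unfolding N_def
    using N1(1) N2(1) negligible_differentiable_image_negligible[of N2 uminus]
    by (intro negligible_Un) (auto simp: differentiable_on_def)
  moreover have "((\<lambda>x. integral {a..x} f) has_vector_derivative f x) (at x)" if x: "x \<in> {a..b} - N" for x
  proof -
    have xab: "a < x" "x < b" using x by (auto simp: N_def)
    have xN: "x \<notin> N1" "- x \<notin> N2" using x by (force simp: N_def image_iff)+
    have fx: "f0 x = f x" using xab by (simp add: f0_def)
    show ?thesis
      unfolding has_vector_derivative_def has_derivative_at_alt
    proof (intro conjI allI impI)
      show "bounded_linear (\<lambda>h. h *\<^sub>R f x)" by (rule bounded_linear_scaleR_left)
      fix e :: real assume "e > 0"
      obtain d1 where d1: "d1 > 0" "\<And>h. 0 < h \<Longrightarrow> h < d1 \<Longrightarrow> norm (integral {x..x + h} f0 /\<^sub>R h - f x) < e"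
        using N1(2)[OF xN(1) \<open>e > 0\<close>] by (auto simp: fx)
      obtain d2 where d2: "d2 > 0" "\<And>h. 0 < h \<Longrightarrow> h < d2 \<Longrightarrow> norm (integral {-x..-x + h} (\<lambda>x. f0 (- x)) /\<^sub>R h - f x) < e"
        using N2(2)[OF xN(2) \<open>e > 0\<close>] by (auto simp: fx)
      show "\<exists>d>0. \<forall>y. norm (y - x) < d \<longrightarrow> norm (integral {a..y} f - integral {a..x} f - (y - x) *\<^sub>R f x) \<le> e * norm (y - x)"
      proof (intro exI[of _ "Min {d1, d2, x - a, b - x}"] conjI allI impI)
        show "Min {d1, d2, x - a, b - x} > 0" using d1 d2 xab by simp
        fix y assume "norm (y - x) < Min {d1, d2, x - a, b - x}"
        then have y: "\<bar>y - x\<bar> < d1" "\<bar>y - x\<bar> < d2" "\<bar>y - x\<bar> < x - a" "\<bar>y - x\<bar> < b - x" by auto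
        have scale: "norm (I - h *\<^sub>R c) \<le> e * h" if "h > 0" "norm (I /\<^sub>R h - c) < e" for I c :: complex and h
        proof -
          have "I - h *\<^sub>R c = h *\<^sub>R (I /\<^sub>R h - c)" using that by (simp add: scaleR_diff_right)
          then show ?thesis using that by (simp add: mult.commute)
        qed
        consider "y = x" | "y > x" | "y < x" by linarith
        then show "norm (integral {a..y} f - integral {a..x} f - (y - x) *\<^sub>R f x) \<le> e * norm (y - x)"
        proof cases
          case 2
          have "integral {a..y} f - integral {a..x} f = integral {x..y} f"
            using integral_diff_left[OF f] 2 y xab by auto
          also have "\<dots> = integral {x..x + (y - x)} f0"
            using y xab by (auto intro!: integral_cong simp: f0_def)
          finally show ?thesis using scale[OF _ d1(2)[of "y - x"]] 2 y by auto
        next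
          case 3
          have "integral {a..x} f - integral {a..y} f = integral {y..x} f"
            using integral_diff_left[OF f] 3 y xab by auto
          also have "\<dots> = integral {y..x} f0"
            using y xab by (auto intro!: integral_cong simp: f0_def)
          also have "\<dots> = integral {-x..-x + (x - y)} (\<lambda>x. f0 (- x))"
            using Henstock_Kurzweil_Integration.integral_reflect_real[of x y f0] by simp
          finally have "norm (integral {a..x} f - integral {a..y} f - (x - y) *\<^sub>R f x) \<le> e * (x - y)" 
            using scale[OF _ d2(2)[of "x - y"]] 3 y by auto
          moreover have "integral {a..y} f - integral {a..x} f - (y - x) *\<^sub>R f x = - (integral {a..x} f - integral {a..y} f - (x - y) *\<^sub>R f x)"
            by (simp add: algebra_simps)
          ultimately show ?thesis using 3 by (simp only: norm_minus_cancel) simp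
        qed simp
      qed
    qed
  qed
  ultimately show ?thesis by (intro exI[of _ N]) (auto simp: N_def)
qed

section \<open>Volterra equations and holomorphic dependence on the spectral parameter\<close>

lemma abs_int_integrable: "f absolutely_integrable_on S \<Longrightarrow> f integrable_on S"
  for f :: "real \<Rightarrow> 'b::euclidean_space"
  using set_lebesgue_integral_eq_integral(1) by blast

lemma absolutely_integrable_mult_continuous:
  fixes f g :: "real \<Rightarrow> complex"
  assumes "f absolutely_integrable_on {a..b}" "continuous_on {a..b} g"
  shows "(\<lambda>x. f x * g x) absolutely_integrable_on {a..b}"
proof -
  have "(\<lambda>x. g x * f x) absolutely_integrable_on {a..b}"
  proof (rule absolutely_integrable_bounded_measurable_product[where h = "(*)" and f = g and g = f, OF _ _ _ _ assms(1)])
    show "bilinear ((*) :: complex \<Rightarrow> complex \<Rightarrow> complex)"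
      by (simp add: bilinear_conv_bounded_bilinear bounded_bilinear_mult)
    show "g \<in> borel_measurable (lebesgue_on {a..b})"
      by (rule continuous_imp_measurable_on_sets_lebesgue[OF assms(2)]) auto
    show "bounded (g ` {a..b})"
      by (intro compact_imp_bounded compact_continuous_image assms) auto
  qed auto
  then show ?thesis by (simp add: mult.commute)
qed

text \<open>
  Substitution \<open>u = \<integral> a\<close> for a merely integrable \<open>a\<close>: the power of the primitive is absolutely
  continuous, so the fundamental theorem above applies.  This produces the factorials in all Picard and
  Gronwall iterations below.
\<close>

lemma has_integral_power_of_primitive:
  fixes a :: "real \<Rightarrow> real"
  assumes a: "a absolutely_integrable_on {0..x}" and "0 \<le> x"
  shows "((\<lambda>t. a t * integral {0..t} a ^ n) has_integral integral {0..x} a ^ Suc n / Suc n) {0..x}"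
proof -
  define c where "c = (\<lambda>t. complex_of_real (a t))"
  define G where "G = (\<lambda>t. integral {0..t} c)"
  have ca: "c absolutely_integrable_on {0..x}"
    using absolutely_integrable_linear[OF a bounded_linear_of_real] by (simp add: c_def o_def)
  have Geq: "G t = of_real (integral {0..t} a)" if "t \<in> {0..x}" for t
  proof -
    have "a integrable_on {0..t}"
      using integrable_on_subinterval[OF abs_int_integrable[OF a]] that by auto
    then show ?thesis using integral_linear[OF _ bounded_linear_of_real] by (simp add: G_def c_def o_def)
  qed
  have acG: "abs_cont_on 0 x G" unfolding G_def by (rule abs_cont_on_indefinite_integral[OF ca])
  have acGn: "abs_cont_on 0 x (\<lambda>t. G t ^ Suc k)" for k
    by (induction k) (use acG abs_cont_on_mult[OF acG] in auto)
  have ac: "abs_cont_on 0 x (\<lambda>t. G t ^ Suc n / of_nat (Suc n))"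
    by (rule abs_cont_on_lipschitz_comp[OF acGn[of n], where L = 1])
       (auto simp: norm_divide divide_simps mult_le_cancel_left1 simp flip: diff_divide_distrib simp del: power_Suc of_nat_Suc)
  obtain N where N: "negligible N" "\<forall>t\<in>{0..x} - N. t \<in> {0<..<x} \<and> (G has_vector_derivative c t) (at t)"
    using indefinite_integral_ae_derivative[OF abs_int_integrable[OF ca]] unfolding G_def by blast
  have "((\<lambda>t. c t * G t ^ n) has_integral (G x ^ Suc n / of_nat (Suc n) - G 0 ^ Suc n / of_nat (Suc n))) {0..x}"
  proof (rule abs_cont_fundamental_theorem[OF ac \<open>0 \<le> x\<close> N(1)])
    fix t assume "t \<in> {0..x} - N"
    then have d: "(G has_vector_derivative c t) (at t within {0..x})" 
      using N(2) has_vector_derivative_at_within by blast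
    have "((\<lambda>z. z ^ Suc n) has_field_derivative of_nat (Suc n) * G t ^ n) (at (G t))"
      by (rule derivative_eq_intros refl)+ simp
    from DERIV_cdivide[OF this, of "of_nat (Suc n)"]
    have "((\<lambda>z. z ^ Suc n / of_nat (Suc n)) has_field_derivative G t ^ n) (at (G t))"
      by (simp del: of_nat_Suc power_Suc)
    from field_vector_diff_chain_within[OF d this[THEN has_field_derivative_at_within]]
    show "((\<lambda>t. G t ^ Suc n / of_nat (Suc n)) has_vector_derivative c t * G t ^ n) (at t within {0..x})"
      by (simp add: o_def)
  qed
  then have "((\<lambda>t. c t * G t ^ n) has_integral (G x ^ Suc n / of_nat (Suc n))) {0..x}"
    by (simp add: G_def)
  then have "((\<lambda>t. complex_of_real (a t * integral {0..t} a ^ n)) has_integral of_real (integral {0..x} a ^ Suc n / Suc n)) {0..x}"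
    by (subst (asm) has_integral_cong[where g = "\<lambda>t. complex_of_real (a t * integral {0..t} a ^ n)"]) (use Geq[of x] Geq \<open>0 \<le> x\<close> in \<open>auto simp: c_def\<close>)
  from has_integral_linear[OF this bounded_linear_Re] show ?thesis by (simp add: o_def)
qed

lemma integral_nonneg_mono:
  fixes a :: "real \<Rightarrow> real"
  assumes "a integrable_on {0..b}" "\<And>t. a t \<ge> 0" "0 \<le> x" "x \<le> y" "y \<le> b"
  shows "integral {0..x} a \<le> integral {0..y} a"
proof -
  have "a integrable_on {0..x}" "a integrable_on {0..y}" 
    using integrable_on_subinterval[OF assms(1)] assms by auto
  then show ?thesis using assms by (intro integral_subset_le) auto
qed

text \<open>
  One application of a Volterra operator raises the power of \<open>G = \<integral> |Q|\<close> and the factorial by one.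
  The next lemma does the same for the second-order operator; its outer integration costs a
  factor \<open>b\<close>.
\<close>

lemma volterra_bound:
  fixes Q u :: "real \<Rightarrow> complex"
  assumes Q: "Q absolutely_integrable_on {0..b}" and u: "continuous_on {0..b} u" and "M \<ge> 0"
    and G: "\<And>x. G x = integral {0..x} (\<lambda>t. norm (Q t))"
    and bnd: "\<And>t. t \<in> {0..b} \<Longrightarrow> norm (u t) \<le> M * G t ^ n / fact n"
    and x: "x \<in> {0..b}"
  shows "norm (integral {0..x} (\<lambda>t. Q t * u t)) \<le> M * G x ^ Suc n / fact (Suc n)"
proof -
  have Qx: "Q absolutely_integrable_on {0..x}" 
    by (rule absolutely_integrable_on_subinterval[OF Q]) (use x in auto)
  have ux: "continuous_on {0..x} u" by (rule continuous_on_subset[OF u]) (use x in auto)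
  have nQ: "(\<lambda>t. norm (Q t)) absolutely_integrable_on {0..x}"
    using absolutely_integrable_norm[OF Qx] by (simp add: o_def)
  have hi: "((\<lambda>t. M / fact n * (norm (Q t) * G t ^ n)) has_integral (M / fact n * (G x ^ Suc n / Suc n))) {0..x}"
    unfolding G by (intro has_integral_mult_right has_integral_power_of_primitive nQ) (use x in auto)
  have "norm (integral {0..x} (\<lambda>t. Q t * u t)) \<le> integral {0..x} (\<lambda>t. M / fact n * (norm (Q t) * G t ^ n))"
  proof (rule integral_norm_bound_integral)
    show "(\<lambda>t. Q t * u t) integrable_on {0..x}"
      by (rule abs_int_integrable[OF absolutely_integrable_mult_continuous[OF Qx ux]])
    show "norm (Q t * u t) \<le> M / fact n * (norm (Q t) * G t ^ n)" if "t \<in> {0..x}" for t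
      using mult_left_mono[OF bnd[of t], of "norm (Q t)"] that x by (simp add: norm_mult algebra_simps)
  qed (use hi in \<open>auto simp: has_integral_integrable\<close>)
  also have "\<dots> = M / fact n * (G x ^ Suc n / Suc n)" using hi by (rule integral_unique)
  also have "\<dots> = M * G x ^ Suc n / fact (Suc n)" by (simp add: field_simps)
  finally show ?thesis .
qed

lemma volterra2_bound:
  fixes Q u :: "real \<Rightarrow> complex"
  assumes Q: "Q absolutely_integrable_on {0..b}" and u: "continuous_on {0..b} u" and "M \<ge> 0"
    and G: "\<And>x. G x = integral {0..x} (\<lambda>t. norm (Q t))"
    and bnd: "\<And>t. t \<in> {0..b} \<Longrightarrow> norm (u t) \<le> M * b ^ n * G t ^ n / fact n"
    and x: "x \<in> {0..b}"
  shows "norm (integral {0..x} (\<lambda>s. integral {0..s} (\<lambda>t. Q t * u t))) \<le> M * b ^ Suc n * G x ^ Suc n / fact (Suc n)"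
proof -
  have b0: "b \<ge> 0" using x by auto
  have nQ: "(\<lambda>t. norm (Q t)) integrable_on {0..b}"
    using absolutely_integrable_norm[OF Q] abs_int_integrable by (auto simp: o_def)
  have Gmono: "G s \<le> G x" "0 \<le> G s" if "s \<in> {0..x}" for s
    unfolding G using integral_nonneg_mono[OF nQ _, of s x] integral_nonneg_mono[OF nQ _, of 0 s] that x by auto
  have "norm (integral {0..x} (\<lambda>s. integral {0..s} (\<lambda>t. Q t * u t))) \<le> integral {0..x} (\<lambda>s. M * b ^ n * G x ^ Suc n / fact (Suc n))"
  proof (rule integral_norm_bound_integral)
    have "continuous_on {0..b} (\<lambda>s. integral {0..s} (\<lambda>t. Q t * u t))"
      by (rule indefinite_integral_continuous_1[OF abs_int_integrable[OF absolutely_integrable_mult_continuous[OF Q u]]])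
    then show "(\<lambda>s. integral {0..s} (\<lambda>t. Q t * u t)) integrable_on {0..x}"
      by (intro integrable_continuous_real continuous_on_subset[where t = "{0..x}" and s = "{0..b}"]) (use x in auto)
    fix s assume s: "s \<in> {0..x}"
    have "norm (integral {0..s} (\<lambda>t. Q t * u t)) \<le> (M * b ^ n) * G s ^ Suc n / fact (Suc n)"
      by (rule volterra_bound[OF Q u _ G]) (use bnd s x b0 \<open>M \<ge> 0\<close> in auto)
    also have "\<dots> \<le> (M * b ^ n) * G x ^ Suc n / fact (Suc n)"
      using Gmono[OF s] b0 \<open>M \<ge> 0\<close> by (intro divide_right_mono mult_left_mono power_mono) auto
    finally show "norm (integral {0..s} (\<lambda>t. Q t * u t)) \<le> M * b ^ n * G x ^ Suc n / fact (Suc n)" .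
  qed auto
  also have "\<dots> = x * (M * b ^ n * G x ^ Suc n / fact (Suc n))" using x by simp
  also have "\<dots> \<le> b * (M * b ^ n * G x ^ Suc n / fact (Suc n))"
    using x b0 \<open>M \<ge> 0\<close> Gmono[of x] by (intro mult_right_mono) auto
  finally show ?thesis by (simp add: algebra_simps)
qed

text \<open>
  Iterating the bound gives \<open>|y x| \<le> M (b G x) ^ n / fact n\<close> for every \<open>n\<close>.
\<close>

lemma volterra_unique:
  fixes Q y :: "real \<Rightarrow> complex"
  assumes Q: "Q absolutely_integrable_on {0..b}" and y: "continuous_on {0..b} y"
    and eq: "\<And>x. x \<in> {0..b} \<Longrightarrow> y x = integral {0..x} (\<lambda>s. integral {0..s} (\<lambda>t. Q t * y t))"
    and x: "x \<in> {0..b}"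
  shows "y x = 0"
proof -
  define G where "G = (\<lambda>x. integral {0..x} (\<lambda>t. norm (Q t)))"
  have "bounded (y ` {0..b})" by (intro compact_imp_bounded compact_continuous_image y) auto
  then obtain M where M: "M > 0" "\<And>t. t \<in> {0..b} \<Longrightarrow> norm (y t) \<le> M" unfolding bounded_pos by blast
  have bnd: "\<forall>t\<in>{0..b}. norm (y t) \<le> M * b ^ n * G t ^ n / fact n" for n
  proof (induction n)
    case 0
    then show ?case using M by simp
  next
    case (Suc n)
    then show ?case
      using volterra2_bound[OF Q y, of M G n] M(1) eq by (simp add: G_def)
  qed
  have "(\<lambda>n. M * ((b * G x) ^ n / fact n)) \<longlonglongrightarrow> M * 0"
    using summable_LIMSEQ_zero[OF summable_exp[of "b * G x"]]
    by (intro tendsto_mult_left) (simp add: divide_inverse mult.commute)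
  then have "(\<lambda>n. M * ((b * G x) ^ n / fact n)) \<longlonglongrightarrow> 0" by simp
  moreover have "\<forall>n\<ge>0. norm (y x) \<le> M * ((b * G x) ^ n / fact n)"
    using bnd x by (simp add: power_mult_distrib mult.assoc)
  ultimately have "norm (y x) \<le> 0" by (rule LIMSEQ_le_const[OF _ exI])
  then show ?thesis by simp
qed

text \<open>
  The equation \<open>- y'' + q y + 2 l p y = l\<^sup>2 y\<close> reads \<open>y'' = potential p q l \<cdot> y\<close>.
\<close>

definition potential :: "(real \<Rightarrow> complex) \<Rightarrow> (real \<Rightarrow> complex) \<Rightarrow> complex \<Rightarrow> real \<Rightarrow> complex" where
  "potential p q l t = q t + 2 * l * p t - l\<^sup>2"

text \<open>
  Polynomials in the spectral parameter whose coefficients are continuous functions of \<open>x\<close>.  The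
  Picard iterates are of this form because the potential is quadratic in \<open>l\<close>.  Their holomorphy in \<open>l\<close> is then
  immediate, without differentiating under the integral sign.
\<close>

inductive polyfam :: "real \<Rightarrow> (complex \<Rightarrow> real \<Rightarrow> complex) \<Rightarrow> bool" for b where
  monom: "continuous_on {0..b} a \<Longrightarrow> polyfam b (\<lambda>l x. l ^ i * a x)"
| add: "polyfam b f \<Longrightarrow> polyfam b g \<Longrightarrow> polyfam b (\<lambda>l x. f l x + g l x)"

lemma polyfam_continuous: "polyfam b f \<Longrightarrow> continuous_on {0..b} (f l)"
  by (induction rule: polyfam.induct) (auto intro!: continuous_intros)

lemma polyfam_holomorphic: "polyfam b f \<Longrightarrow> (\<lambda>l. f l x) holomorphic_on S"
  by (induction rule: polyfam.induct) (auto intro!: holomorphic_intros)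

lemma indefinite_integral_add:
  fixes f g :: "real \<Rightarrow> complex"
  assumes "f integrable_on {0..b}" "g integrable_on {0..b}" "x \<in> {0..b}"
  shows "integral {0..x} (\<lambda>t. f t + g t) = integral {0..x} f + integral {0..x} g"
  by (rule integral_add; rule integrable_on_subinterval[OF assms(1)] integrable_on_subinterval[OF assms(2)]) 
     (use assms in auto)

lemma polyfam_integral:
  assumes "polyfam b f"
  shows "\<exists>g. polyfam b g \<and> (\<forall>l. \<forall>x\<in>{0..b}. integral {0..x} (f l) = g l x)"
  using assms
proof induction
  case (monom a i)
  have "continuous_on {0..b} (\<lambda>x. integral {0..x} a)"
    by (rule indefinite_integral_continuous_1[OF integrable_continuous_real[OF monom]])
  then have "polyfam b (\<lambda>l x. l ^ i * integral {0..x} a)" by (rule polyfam.monom)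
  then show ?case by (intro exI conjI) auto
next
  case (add f1 f2)
  then obtain g1 g2 where g: "polyfam b g1" "polyfam b g2"
     "\<forall>l. \<forall>x\<in>{0..b}. integral {0..x} (f1 l) = g1 l x" "\<forall>l. \<forall>x\<in>{0..b}. integral {0..x} (f2 l) = g2 l x" by blast
  have int: "f1 l integrable_on {0..b}" "f2 l integrable_on {0..b}" for l
    using add(1,2) by (auto intro!: integrable_continuous_real polyfam_continuous)
  show ?case
    by (rule exI[of _ "\<lambda>l x. g1 l x + g2 l x"]) 
       (use g polyfam.add indefinite_integral_add[OF int] in auto)
qed

lemma potential_abs_int:
  assumes p: "continuous_on {0..b} p" and q: "q absolutely_integrable_on {0..b}"
  shows "potential p q l absolutely_integrable_on {0..b}"
  unfolding potential_def
  by (intro set_integral_diff(1) set_integral_add(1) q absolutely_integrable_continuous_real continuous_intros p)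

lemma polyfam_potential_integral:
  assumes p: "continuous_on {0..b} p" and q: "q absolutely_integrable_on {0..b}" and "polyfam b f"
  shows "\<exists>g. polyfam b g \<and> (\<forall>l. \<forall>x\<in>{0..b}. integral {0..x} (\<lambda>t. potential p q l t * f l t) = g l x)"
  using assms(3)
proof induction
  case (monom a i)
  note qa = abs_int_integrable[OF absolutely_integrable_mult_continuous[OF q monom]]
  have pa: "(\<lambda>t. 2 * p t * a t) integrable_on {0..b}"
    by (intro integrable_continuous_real continuous_intros p monom)
  have ma: "(\<lambda>t. - a t) integrable_on {0..b}" 
    by (intro integrable_continuous_real continuous_intros monom)
  define g where "g = (\<lambda>l x. (l ^ i * integral {0..x} (\<lambda>t. q t * a t) + l ^ Suc i * integral {0..x} (\<lambda>t. 2 * p t * a t)) 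
     + l ^ Suc (Suc i) * integral {0..x} (\<lambda>t. - a t))"
  have "polyfam b g" unfolding g_def
    by (intro polyfam.add polyfam.monom indefinite_integral_continuous_1 qa pa ma)
  moreover have "integral {0..x} (\<lambda>t. potential p q l t * (l ^ i * a t)) = g l x" if x: "x \<in> {0..b}" for l x
  proof -
    have s: "{0..x} \<subseteq> {0..b}" using x by auto
    have ints: "(\<lambda>t. l ^ i * (q t * a t)) integrable_on {0..b}" "(\<lambda>t. l ^ Suc i * (2 * p t * a t)) integrable_on {0..b}"
      "(\<lambda>t. l ^ Suc (Suc i) * (- a t)) integrable_on {0..b}"
      by (intro integrable_on_mult_right qa pa ma)+
    have "integral {0..x} (\<lambda>t. potential p q l t * (l ^ i * a t)) = 
        integral {0..x} (\<lambda>t. (l ^ i * (q t * a t) + l ^ Suc i * (2 * p t * a t)) + l ^ Suc (Suc i) * (- a t))"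
      by (simp add: potential_def algebra_simps power2_eq_square)
    also have "\<dots> = g l x" unfolding g_def
      by (subst indefinite_integral_add[OF integrable_add[OF ints(1,2)] ints(3) x], 
          subst indefinite_integral_add[OF ints(1,2) x]) (simp del: power_Suc add: integral_mult_right)
    finally show ?thesis .
  qed
  ultimately show ?case by blast
next
  case (add f1 f2)
  then obtain g1 g2 where g: "polyfam b g1" "polyfam b g2"
     "\<forall>l. \<forall>x\<in>{0..b}. integral {0..x} (\<lambda>t. potential p q l t * f1 l t) = g1 l x" 
     "\<forall>l. \<forall>x\<in>{0..b}. integral {0..x} (\<lambda>t. potential p q l t * f2 l t) = g2 l x" by blast
  note Q = potential_abs_int[OF p q]
  have int: "(\<lambda>t. potential p q l t * f1 l t) integrable_on {0..b}" "(\<lambda>t. potential p q l t * f2 l t) integrable_on {0..b}" for l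
    using add(1,2) by (auto intro!: abs_int_integrable absolutely_integrable_mult_continuous Q polyfam_continuous)
  show ?case
    by (rule exI[of _ "\<lambda>l x. g1 l x + g2 l x"]) 
       (use g polyfam.add indefinite_integral_add[OF int] in \<open>auto simp: distrib_left\<close>)
qed

text \<open>
  The \<open>n\<close>-th terms of the Picard series for \<open>y\<close> and for \<open>y'\<close>, with initial
  values \<open>c0\<close> and \<open>c1\<close>; the solution is their sum over \<open>n\<close>.
\<close>

primrec picard :: "(complex \<Rightarrow> real \<Rightarrow> complex) \<Rightarrow> complex \<Rightarrow> complex \<Rightarrow> nat \<Rightarrow> complex \<Rightarrow> real \<Rightarrow> complex" where
  "picard Q c0 c1 0 l x = c0 + c1 * of_real x"
| "picard Q c0 c1 (Suc n) l x = integral {0..x} (\<lambda>s. integral {0..s} (\<lambda>t. Q l t * picard Q c0 c1 n l t))"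

primrec picard' :: "(complex \<Rightarrow> real \<Rightarrow> complex) \<Rightarrow> complex \<Rightarrow> complex \<Rightarrow> nat \<Rightarrow> complex \<Rightarrow> real \<Rightarrow> complex" where
  "picard' Q c0 c1 0 l x = c1"
| "picard' Q c0 c1 (Suc n) l x = integral {0..x} (\<lambda>t. Q l t * picard Q c0 c1 n l t)"

lemma picard_polyfam:
  assumes p: "continuous_on {0..b} p" and q: "q absolutely_integrable_on {0..b}"
  shows "\<exists>g. polyfam b g \<and> (\<forall>l. \<forall>x\<in>{0..b}. picard (potential p q) c0 c1 n l x = g l x)"
    and "\<exists>g. polyfam b g \<and> (\<forall>l. \<forall>x\<in>{0..b}. picard' (potential p q) c0 c1 n l x = g l x)"
proof -
  let ?P = "\<lambda>f. \<exists>g. polyfam b g \<and> (\<forall>l. \<forall>x\<in>{0..b}. f l x = g l x)"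
  have Qint: "?P (\<lambda>l x. integral {0..x} (\<lambda>t. potential p q l t * f l t))" if f: "?P f" for f
  proof -
    from f obtain g where g: "polyfam b g" "\<forall>l. \<forall>x\<in>{0..b}. f l x = g l x" by blast
    have "integral {0..x} (\<lambda>t. potential p q l t * f l t) = integral {0..x} (\<lambda>t. potential p q l t * g l t)" 
      if "x \<in> {0..b}" for l x
      using g(2) that by (intro integral_cong) auto
    then show ?thesis using polyfam_potential_integral[OF p q g(1)] by auto
  qed
  have int: "?P (\<lambda>l x. integral {0..x} (f l))" if f: "?P f" for f
  proof -
    from f obtain g where g: "polyfam b g" "\<forall>l. \<forall>x\<in>{0..b}. f l x = g l x" by blast
    have "integral {0..x} (f l) = integral {0..x} (g l)" if "x \<in> {0..b}" for l x
      using g(2) that by (intro integral_cong) auto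
    then show ?thesis using polyfam_integral[OF g(1)] by auto
  qed
  show *: "?P (picard (potential p q) c0 c1 n)" for n
  proof (induction n)
    case 0
    have "polyfam b (\<lambda>l x. l ^ 0 * (c0 + c1 * of_real x))"
      by (intro polyfam.monom continuous_intros)
    then show ?case by (intro exI conjI) auto
  next
    case (Suc n)
    from int[OF Qint[OF this]] show ?case by simp
  qed
  show "?P (picard' (potential p q) c0 c1 n)"
  proof (cases n)
    case 0
    have "polyfam b (\<lambda>l x. l ^ 0 * c1)"
      by (intro polyfam.monom continuous_intros)
    then show ?thesis using 0 by (intro exI conjI) auto
  next
    case (Suc n)
    from Qint[OF *[of n]] show ?thesis using Suc by simp
  qed
qed

lemma picard_continuous:
  assumes "continuous_on {0..b} p" and "q absolutely_integrable_on {0..b}"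
  shows "continuous_on {0..b} (picard (potential p q) c0 c1 n l)" "continuous_on {0..b} (picard' (potential p q) c0 c1 n l)"
  using picard_polyfam[OF assms, of c0 c1 n] by (metis continuous_on_cong polyfam_continuous)+

lemma picard_holomorphic:
  assumes "continuous_on {0..b} p" and "q absolutely_integrable_on {0..b}" "x \<in> {0..b}"
  shows "(\<lambda>l. picard (potential p q) c0 c1 n l x) holomorphic_on S" "(\<lambda>l. picard' (potential p q) c0 c1 n l x) holomorphic_on S"
proof -
  obtain g where g: "polyfam b g" "\<forall>l. picard (potential p q) c0 c1 n l x = g l x"
    using picard_polyfam(1)[OF assms(1,2), of c0 c1 n] assms(3) by blast
  then show "(\<lambda>l. picard (potential p q) c0 c1 n l x) holomorphic_on S" using polyfam_holomorphic by auto
  obtain g where g: "polyfam b g" "\<forall>l. picard' (potential p q) c0 c1 n l x = g l x"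
    using picard_polyfam(2)[OF assms(1,2), of c0 c1 n] assms(3) by blast
  then show "(\<lambda>l. picard' (potential p q) c0 c1 n l x) holomorphic_on S" using polyfam_holomorphic by auto
qed

text \<open>
  The bound is uniform for \<open>norm l \<le> R\<close>, since \<open>\<integral> |potential p q l|\<close> is bounded there.
  The derivative terms are shifted by one because \<open>picard'\<close> starts with the
  constant \<open>c1\<close>.
\<close>

lemma picard_bound:
  assumes p: "continuous_on {0..b} p" and q: "q absolutely_integrable_on {0..b}" and "b \<ge> 0"
  shows "\<exists>A K. K \<ge> 0 \<and> A \<ge> 0 \<and> (\<forall>n l x. norm l \<le> R \<longrightarrow> x \<in> {0..b} \<longrightarrow> 
      norm (picard (potential p q) c0 c1 n l x) \<le> A * (K ^ n / fact n) \<and>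
      norm (picard' (potential p q) c0 c1 (Suc n) l x) \<le> A * (K ^ n / fact n))"
proof -
  define M where "M = norm c0 + norm c1 * b"
  have "M \<ge> 0" using \<open>b \<ge> 0\<close> by (simp add: M_def)
  have nq: "(\<lambda>t. norm (q t)) integrable_on {0..b}" "(\<lambda>t. norm (p t)) integrable_on {0..b}"
    using absolutely_integrable_norm[OF q, unfolded o_def, THEN abs_int_integrable]
    by (simp_all add: integrable_continuous_real continuous_on_norm p)
  define K where "K = integral {0..b} (\<lambda>t. norm (q t) + 2 * \<bar>R\<bar> * norm (p t) + R\<^sup>2)"
  define G where "G = (\<lambda>l x. integral {0..x} (\<lambda>t. norm (potential p q l t)))"
  have G: "0 \<le> G l x" "G l x \<le> K" if "norm l \<le> R" "x \<in> {0..b}" for l x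
  proof -
    have nQ: "(\<lambda>t. norm (potential p q l t)) integrable_on {0..b}"
      using absolutely_integrable_norm[OF potential_abs_int[OF p q]] abs_int_integrable by (auto simp: o_def)
    show "0 \<le> G l x" unfolding G_def by (rule integral_nonneg[OF integrable_on_subinterval[OF nQ]]) (use that in auto)
    have "G l x \<le> G l b" unfolding G_def by (rule integral_nonneg_mono[OF nQ]) (use that in auto)
    also have "G l b \<le> K" unfolding G_def K_def
    proof (rule integral_le[OF nQ])
      show "(\<lambda>t. norm (q t) + 2 * \<bar>R\<bar> * norm (p t) + R\<^sup>2) integrable_on {0..b}"
        using nq by (intro integrable_add integrable_on_mult_right) auto
      fix t assume "t \<in> {0..b}"
      have "norm (potential p q l t) \<le> norm (q t + 2 * l * p t) + norm (l\<^sup>2)"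
        unfolding potential_def by (rule norm_triangle_ineq4)
      also have "\<dots> \<le> norm (q t) + norm (2 * l * p t) + norm (l\<^sup>2)"
        by (intro add_mono norm_triangle_ineq order_refl)
      also have "norm (2 * l * p t) \<le> 2 * \<bar>R\<bar> * norm (p t)"
        using that(1) by (auto simp: norm_mult intro!: mult_right_mono)
      also have "norm (l\<^sup>2) \<le> R\<^sup>2" using that(1) by (simp add: norm_power power_mono)
      finally show "norm (potential p q l t) \<le> norm (q t) + 2 * \<bar>R\<bar> * norm (p t) + R\<^sup>2" by simp
    qed
    finally show "G l x \<le> K" .
  qed
  have K0: "K \<ge> 0" unfolding K_def
    using nq by (intro integral_nonneg integrable_add integrable_on_mult_right) auto
  note Q = potential_abs_int[OF p q]
  have pb: "\<forall>x\<in>{0..b}. norm (picard (potential p q) c0 c1 n l x) \<le> M * b ^ n * G l x ^ n / fact n" for n l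
  proof (induction n)
    case 0
    have "norm (c0 + c1 * of_real x) \<le> M" if "x \<in> {0..b}" for x
    proof -
      have "norm (c0 + c1 * of_real x) \<le> norm c0 + norm c1 * \<bar>x\<bar>"
        using norm_triangle_ineq[of c0 "c1 * of_real x"] by (simp add: norm_mult)
      also have "\<dots> \<le> M" unfolding M_def using that by (intro add_left_mono mult_left_mono) auto
      finally show ?thesis .
    qed
    then show ?case by simp
  next
    case (Suc n)
    show ?case
    proof
      fix x assume "x \<in> {0..b}"
      then show "norm (picard (potential p q) c0 c1 (Suc n) l x) \<le> M * b ^ Suc n * G l x ^ Suc n / fact (Suc n)"
        unfolding picard.simps
        by (intro volterra2_bound[OF Q picard_continuous(1)[OF p q] \<open>M \<ge> 0\<close>]) (use Suc in \<open>auto simp: G_def\<close>)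
    qed
  qed
  have pb': "norm (picard' (potential p q) c0 c1 (Suc n) l x) \<le> M * b ^ n * G l x ^ Suc n / fact (Suc n)" 
    if "x \<in> {0..b}" for n x and l :: complex
    unfolding picard'.simps
    by (intro volterra_bound[OF Q picard_continuous(1)[OF p q]]) (use \<open>M \<ge> 0\<close> \<open>b \<ge> 0\<close> pb that in \<open>auto simp: G_def\<close>)
  show ?thesis
  proof (rule exI[of _ "M * (1 + K)"], rule exI[of _ "b * K"], intro conjI allI impI)
    fix n x and l :: complex assume lx: "norm l \<le> R" "x \<in> {0..b}"
    have g: "G l x ^ n \<le> K ^ n" "G l x ^ Suc n \<le> K ^ Suc n" using G[OF lx] by (auto intro: power_mono simp del: power_Suc)
    have "norm (picard (potential p q) c0 c1 n l x) \<le> M * b ^ n * G l x ^ n / fact n" using pb lx by blast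
    also have "\<dots> \<le> M * b ^ n * K ^ n / fact n"
      using g \<open>M \<ge> 0\<close> \<open>b \<ge> 0\<close> by (intro divide_right_mono mult_left_mono) auto
    also have "\<dots> = M * 1 * ((b * K) ^ n / fact n)" by (simp add: power_mult_distrib)
    also have "\<dots> \<le> M * (1 + K) * ((b * K) ^ n / fact n)"
      using \<open>M \<ge> 0\<close> \<open>b \<ge> 0\<close> K0 by (intro mult_right_mono mult_left_mono) auto
    finally show "norm (picard (potential p q) c0 c1 n l x) \<le> M * (1 + K) * ((b * K) ^ n / fact n)" .
    have "norm (picard' (potential p q) c0 c1 (Suc n) l x) \<le> M * b ^ n * G l x ^ Suc n / fact (Suc n)" using pb' lx by blast
    also have "\<dots> \<le> M * b ^ n * K ^ Suc n / fact n"
      using g \<open>M \<ge> 0\<close> \<open>b \<ge> 0\<close> K0 G[OF lx] fact_mono[of n "Suc n", where 'a = real]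
      by (intro frac_le mult_left_mono) (auto simp del: power_Suc)
    also have "\<dots> = M * K * ((b * K) ^ n / fact n)" by (simp add: power_mult_distrib)
    also have "\<dots> \<le> M * (1 + K) * ((b * K) ^ n / fact n)"
      using \<open>M \<ge> 0\<close> \<open>b \<ge> 0\<close> K0 by (intro mult_right_mono mult_left_mono) auto
    finally show "norm (picard' (potential p q) c0 c1 (Suc n) l x) \<le> M * (1 + K) * ((b * K) ^ n / fact n)" .
  qed (use \<open>M \<ge> 0\<close> \<open>b \<ge> 0\<close> K0 in auto)
qed

lemma uniform_limit_picard:
  assumes p: "continuous_on {0..b} p" and q: "q absolutely_integrable_on {0..b}" and "b \<ge> 0"
  shows "uniform_limit ({l. norm l \<le> R} \<times> {0..b}) (\<lambda>N (l, x). \<Sum>n<N. picard (potential p q) c0 c1 n l x)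
           (\<lambda>(l, x). \<Sum>n. picard (potential p q) c0 c1 n l x) sequentially" (is ?T1)
    and "uniform_limit ({l. norm l \<le> R} \<times> {0..b}) (\<lambda>N (l, x). \<Sum>n<N. picard' (potential p q) c0 c1 n l x)
           (\<lambda>(l, x). \<Sum>n. picard' (potential p q) c0 c1 n l x) sequentially" (is ?T2)
proof -
  obtain A K where AK: "K \<ge> 0" "A \<ge> 0" and b: "\<And>n l x. norm l \<le> R \<Longrightarrow> x \<in> {0..b} \<Longrightarrow>
      norm (picard (potential p q) c0 c1 n l x) \<le> A * (K ^ n / fact n) \<and>
      norm (picard' (potential p q) c0 c1 (Suc n) l x) \<le> A * (K ^ n / fact n)"
    using picard_bound[OF assms, of R c0 c1] by blast
  have sm: "summable (\<lambda>n. A * (K ^ n / fact n))"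
    using summable_exp[of K] by (intro summable_mult) (simp add: divide_inverse mult.commute)
  have "uniform_limit ({l. norm l \<le> R} \<times> {0..b}) (\<lambda>N z. \<Sum>n<N. (\<lambda>(l, x). picard (potential p q) c0 c1 n l x) z)
           (\<lambda>z. \<Sum>n. (\<lambda>(l, x). picard (potential p q) c0 c1 n l x) z) sequentially"
    by (rule Weierstrass_m_test[OF _ sm]) (use b in auto)
  then show ?T1 by (simp add: case_prod_unfold)
  have "uniform_limit ({l. norm l \<le> R} \<times> {0..b}) (\<lambda>N z. \<Sum>n<N. (\<lambda>(l, x). picard' (potential p q) c0 c1 n l x) z)
           (\<lambda>z. \<Sum>n. (\<lambda>(l, x). picard' (potential p q) c0 c1 n l x) z) sequentially"
  proof (rule Weierstrass_m_test)
    show "summable (\<lambda>n. case n of 0 \<Rightarrow> norm c1 | Suc n \<Rightarrow> A * (K ^ n / fact n))"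
      by (subst summable_Suc_iff[symmetric]) (use sm in simp)
    show "norm ((\<lambda>(l, x). picard' (potential p q) c0 c1 n l x) z) \<le> (case n of 0 \<Rightarrow> norm c1 | Suc n \<Rightarrow> A * (K ^ n / fact n))"
      if "z \<in> {l. norm l \<le> R} \<times> {0..b}" for n z
      using b that by (cases n) (auto simp del: picard'.simps(2))
  qed
  then show ?T2 by (simp add: case_prod_unfold)
qed

text \<open>
  The Picard series converges uniformly for \<open>l\<close> in bounded sets, so the sum is holomorphic in \<open>l\<close>.
  The integral equations pass to the limit: by uniform convergence for the first, and by dominated
  convergence for the second, where the potential need not be bounded.
\<close>

theorem linear_ivp_exists:
  fixes p q :: "real \<Rightarrow> complex"
  assumes p: "continuous_on {0..b} p" and q: "q absolutely_integrable_on {0..b}" and "b \<ge> 0"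
  shows "\<exists>Y V. (\<forall>l. continuous_on {0..b} (Y l) \<and> continuous_on {0..b} (V l)) \<and>
     (\<forall>l. \<forall>x\<in>{0..b}. Y l x = c0 + integral {0..x} (V l) \<and>
        V l x = c1 + integral {0..x} (\<lambda>t. potential p q l t * Y l t)) \<and>
     (\<forall>x\<in>{0..b}. (\<lambda>l. Y l x) holomorphic_on UNIV \<and> (\<lambda>l. V l x) holomorphic_on UNIV)"
proof -
  let ?P = "picard (potential p q) c0 c1" and ?P' = "picard' (potential p q) c0 c1"
  define Y where "Y = (\<lambda>l x. \<Sum>n. ?P n l x)"
  define V where "V = (\<lambda>l x. \<Sum>n. ?P' n l x)"
  have uY: "uniform_limit ({l. norm l \<le> R} \<times> {0..b}) (\<lambda>N (l, x). \<Sum>n<N. ?P n l x) (\<lambda>(l, x). Y l x) sequentially" for R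
    unfolding Y_def by (rule uniform_limit_picard[OF assms])
  have uV: "uniform_limit ({l. norm l \<le> R} \<times> {0..b}) (\<lambda>N (l, x). \<Sum>n<N. ?P' n l x) (\<lambda>(l, x). V l x) sequentially" for R
    unfolding V_def by (rule uniform_limit_picard[OF assms])
  have ux: "uniform_limit {0..b} (\<lambda>N x. \<Sum>n<N. ?P n l x) (Y l) sequentially"
           "uniform_limit {0..b} (\<lambda>N x. \<Sum>n<N. ?P' n l x) (V l) sequentially" for l
    using uniform_limit_compose'[OF uY[of "norm l"], of "\<lambda>x. (l, x)" "{0..b}"] 
          uniform_limit_compose'[OF uV[of "norm l"], of "\<lambda>x. (l, x)" "{0..b}"] by auto
  have contS: "continuous_on {0..b} (\<lambda>x. \<Sum>n<N. ?P n l x)" "continuous_on {0..b} (\<lambda>x. \<Sum>n<N. ?P' n l x)" for N l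
    by (intro continuous_on_sum picard_continuous[OF p q])+
  have contY: "continuous_on {0..b} (Y l)" and contV: "continuous_on {0..b} (V l)" for l
    by (rule uniform_limit_theorem[OF _ ux(1)[of l]] uniform_limit_theorem[OF _ ux(2)[of l]]; use contS in auto)+
  have hol: "(\<lambda>l. Y l x) holomorphic_on UNIV" "(\<lambda>l. V l x) holomorphic_on UNIV" if x: "x \<in> {0..b}" for x
  proof -
    have u: "\<exists>d>0. cball z d \<subseteq> UNIV \<and> uniform_limit (cball z d) (\<lambda>N l. \<Sum>n<N. ?P n l x) (\<lambda>l. Y l x) sequentially"
            "\<exists>d>0. cball z d \<subseteq> UNIV \<and> uniform_limit (cball z d) (\<lambda>N l. \<Sum>n<N. ?P' n l x) (\<lambda>l. V l x) sequentially" for z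
    proof -
      have "norm l \<le> norm z + 1" if "l \<in> cball z 1" for l
        using that norm_triangle_sub[of l z] by (auto simp: dist_norm norm_minus_commute)
      then have s: "(\<lambda>l. (l, x)) \<in> cball z 1 \<rightarrow> {l. norm l \<le> norm z + 1} \<times> {0..b}" using x by auto
      show "\<exists>d>0. cball z d \<subseteq> UNIV \<and> uniform_limit (cball z d) (\<lambda>N l. \<Sum>n<N. ?P n l x) (\<lambda>l. Y l x) sequentially"
        using uniform_limit_compose'[OF uY[of "norm z + 1"] s] by (intro exI[of _ 1]) auto
      show "\<exists>d>0. cball z d \<subseteq> UNIV \<and> uniform_limit (cball z d) (\<lambda>N l. \<Sum>n<N. ?P' n l x) (\<lambda>l. V l x) sequentially"
        using uniform_limit_compose'[OF uV[of "norm z + 1"] s] by (intro exI[of _ 1]) auto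
    qed
    show "(\<lambda>l. Y l x) holomorphic_on UNIV"
      by (rule holomorphic_uniform_sequence[OF open_UNIV _ u(1)]) (intro holomorphic_intros picard_holomorphic[OF p q x])
    show "(\<lambda>l. V l x) holomorphic_on UNIV"
      by (rule holomorphic_uniform_sequence[OF open_UNIV _ u(2)]) (intro holomorphic_intros picard_holomorphic[OF p q x])
  qed
  have eqs: "Y l x = c0 + integral {0..x} (V l)" "V l x = c1 + integral {0..x} (\<lambda>t. potential p q l t * Y l t)"
    if x: "x \<in> {0..b}" for l x
  proof -
    note Q = potential_abs_int[OF p q, of l]
    have sub: "{0..x} \<subseteq> {0..b}" using x by auto
    have Qx: "potential p q l absolutely_integrable_on {0..x}" by (rule absolutely_integrable_on_subinterval[OF Q sub])
    have ux': "uniform_limit {0..x} (\<lambda>N x. \<Sum>n<N. ?P n l x) (Y l) sequentially"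
           "uniform_limit {0..x} (\<lambda>N x. \<Sum>n<N. ?P' n l x) (V l) sequentially"
      using ux sub uniform_limit_on_subset by blast+
    have cP: "continuous_on {0..x} (?P n l)" "continuous_on {0..x} (?P' n l)" for n
      using picard_continuous[OF p q] sub continuous_on_subset by blast+
    have iP': "?P' n l integrable_on {0..x}" for n by (rule integrable_continuous_real[OF cP(2)])
    have iQP: "(\<lambda>t. potential p q l t * ?P n l t) integrable_on {0..x}" for n
      by (rule abs_int_integrable[OF absolutely_integrable_mult_continuous[OF Qx cP(1)]])
    have iV: "(\<lambda>N. integral {0..x} (\<lambda>t. \<Sum>n<N. ?P' n l t)) \<longlonglongrightarrow> integral {0..x} (V l)"
    proof (rule uniform_limit_integral[OF ux'(2)])
      show "continuous_on {0..x} (\<lambda>t. \<Sum>n<N. ?P' n l t)" for N by (intro continuous_on_sum cP)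
      fix I J assume "\<And>N. ((\<lambda>t. \<Sum>n<N. ?P' n l t) has_integral I N) {0..x}" "(V l has_integral J) {0..x}" "I \<longlonglongrightarrow> J"
      moreover from this have "(\<lambda>N. integral {0..x} (\<lambda>t. \<Sum>n<N. ?P' n l t)) = I"
        using integral_unique by blast
      ultimately show ?thesis by (simp add: integral_unique)
    qed auto
    have iP: "integral {0..x} (\<lambda>t. \<Sum>n<Suc N. ?P' n l t) = (\<Sum>n<Suc N. ?P n l x) - c0" for N
    proof -
      have "integral {0..x} (\<lambda>t. \<Sum>n<Suc N. ?P' n l t) = (\<Sum>n<Suc N. integral {0..x} (?P' n l))"
        by (rule integral_sum) (auto intro: iP')
      also have "\<dots> = (\<Sum>n<Suc N. ?P n l x) - c0"
      proof -
        have "?P' 0 l = (\<lambda>_. c1)" "?P' (Suc n) l = (\<lambda>s. integral {0..s} (\<lambda>t. potential p q l t * ?P n l t))" for n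
          by (simp_all add: fun_eq_iff)
        then show ?thesis
          using x by (simp only: sum.lessThan_Suc_shift) (simp add: mult.commute scaleR_conv_of_real)
      qed
      finally show ?thesis .
    qed
    from LIMSEQ_Suc[OF iV] have "(\<lambda>N. (\<Sum>n<Suc N. ?P n l x) - c0) \<longlonglongrightarrow> integral {0..x} (V l)" by (simp only: iP)
    moreover have limP: "(\<lambda>N. (\<Sum>n<N. ?P n l x)) \<longlonglongrightarrow> Y l x" and limP': "(\<lambda>N. (\<Sum>n<N. ?P' n l x)) \<longlonglongrightarrow> V l x"
      using tendsto_uniform_limitI[OF ux(1) x] tendsto_uniform_limitI[OF ux(2) x] by auto
    from LIMSEQ_Suc[OF limP] have "(\<lambda>N. (\<Sum>n<Suc N. ?P n l x) - c0) \<longlonglongrightarrow> Y l x - c0"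
      by (intro tendsto_intros)
    ultimately show "Y l x = c0 + integral {0..x} (V l)" using LIMSEQ_unique by fastforce
    obtain B where B: "\<And>N t. t \<in> {0..x} \<Longrightarrow> norm (\<Sum>n<N. ?P n l t) \<le> B"
    proof -
      obtain A K where AK: "K \<ge> 0" "A \<ge> 0" and bd: "\<And>n t. t \<in> {0..b} \<Longrightarrow> norm (?P n l t) \<le> A * (K ^ n / fact n)"
        using picard_bound[OF assms, of "norm l" c0 c1] by blast
      have sm: "summable (\<lambda>n. A * (K ^ n / fact n))"
        using summable_exp[of K] by (intro summable_mult) (simp add: divide_inverse mult.commute)
      show thesis
      proof (rule that)
        fix N t assume t: "t \<in> {0..x}"
        have "norm (\<Sum>n<N. ?P n l t) \<le> (\<Sum>n<N. A * (K ^ n / fact n))"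
          by (rule sum_norm_le) (use bd t sub in auto)
        also have "\<dots> \<le> (\<Sum>n. A * (K ^ n / fact n))"
          by (rule sum_le_suminf[OF sm]) (use AK in auto)
        finally show "norm (\<Sum>n<N. ?P n l t) \<le> (\<Sum>n. A * (K ^ n / fact n))" .
      qed
    qed
    have "(\<lambda>N. integral {0..x} (\<lambda>t. potential p q l t * (\<Sum>n<N. ?P n l t))) \<longlonglongrightarrow> integral {0..x} (\<lambda>t. potential p q l t * Y l t)"
    proof (rule dominated_convergence(2)[where h = "\<lambda>t. norm (potential p q l t) * B"])
      show "(\<lambda>t. potential p q l t * (\<Sum>n<N. ?P n l t)) integrable_on {0..x}" for N
        by (rule abs_int_integrable[OF absolutely_integrable_mult_continuous[OF Qx]]) (intro continuous_on_sum cP)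
      show "(\<lambda>t. norm (potential p q l t) * B) integrable_on {0..x}"
        using absolutely_integrable_norm[OF Qx] abs_int_integrable
        by (intro integrable_on_mult_left) (auto simp: o_def)
      show "norm (potential p q l t * (\<Sum>n<N. ?P n l t)) \<le> norm (potential p q l t) * B" if "t \<in> {0..x}" for N t
        using B[OF that] by (simp add: norm_mult mult_left_mono)
      show "(\<lambda>N. potential p q l t * (\<Sum>n<N. ?P n l t)) \<longlonglongrightarrow> potential p q l t * Y l t" if "t \<in> {0..x}" for t
        using tendsto_uniform_limitI[OF ux'(1) that] by (intro tendsto_mult_left) auto
    qed
    moreover have "integral {0..x} (\<lambda>t. potential p q l t * (\<Sum>n<N. ?P n l t)) = (\<Sum>n<Suc N. ?P' n l x) - c1" for N
    proof -
      have "integral {0..x} (\<lambda>t. \<Sum>n<N. potential p q l t * ?P n l t) = (\<Sum>n<N. integral {0..x} (\<lambda>t. potential p q l t * ?P n l t))"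
        by (rule integral_sum) (auto intro: iQP)
      then show ?thesis by (simp only: sum.lessThan_Suc_shift) (simp add: sum_distrib_left)
    qed
    ultimately have "(\<lambda>N. (\<Sum>n<Suc N. ?P' n l x) - c1) \<longlonglongrightarrow> integral {0..x} (\<lambda>t. potential p q l t * Y l t)" by simp
    moreover from LIMSEQ_Suc[OF limP'] have "(\<lambda>N. (\<Sum>n<Suc N. ?P' n l x) - c1) \<longlonglongrightarrow> V l x - c1"
      by (intro tendsto_intros)
    ultimately show "V l x = c1 + integral {0..x} (\<lambda>t. potential p q l t * Y l t)" using LIMSEQ_unique by fastforce
  qed
  show ?thesis
    by (rule exI[of _ Y], rule exI[of _ V]) (intro conjI allI ballI contY contV hol eqs)
qed

section \<open>The initial value problem on an edge\<close>

lemma abs_cont_on_subset: "abs_cont_on a b f \<Longrightarrow> a \<le> c \<Longrightarrow> d \<le> b \<Longrightarrow> abs_cont_on c d f"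
  unfolding abs_cont_on_def by (smt (verit, best))

lemma abs_cont_on_cong: "(\<And>x. x \<in> {a..b} \<Longrightarrow> f x = g x) \<Longrightarrow> abs_cont_on a b f \<Longrightarrow> abs_cont_on a b g"
  by (rule abs_cont_on_lipschitz_comp[where L = 1]) auto

lemma abs_cont_on_const: "abs_cont_on a b (\<lambda>_. c)"
  by (rule abs_cont_on_lipschitz_comp[OF abs_cont_on_of_real, where L = 0]) auto

text \<open>
  The initial value problem \<open>y'' = Q y\<close>, \<open>y 0 = c0\<close>, \<open>y' 0 = c1\<close> as a first-order system in
  integrated form, with \<open>v\<close> in the role of \<open>y'\<close>.  In this form no almost everywhere derivatives
  occur.
\<close>

definition ivp :: "(real \<Rightarrow> complex) \<Rightarrow> complex \<Rightarrow> complex \<Rightarrow> (real \<Rightarrow> complex) \<Rightarrow> (real \<Rightarrow> complex) \<Rightarrow> bool" where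
  "ivp Q c0 c1 y v \<longleftrightarrow> continuous_on {0..pi} y \<and> continuous_on {0..pi} v \<and>
     (\<forall>x\<in>{0..pi}. y x = c0 + integral {0..x} v \<and> v x = c1 + integral {0..x} (\<lambda>t. Q t * y t))"

lemma ivp_init: "ivp Q c0 c1 y v \<Longrightarrow> y 0 = c0 \<and> v 0 = c1"
  unfolding ivp_def by (metis add_cancel_right_right atLeastAtMost_iff integral_singleton box_real(2) cbox_idem order_refl pi_ge_zero)

lemma ivp_lincomb:
  assumes Q: "Q absolutely_integrable_on {0..pi}" and y: "ivp Q c0 c1 y v" and z: "ivp Q d0 d1 z w"
  shows "ivp Q (a * c0 + b * d0) (a * c1 + b * d1) (\<lambda>x. a * y x + b * z x) (\<lambda>x. a * v x + b * w x)"
  unfolding ivp_def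
proof (intro conjI ballI)
  show "continuous_on {0..pi} (\<lambda>x. a * y x + b * z x)" "continuous_on {0..pi} (\<lambda>x. a * v x + b * w x)"
    using y z by (auto simp: ivp_def intro!: continuous_intros)
  fix x :: real assume x: "x \<in> {0..pi}"
  have sub: "{0..x} \<subseteq> {0..pi}" using x by auto
  have cont: "continuous_on {0..x} y" "continuous_on {0..x} z" "continuous_on {0..x} v" "continuous_on {0..x} w"
    using y z continuous_on_subset[OF _ sub] by (auto simp: ivp_def)
  have Qx: "Q absolutely_integrable_on {0..x}" by (rule absolutely_integrable_on_subinterval[OF Q sub])
  have i: "(\<lambda>x. a * v x) integrable_on {0..x}" "(\<lambda>x. b * w x) integrable_on {0..x}"
    using cont by (auto intro!: integrable_continuous_real continuous_intros)
  have iQ: "(\<lambda>t. Q t * y t) integrable_on {0..x}" "(\<lambda>t. Q t * z t) integrable_on {0..x}"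
    using cont by (auto intro!: abs_int_integrable absolutely_integrable_mult_continuous[OF Qx])
  show "a * y x + b * z x = a * c0 + b * d0 + integral {0..x} (\<lambda>x. a * v x + b * w x)"
    using y z x by (simp add: integral_add[OF i] ivp_def algebra_simps)
  have "integral {0..x} (\<lambda>t. Q t * (a * y t + b * z t)) = integral {0..x} (\<lambda>t. a * (Q t * y t) + b * (Q t * z t))"
    by (simp add: algebra_simps)
  also have "\<dots> = a * integral {0..x} (\<lambda>t. Q t * y t) + b * integral {0..x} (\<lambda>t. Q t * z t)"
    using iQ by (subst integral_add) (auto intro: integrable_on_mult_right)
  finally show "a * v x + b * w x = a * c1 + b * d1 + integral {0..x} (\<lambda>t. Q t * (a * y t + b * z t))"
    using y z x by (simp add: ivp_def algebra_simps)
qed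

lemma ivp_unique:
  assumes Q: "Q absolutely_integrable_on {0..pi}" and y: "ivp Q c0 c1 y v" and z: "ivp Q c0 c1 z w"
    and x: "x \<in> {0..pi}"
  shows "y x = z x" "v x = w x"
proof -
  have d: "ivp Q 0 0 (\<lambda>x. y x - z x) (\<lambda>x. v x - w x)"
    using ivp_lincomb[OF Q y z, of 1 "-1"] by simp
  have d0: "y t - z t = 0" if t: "t \<in> {0..pi}" for t
  proof (rule volterra_unique[OF Q _ _ t])
    show "continuous_on {0..pi} (\<lambda>x. y x - z x)" using d by (simp add: ivp_def)
    fix x assume x: "x \<in> {0..pi}"
    have "y x - z x = integral {0..x} (\<lambda>s. v s - w s)" using d x by (simp add: ivp_def)
    also have "\<dots> = integral {0..x} (\<lambda>s. integral {0..s} (\<lambda>t. Q t * (y t - z t)))"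
      using d x by (intro integral_cong) (auto simp: ivp_def)
    finally show "y x - z x = integral {0..x} (\<lambda>s. integral {0..s} (\<lambda>t. Q t * (y t - z t)))" .
  qed
  then show "y x = z x" using x by simp
  have "v x - w x = integral {0..x} (\<lambda>t. Q t * (y t - z t))" using d x by (simp add: ivp_def)
  also have "\<dots> = integral {0..x} (\<lambda>t. 0)" using x d0 by (intro integral_cong) auto
  finally show "v x = w x" by simp
qed

lemma ivp_has_derivative:
  assumes "ivp Q c0 c1 y v" "x \<in> {0..pi}"
  shows "(y has_vector_derivative v x) (at x within {0..pi})"
proof -
  have "continuous_on {0..pi} v" using assms by (simp add: ivp_def)
  from integral_has_vector_derivative[OF this assms(2)]
  have "((\<lambda>u. c0 + integral {0..u} v) has_vector_derivative v x) (at x within {0..pi})"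
    by (auto intro!: derivative_eq_intros)
  then show ?thesis
    by (rule has_vector_derivative_transform[OF assms(2), rotated]) (use assms(1) in \<open>auto simp: ivp_def\<close>)
qed

lemma ivp_ae_derivative:
  assumes Q: "Q absolutely_integrable_on {0..pi}" and y: "ivp Q c0 c1 y v"
  shows "\<exists>N. negligible N \<and> (\<forall>x\<in>{0..pi} - N. x \<in> {0<..<pi} \<and> (v has_vector_derivative Q x * y x) (at x))"
proof -
  have "(\<lambda>t. Q t * y t) absolutely_integrable_on {0..pi}"
    using y absolutely_integrable_mult_continuous[OF Q] by (simp add: ivp_def)
  from indefinite_integral_ae_derivative[OF abs_int_integrable[OF this]]
  obtain N where N: "negligible N" "\<And>x. x \<in> {0..pi} - N \<Longrightarrow> x \<in> {0<..<pi} \<and> 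
    ((\<lambda>x. integral {0..x} (\<lambda>t. Q t * y t)) has_vector_derivative Q x * y x) (at x)" by blast
  have "(v has_vector_derivative Q x * y x) (at x)" if x: "x \<in> {0..pi} - N" for x
  proof -
    have "((\<lambda>x. c1 + integral {0..x} (\<lambda>t. Q t * y t)) has_vector_derivative Q x * y x) (at x)"
      using N(2)[OF x] by (auto intro!: derivative_eq_intros)
    then show ?thesis
      by (rule has_vector_derivative_transform_within_open[where S = "{0<..<pi}"]) 
         (use N(2)[OF x] y in \<open>auto simp: ivp_def\<close>)
  qed
  then show ?thesis using N by blast
qed

lemma ivp_abs_cont:
  assumes Q: "Q absolutely_integrable_on {0..pi}" and y: "ivp Q c0 c1 y v"
  shows "abs_cont_on 0 pi y" "abs_cont_on 0 pi v"
proof -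
  show "abs_cont_on 0 pi y"
    by (rule abs_cont_on_C1[OF ivp_has_derivative[OF y]]) (use y in \<open>auto simp: ivp_def\<close>)
  have "(\<lambda>t. Q t * y t) absolutely_integrable_on {0..pi}"
    using y absolutely_integrable_mult_continuous[OF Q] by (simp add: ivp_def)
  from abs_cont_on_add[OF abs_cont_on_const abs_cont_on_indefinite_integral[OF this], of c1]
  show "abs_cont_on 0 pi v" by (rule abs_cont_on_cong[rotated]) (use y in \<open>auto simp: ivp_def\<close>)
qed

lemma ivp_D1:
  assumes "ivp Q c0 c1 y v" "x \<in> {0..pi}"
  shows "D1 y x = v x"
  unfolding D1_def using vector_derivative_within_cbox[of 0 pi x y "v x"] ivp_has_derivative[OF assms] assms(2) by simp

lemma ivp_imp_solves_eq:
  assumes p: "continuous_on {0..pi} p" and q: "q absolutely_integrable_on {0..pi}"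
    and y: "ivp (potential p q l) c0 c1 y v"
  shows "solves_eq p q l y"
  unfolding solves_eq_def W21_def
proof (intro conjI)
  note Q = potential_abs_int[OF p q, of l]
  show "y differentiable_on {0..pi}"
    using ivp_has_derivative[OF y] unfolding differentiable_on_def
    by (metis differentiableI_vector)
  show "abs_cont_on 0 pi y" by (rule ivp_abs_cont[OF Q y])
  show "abs_cont_on 0 pi (D1 y)"
    by (rule abs_cont_on_cong[OF _ ivp_abs_cont(2)[OF Q y]]) (simp add: ivp_D1[OF y])
  obtain N where N: "negligible N" "\<And>x. x \<in> {0..pi} - N \<Longrightarrow> x \<in> {0<..<pi} \<and> (v has_vector_derivative potential p q l x * y x) (at x)"
    using ivp_ae_derivative[OF Q y] by blast
  show "AE x in lebesgue. x \<in> {0<..<pi} \<longrightarrow>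
        (\<exists>y2. (D1 y has_vector_derivative y2) (at x) \<and>
              - y2 + q x * y x + 2 * l * p x * y x = l\<^sup>2 * y x)"
  proof (rule AE_I')
    show "N \<in> null_sets lebesgue" using N(1) by (simp add: negligible_iff_null_sets)
    have "\<exists>y2. (D1 y has_vector_derivative y2) (at x) \<and> - y2 + q x * y x + 2 * l * p x * y x = l\<^sup>2 * y x"
      if x: "x \<in> {0<..<pi}" "x \<notin> N" for x
    proof (intro exI conjI)
      have "(v has_vector_derivative potential p q l x * y x) (at x)" using N(2)[of x] x by auto
      then show "(D1 y has_vector_derivative potential p q l x * y x) (at x)"
        by (rule has_vector_derivative_transform_within_open[where S = "{0<..<pi}"]) (use x ivp_D1[OF y] in auto)
      show "- (potential p q l x * y x) + q x * y x + 2 * l * p x * y x = l\<^sup>2 * y x"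
        by (simp add: potential_def algebra_simps)
    qed
    then show "{x \<in> space lebesgue. \<not> (x \<in> {0<..<pi} \<longrightarrow> (\<exists>y2. (D1 y has_vector_derivative y2) (at x) \<and>
              - y2 + q x * y x + 2 * l * p x * y x = l\<^sup>2 * y x))} \<subseteq> N" by blast
  qed
qed

text \<open>
  Together with \<open>ivp_imp_solves_eq\<close> this identifies Sobolev solutions with solutions of the integrated
  system.  The second derivative is known almost everywhere only; absolute continuity of \<open>D1 y\<close> is what
  allows to integrate it.
\<close>

lemma solves_eq_imp_ivp:
  assumes p: "continuous_on {0..pi} p" and q: "q absolutely_integrable_on {0..pi}"
    and y: "solves_eq p q l y"
  shows "ivp (potential p q l) (y 0) (D1 y 0) y (D1 y)"
  unfolding ivp_def
proof (intro conjI ballI)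
  have dy: "(y has_vector_derivative D1 y x) (at x within {0..pi})" if "x \<in> {0..pi}" for x
    using y that unfolding D1_def solves_eq_def W21_def differentiable_on_def by (simp add: vector_derivative_works)
  have ac: "abs_cont_on 0 pi (D1 y)" "abs_cont_on 0 pi y" using y by (auto simp: solves_eq_def W21_def)
  show "continuous_on {0..pi} y" "continuous_on {0..pi} (D1 y)"
    by (rule abs_cont_on_imp_continuous[OF ac(2)] abs_cont_on_imp_continuous[OF ac(1)])+
  from y have "AE x in lebesgue. x \<in> {0<..<pi} \<longrightarrow>
        (\<exists>y2. (D1 y has_vector_derivative y2) (at x) \<and>
              - y2 + q x * y x + 2 * l * p x * y x = l\<^sup>2 * y x)" by (simp add: solves_eq_def)
  then obtain N where N: "N \<in> null_sets lebesgue" "{x \<in> space lebesgue. \<not> (x \<in> {0<..<pi} \<longrightarrow> (\<exists>y2. (D1 y has_vector_derivative y2) (at x) \<and>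
              - y2 + q x * y x + 2 * l * p x * y x = l\<^sup>2 * y x))} \<subseteq> N"
    unfolding eventually_ae_filter by blast
  have neg: "negligible (N \<union> {0, pi})" using N(1) by (simp add: negligible_iff_null_sets[symmetric])
  fix x :: real assume x: "x \<in> {0..pi}"
  have sub: "{0..x} \<subseteq> {0..pi}" using x by auto
  have "(D1 y has_integral y x - y 0) {0..x}"
  proof (rule fundamental_theorem_of_calculus)
    show "(y has_vector_derivative D1 y t) (at t within {0..x})" if "t \<in> {0..x}" for t
      using has_vector_derivative_within_subset[OF dy sub, of t] that sub by blast
  qed (use x in auto)
  then show "y x = y 0 + integral {0..x} (D1 y)" by (simp add: integral_unique)
  have "((\<lambda>t. potential p q l t * y t) has_integral D1 y x - D1 y 0) {0..x}"
  proof (rule abs_cont_fundamental_theorem[OF _ _ neg])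
    show "abs_cont_on 0 x (D1 y)" by (rule abs_cont_on_subset[OF ac(1)]) (use x in auto)
    fix t assume t: "t \<in> {0..x} - (N \<union> {0, pi})"
    then have "t \<in> {0<..<pi}" "t \<notin> N" using x by auto
    then obtain y2 where y2: "(D1 y has_vector_derivative y2) (at t)" "- y2 + q t * y t + 2 * l * p t * y t = l\<^sup>2 * y t"
      using N(2) by auto
    have "y2 = potential p q l t * y t" using y2(2) by (simp add: potential_def algebra_simps)
    then show "(D1 y has_vector_derivative potential p q l t * y t) (at t within {0..x})"
      using y2(1) has_vector_derivative_at_within by blast
  qed (use x in auto)
  then show "D1 y x = D1 y 0 + integral {0..x} (\<lambda>t. potential p q l t * y t)" by (simp add: integral_unique)
qed

text \<open>
  The Wronskian is absolutely continuous and its derivative vanishes almost everywhere.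
\<close>

lemma ivp_wronskian:
  assumes Q: "Q absolutely_integrable_on {0..pi}" and y: "ivp Q c0 c1 y v" and z: "ivp Q d0 d1 z w" and x: "x \<in> {0..pi}"
  shows "y x * w x - v x * z x = c0 * d1 - c1 * d0"
proof -
  define W where "W = (\<lambda>x. y x * w x + (-1) * (v x * z x))"
  obtain N1 where N1: "negligible N1" "\<And>x. x \<in> {0..pi} - N1 \<Longrightarrow> x \<in> {0<..<pi} \<and> (v has_vector_derivative Q x * y x) (at x)"
    using ivp_ae_derivative[OF Q y] by blast
  obtain N2 where N2: "negligible N2" "\<And>x. x \<in> {0..pi} - N2 \<Longrightarrow> x \<in> {0<..<pi} \<and> (w has_vector_derivative Q x * z x) (at x)"
    using ivp_ae_derivative[OF Q z] by blast
  have sub: "{0..x} \<subseteq> {0..pi}" using x by auto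
  have "((\<lambda>_. 0) has_integral W x - W 0) {0..x}"
  proof (rule abs_cont_fundamental_theorem[where N = "N1 \<union> N2"])
    have "abs_cont_on 0 pi W" unfolding W_def
      by (intro abs_cont_on_add abs_cont_on_mult abs_cont_on_const ivp_abs_cont[OF Q y] ivp_abs_cont[OF Q z])
    then show "abs_cont_on 0 x W" by (rule abs_cont_on_subset) (use x in auto)
    show "negligible (N1 \<union> N2)" using N1 N2 by simp
    fix t assume t: "t \<in> {0..x} - (N1 \<union> N2)"
    then have tp: "t \<in> {0..pi}" using sub by auto
    have d: "(v has_vector_derivative Q t * y t) (at t within {0..x})" "(w has_vector_derivative Q t * z t) (at t within {0..x})"
      using N1(2)[of t] N2(2)[of t] t tp has_vector_derivative_at_within by blast+
    have d': "(y has_vector_derivative v t) (at t within {0..x})" "(z has_vector_derivative w t) (at t within {0..x})"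
      using ivp_has_derivative[OF y tp] ivp_has_derivative[OF z tp] has_vector_derivative_within_subset[OF _ sub] by blast+
    show "(W has_vector_derivative 0) (at t within {0..x})" unfolding W_def
      by (rule derivative_eq_intros d d' refl)+ (simp add: algebra_simps)
  qed (use x in auto)
  then have "W x - W 0 = 0" by (metis has_integral_0_eq)
  then show ?thesis using ivp_init[OF y] ivp_init[OF z] by (simp add: W_def)
qed

lemma ivp_exists:
  assumes p: "continuous_on {0..pi} p" and q: "q absolutely_integrable_on {0..pi}"
  shows "\<exists>Y V. (\<forall>l. ivp (potential p q l) c0 c1 (Y l) (V l)) \<and> (\<lambda>l. Y l pi) holomorphic_on UNIV \<and> (\<lambda>l. V l pi) holomorphic_on UNIV"
proof -
  obtain Y V where "\<And>l. continuous_on {0..pi} (Y l) \<and> continuous_on {0..pi} (V l)"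
     "\<And>l x. x \<in> {0..pi} \<Longrightarrow> Y l x = c0 + integral {0..x} (V l) \<and>
        V l x = c1 + integral {0..x} (\<lambda>t. potential p q l t * Y l t)"
     "\<And>x. x \<in> {0..pi} \<Longrightarrow> (\<lambda>l. Y l x) holomorphic_on UNIV \<and> (\<lambda>l. V l x) holomorphic_on UNIV"
    using linear_ivp_exists[OF p q pi_ge_zero, of c0 c1] by blast
  then show ?thesis unfolding ivp_def by (intro exI[of _ Y] exI[of _ V]) auto
qed

lemma sol_S_ivp:
  assumes p: "continuous_on {0..pi} p" and q: "q absolutely_integrable_on {0..pi}"
  shows "ivp (potential p q l) 0 1 (sol_S p q l) (D1 (sol_S p q l))"
proof -
  obtain Y V where Y: "ivp (potential p q l) 0 1 Y V" using ivp_exists[OF p q, of 0 1] by blast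
  have "solves_eq p q l Y \<and> Y 0 = 0 \<and> D1 Y 0 = 1"
    using ivp_imp_solves_eq[OF p q Y] ivp_init[OF Y] ivp_D1[OF Y, of 0] by simp
  then have "solves_eq p q l (sol_S p q l) \<and> sol_S p q l 0 = 0 \<and> D1 (sol_S p q l) 0 = 1"
    unfolding sol_S_def by (rule someI[where P = "\<lambda>y. solves_eq p q l y \<and> y 0 = 0 \<and> D1 y 0 = 1"])
  then show ?thesis using solves_eq_imp_ivp[OF p q] by metis
qed

lemma sol_C_ivp:
  assumes p: "continuous_on {0..pi} p" and q: "q absolutely_integrable_on {0..pi}"
  shows "ivp (potential p q l) 1 0 (sol_C p q l) (D1 (sol_C p q l))"
proof -
  obtain Y V where Y: "ivp (potential p q l) 1 0 Y V" using ivp_exists[OF p q, of 1 0] by blast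
  have "solves_eq p q l Y \<and> Y 0 = 1 \<and> D1 Y 0 = 0"
    using ivp_imp_solves_eq[OF p q Y] ivp_init[OF Y] ivp_D1[OF Y, of 0] by simp
  then have "solves_eq p q l (sol_C p q l) \<and> sol_C p q l 0 = 1 \<and> D1 (sol_C p q l) 0 = 0"
    unfolding sol_C_def by (rule someI[where P = "\<lambda>y. solves_eq p q l y \<and> y 0 = 1 \<and> D1 y 0 = 0"])
  then show ?thesis using solves_eq_imp_ivp[OF p q] by metis
qed

text \<open>
  The chosen solutions agree, by uniqueness, with the sums of the Picard series, which are holomorphic
  in \<open>l\<close>.
\<close>

lemma sol_holomorphic:
  assumes p: "continuous_on {0..pi} p" and q: "q absolutely_integrable_on {0..pi}"
  shows "(\<lambda>l. sol_S p q l pi) holomorphic_on UNIV" "(\<lambda>l. D1 (sol_S p q l) pi) holomorphic_on UNIV"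
    "(\<lambda>l. sol_C p q l pi) holomorphic_on UNIV"
proof -
  note Q = potential_abs_int[OF p q]
  obtain Y V where Y: "\<And>l. ivp (potential p q l) 0 1 (Y l) (V l)" "(\<lambda>l. Y l pi) holomorphic_on UNIV" "(\<lambda>l. V l pi) holomorphic_on UNIV"
    using ivp_exists[OF p q, of 0 1] by blast
  have "(\<lambda>l. sol_S p q l pi) = (\<lambda>l. Y l pi)" "(\<lambda>l. D1 (sol_S p q l) pi) = (\<lambda>l. V l pi)"
    using ivp_unique[OF Q sol_S_ivp[OF p q] Y(1), of pi] by auto
  then show "(\<lambda>l. sol_S p q l pi) holomorphic_on UNIV" "(\<lambda>l. D1 (sol_S p q l) pi) holomorphic_on UNIV"
    using Y by simp_all
  obtain Y V where Y: "\<And>l. ivp (potential p q l) 1 0 (Y l) (V l)" "(\<lambda>l. Y l pi) holomorphic_on UNIV" "(\<lambda>l. V l pi) holomorphic_on UNIV"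
    using ivp_exists[OF p q, of 1 0] by blast
  have "(\<lambda>l. sol_C p q l pi) = (\<lambda>l. Y l pi)"
    using ivp_unique[OF Q sol_C_ivp[OF p q] Y(1), of pi] by auto
  then show "(\<lambda>l. sol_C p q l pi) holomorphic_on UNIV" using Y by simp
qed

lemma solves_eq_lincomb:
  assumes p: "continuous_on {0..pi} p" and q: "q absolutely_integrable_on {0..pi}"
  shows "solves_eq p q l (\<lambda>x. a * sol_C p q l x + b * sol_S p q l x)"
    and "x \<in> {0..pi} \<Longrightarrow> D1 (\<lambda>x. a * sol_C p q l x + b * sol_S p q l x) x = a * D1 (sol_C p q l) x + b * D1 (sol_S p q l) x"
proof -
  note i = ivp_lincomb[OF potential_abs_int[OF p q] sol_C_ivp[OF p q] sol_S_ivp[OF p q], of l a b]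
  show "solves_eq p q l (\<lambda>x. a * sol_C p q l x + b * sol_S p q l x)"
    by (rule ivp_imp_solves_eq[OF p q i])
  show "D1 (\<lambda>x. a * sol_C p q l x + b * sol_S p q l x) x = a * D1 (sol_C p q l) x + b * D1 (sol_S p q l) x" if "x \<in> {0..pi}"
    by (rule ivp_D1[OF i that])
qed

lemma solves_eq_representation:
  assumes p: "continuous_on {0..pi} p" and q: "q absolutely_integrable_on {0..pi}"
    and y: "solves_eq p q l y" and x: "x \<in> {0..pi}"
  shows "y x = y 0 * sol_C p q l x + D1 y 0 * sol_S p q l x"
    and "D1 y x = y 0 * D1 (sol_C p q l) x + D1 y 0 * D1 (sol_S p q l) x"
proof -
  note Q = potential_abs_int[OF p q, of l]
  note i = ivp_lincomb[OF Q sol_C_ivp[OF p q] sol_S_ivp[OF p q], of "y 0" "D1 y 0"]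
  have j: "ivp (potential p q l) (y 0 * 1 + D1 y 0 * 0) (y 0 * 0 + D1 y 0 * 1) y (D1 y)"
    using solves_eq_imp_ivp[OF p q y] by simp
  show "y x = y 0 * sol_C p q l x + D1 y 0 * sol_S p q l x" "D1 y x = y 0 * D1 (sol_C p q l) x + D1 y 0 * D1 (sol_S p q l) x"
    by (rule ivp_unique[OF Q j i x])+
qed

section \<open>Smoothing a function of bounded variation\<close>

text \<open>
  Cut \<open>{0..b}\<close> into \<open>N\<close> cells shorter than the \<open>\<delta>\<close> that belongs to \<open>\<epsilon> = 1\<close>.  The variation over each
  cell is at most \<open>1\<close>, hence the total is at most \<open>N\<close>.
\<close>

lemma abs_cont_imp_bounded_variation:
  assumes ac: "abs_cont_on 0 b p" and "0 < b"
  shows "\<exists>B. \<forall>n (t :: nat \<Rightarrow> real). mono t \<longrightarrow> 0 \<le> t 0 \<longrightarrow> t n \<le> b \<longrightarrow> (\<Sum>i<n. norm (p (t (Suc i)) - p (t i))) \<le> B"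
proof -
  have "\<exists>\<delta>>0. \<forall>(n::nat) u v. (\<forall>i<n. 0 \<le> u i \<and> u i \<le> v i \<and> v i \<le> b) \<longrightarrow>
        disjoint_family_on (\<lambda>i. {u i<..<v i}) {..<n} \<longrightarrow> (\<Sum>i<n. v i - u i) < \<delta> \<longrightarrow>
        (\<Sum>i<n. norm (p (v i) - p (u i))) < 1"
    using ac unfolding abs_cont_on_def by simp
  then obtain \<delta> where "\<delta> > 0" and \<delta>: "\<forall>(n::nat) u v. (\<forall>i<n. 0 \<le> u i \<and> u i \<le> v i \<and> v i \<le> b) \<longrightarrow>
        disjoint_family_on (\<lambda>i. {u i<..<v i}) {..<n} \<longrightarrow> (\<Sum>i<n. v i - u i) < \<delta> \<longrightarrow>
        (\<Sum>i<n. norm (p (v i) - p (u i))) < 1" by blast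
  obtain N :: nat where N: "b / \<delta> < real N" using reals_Archimedean2 by blast
  have "N > 0" using N \<open>\<delta> > 0\<close> \<open>b > 0\<close> by (metis divide_pos_pos gr_zeroI not_less_iff_gr_or_eq of_nat_0)
  define c where "c = (\<lambda>j::nat. real j * b / real N)"
  have cstep: "c (Suc j) - c j < \<delta>" "c j \<le> c (Suc j)" for j
    using N \<open>N > 0\<close> \<open>\<delta> > 0\<close> \<open>b > 0\<close> by (simp_all add: c_def field_simps)
  have c0: "c 0 = 0" "c N = b" using \<open>N > 0\<close> by (auto simp: c_def)
  have cb: "0 \<le> c j" "j \<le> N \<Longrightarrow> c j \<le> b" for j
    using \<open>N > 0\<close> \<open>b > 0\<close> by (auto simp: c_def field_simps)
  have cell: "(\<Sum>i<n. norm (p (t (Suc i)) - p (t i))) \<le> 1"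
    if t: "mono t" "c j \<le> t 0" "t n \<le> c (Suc j)" "j < N" for n and t :: "nat \<Rightarrow> real" and j
  proof -
    have tb: "c j \<le> t i" "i \<le> n \<Longrightarrow> t i \<le> c (Suc j)" "t i \<le> t (Suc i)" for i
      using t(1-3) monoD[OF t(1)] by (meson le0 order_trans lessI less_imp_le)+
    have "(\<Sum>i<n. norm (p (t (Suc i)) - p (t i))) < 1"
    proof (rule \<delta>[THEN spec, THEN spec, THEN spec, THEN mp, THEN mp, THEN mp])
      show "\<forall>i<n. 0 \<le> t i \<and> t i \<le> t (Suc i) \<and> t (Suc i) \<le> b"
        using tb cb(1)[of j] cb(2)[of "Suc j"] t(4) by (meson Suc_leI order_trans)
      show "disjoint_family_on (\<lambda>i. {t i<..<t (Suc i)}) {..<n}"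
      proof (unfold disjoint_family_on_def, intro ballI impI)
        fix i k :: nat assume "i \<noteq> k"
        then have "t (Suc i) \<le> t k \<or> t (Suc k) \<le> t i"
          using monoD[OF t(1)] by (metis Suc_leI linorder_neqE_nat)
        then show "{t i<..<t (Suc i)} \<inter> {t k<..<t (Suc k)} = {}" by auto
      qed
      have "(\<Sum>i<n. t (Suc i) - t i) = t n - t 0" by (rule sum_lessThan_telescope)
      then show "(\<Sum>i<n. t (Suc i) - t i) < \<delta>" using t(2,3) cstep(1)[of j] by linarith
    qed
    then show ?thesis by simp
  qed
  \<comment> \<open>A partition need not respect the cells: projecting it to each cell and telescoping
    over the cells replaces the refinement of the partition.\<close>
  define cl where "cl = (\<lambda>j x. max (c j) (min (c (Suc j)) x))"
  have tel: "(\<Sum>j<k. p (cl j x) - p (c j)) = p (min (c k) x) - p 0" if "x \<ge> 0" for k x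
  proof (induction k)
    case 0
    then show ?case using that c0 by simp
  next
    case (Suc k)
    have "p (min (c k) x) + (p (cl k x) - p (c k)) = p (min (c (Suc k)) x)"
      using cstep(2)[of k] by (auto simp: cl_def min_def max_def)
    then show ?case using Suc unfolding sum.lessThan_Suc by (metis (no_types, lifting) add.commute add_diff_eq diff_add_cancel)
  qed
  show ?thesis
  proof (intro exI[of _ "real N"] allI impI)
    fix n and t :: "nat \<Rightarrow> real" assume t: "mono t" "0 \<le> t 0" "t n \<le> b"
    have tb: "0 \<le> t i" "i \<le> n \<Longrightarrow> t i \<le> b" for i
      using t monoD[OF t(1)] by (meson le0 order_trans)+
    have "(\<Sum>i<n. norm (p (t (Suc i)) - p (t i))) \<le> (\<Sum>i<n. \<Sum>j<N. norm (p (cl j (t (Suc i))) - p (cl j (t i))))"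
    proof (rule sum_mono)
      fix i assume "i \<in> {..<n}"
      then have i: "t i \<le> b" "t (Suc i) \<le> b" using tb by auto
      have "p (t (Suc i)) - p (t i) = (\<Sum>j<N. p (cl j (t (Suc i))) - p (c j)) - (\<Sum>j<N. p (cl j (t i)) - p (c j))"
        using tel[where x = "t i" and k = N, OF tb(1)] tel[where x = "t (Suc i)" and k = N, OF tb(1)] i c0 by (simp add: min_def)
      also have "\<dots> = (\<Sum>j<N. p (cl j (t (Suc i))) - p (cl j (t i)))"
        by (simp add: sum_subtractf)
      finally show "norm (p (t (Suc i)) - p (t i)) \<le> (\<Sum>j<N. norm (p (cl j (t (Suc i))) - p (cl j (t i))))"
        by (simp add: norm_sum)
    qed
    also have "\<dots> = (\<Sum>j<N. \<Sum>i<n. norm (p (cl j (t (Suc i))) - p (cl j (t i))))" by (rule sum.swap)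
    also have "\<dots> \<le> (\<Sum>j<N. 1)"
    proof (rule sum_mono)
      fix j assume "j \<in> {..<N}"
      moreover have "mono (\<lambda>i. cl j (t i))" using monoD[OF t(1)] by (auto simp: mono_def cl_def max_def min_def) (meson order_trans linorder_linear)+
      ultimately show "(\<Sum>i<n. norm (p (cl j (t (Suc i))) - p (cl j (t i)))) \<le> 1"
        using cell[of "\<lambda>i. cl j (t i)" j n] cstep(2)[of j] by (auto simp: cl_def)
    qed
    also have "\<dots> = real N" by simp
    finally show "(\<Sum>i<n. norm (p (t (Suc i)) - p (t i))) \<le> real N" .
  qed
qed

text \<open>
  Projection to \<open>{0..b}\<close>.  It extends functions on the interval to the whole line by constants, so
  that they can be shifted.
\<close>

definition clamp_from_zero :: "real \<Rightarrow> real \<Rightarrow> real" where "clamp_from_zero b x = max 0 (min b x)"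

text \<open>
  \<open>V\<close> is the total variation over \<open>{0..x}\<close>.
\<close>

lemma variation_function:
  assumes ac: "abs_cont_on 0 b p" and "0 < b"
  shows "\<exists>V B. mono V \<and> (\<forall>x. 0 \<le> V x \<and> V x \<le> (B::real)) \<and>
     (\<forall>x y. x \<le> y \<longrightarrow> norm (p (clamp_from_zero b y) - p (clamp_from_zero b x)) \<le> V y - V x)"
proof -
  obtain B where B: "\<And>n t. mono t \<Longrightarrow> 0 \<le> t 0 \<Longrightarrow> t n \<le> b \<Longrightarrow> (\<Sum>i<n. norm (p (t (Suc i)) - p (t i))) \<le> B"
    using abs_cont_imp_bounded_variation[OF assms] by blast
  define S where "S = (\<lambda>x. {s. \<exists>n (t::nat \<Rightarrow> real). mono t \<and> 0 \<le> t 0 \<and> t n \<le> clamp_from_zero b x \<and> s = (\<Sum>i<n. norm (p (t (Suc i)) - p (t i)))})"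
  define V where "V = (\<lambda>x. Sup (S x))"
  have cl: "0 \<le> clamp_from_zero b x" "clamp_from_zero b x \<le> b" "x \<le> y \<Longrightarrow> clamp_from_zero b x \<le> clamp_from_zero b y" for x y
    using \<open>0 < b\<close> by (auto simp: clamp_from_zero_def)
  have zero: "0 \<in> S x" for x
    unfolding S_def using cl(1)[of x] by (intro CollectI exI[of _ 0] exI[of _ "\<lambda>_. 0"]) (auto simp: mono_def)
  have SB: "s \<le> B" if "s \<in> S x" for s x
    using that B cl(2)[of x] unfolding S_def by (auto intro: order_trans)
  have bdd: "bdd_above (S x)" for x using SB by (meson bdd_aboveI)
  have Vb: "0 \<le> V x" "V x \<le> B" for x
    unfolding V_def using cSup_upper[OF zero bdd] cSup_least[of "S x" B] zero SB by blast+
  have step: "V x + norm (p (clamp_from_zero b y) - p (clamp_from_zero b x)) \<le> V y" if xy: "x \<le> y" for x y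
  proof -
    have "s \<le> V y - norm (p (clamp_from_zero b y) - p (clamp_from_zero b x))" if s: "s \<in> S x" for s
    proof -
      obtain n and t :: "nat \<Rightarrow> real" where t: "mono t" "0 \<le> t 0" "t n \<le> clamp_from_zero b x" and s: "s = (\<Sum>i<n. norm (p (t (Suc i)) - p (t i)))"
        using s unfolding S_def by blast
      \<comment> \<open>A partition of \<open>{0..x}\<close>, continued by the points \<open>x\<close> and \<open>y\<close>.\<close>
      define t' where "t' = (\<lambda>i. if i \<le> n then t i else if i = Suc n then clamp_from_zero b x else clamp_from_zero b y)"
      have "mono t'"
      proof (rule incseq_SucI)
        fix i
        show "t' i \<le> t' (Suc i)"
          using t(3) monoD[OF t(1), of i "Suc i"] cl(3)[OF xy]
          by (auto simp: t'_def le_Suc_eq)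
      qed
      have "(\<Sum>i<Suc (Suc n). norm (p (t' (Suc i)) - p (t' i))) \<in> S y"
        unfolding S_def using \<open>mono t'\<close> t(2) by (intro CollectI exI[of _ "Suc (Suc n)"] exI[of _ t']) (auto simp: t'_def)
      then have "(\<Sum>i<Suc (Suc n). norm (p (t' (Suc i)) - p (t' i))) \<le> V y"
        unfolding V_def by (rule cSup_upper[OF _ bdd])
      moreover have "(\<Sum>i<n. norm (p (t' (Suc i)) - p (t' i))) = s"
        unfolding s by (rule sum.cong) (auto simp: t'_def)
      moreover have "norm (p (t' (Suc (Suc n))) - p (t' (Suc n))) = norm (p (clamp_from_zero b y) - p (clamp_from_zero b x))"
        by (simp add: t'_def)
      moreover have "norm (p (t' (Suc n)) - p (t' n)) \<ge> 0" by simp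
      ultimately show ?thesis unfolding sum.lessThan_Suc by linarith
    qed
    then have "V x \<le> V y - norm (p (clamp_from_zero b y) - p (clamp_from_zero b x))"
      unfolding V_def using zero by (intro cSup_least) auto
    then show ?thesis by simp
  qed
  have "mono V"
  proof (rule monoI)
    fix x y :: real assume "x \<le> y"
    from step[OF this] show "V x \<le> V y"
      using norm_ge_zero[of "p (clamp_from_zero b y) - p (clamp_from_zero b x)"] by linarith
  qed
  then show ?thesis using Vb step by (intro exI[of _ V] exI[of _ B]) (auto simp: algebra_simps)
qed

text \<open>
  All but the two ends cancel: the integrals of \<open>V\<close> over \<open>{b..b+h}\<close> and over \<open>{0..h}\<close> remain.
\<close>

lemma integral_shift_mono_le:
  fixes V :: "real \<Rightarrow> real"
  assumes "mono V" and V: "\<And>x. 0 \<le> V x \<and> V x \<le> B" and "0 \<le> b" "0 < h"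
  shows "(\<lambda>x. V (x + h) - V x) absolutely_integrable_on {0..b}" "integral {0..b} (\<lambda>x. V (x + h) - V x) \<le> h * B"
proof -
  have i: "V integrable_on {c..d}" for c d by (rule integrable_on_mono_on) (use \<open>mono V\<close> mono_on_subset in blast)
  have "mono (\<lambda>x. V (x + h))" using \<open>mono V\<close> by (auto simp: mono_def)
  then have i': "(\<lambda>x. V (x + h)) integrable_on {c..d}" for c d by (intro integrable_on_mono_on) (use mono_on_subset in blast)
  show "(\<lambda>x. V (x + h) - V x) absolutely_integrable_on {0..b}"
    by (rule nonnegative_absolutely_integrable_1[OF integrable_diff[OF i' i]]) (use monoD[OF \<open>mono V\<close>] \<open>h > 0\<close> in auto)
  have "((\<lambda>x. V (x + h)) has_integral integral {h..b+h} V) {0..b}"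
    using has_integral_shift_real_ivl[where f = V and a = h and b = "b + h" and c = h, OF integrable_integral[OF i]] by simp
  then have "integral {0..b} (\<lambda>x. V (x + h) - V x) = integral {h..b+h} V - integral {0..b} V"
    using integral_diff[OF i' i, of 0 b] by (simp add: integral_unique)
  also have "\<dots> = integral {b..b+h} V - integral {0..h} V"
    using Henstock_Kurzweil_Integration.integral_combine[of 0 h "b + h" V] 
          Henstock_Kurzweil_Integration.integral_combine[of 0 b "b + h" V] i assms by simp
  finally have eq: "integral {0..b} (\<lambda>x. V (x + h) - V x) = integral {b..b+h} V - integral {0..h} V" .
  have "integral {b..b+h} V \<le> integral {b..b+h} (\<lambda>_. B)" by (rule integral_le[OF i]) (use V in auto)
  also have "\<dots> = h * B" using \<open>h > 0\<close> by simp
  finally have "integral {b..b+h} V \<le> h * B" .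
  moreover have "integral {0..h} V \<ge> 0" by (rule integral_nonneg[OF i]) (use V in auto)
  ultimately show "integral {0..b} (\<lambda>x. V (x + h) - V x) \<le> h * B" using eq by linarith
qed

text \<open>
  The moving average of \<open>p\<close> over \<open>{x..x+h}\<close> is continuously differentiable.  With
  \<open>g x = V (x + h) - V x\<close> for the variation \<open>V\<close> of \<open>p\<close>, it differs from \<open>p\<close> by at most \<open>g\<close>, and its
  derivative is at most \<open>g / h\<close>.  Thus \<open>r\<close> is \<open>h\<close>-close to \<open>p\<close> in the mean while
  \<open>\<integral> |r'|\<close> stays bounded as \<open>h \<rightarrow> 0\<close>.
\<close>

lemma steklov_mean:
  assumes ac: "abs_cont_on 0 b p" and "0 < b"
  shows "\<exists>M B. M \<ge> 0 \<and> B \<ge> 0 \<and> (\<forall>x\<in>{0..b}. norm (p x) \<le> M) \<and> (\<forall>h>0. \<exists>r r' :: real \<Rightarrow> complex. \<exists>g :: real \<Rightarrow> real.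
     (\<forall>x\<in>{0..b}. (r has_vector_derivative r' x) (at x within {0..b})) \<and> continuous_on {0..b} r' \<and>
     (\<forall>x\<in>{0..b}. norm (r x) \<le> M) \<and> (\<forall>x\<in>{0..b}. norm (p x - r x) \<le> g x \<and> norm (r' x) \<le> g x / h) \<and>
     (\<forall>x. g x \<ge> 0) \<and> g absolutely_integrable_on {0..b} \<and> integral {0..b} g \<le> h * B)"
proof -
  obtain V B where V: "mono V" "\<And>x. 0 \<le> V x \<and> V x \<le> (B::real)"
     "\<And>x y. x \<le> y \<Longrightarrow> norm (p (clamp_from_zero b y) - p (clamp_from_zero b x)) \<le> V y - V x"
    using variation_function[OF assms] by blast
  define P where "P = (\<lambda>x. p (clamp_from_zero b x))"
  have cl: "clamp_from_zero b x \<in> {0..b}" for x using \<open>0 < b\<close> by (auto simp: clamp_from_zero_def)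
  have cont: "continuous_on {0..b} p" by (rule abs_cont_on_imp_continuous[OF ac])
  have contP: "continuous_on S P" for S unfolding P_def
    by (rule continuous_on_compose2[OF cont]) (use cl in \<open>auto simp: clamp_from_zero_def intro!: continuous_intros\<close>)
  have Pp: "P x = p x" if "x \<in> {0..b}" for x using that by (simp add: P_def clamp_from_zero_def)
  have "bounded (p ` {0..b})" by (intro compact_imp_bounded compact_continuous_image cont) auto
  then obtain M where "M > 0" and M: "\<And>x. x \<in> {0..b} \<Longrightarrow> norm (p x) \<le> M" unfolding bounded_pos by blast
  have MP: "norm (P x) \<le> M" for x unfolding P_def using M[OF cl] .
  show ?thesis
  proof (rule exI[of _ M], rule exI[of _ B], intro conjI allI impI ballI)
    show "M \<ge> 0" using \<open>M > 0\<close> by simp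
    show "B \<ge> 0" using V(2)[of 0] by linarith
    show "norm (p x) \<le> M" if "x \<in> {0..b}" for x using M[OF that] .
    fix h :: real assume "h > 0"
    define r where "r = (\<lambda>x. (integral {0..x + h} P - integral {0..x} P) / of_real h)"
    define r' where "r' = (\<lambda>x. (P (x + h) - P x) / of_real h)"
    define g where "g = (\<lambda>x. V (x + h) - V x)"
    have rI: "r x = integral {x..x+h} P / of_real h" if "x \<ge> 0" for x
      using integral_diff_left[OF integrable_continuous_real[OF contP], of 0 x "x + h" "x + h"] that \<open>h > 0\<close> by (simp add: r_def)
    have d1: "((\<lambda>x. integral {0..x} P) has_vector_derivative P x) (at x within {0..b+h})" if "x \<in> {0..b+h}" for x
      by (rule integral_has_vector_derivative[OF contP that])
    have der: "(r has_vector_derivative r' x) (at x within {0..b})" if x: "x \<in> {0..b}" for x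
    proof -
      have a: "((\<lambda>x. integral {0..x} P) has_vector_derivative P x) (at x within {0..b})"
        using d1[of x] x \<open>h > 0\<close> by (intro has_vector_derivative_within_subset[OF d1]) auto
      have s: "((\<lambda>x. x + h) has_vector_derivative 1) (at x within {0..b})"
        by (auto intro!: derivative_eq_intros)
      have "((\<lambda>x. integral {0..x} P) has_vector_derivative P (x + h)) (at (x + h) within (\<lambda>x. x + h) ` {0..b})"
        using x \<open>h > 0\<close> by (intro has_vector_derivative_within_subset[OF d1]) auto
      from vector_diff_chain_within[OF s this]
      have "((\<lambda>x. integral {0..x + h} P) has_vector_derivative P (x + h)) (at x within {0..b})"
        by (simp add: o_def)
      from has_vector_derivative_diff[OF this a]
      have "((\<lambda>x. (1 / of_real h) * (integral {0..x + h} P - integral {0..x} P)) has_vector_derivative (1 / of_real h) * (P (x + h) - P x)) (at x within {0..b})"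
        by (rule has_vector_derivative_mult_right)
      then show ?thesis by (simp add: r_def[abs_def] r'_def)
    qed
    have rb: "norm (r x) \<le> M" if x: "x \<in> {0..b}" for x
    proof -
      have "norm (integral {x..x+h} P) \<le> M * (x + h - x)"
        by (rule integral_bound) (use \<open>h > 0\<close> contP MP in auto)
      then show ?thesis using \<open>h > 0\<close> x by (simp add: rI norm_divide field_simps)
    qed
    have pr: "norm (p x - r x) \<le> g x" if x: "x \<in> {0..b}" for x
    proof -
      have "integral {x..x+h} (\<lambda>t. P t - P x) = integral {x..x+h} P - of_real h * P x"
        using \<open>h > 0\<close> contP[THEN integrable_continuous_real] by (subst integral_diff) (auto simp: scaleR_conv_of_real)
      then have "r x - p x = integral {x..x+h} (\<lambda>t. P t - P x) / of_real h"
        using \<open>h > 0\<close> x by (simp add: rI Pp field_simps)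
      also have "norm \<dots> \<le> g x"
      proof -
        have "norm (integral {x..x+h} (\<lambda>t. P t - P x)) \<le> g x * (x + h - x)"
        proof (rule integral_bound)
          show "norm (P t - P x) \<le> g x" if "t \<in> {x..x+h}" for t
            using V(3)[of x t] monoD[OF V(1), of t "x + h"] that by (simp add: P_def g_def)
        qed (use \<open>h > 0\<close> contP in \<open>auto intro!: continuous_intros\<close>)
        then show ?thesis using \<open>h > 0\<close> by (simp add: norm_divide field_simps)
      qed
      finally show ?thesis by (simp add: norm_minus_commute)
    qed
    have r'b: "norm (r' x) \<le> g x / h" for x
      using V(3)[of x "x + h"] \<open>h > 0\<close> by (simp add: r'_def norm_divide P_def g_def divide_right_mono)
    have cr': "continuous_on {0..b} r'" unfolding r'_def using \<open>h > 0\<close>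
      by (intro continuous_intros contP continuous_on_compose2[OF contP[of UNIV]]) auto
    show "\<exists>r r' :: real \<Rightarrow> complex. \<exists>g :: real \<Rightarrow> real.
     (\<forall>x\<in>{0..b}. (r has_vector_derivative r' x) (at x within {0..b})) \<and> continuous_on {0..b} r' \<and>
     (\<forall>x\<in>{0..b}. norm (r x) \<le> M) \<and> (\<forall>x\<in>{0..b}. norm (p x - r x) \<le> g x \<and> norm (r' x) \<le> g x / h) \<and>
     (\<forall>x. g x \<ge> 0) \<and> g absolutely_integrable_on {0..b} \<and> integral {0..b} g \<le> h * B"
      using integral_shift_mono_le[OF V(1,2) _ \<open>h > 0\<close>, of b] \<open>0 < b\<close> der cr' rb pr r'b monoD[OF V(1)] \<open>h > 0\<close>
      by (intro exI[of _ r] exI[of _ r'] exI[of _ g]) (auto simp: g_def)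
  qed
qed

text \<open>
  The kernel \<open>a\<close> is merely integrable, so the bound is not obtained by differentiation but by iterating the
  inequality: after \<open>n\<close> steps it is a partial sum of \<open>c exp (\<integral> a)\<close> plus a term that tends to \<open>0\<close>.
\<close>

lemma gronwall:
  fixes u a :: "real \<Rightarrow> real"
  assumes a: "a absolutely_integrable_on {0..b}" and a0: "\<And>t. a t \<ge> 0"
    and u: "continuous_on {0..b} u" and "c \<ge> 0"
    and le: "\<And>x. x \<in> {0..b} \<Longrightarrow> u x \<le> c + integral {0..x} (\<lambda>t. a t * u t)"
    and x: "x \<in> {0..b}"
  shows "u x \<le> c * exp (integral {0..x} a)"
proof -
  define G where "G = (\<lambda>x. integral {0..x} a)"
  have "bounded (u ` {0..b})" by (intro compact_imp_bounded compact_continuous_image u) auto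
  then obtain M where M: "M > 0" "\<And>t. t \<in> {0..b} \<Longrightarrow> norm (u t) \<le> M" unfolding bounded_pos by blast
  have ax: "a absolutely_integrable_on {0..x}" if "x \<in> {0..b}" for x
    by (rule absolutely_integrable_on_subinterval[OF a]) (use that in auto)
  \<comment> \<open>\<open>M\<close> is any bound for \<open>u\<close>; the remainder starts from \<open>u \<le> M\<close>.\<close>
  have bnd: "\<forall>x\<in>{0..b}. u x \<le> (\<Sum>k<n. c * (G x ^ k / fact k)) + M * (G x ^ n / fact n)" for n
  proof (induction n)
    case 0
    then show ?case using M(2) by (auto simp: abs_le_iff)
  next
    case (Suc n)
    show ?case
    proof
      fix x assume x: "x \<in> {0..b}"
      have pw: "((\<lambda>t. K / fact k * (a t * G t ^ k)) has_integral K / fact k * (G x ^ Suc k / Suc k)) {0..x}" for k K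
        unfolding G_def by (intro has_integral_mult_right has_integral_power_of_primitive ax) (use x in auto)
      have "((\<lambda>t. (\<Sum>k<n. c / fact k * (a t * G t ^ k)) + M / fact n * (a t * G t ^ n)) has_integral
          ((\<Sum>k<n. c / fact k * (G x ^ Suc k / Suc k)) + M / fact n * (G x ^ Suc n / Suc n))) {0..x}"
        by (intro has_integral_add has_integral_sum pw) auto
      moreover have "(\<Sum>k<n. c / fact k * (a t * G t ^ k)) + M / fact n * (a t * G t ^ n) =
           a t * ((\<Sum>k<n. c * (G t ^ k / fact k)) + M * (G t ^ n / fact n))" for t
        by (simp add: sum_distrib_left algebra_simps)
      moreover have "((\<Sum>k<n. c / fact k * (G x ^ Suc k / Suc k)) + M / fact n * (G x ^ Suc n / Suc n))
         = (\<Sum>k<n. c * (G x ^ Suc k / fact (Suc k))) + M * (G x ^ Suc n / fact (Suc n))"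
        by (simp add: field_simps)
      ultimately have hi: "((\<lambda>t. a t * ((\<Sum>k<n. c * (G t ^ k / fact k)) + M * (G t ^ n / fact n))) has_integral
          ((\<Sum>k<n. c * (G x ^ Suc k / fact (Suc k))) + M * (G x ^ Suc n / fact (Suc n)))) {0..x}" by simp
      have "u x \<le> c + integral {0..x} (\<lambda>t. a t * u t)" using le x by blast
      also have "integral {0..x} (\<lambda>t. a t * u t) \<le> integral {0..x} (\<lambda>t. a t * ((\<Sum>k<n. c * (G t ^ k / fact k)) + M * (G t ^ n / fact n)))"
      proof (rule integral_le)
        have "continuous_on {0..x} u" by (rule continuous_on_subset[OF u]) (use x in auto)
        then have "(\<lambda>t. u t * a t) absolutely_integrable_on {0..x}"
          by (intro absolutely_integrable_bounded_measurable_product_real ax x continuous_imp_measurable_on_sets_lebesgue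
                compact_imp_bounded compact_continuous_image) auto
        then show "(\<lambda>t. a t * u t) integrable_on {0..x}" using abs_int_integrable by (simp add: mult.commute)
        show "a t * u t \<le> a t * ((\<Sum>k<n. c * (G t ^ k / fact k)) + M * (G t ^ n / fact n))" if "t \<in> {0..x}" for t
          using Suc that x a0[of t] by (intro mult_left_mono) auto
      qed (use hi in \<open>auto simp: has_integral_integrable\<close>)
      also have "\<dots> = (\<Sum>k<n. c * (G x ^ Suc k / fact (Suc k))) + M * (G x ^ Suc n / fact (Suc n))"
        using hi by (rule integral_unique)
      finally show "u x \<le> (\<Sum>k<Suc n. c * (G x ^ k / fact k)) + M * (G x ^ Suc n / fact (Suc n))"
        by (simp only: sum.lessThan_Suc_shift) simp
    qed
  qed
  have e: "(\<lambda>k. c * (G x ^ k / fact k)) sums (c * exp (G x))"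
    using exp_converges[of "G x"] by (intro sums_mult) (simp add: divide_inverse mult.commute)
  have "(\<lambda>n. M * (G x ^ n / fact n)) \<longlonglongrightarrow> M * 0"
    using summable_LIMSEQ_zero[OF summable_exp[of "G x"]]
    by (intro tendsto_mult_left) (simp add: divide_inverse mult.commute)
  from tendsto_add[OF e[unfolded sums_def] this]
  have "(\<lambda>n. (\<Sum>k<n. c * (G x ^ k / fact k)) + M * (G x ^ n / fact n)) \<longlonglongrightarrow> c * exp (G x)" by simp
  then have "u x \<le> c * exp (G x)" by (rule LIMSEQ_le_const) (use bnd x in auto)
  then show ?thesis by (simp add: G_def)
qed

section \<open>WKB estimates\<close>

text \<open>
  Approximate factorization of the equation.  For \<open>\<kappa> = \<i>\<close> or \<open>\<kappa> = -\<i>\<close> and a smooth substitute \<open>r\<close> of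
  \<open>p\<close>, the function \<open>w = y' + \<kappa> (l - r) y\<close> satisfies
  \<open>w' - \<kappa> (l - r) w = (q + 2 l (p - r) + r\<^sup>2 - \<kappa> r') y\<close>, because \<open>\<kappa>\<^sup>2 = -1\<close> turns the
  quadratic terms into \<open>- l\<^sup>2 + 2 l p + (l - r)\<^sup>2\<close>.  The formula below is this equation integrated with
  the factor \<open>exp (- \<kappa> \<theta>)\<close>, where \<open>\<theta>' = l - r\<close>.
\<close>

lemma wkb_representation:
  fixes \<kappa> l :: complex
  assumes p: "continuous_on {0..pi} p" and q: "q absolutely_integrable_on {0..pi}"
    and y: "ivp (potential p q l) c0 c1 y v"
    and r: "\<And>x. x \<in> {0..pi} \<Longrightarrow> (r has_vector_derivative r' x) (at x within {0..pi})" and cr': "continuous_on {0..pi} r'"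
    and \<kappa>: "\<kappa>\<^sup>2 = -1" and x: "x \<in> {0..pi}"
  defines "\<theta> \<equiv> \<lambda>x. l * of_real x - integral {0..x} r"
  defines "w \<equiv> \<lambda>x. v x + \<kappa> * (l - r x) * y x"
  defines "F \<equiv> \<lambda>t. exp (- \<kappa> * \<theta> t) * (q t + 2 * l * (p t - r t) + (r t)\<^sup>2 - \<kappa> * r' t) * y t"
  shows "(F has_integral exp (- \<kappa> * \<theta> x) * w x - w 0) {0..x}"
proof -
  note Q = potential_abs_int[OF p q, of l]
  have sub: "{0..x} \<subseteq> {0..pi}" using x by auto
  have cr: "continuous_on {0..pi} r" using continuous_on_vector_derivative[OF r] by blast
  have d\<theta>: "(\<theta> has_vector_derivative l - r t) (at t within {0..pi})" if "t \<in> {0..pi}" for t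
    unfolding \<theta>_def using integral_has_vector_derivative[OF cr that]
    by (auto intro!: derivative_eq_intros)
  have dE: "((\<lambda>x. exp (- \<kappa> * \<theta> x)) has_vector_derivative (- \<kappa> * (l - r t)) * exp (- \<kappa> * \<theta> t)) (at t within {0..pi})" if t: "t \<in> {0..pi}" for t
  proof -
    have "((\<lambda>x. - \<kappa> * \<theta> x) has_vector_derivative - \<kappa> * (l - r t)) (at t within {0..pi})"
      by (rule has_vector_derivative_mult_right[OF d\<theta>[OF t]])
    from field_vector_diff_chain_within[OF this, of exp "exp (- \<kappa> * \<theta> t)"]
    show ?thesis by (simp add: o_def DERIV_exp has_field_derivative_at_within)
  qed
  have c\<theta>: "continuous_on {0..pi} \<theta>" using continuous_on_vector_derivative[OF d\<theta>] by blast
  have acE: "abs_cont_on 0 pi (\<lambda>x. exp (- \<kappa> * \<theta> x))"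
    by (rule abs_cont_on_C1[OF dE]) (auto intro!: continuous_intros cr c\<theta>)
  have acr: "abs_cont_on 0 pi (\<lambda>x. \<kappa> * (l - r x))"
  proof (rule abs_cont_on_C1)
    show "((\<lambda>x. \<kappa> * (l - r x)) has_vector_derivative \<kappa> * (- r' t)) (at t within {0..pi})" if "t \<in> {0..pi}" for t
      using r[OF that] by (auto intro!: derivative_eq_intros)
  qed (intro continuous_intros cr')
  have ac: "abs_cont_on 0 pi (\<lambda>x. exp (- \<kappa> * \<theta> x) * w x)"
    unfolding w_def by (intro abs_cont_on_mult acE abs_cont_on_add acr ivp_abs_cont[OF Q y])
  obtain N where N: "negligible N" "\<And>x. x \<in> {0..pi} - N \<Longrightarrow> x \<in> {0<..<pi} \<and> (v has_vector_derivative potential p q l x * y x) (at x)"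
    using ivp_ae_derivative[OF Q y] by blast
  have "(F has_integral exp (- \<kappa> * \<theta> x) * w x - exp (- \<kappa> * \<theta> 0) * w 0) {0..x}"
  proof (rule abs_cont_fundamental_theorem[OF _ _ N(1)])
    show "abs_cont_on 0 x (\<lambda>x. exp (- \<kappa> * \<theta> x) * w x)" by (rule abs_cont_on_subset[OF ac]) (use x in auto)
    fix t assume t: "t \<in> {0..x} - N"
    then have tp: "t \<in> {0..pi}" using sub by auto
    have dv: "(v has_vector_derivative potential p q l t * y t) (at t within {0..pi})"
      using N(2)[of t] t tp has_vector_derivative_at_within by blast
    have "(w has_vector_derivative potential p q l t * y t + (\<kappa> * (l - r t) * v t + \<kappa> * (- r' t) * y t)) (at t within {0..pi})"
      unfolding w_def
      by (rule derivative_eq_intros dv r[OF tp] ivp_has_derivative[OF y tp] refl)+ (simp add: algebra_simps)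
    from has_vector_derivative_mult[OF dE[OF tp] this]
    have "((\<lambda>x. exp (- \<kappa> * \<theta> x) * w x) has_vector_derivative 
        exp (- \<kappa> * \<theta> t) * (potential p q l t * y t + (\<kappa> * (l - r t) * v t + \<kappa> * (- r' t) * y t)) + (- \<kappa> * (l - r t)) * exp (- \<kappa> * \<theta> t) * w t) (at t within {0..pi})" .
    moreover have "exp (- \<kappa> * \<theta> t) * (potential p q l t * y t + (\<kappa> * (l - r t) * v t + \<kappa> * (- r' t) * y t)) + (- \<kappa> * (l - r t)) * exp (- \<kappa> * \<theta> t) * w t = F t"
    proof -
      have "(- \<kappa> * (l - r t)) * w t = - \<kappa> * (l - r t) * v t - \<kappa>\<^sup>2 * (l - r t)\<^sup>2 * y t"
        by (simp add: w_def algebra_simps power2_eq_square)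
      then have e: "(- \<kappa> * (l - r t)) * w t = - \<kappa> * (l - r t) * v t + (l - r t)\<^sup>2 * y t" by (simp add: \<kappa>)
      have "exp (- \<kappa> * \<theta> t) * (potential p q l t * y t + (\<kappa> * (l - r t) * v t + \<kappa> * (- r' t) * y t)) + (- \<kappa> * (l - r t)) * exp (- \<kappa> * \<theta> t) * w t 
        = exp (- \<kappa> * \<theta> t) * (potential p q l t * y t + (\<kappa> * (l - r t) * v t + \<kappa> * (- r' t) * y t) + (- \<kappa> * (l - r t)) * w t)"
        by (simp add: algebra_simps)
      also have "\<dots> = F t" unfolding e by (simp add: F_def potential_def algebra_simps power2_eq_square)
      finally show ?thesis .
    qed
    ultimately show "((\<lambda>x. exp (- \<kappa> * \<theta> x) * w x) has_vector_derivative F t) (at t within {0..x})"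
      using has_vector_derivative_within_subset[OF _ sub] by metis
  qed (use x in auto)
  then show ?thesis by (simp add: \<theta>_def)
qed

lemma norm_exp_diff_one_le: "norm (exp z - 1) \<le> norm z * exp (norm z)" for z :: complex
proof -
  have "norm (exp z - (\<Sum>i\<le>0. z ^ i / fact i)) \<le> exp \<bar>Re z\<bar> * norm z ^ Suc 0 / fact 0"
    by (rule Taylor_exp)
  also have "\<dots> \<le> norm z * exp (norm z)"
    using abs_Re_le_cmod[of z] by (simp add: mult.commute mult_left_mono)
  finally show ?thesis by simp
qed

text \<open>
  Take for \<open>r\<close> the Steklov mean of \<open>p\<close> with \<open>h = 1 / |l|\<close>.  Then \<open>2 l (p - r)\<close> and \<open>r'\<close> are bounded
  in \<open>L\<^sup>1\<close> independently of \<open>l\<close>, so the whole coefficient in \<open>wkb_representation\<close> is.  The functions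
  \<open>w\<close> for the two signs of \<open>\<kappa>\<close> together recover \<open>y\<close> up to the factor \<open>1 / |l|\<close>, which is the gain
  in the estimate; Gronwall closes the circle.  The numbers \<open>r0\<close>, \<open>r1\<close> are the values of \<open>r\<close> at the two
  endpoints.  They depend on \<open>l\<close> and remain in the statement, since their removal differs for \<open>S\<close>
  and \<open>C\<close>.
\<close>

theorem wkb_estimate:
  assumes ac: "abs_cont_on 0 pi p" and q: "q absolutely_integrable_on {0..pi}"
  shows "\<exists>A R. A \<ge> 0 \<and> R \<ge> 1 \<and> (\<forall>l. norm l \<ge> R \<longrightarrow> (\<exists>r0 r1. norm r0 \<le> R / 2 \<and> norm r1 \<le> R / 2 \<and>
     (\<forall>\<kappa>\<in>{\<i>, -\<i>}. \<forall>c0 c1 y v. ivp (potential p q l) c0 c1 y v \<longrightarrow>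
        norm (v pi + \<kappa> * (l - r1) * y pi - exp (\<kappa> * (l * of_real pi - integral {0..pi} p)) * (c1 + \<kappa> * (l - r0) * c0))
          \<le> A / norm l * exp (pi * \<bar>Im l\<bar>) * (norm c1 + norm l * norm c0))))"
proof -
  have p: "continuous_on {0..pi} p" by (rule abs_cont_on_imp_continuous[OF ac])
  obtain M B where M0: "M \<ge> 0" "B \<ge> 0" and Mp: "\<And>x. x \<in> {0..pi} \<Longrightarrow> norm (p x) \<le> M" and st: "\<And>h. h > 0 \<Longrightarrow> \<exists>r r' :: real \<Rightarrow> complex. \<exists>g :: real \<Rightarrow> real.
     (\<forall>x\<in>{0..pi}. (r has_vector_derivative r' x) (at x within {0..pi})) \<and> continuous_on {0..pi} r' \<and>
     (\<forall>x\<in>{0..pi}. norm (r x) \<le> M) \<and> (\<forall>x\<in>{0..pi}. norm (p x - r x) \<le> g x \<and> norm (r' x) \<le> g x / h) \<and>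
     (\<forall>x. g x \<ge> 0) \<and> g absolutely_integrable_on {0..pi} \<and> integral {0..pi} g \<le> h * B"
    using steklov_mean[OF ac pi_gt_zero] by blast
  define nq where "nq = integral {0..pi} (\<lambda>t. norm (q t))"
  define P where "P = nq + 3 * B + pi * M\<^sup>2"
  define K where "K = exp (pi * M)"
  have K1: "K \<ge> 1" using M0 by (simp add: K_def)
  have qi: "(\<lambda>t. norm (q t)) absolutely_integrable_on {0..pi}" using absolutely_integrable_norm[OF q] by (simp add: o_def)
  have "nq \<ge> 0" unfolding nq_def by (rule integral_nonneg[OF abs_int_integrable[OF qi]]) auto
  then have P0: "P \<ge> 0" using M0 by (simp add: P_def)
  define A1 where "A1 = 4 * K * P * K * exp (2 * K * P)"
  define A2 where "A2 = 2 * K * B * exp B"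
  have A0: "A1 \<ge> 0" "A2 \<ge> 0" using K1 P0 M0 by (auto simp: A1_def A2_def)
  \<comment> \<open>Beyond \<open>R\<close> the frequency \<open>l - r x\<close> has modulus at least \<open>|l| / 2\<close>.\<close>
  define R where "R = 1 + 2 * M"
  show ?thesis
  proof (rule exI[of _ "A1 + A2"], rule exI[of _ R], intro conjI allI impI)
    show "A1 + A2 \<ge> 0" using A0 by simp
    show "R \<ge> 1" using M0 by (simp add: R_def)
    fix l :: complex assume lR: "norm l \<ge> R"
    then have l1: "norm l \<ge> 1" "norm l \<ge> 2 * M" using M0 by (auto simp: R_def)
    define \<tau> where "\<tau> = \<bar>Im l\<bar>"
    have lpos: "norm l > 0" using l1 by linarith
    then have "1 / norm l > 0" by simp
    from st[OF this] obtain r r' :: "real \<Rightarrow> complex" and g :: "real \<Rightarrow> real"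
      where r: "\<And>x. x \<in> {0..pi} \<Longrightarrow> (r has_vector_derivative r' x) (at x within {0..pi})" 
      and cr': "continuous_on {0..pi} r'" and rM: "\<And>x. x \<in> {0..pi} \<Longrightarrow> norm (r x) \<le> M" 
      and pr: "\<And>x. x \<in> {0..pi} \<Longrightarrow> norm (p x - r x) \<le> g x" and r'g: "\<And>x. x \<in> {0..pi} \<Longrightarrow> norm (r' x) \<le> g x / (1 / norm l)"
      and g0: "\<And>x. g x \<ge> 0" and gi: "g absolutely_integrable_on {0..pi}" and gB: "integral {0..pi} g \<le> 1 / norm l * B"
      by blast
    have cr: "continuous_on {0..pi} r" using continuous_on_vector_derivative[OF r] by blast
    \<comment> \<open>Majorant of the coefficient \<open>q + 2 l (p - r) + r\<^sup>2 - \<kappa> r'\<close>; its integral is at most \<open>P\<close>.\<close>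
    define \<rho> where "\<rho> = (\<lambda>t. norm (q t) + 3 * norm l * g t + M\<^sup>2)"
    have \<rho>0: "\<rho> t \<ge> 0" for t using g0[of t] by (simp add: \<rho>_def)
    have \<rho>i: "\<rho> absolutely_integrable_on {0..pi}" unfolding \<rho>_def
      by (intro set_integral_add(1) qi set_integrable_mult_right gi absolutely_integrable_continuous_real) auto
    have \<rho>P: "integral {0..pi} \<rho> \<le> P"
    proof -
      have "integral {0..pi} \<rho> = nq + 3 * norm l * integral {0..pi} g + pi * M\<^sup>2"
      proof (rule integral_unique)
        have "((\<lambda>_. M\<^sup>2) has_integral pi * M\<^sup>2) {0..pi}" using has_integral_const_real[of "M\<^sup>2" 0 pi] by simp
        then show "(\<rho> has_integral nq + 3 * norm l * integral {0..pi} g + pi * M\<^sup>2) {0..pi}"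
          unfolding \<rho>_def nq_def
          by (intro has_integral_add has_integral_mult_right integrable_integral abs_int_integrable[OF qi] abs_int_integrable[OF gi])
      qed
      moreover have "3 * norm l * integral {0..pi} g \<le> 3 * B"
        using gB lpos by (simp add: field_simps)
      ultimately show ?thesis by (simp add: P_def)
    qed
    define \<theta> where "\<theta> = (\<lambda>x. l * of_real x - integral {0..x} r)"
    have Eb: "norm (exp (\<kappa> * (\<theta> x - \<theta> t))) \<le> K * exp (\<tau> * (x - t))" if \<kappa>: "\<kappa> \<in> {\<i>, -\<i>}" and xt: "0 \<le> t" "t \<le> x" "x \<le> pi" for \<kappa> x t
    proof -
      have "\<theta> x - \<theta> t = l * of_real (x - t) - integral {t..x} r"
        using integral_diff_left[OF integrable_continuous_real[OF cr], of t x] xt by (simp add: \<theta>_def algebra_simps)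
      then have "\<kappa> * (\<theta> x - \<theta> t) = (x - t) *\<^sub>R (\<kappa> * l) - \<kappa> * integral {t..x} r"
        by (simp only: right_diff_distrib scaleR_conv_of_real) (simp add: mult.left_commute)
      then have "Re (\<kappa> * (\<theta> x - \<theta> t)) = Re (\<kappa> * l) * (x - t) - Re (\<kappa> * integral {t..x} r)"
        by (simp only: minus_complex.sel scaleR_complex.sel mult.commute)
      moreover have "Re (\<kappa> * l) * (x - t) \<le> \<tau> * (x - t)"
        using \<kappa> xt by (intro mult_right_mono) (auto simp: \<tau>_def)
      moreover have "- Re (\<kappa> * integral {t..x} r) \<le> pi * M"
      proof -
        have "- Re (\<kappa> * integral {t..x} r) \<le> norm (\<kappa> * integral {t..x} r)"
          by (metis abs_Re_le_cmod abs_le_D2)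
        also have "\<dots> = norm (integral {t..x} r)" using \<kappa> by (auto simp: norm_mult)
        also have "\<dots> \<le> M * (x - t)"
          by (rule integral_bound) (use xt rM continuous_on_subset[OF cr] in auto)
        also have "\<dots> \<le> M * pi" using xt M0 by (intro mult_left_mono) auto
        finally show ?thesis by (simp add: mult.commute)
      qed
      ultimately have "Re (\<kappa> * (\<theta> x - \<theta> t)) \<le> \<tau> * (x - t) + pi * M" by linarith
      then have "norm (exp (\<kappa> * (\<theta> x - \<theta> t))) \<le> exp (\<tau> * (x - t) + pi * M)" by simp
      then show ?thesis by (simp add: exp_add K_def mult.commute)
    qed
    define a where "a = integral {0..pi} p"
    \<comment> \<open>Replacing the phase \<open>\<integral> r\<close> by \<open>\<integral> p\<close> costs \<open>\<integral> |p - r| \<le> B / |l|\<close>.\<close>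
    have \<theta>a: "norm (exp (\<kappa> * \<theta> pi) - exp (\<kappa> * (l * of_real pi - a))) \<le> A2 / 2 / norm l * exp (pi * \<tau>)" if \<kappa>: "\<kappa> \<in> {\<i>, -\<i>}" for \<kappa>
    proof -
      define d where "d = a - integral {0..pi} r"
      have "d = integral {0..pi} (\<lambda>t. p t - r t)" unfolding d_def a_def
        using integral_diff[OF integrable_continuous_real[OF p] integrable_continuous_real[OF cr]] by simp
      also have "norm \<dots> \<le> integral {0..pi} g"
        by (rule integral_norm_bound_integral[OF integrable_continuous_real[OF continuous_on_diff[OF p cr]] abs_int_integrable[OF gi] pr])
      finally have dB: "norm d \<le> B / norm l" using gB by simp
      also have "\<dots> \<le> B" using l1 M0 lpos mult_left_mono[of 1 "norm l" B] by (simp add: divide_le_eq mult.commute)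
      finally have dB': "norm d \<le> B" .
      have \<kappa>d: "norm (\<kappa> * d) = norm d" using \<kappa> by (auto simp: norm_mult)
      have "exp (\<kappa> * \<theta> pi) - exp (\<kappa> * (l * of_real pi - a)) = exp (\<kappa> * (\<theta> pi - \<theta> 0)) * exp (- (\<kappa> * d)) * (exp (\<kappa> * d) - 1)"
        by (simp add: \<theta>_def d_def algebra_simps flip: exp_add)
      also have "norm \<dots> = norm (exp (\<kappa> * (\<theta> pi - \<theta> 0))) * norm (exp (- (\<kappa> * d)) * (exp (\<kappa> * d) - 1))"
        by (simp add: norm_mult mult.assoc)
      also have "exp (- (\<kappa> * d)) * (exp (\<kappa> * d) - 1) = - (exp (- (\<kappa> * d)) - 1)"
        by (simp add: algebra_simps exp_minus)
      also have "norm (exp (\<kappa> * (\<theta> pi - \<theta> 0))) * norm (- (exp (- (\<kappa> * d)) - 1)) \<le> (K * exp (\<tau> * (pi - 0))) * (B / norm l * exp B)"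
      proof (intro mult_mono)
        have "norm (- (exp (- (\<kappa> * d)) - 1)) \<le> norm d * exp (norm d)"
          using norm_exp_diff_one_le[of "- (\<kappa> * d)"] \<kappa>d by (simp add: norm_minus_commute)
        also have "\<dots> \<le> B / norm l * exp B" using dB dB' M0 by (intro mult_mono) auto
        finally show "norm (- (exp (- (\<kappa> * d)) - 1)) \<le> B / norm l * exp B" .
      qed (use Eb[OF \<kappa>, of 0 pi] K1 in auto)
      finally show ?thesis by (simp add: A2_def mult_ac)
    qed
    have r0: "norm (r 0) \<le> R / 2" "norm (r pi) \<le> R / 2" using rM[of 0] rM[of pi] by (auto simp: R_def)
    have main: "norm (v pi + \<kappa> * (l - r pi) * y pi - exp (\<kappa> * (l * of_real pi - a)) * (c1 + \<kappa> * (l - r 0) * c0))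
          \<le> (A1 + A2) / norm l * exp (pi * \<bar>Im l\<bar>) * (norm c1 + norm l * norm c0)"
      if \<kappa>: "\<kappa> \<in> {\<i>, -\<i>}" and y: "ivp (potential p q l) c0 c1 y v" for \<kappa> c0 c1 y v
    proof -
      define w where "w = (\<lambda>\<kappa> x. v x + \<kappa> * (l - r x) * y x)"
      \<comment> \<open>Weighting by \<open>exp (- |Im l| x)\<close> makes the integral inequality for \<open>N\<close> uniform in \<open>l\<close>.\<close>
      define N where "N = (\<lambda>x. (norm (w \<i> x) + norm (w (-\<i>) x)) * exp (- \<tau> * x))"
      have cy: "continuous_on {0..pi} y" "continuous_on {0..pi} v" using y by (auto simp: ivp_def)
      have cw: "continuous_on {0..pi} (w \<kappa>)" for \<kappa> unfolding w_def by (intro continuous_intros cy cr)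
      have cN: "continuous_on {0..pi} N" unfolding N_def by (intro continuous_intros cw)
      have w0: "w \<kappa> 0 = c1 + \<kappa> * (l - r 0) * c0" for \<kappa> using ivp_init[OF y] by (simp add: w_def)
      have lr: "norm (l - r x) \<ge> norm l / 2" "norm (l - r x) \<le> 2 * norm l" if "x \<in> {0..pi}" for x
        using rM[OF that] l1 norm_triangle_ineq2[of l "r x"] norm_triangle_ineq4[of l "r x"] M0 by linarith+
      have yb: "norm (y t) \<le> N t * exp (\<tau> * t) / norm l" if "t \<in> {0..pi}" for t
      proof -
        have "2 * \<i> * (l - r t) * y t = w \<i> t - w (-\<i>) t" by (simp add: w_def algebra_simps)
        then have "norm (2 * \<i> * (l - r t) * y t) \<le> norm (w \<i> t) + norm (w (-\<i>) t)"
          by (metis norm_triangle_ineq4)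
        moreover have "norm l * norm (y t) \<le> norm (2 * \<i> * (l - r t) * y t)"
          using mult_right_mono[OF lr(1)[OF that], of "norm (y t)"] by (simp add: norm_mult)
        moreover have "N t * exp (\<tau> * t) = norm (w \<i> t) + norm (w (-\<i>) t)" by (simp add: N_def mult.assoc flip: exp_add)
        ultimately show ?thesis using lpos by (simp add: field_simps) 
      qed
      have wb: "norm (w \<kappa> x - exp (\<kappa> * \<theta> x) * w \<kappa> 0) \<le> exp (\<tau> * x) * (K / norm l) * integral {0..x} (\<lambda>t. \<rho> t * N t)"
        and \<rho>N: "(\<lambda>t. \<rho> t * N t) integrable_on {0..x}"
        if \<kappa>: "\<kappa> \<in> {\<i>, -\<i>}" and x: "x \<in> {0..pi}" for \<kappa> x
      proof -
        have sub: "{0..x} \<subseteq> {0..pi}" using x by auto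
        define F where "F = (\<lambda>t. exp (- \<kappa> * \<theta> t) * (q t + 2 * l * (p t - r t) + (r t)\<^sup>2 - \<kappa> * r' t) * y t)"
        have "\<kappa>\<^sup>2 = -1" using \<kappa> by auto
        from wkb_representation[OF p q y r cr' this x]
        have F: "(F has_integral exp (- \<kappa> * \<theta> x) * w \<kappa> x - w \<kappa> 0) {0..x}"
          unfolding F_def \<theta>_def w_def by simp
        from has_integral_mult_right[OF this, of "exp (\<kappa> * \<theta> x)"]
        have F2: "((\<lambda>t. exp (\<kappa> * \<theta> x) * F t) has_integral w \<kappa> x - exp (\<kappa> * \<theta> x) * w \<kappa> 0) {0..x}"
          by (simp add: algebra_simps exp_minus)
        have "(\<lambda>t. \<rho> t * N t) absolutely_integrable_on {0..pi}"
          using absolutely_integrable_bounded_measurable_product_real[OF _ _ _ \<rho>i, of N]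
          by (simp add: mult.commute continuous_imp_measurable_on_sets_lebesgue[OF cN] compact_imp_bounded[OF compact_continuous_image[OF cN]])
        then show \<rho>N: "(\<lambda>t. \<rho> t * N t) integrable_on {0..x}"
          using integrable_on_subinterval[OF abs_int_integrable sub] by blast
        have "norm (w \<kappa> x - exp (\<kappa> * \<theta> x) * w \<kappa> 0) \<le> integral {0..x} (\<lambda>t. exp (\<tau> * x) * (K / norm l) * (\<rho> t * N t))"
          unfolding integral_unique[OF F2, symmetric]
        proof (rule integral_norm_bound_integral)
          show "(\<lambda>t. exp (\<kappa> * \<theta> x) * F t) integrable_on {0..x}" using F2 by (rule has_integral_integrable)
          show "(\<lambda>t. exp (\<tau> * x) * (K / norm l) * (\<rho> t * N t)) integrable_on {0..x}" by (intro integrable_on_mult_right \<rho>N)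
          fix t assume t: "t \<in> {0..x}"
          then have tp: "t \<in> {0..pi}" using sub by auto
          have "norm (q t + 2 * l * (p t - r t) + (r t)\<^sup>2 - \<kappa> * r' t) \<le> norm (q t) + norm (2 * l * (p t - r t)) + norm ((r t)\<^sup>2) + norm (\<kappa> * r' t)"
            by (intro order_trans[OF norm_triangle_ineq4] add_right_mono order_trans[OF norm_triangle_ineq] order_refl)
          also have "\<dots> \<le> norm (q t) + 2 * norm l * g t + M\<^sup>2 + norm l * g t"
            using pr[OF tp] r'g[OF tp] rM[OF tp] \<kappa> by (intro add_mono) (auto simp: norm_mult norm_power mult.commute intro!: power_mono mult_left_mono)
          also have "\<dots> = \<rho> t" by (simp add: \<rho>_def)
          finally have \<rho>: "norm (q t + 2 * l * (p t - r t) + (r t)\<^sup>2 - \<kappa> * r' t) \<le> \<rho> t" .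
          have "exp (\<kappa> * \<theta> x) * F t = exp (\<kappa> * (\<theta> x - \<theta> t)) * (q t + 2 * l * (p t - r t) + (r t)\<^sup>2 - \<kappa> * r' t) * y t"
            by (simp add: F_def right_diff_distrib exp_diff exp_minus field_simps)
          also have "norm \<dots> \<le> (K * exp (\<tau> * (x - t))) * \<rho> t * (N t * exp (\<tau> * t) / norm l)"
            unfolding norm_mult using Eb[OF \<kappa>, of t x] t x \<rho> yb[OF tp] K1 \<rho>0[of t] by (intro mult_mono) auto
          also have "\<dots> = exp (\<tau> * x) * (K / norm l) * (\<rho> t * N t)"
            by (simp add: right_diff_distrib exp_diff)
          finally show "norm (exp (\<kappa> * \<theta> x) * F t) \<le> exp (\<tau> * x) * (K / norm l) * (\<rho> t * N t)" .
        qed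
        also have "\<dots> = exp (\<tau> * x) * (K / norm l) * integral {0..x} (\<lambda>t. \<rho> t * N t)"
          by (rule integral_mult_right)
        finally show "norm (w \<kappa> x - exp (\<kappa> * \<theta> x) * w \<kappa> 0) \<le> exp (\<tau> * x) * (K / norm l) * integral {0..x} (\<lambda>t. \<rho> t * N t)" .
      qed
      define N0 where "N0 = norm (w \<i> 0) + norm (w (-\<i>) 0)"
      have N00: "N0 \<ge> 0" by (simp add: N0_def)
      have Nx: "N x \<le> K * N0 + integral {0..x} (\<lambda>t. 2 * K / norm l * \<rho> t * N t)" if x: "x \<in> {0..pi}" for x
      proof -
        have one: "norm (w \<kappa> x) * exp (- \<tau> * x) \<le> K * norm (w \<kappa> 0) + K / norm l * integral {0..x} (\<lambda>t. \<rho> t * N t)" if \<kappa>: "\<kappa> \<in> {\<i>, -\<i>}" for \<kappa>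
        proof -
          have "norm (w \<kappa> x) \<le> norm (exp (\<kappa> * \<theta> x) * w \<kappa> 0) + norm (w \<kappa> x - exp (\<kappa> * \<theta> x) * w \<kappa> 0)"
            by (metis add.commute norm_triangle_sub)
          also have "\<dots> \<le> K * exp (\<tau> * x) * norm (w \<kappa> 0) + exp (\<tau> * x) * (K / norm l) * integral {0..x} (\<lambda>t. \<rho> t * N t)"
            using Eb[OF \<kappa>, of 0 x] x wb[OF \<kappa> x] by (intro add_mono) (auto simp: norm_mult \<theta>_def intro!: mult_right_mono)
          finally have "norm (w \<kappa> x) * exp (- \<tau> * x) \<le> (K * exp (\<tau> * x) * norm (w \<kappa> 0) + exp (\<tau> * x) * (K / norm l) * integral {0..x} (\<lambda>t. \<rho> t * N t)) * exp (- \<tau> * x)"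
            by (intro mult_right_mono) auto
          also have "\<dots> = K * norm (w \<kappa> 0) + K / norm l * integral {0..x} (\<lambda>t. \<rho> t * N t)"
            by (simp add: exp_minus field_simps)
          finally show ?thesis .
        qed
        have "N x \<le> K * N0 + 2 * K / norm l * integral {0..x} (\<lambda>t. \<rho> t * N t)"
        proof -
          have "N x = norm (w \<i> x) * exp (- \<tau> * x) + norm (w (-\<i>) x) * exp (- \<tau> * x)"
            by (simp only: N_def distrib_right)
          moreover have "K * N0 = K * norm (w \<i> 0) + K * norm (w (-\<i>) 0)" by (simp only: N0_def distrib_left)
          moreover have "2 * K / norm l * J = K / norm l * J + K / norm l * J" for J by simp
          ultimately show ?thesis using add_mono[OF one[of \<i>] one[of "-\<i>"]] by simp
        qed
        also have "2 * K / norm l * integral {0..x} (\<lambda>t. \<rho> t * N t) = integral {0..x} (\<lambda>t. 2 * K / norm l * (\<rho> t * N t))"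
          by (rule integral_mult_right[symmetric])
        finally show ?thesis by (simp add: mult.assoc)
      qed
      have Nb: "N x \<le> K * N0 * exp (2 * K * P)" if x: "x \<in> {0..pi}" for x
      proof -
        have "N x \<le> (K * N0) * exp (integral {0..x} (\<lambda>t. 2 * K / norm l * \<rho> t))"
          by (rule gronwall[OF _ _ cN _ _ x]) (use Nx K1 \<rho>0 \<rho>i N00 in \<open>auto intro!: set_integrable_mult_right\<close>)
        also have "\<dots> \<le> (K * N0) * exp (2 * K * P)"
        proof (intro mult_left_mono iffD2[OF exp_le_cancel_iff])
          have "integral {0..x} (\<lambda>t. 2 * K / norm l * \<rho> t) = 2 * K / norm l * integral {0..x} \<rho>" by (rule integral_mult_right)
          also have "\<dots> \<le> 2 * K * P"
          proof (rule mult_mono)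
            show "2 * K / norm l \<le> 2 * K" using l1 K1 lpos mult_left_mono[of 1 "norm l" K] by (simp add: divide_le_eq mult.commute)
            show "integral {0..x} \<rho> \<le> P" using integral_nonneg_mono[OF abs_int_integrable[OF \<rho>i] \<rho>0, of x pi] x \<rho>P by auto
            show "0 \<le> integral {0..x} \<rho>"
              using integral_nonneg_mono[OF abs_int_integrable[OF \<rho>i] \<rho>0, of 0 x] x by auto
          qed (use K1 in auto)
          finally show "integral {0..x} (\<lambda>t. 2 * K / norm l * \<rho> t) \<le> 2 * K * P" .
        qed (use K1 N00 in auto)
        finally show ?thesis .
      qed
      have "integral {0..pi} (\<lambda>t. \<rho> t * N t) \<le> integral {0..pi} (\<lambda>t. \<rho> t * (K * N0 * exp (2 * K * P)))"
        by (rule integral_le) (use \<rho>N[OF \<kappa>, of pi] abs_int_integrable[OF \<rho>i] \<rho>0 Nb in \<open>auto intro!: integrable_on_mult_left mult_left_mono\<close>)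
      also have "\<dots> = integral {0..pi} \<rho> * (K * N0 * exp (2 * K * P))" by (rule integral_mult_left)
      also have "\<dots> \<le> P * (K * N0 * exp (2 * K * P))"
        by (rule mult_right_mono[OF \<rho>P]) (use K1 N00 in auto)
      finally have iN: "integral {0..pi} (\<lambda>t. \<rho> t * N t) \<le> P * (K * N0 * exp (2 * K * P))" .
      define n where "n = norm c1 + norm l * norm c0"
      have w0b: "norm (w \<kappa> 0) \<le> 2 * n" if \<kappa>: "\<kappa> \<in> {\<i>, -\<i>}" for \<kappa>
      proof -
        have "norm (w \<kappa> 0) \<le> norm c1 + norm (\<kappa> * (l - r 0) * c0)" unfolding w0 by (rule norm_triangle_ineq)
        also have "norm (\<kappa> * (l - r 0) * c0) = norm (l - r 0) * norm c0" using \<kappa> by (auto simp: norm_mult)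
        also have "\<dots> \<le> 2 * norm l * norm c0" using lr(2)[of 0] by (intro mult_right_mono) auto
        finally show ?thesis by (simp add: n_def) (use norm_ge_zero[of c1] in linarith)
      qed
      have "N0 \<le> 4 * n" using w0b[of \<i>] w0b[of "-\<i>"] by (simp add: N0_def)
      have "norm (w \<kappa> pi - exp (\<kappa> * \<theta> pi) * w \<kappa> 0) \<le> exp (\<tau> * pi) * (K / norm l) * integral {0..pi} (\<lambda>t. \<rho> t * N t)"
        using wb[OF \<kappa>, of pi] by simp
      also have "\<dots> \<le> exp (\<tau> * pi) * (K / norm l) * (P * (K * N0 * exp (2 * K * P)))"
        using iN K1 by (intro mult_left_mono) auto
      also have "\<dots> \<le> exp (\<tau> * pi) * (K / norm l) * (P * (K * (4 * n) * exp (2 * K * P)))"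
        using \<open>N0 \<le> 4 * n\<close> K1 P0 by (intro mult_left_mono mult_right_mono) auto
      also have "\<dots> = A1 / norm l * exp (pi * \<tau>) * n" by (simp add: A1_def mult_ac)
      finally have e1: "norm (w \<kappa> pi - exp (\<kappa> * \<theta> pi) * w \<kappa> 0) \<le> A1 / norm l * exp (pi * \<tau>) * n" .
      have "norm ((exp (\<kappa> * \<theta> pi) - exp (\<kappa> * (l * of_real pi - a))) * w \<kappa> 0) \<le> (A2 / 2 / norm l * exp (pi * \<tau>)) * (2 * n)"
        unfolding norm_mult using \<theta>a[OF \<kappa>] w0b[OF \<kappa>] A0 by (intro mult_mono) auto
      then have e2: "norm ((exp (\<kappa> * \<theta> pi) - exp (\<kappa> * (l * of_real pi - a))) * w \<kappa> 0) \<le> A2 / norm l * exp (pi * \<tau>) * n"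
        by simp
      have "w \<kappa> pi - exp (\<kappa> * (l * of_real pi - a)) * w \<kappa> 0 = (w \<kappa> pi - exp (\<kappa> * \<theta> pi) * w \<kappa> 0) + (exp (\<kappa> * \<theta> pi) - exp (\<kappa> * (l * of_real pi - a))) * w \<kappa> 0"
        by (simp add: algebra_simps)
      also have "norm \<dots> \<le> A1 / norm l * exp (pi * \<tau>) * n + A2 / norm l * exp (pi * \<tau>) * n"
        using e1 e2 norm_triangle_mono by blast
      also have "\<dots> = (A1 + A2) / norm l * exp (pi * \<tau>) * n" by (simp add: add_divide_distrib algebra_simps)
      finally show ?thesis unfolding w0 by (simp add: w_def n_def \<tau>_def)
    qed
    then show "\<exists>r0 r1. norm r0 \<le> R / 2 \<and> norm r1 \<le> R / 2 \<and>
     (\<forall>\<kappa>\<in>{\<i>, -\<i>}. \<forall>c0 c1 y v. ivp (potential p q l) c0 c1 y v \<longrightarrow>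
        norm (v pi + \<kappa> * (l - r1) * y pi - exp (\<kappa> * (l * of_real pi - integral {0..pi} p)) * (c1 + \<kappa> * (l - r0) * c0))
          \<le> (A1 + A2) / norm l * exp (pi * \<bar>Im l\<bar>) * (norm c1 + norm l * norm c0))"
      using r0 unfolding a_def by blast
  qed
qed

section \<open>Asymptotics of the fundamental solutions on an edge\<close>

lemma norm_sin_cos_le: "norm (sin z) \<le> exp \<bar>Im z\<bar>" "norm (cos z) \<le> exp \<bar>Im z\<bar>"
proof -
  have e: "norm (exp (\<i> * z)) \<le> exp \<bar>Im z\<bar>" "norm (exp (- (\<i> * z))) \<le> exp \<bar>Im z\<bar>" by auto
  have "norm (exp (\<i> * z) - exp (- (\<i> * z))) \<le> 2 * exp \<bar>Im z\<bar>" "norm (exp (\<i> * z) + exp (- (\<i> * z))) \<le> 2 * exp \<bar>Im z\<bar>"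
    using norm_triangle_ineq4[of "exp (\<i> * z)" "exp (- (\<i> * z))"] norm_triangle_ineq[of "exp (\<i> * z)" "exp (- (\<i> * z))"] e 
    by linarith+
  then show "norm (sin z) \<le> exp \<bar>Im z\<bar>" "norm (cos z) \<le> exp \<bar>Im z\<bar>"
    by (simp_all add: sin_exp_eq cos_exp_eq norm_divide norm_mult)
qed

text \<open>
  Sums and differences of the WKB estimates for \<open>\<kappa> = \<plusminus>\<i>\<close> separate \<open>y'\<close> and \<open>(l - r) y\<close> at the endpoint; the
  exponentials combine to sine and cosine.  Since \<open>y\<close> is smaller than \<open>y'\<close> by a factor \<open>|l|\<close>, the bounded
  terms containing \<open>r0\<close>, \<open>r1\<close> disappear in the error.
\<close>

theorem edge_asymptotics:
  assumes ac: "abs_cont_on 0 pi p" and q: "q absolutely_integrable_on {0..pi}"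
  shows "\<exists>C R. C \<ge> 0 \<and> R \<ge> 1 \<and> (\<forall>l. norm l \<ge> R \<longrightarrow> 
     norm (l * sol_S p q l pi - sin (l * of_real pi - integral {0..pi} p)) \<le> C / norm l * exp (pi * \<bar>Im l\<bar>) \<and>
     norm (D1 (sol_S p q l) pi - cos (l * of_real pi - integral {0..pi} p)) \<le> C / norm l * exp (pi * \<bar>Im l\<bar>) \<and>
     norm (sol_C p q l pi - cos (l * of_real pi - integral {0..pi} p)) \<le> C / norm l * exp (pi * \<bar>Im l\<bar>) \<and>
     norm (D1 (sol_C p q l) pi / l + sin (l * of_real pi - integral {0..pi} p)) \<le> C / norm l * exp (pi * \<bar>Im l\<bar>))"
proof -
  have p: "continuous_on {0..pi} p" by (rule abs_cont_on_imp_continuous[OF ac])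
  define a where "a = integral {0..pi} p"
  obtain A R where A: "A \<ge> 0" and R: "R \<ge> 1" and wkb: "\<And>l. norm l \<ge> R \<Longrightarrow> \<exists>r0 r1. norm r0 \<le> R / 2 \<and> norm r1 \<le> R / 2 \<and>
     (\<forall>\<kappa>\<in>{\<i>, -\<i>}. \<forall>c0 c1 y v. ivp (potential p q l) c0 c1 y v \<longrightarrow>
        norm (v pi + \<kappa> * (l - r1) * y pi - exp (\<kappa> * (l * of_real pi - a)) * (c1 + \<kappa> * (l - r0) * c0))
          \<le> A / norm l * exp (pi * \<bar>Im l\<bar>) * (norm c1 + norm l * norm c0))"
    using wkb_estimate[OF ac q] unfolding a_def by blast
  define K where "K = exp (norm a)"
  define C where "C = A + R * (4 * K + 2 * A)"
  have K: "K \<ge> 0" by (simp add: K_def)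
  show ?thesis
  proof (rule exI[of _ C], rule exI[of _ R], intro conjI allI impI)
    show "C \<ge> 0" using A R K by (simp add: C_def)
    show "R \<ge> 1" by (rule R)
    fix l :: complex assume lR: "norm l \<ge> R"
    have lpos: "norm l > 0" "norm l \<ge> 1" using lR R by linarith+
    define e where "e = exp (pi * \<bar>Im l\<bar>)"
    have e0: "e > 0" by (simp add: e_def)
    define z where "z = l * of_real pi - a"
    have Imz: "\<bar>Im z\<bar> \<le> pi * \<bar>Im l\<bar> + norm a"
    proof -
      have "\<bar>Im z\<bar> \<le> \<bar>Im (l * of_real pi)\<bar> + \<bar>Im a\<bar>" by (simp add: z_def)
      also have "\<bar>Im (l * of_real pi)\<bar> = pi * \<bar>Im l\<bar>" by (simp add: abs_mult)
      finally show ?thesis using abs_Im_le_cmod[of a] by linarith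
    qed
    have "exp \<bar>Im z\<bar> \<le> K * e" using Imz by (simp add: K_def e_def add.commute flip: exp_add)
    then have sc: "norm (sin z) \<le> K * e" "norm (cos z) \<le> K * e" using norm_sin_cos_le[of z] by linarith+
    obtain r0 r1 where r: "norm r0 \<le> R / 2" "norm r1 \<le> R / 2" and
      w: "\<And>\<kappa> c0 c1 y v. \<kappa> \<in> {\<i>, -\<i>} \<Longrightarrow> ivp (potential p q l) c0 c1 y v \<Longrightarrow>
        norm (v pi + \<kappa> * (l - r1) * y pi - exp (\<kappa> * z) * (c1 + \<kappa> * (l - r0) * c0))
          \<le> A / norm l * e * (norm c1 + norm l * norm c0)"
      using wkb[OF lR] unfolding z_def e_def by blast
    have exps: "exp (\<i> * z) = cos z + \<i> * sin z" "exp (- \<i> * z) = cos z - \<i> * sin z"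
      using exp_Euler[of z] exp_Euler[of "- z"] by simp_all
    have half: "norm (X + Y) \<le> 2 * B" "norm (X - Y) \<le> 2 * B" if "norm X \<le> B" "norm Y \<le> B" for X Y :: complex and B
      using that norm_triangle_ineq[of X Y] norm_triangle_ineq4[of X Y] by linarith+
    have lr1: "norm (l - r1) \<ge> norm l / 2" "norm (l - r0) \<le> 2 * norm l"
      using norm_triangle_ineq2[of l r1] norm_triangle_ineq4[of l r0] r lR R by linarith+
    have small: "norm y \<le> 2 * B / norm l" if "norm ((l - r1) * y) \<le> B" for y B
    proof -
      have "norm l / 2 * norm y \<le> B"
        using mult_right_mono[OF lr1(1), of "norm y"] that by (simp add: norm_mult)
      then show ?thesis using lpos by (simp add: field_simps)
    qed
    have fin: "norm X \<le> C / norm l * exp (pi * \<bar>Im l\<bar>)" if "norm X \<le> B * e / norm l" "B \<le> C" for X :: complex and B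
    proof -
      have "B * e / norm l \<le> C * e / norm l" using that(2) e0 lpos by (intro divide_right_mono mult_right_mono) auto
      then show ?thesis using that(1) by (simp add: e_def)
    qed
    define S S' where "S = sol_S p q l pi" and "S' = D1 (sol_S p q l) pi"
    define c c' where "c = sol_C p q l pi" and "c' = D1 (sol_C p q l) pi"
    have wS: "norm (S' + \<kappa> * (l - r1) * S - exp (\<kappa> * z)) \<le> A * e / norm l" if "\<kappa> \<in> {\<i>, -\<i>}" for \<kappa>
      using w[OF that sol_S_ivp[OF p q]] by (simp add: S_def S'_def)
    have wC: "norm (c' + \<kappa> * (l - r1) * c - exp (\<kappa> * z) * (\<kappa> * (l - r0))) \<le> A * e" if "\<kappa> \<in> {\<i>, -\<i>}" for \<kappa>
      using w[OF that sol_C_ivp[OF p q]] lpos by (simp add: c_def c'_def)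
    let ?P = "S' + \<i> * (l - r1) * S - exp (\<i> * z)" and ?M = "S' + (- \<i>) * (l - r1) * S - exp (- \<i> * z)"
    have PM: "norm (?P + ?M) \<le> 2 * (A * e / norm l)" "norm (?P - ?M) \<le> 2 * (A * e / norm l)"
      using half[OF wS[of \<i>] wS[of "-\<i>"]] by auto
    have "?P + ?M = 2 * (S' - cos z)" "?P - ?M = 2 * \<i> * ((l - r1) * S - sin z)"
      unfolding exps by (simp_all add: algebra_simps)
    with PM have S1: "norm (S' - cos z) \<le> A * e / norm l" "norm ((l - r1) * S - sin z) \<le> A * e / norm l"
      by (simp_all only: norm_mult) simp_all
    have Ael: "A * e / norm l \<le> A * e" using A e0 lpos mult_left_mono[of 1 "norm l" "A * e"] by (simp add: divide_le_eq)
    have "norm ((l - r1) * S) \<le> (K + A) * e"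
      using norm_triangle_ineq[of "(l - r1) * S - sin z" "sin z"] S1(2) sc(1) Ael by (simp add: algebra_simps)
    from small[OF this] have Sb: "norm S \<le> 2 * ((K + A) * e) / norm l" .
    have "norm (r1 * S) \<le> R / 2 * (2 * ((K + A) * e) / norm l)"
      unfolding norm_mult using r Sb R by (intro mult_mono) auto
    moreover have "l * S - sin z = ((l - r1) * S - sin z) + r1 * S" by (simp add: algebra_simps)
    ultimately have "norm (l * S - sin z) \<le> A * e / norm l + R / 2 * (2 * ((K + A) * e) / norm l)"
      using S1(2) norm_triangle_mono by metis
    also have "\<dots> = (A + R * (K + A)) * e / norm l" using lpos by (simp add: field_simps)
    finally have "norm (l * S - sin z) \<le> (A + R * (K + A)) * e / norm l" .
    then show "norm (l * sol_S p q l pi - sin (l * of_real pi - integral {0..pi} p)) \<le> C / norm l * exp (pi * \<bar>Im l\<bar>)"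
      unfolding S_def z_def a_def by (rule fin) (use A R K in \<open>simp add: C_def mult_left_mono\<close>)
    show "norm (D1 (sol_S p q l) pi - cos (l * of_real pi - integral {0..pi} p)) \<le> C / norm l * exp (pi * \<bar>Im l\<bar>)"
      using S1(1) unfolding S'_def z_def a_def by (rule fin) (use A R K in \<open>simp add: C_def\<close>)
    let ?P = "c' + \<i> * (l - r1) * c - exp (\<i> * z) * (\<i> * (l - r0))" and ?M = "c' + (- \<i>) * (l - r1) * c - exp (- \<i> * z) * (- \<i> * (l - r0))"
    have PM: "norm (?P + ?M) \<le> 2 * (A * e)" "norm (?P - ?M) \<le> 2 * (A * e)"
      using half[OF wC[of \<i>] wC[of "-\<i>"]] by auto
    have "?P + ?M = 2 * (c' + (l - r0) * sin z)" "?P - ?M = 2 * \<i> * ((l - r1) * c - (l - r0) * cos z)"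
      unfolding exps by (simp_all add: algebra_simps)
    with PM have C1: "norm (c' + (l - r0) * sin z) \<le> A * e" "norm ((l - r1) * c - (l - r0) * cos z) \<le> A * e"
      by (simp_all only: norm_mult) simp_all
    have rsc: "norm (r0 * sin z) \<le> R / 2 * (K * e)" "norm (r0 * cos z) \<le> R / 2 * (K * e)"
      unfolding norm_mult using r sc R by (intro mult_mono; simp)+
    have "c' / l + sin z = ((c' + (l - r0) * sin z) + r0 * sin z) / l"
      using lpos by (simp add: field_simps)
    also have "norm \<dots> \<le> (A * e + R / 2 * (K * e)) / norm l"
      unfolding norm_divide using C1(1) rsc(1) by (intro divide_right_mono norm_triangle_mono) auto
    also have "\<dots> = (A + R / 2 * K) * e / norm l" by (simp add: algebra_simps)
    finally show "norm (D1 (sol_C p q l) pi / l + sin (l * of_real pi - integral {0..pi} p)) \<le> C / norm l * exp (pi * \<bar>Im l\<bar>)"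
      unfolding c'_def z_def a_def by (rule fin) (use A R K in \<open>simp add: C_def algebra_simps\<close>)
    have "norm ((l - r0) * cos z) \<le> 2 * norm l * (K * e)"
      unfolding norm_mult using lr1 sc K e0 by (intro mult_mono) auto
    then have "norm ((l - r1) * c) \<le> norm l * ((2 * K + A) * e)"
      using norm_triangle_ineq[of "(l - r1) * c - (l - r0) * cos z" "(l - r0) * cos z"] C1(2) 
        mult_right_mono[OF lpos(2), of "A * e"] A e0 by (simp add: algebra_simps)
    from small[OF this] have "norm c \<le> 2 * ((2 * K + A) * e)" using lpos by simp
    then have rc: "norm (r1 * c) \<le> R / 2 * (2 * ((2 * K + A) * e))"
      unfolding norm_mult using r R by (intro mult_mono) auto
    have "c - cos z = (((l - r1) * c - (l - r0) * cos z) + r1 * c - r0 * cos z) / l"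
      using lpos by (simp add: field_simps)
    also have "norm \<dots> \<le> (A * e + R / 2 * (2 * ((2 * K + A) * e)) + R / 2 * (K * e)) / norm l"
      unfolding norm_divide
    proof (rule divide_right_mono)
      show "norm ((l - r1) * c - (l - r0) * cos z + r1 * c - r0 * cos z) \<le> A * e + R / 2 * (2 * ((2 * K + A) * e)) + R / 2 * (K * e)"
        using norm_triangle_ineq4[of "(l - r1) * c - (l - r0) * cos z + r1 * c" "r0 * cos z"]
          norm_triangle_ineq[of "(l - r1) * c - (l - r0) * cos z" "r1 * c"] C1(2) rsc(2) rc by linarith
    qed simp
    also have "\<dots> = (A + R * (2 * K + A) + R / 2 * K) * e / norm l" by (simp add: algebra_simps)
    finally show "norm (sol_C p q l pi - cos (l * of_real pi - integral {0..pi} p)) \<le> C / norm l * exp (pi * \<bar>Im l\<bar>)"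
      unfolding c_def z_def a_def by (rule fin) (use A R K in \<open>simp add: C_def algebra_simps\<close>)
  qed
qed

section \<open>Eigenvalues as zeros of the characteristic function\<close>

text \<open>
  The matching conditions for \<open>y\<^sub>j = a\<^sub>j S\<^sub>j\<close> on the boundary edges and \<open>y\<^sub>m = b C\<^sub>m + a\<^sub>m S\<^sub>m\<close> on the
  loop.  Here \<open>b\<close> is the value at the internal vertex, \<open>a\<^sub>j\<close> the slope at the start of the edge \<open>j\<close>, and the
  remaining arguments are values at the endpoint \<open>\<pi>\<close>.
\<close>

definition has_nontrivial_matching where
  "has_nontrivial_matching m S S' c c' \<longleftrightarrow> (\<exists>(a :: nat \<Rightarrow> complex) b. (b \<noteq> 0 \<or> (\<exists>j\<in>{1..m}. a j \<noteq> 0)) \<and> 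
     (\<forall>j\<in>{1..m-1}. b = a j * S j) \<and> b = a m * S m + b * c \<and>
     a m = (\<Sum>j=1..m-1. a j * S' j) + a m * S' m + b * c')"

text \<open>
  If no \<open>S\<^sub>j\<close> of a boundary edge vanishes, eliminating \<open>a\<^sub>j = b / S\<^sub>j\<close> leaves a 2 by 2 system for
  \<open>a\<^sub>m\<close> and \<open>b\<close>, whose determinant is the right-hand side divided by \<open>\<Prod> S\<^sub>j\<close>.  If \<open>S\<^sub>i = 0\<close>, then
  \<open>b = 0\<close>, the right-hand side reduces to \<open>S\<^sub>m S\<^sub>i' \<Prod> S\<^sub>k\<close> over \<open>k \<noteq> i\<close>, and a solution exists iff a second
  one among \<open>S\<^sub>1, \<dots>, S\<^sub>m\<close> vanishes: two edges with vanishing \<open>S\<close> can balance their fluxes at the vertex,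
  a single one cannot.  The hypotheses come from the Wronskian.
\<close>

lemma matching_iff_determinant:
  fixes S S' :: "nat \<Rightarrow> complex" and c c' :: complex
  assumes m: "m \<ge> 2" and wr: "c * S' m - c' * S m = 1" and S'0: "\<And>j. j \<in> {1..m-1} \<Longrightarrow> S j = 0 \<Longrightarrow> S' j \<noteq> 0"
  shows "has_nontrivial_matching m S S' c c' \<longleftrightarrow>
     (\<Sum>j=1..m-1. S' j * (\<Prod>k\<in>{1..m} - {j}. S k)) + (S' m + c - 2) * (\<Prod>k=1..m-1. S k) = 0"
proof -
  define I where "I = {1..m-1}"
  define d where "d = S' m + c - 2"
  have fI: "finite I" and mI: "m \<notin> I" "insert m I = {1..m}" using m by (auto simp: I_def)
  have d: "d = c' * S m - (c - 1) * (S' m - 1)" using wr by (simp add: d_def algebra_simps)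
  have "(\<Prod>k\<in>{1..m} - {j}. S k) = S m * (\<Prod>k\<in>I - {j}. S k)" if "j \<in> I" for j
  proof -
    have "{1..m} - {j} = insert m (I - {j})" using that mI by auto
    then show ?thesis using fI mI by simp
  qed
  then have "(\<Sum>j=1..m-1. S' j * (\<Prod>k\<in>{1..m} - {j}. S k)) = (\<Sum>j\<in>I. S' j * (S m * (\<Prod>k\<in>I - {j}. S k)))"
    unfolding I_def[symmetric] by (intro sum.cong) auto
  then have \<Delta>: "(\<Sum>j=1..m-1. S' j * (\<Prod>k\<in>{1..m} - {j}. S k)) + (S' m + c - 2) * (\<Prod>k=1..m-1. S k)
     = S m * (\<Sum>j\<in>I. S' j * (\<Prod>k\<in>I - {j}. S k)) + d * (\<Prod>k\<in>I. S k)" (is "?\<Delta> = _")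
    by (simp add: I_def d_def sum_distrib_left mult_ac)
  have hnm: "has_nontrivial_matching m S S' c c' \<longleftrightarrow> (\<exists>a b. (b \<noteq> 0 \<or> (\<exists>j\<in>{1..m}. a j \<noteq> 0)) \<and> 
     (\<forall>j\<in>I. b = a j * S j) \<and> b = a m * S m + b * c \<and> a m = (\<Sum>j\<in>I. a j * S' j) + a m * S' m + b * c')"
    by (simp add: has_nontrivial_matching_def I_def)
  show ?thesis
  proof (cases "\<exists>i\<in>I. S i = 0")
    case False
    then have nz: "(\<Prod>k\<in>I. S k) \<noteq> 0" using fI by simp
    define \<sigma> where "\<sigma> = (\<Sum>j\<in>I. S' j / S j)"
    have "(\<Prod>k\<in>I - {j}. S k) = (\<Prod>k\<in>I. S k) / S j" if "j \<in> I" for j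
      using that fI False by (simp add: prod.remove[of I j])
    then have "(\<Sum>j\<in>I. S' j * (\<Prod>k\<in>I - {j}. S k)) = (\<Prod>k\<in>I. S k) * \<sigma>"
      unfolding \<sigma>_def sum_distrib_left by (intro sum.cong) auto
    then have \<Delta>': "?\<Delta> = (\<Prod>k\<in>I. S k) * (S m * \<sigma> + d)" unfolding \<Delta> by (simp add: algebra_simps)
    have det: "S m * \<sigma> + d = S m * (\<sigma> + c') - (c - 1) * (S' m - 1)" by (simp add: d algebra_simps)
    show ?thesis
    proof
      assume "has_nontrivial_matching m S S' c c'"
      then obtain a b where ab: "b \<noteq> 0 \<or> (\<exists>j\<in>{1..m}. a j \<noteq> 0)" "\<And>j. j \<in> I \<Longrightarrow> b = a j * S j" "b = a m * S m + b * c"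
        "a m = (\<Sum>j\<in>I. a j * S' j) + a m * S' m + b * c'" unfolding hnm by blast
      have aj: "a j = b / S j" if "j \<in> I" for j using ab(2)[OF that] False that by (simp add: field_simps)
      have "(\<Sum>j\<in>I. a j * S' j) = b * \<sigma>" unfolding \<sigma>_def sum_distrib_left by (intro sum.cong) (auto simp: aj)
      with ab(4) have e2: "a m * (S' m - 1) + b * (\<sigma> + c') = 0" by (simp add: algebra_simps)
      have e1: "a m * S m + b * (c - 1) = 0" using ab(3) by (simp add: algebra_simps)
      have nt: "b \<noteq> 0 \<or> a m \<noteq> 0" using ab(1) aj mI by fastforce
      have "(S m * \<sigma> + d) * b = S m * (a m * (S' m - 1) + b * (\<sigma> + c')) - (S' m - 1) * (a m * S m + b * (c - 1))"
        unfolding det by (simp add: algebra_simps)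
      moreover have "(S m * \<sigma> + d) * a m = (\<sigma> + c') * (a m * S m + b * (c - 1)) - (c - 1) * (a m * (S' m - 1) + b * (\<sigma> + c'))"
        unfolding det by (simp add: algebra_simps)
      ultimately have "S m * \<sigma> + d = 0" using nt unfolding e1 e2 by auto
      then show "?\<Delta> = 0" unfolding \<Delta>' by simp
    next
      assume "?\<Delta> = 0"
      then have z: "S m * (\<sigma> + c') - (c - 1) * (S' m - 1) = 0" using nz det unfolding \<Delta>' by simp
      obtain am b where amb: "b \<noteq> 0 \<or> am \<noteq> 0" "am * S m + b * (c - 1) = 0" "am * (S' m - 1) + b * (\<sigma> + c') = 0"
      proof (cases "S m = 0 \<and> c = 1")
        case True
        then have "S' m = 1" using wr by simp
        then show thesis using that[of 0 1] True by simp
      next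
        case False
        \<comment> \<open>\<open>(b, a\<^sub>m) = (- S\<^sub>m, c - 1)\<close> spans the kernel of the continuity condition.\<close>
        then show thesis using that[of "- S m" "c - 1"] z by (auto simp: algebra_simps)
      qed
      define a where "a = (\<lambda>j. if j = m then am else b / S j)"
      have ai: "a j = b / S j" if "j \<in> I" for j using that mI by (auto simp: a_def)
      have "(\<Sum>j\<in>I. a j * S' j) = b * \<sigma>" unfolding \<sigma>_def sum_distrib_left by (intro sum.cong) (auto simp: ai)
      then have "a m = (\<Sum>j\<in>I. a j * S' j) + a m * S' m + b * c'" using amb(3) by (simp add: a_def algebra_simps)
      moreover have "b = a m * S m + b * c" using amb(2) by (simp add: a_def algebra_simps)
      moreover have "\<forall>j\<in>I. b = a j * S j" using ai False by auto
      moreover have "b \<noteq> 0 \<or> (\<exists>j\<in>{1..m}. a j \<noteq> 0)" using amb(1) m by (auto simp: a_def intro!: bexI[of _ m])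
      ultimately show "has_nontrivial_matching m S S' c c'" unfolding hnm by blast
    qed
  next
    case True
    then obtain i where i: "i \<in> I" "S i = 0" by blast
    have "(\<Sum>j\<in>I. S' j * (\<Prod>k\<in>I - {j}. S k)) = S' i * (\<Prod>k\<in>I - {i}. S k) + (\<Sum>j\<in>I-{i}. S' j * (\<Prod>k\<in>I - {j}. S k))"
      by (rule sum.remove[OF fI i(1)])
    also have "(\<Sum>j\<in>I-{i}. S' j * (\<Prod>k\<in>I - {j}. S k)) = 0"
    proof (rule sum.neutral, rule ballI)
      fix j assume "j \<in> I - {i}"
      then have "(\<Prod>k\<in>I - {j}. S k) = 0" using i fI by (intro prod_zero) auto
      then show "S' j * (\<Prod>k\<in>I - {j}. S k) = 0" by simp
    qed
    finally have "?\<Delta> = S m * S' i * (\<Prod>k\<in>I - {i}. S k)"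
      unfolding \<Delta> using prod_zero[OF fI, of S] i by auto
    then have \<Delta>0: "?\<Delta> = 0 \<longleftrightarrow> S m = 0 \<or> (\<exists>k\<in>I-{i}. S k = 0)"
      using S'0[of i] i fI by (auto simp: I_def)
    show ?thesis
    proof
      assume "has_nontrivial_matching m S S' c c'"
      then obtain a b where ab: "b \<noteq> 0 \<or> (\<exists>j\<in>{1..m}. a j \<noteq> 0)" "\<And>j. j \<in> I \<Longrightarrow> b = a j * S j" "b = a m * S m + b * c"
        "a m = (\<Sum>j\<in>I. a j * S' j) + a m * S' m + b * c'" unfolding hnm by blast
      have b0: "b = 0" using ab(2)[OF i(1)] i by simp
      show "?\<Delta> = 0"
      proof (rule ccontr)
        assume "?\<Delta> \<noteq> 0"
        then have nz: "S m \<noteq> 0" "\<And>k. k \<in> I - {i} \<Longrightarrow> S k \<noteq> 0" unfolding \<Delta>0 by auto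
        have am: "a m = 0" using ab(3) b0 nz by simp
        have ak: "a k = 0" if "k \<in> I - {i}" for k using ab(2)[of k] that nz(2)[OF that] b0 by auto
        have "(\<Sum>j\<in>I. a j * S' j) = a i * S' i" using ak by (subst sum.remove[OF fI i(1)]) auto
        then have "a i = 0" using ab(4) am b0 S'0[of i] i by (simp add: I_def)
        then have "\<forall>j\<in>insert m I. a j = 0" using am ak by blast
        then show False using ab(1) b0 mI by auto
      qed
    next
      assume "?\<Delta> = 0"
      then consider "S m = 0" | k where "k \<in> I - {i}" "S k = 0" unfolding \<Delta>0 by blast
      then show "has_nontrivial_matching m S S' c c'"
      proof cases
        case 1
        \<comment> \<open>Amplitude \<open>1\<close> on the loop; the edge \<open>i\<close> balances the flux.\<close>
        define a where "a = (\<lambda>j. if j = m then 1 else if j = i then (1 - S' m) / S' i else 0)"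
        have im: "i \<noteq> m" using i mI by auto
        have "a j = 0" if "j \<in> I - {i}" for j using that mI by (auto simp: a_def)
        then have "(\<Sum>j\<in>I. a j * S' j) = a i * S' i" by (subst sum.remove[OF fI i(1)]) auto
        also have "\<dots> = 1 - S' m" using im S'0[of i] i by (simp add: a_def I_def)
        finally have "a m = (\<Sum>j\<in>I. a j * S' j) + a m * S' m + 0 * c'" by (simp add: a_def)
        moreover have "\<forall>j\<in>I. 0 = a j * S j" using i mI by (auto simp: a_def)
        moreover have "0 = a m * S m + 0 * c" using 1 by simp
        moreover have "\<exists>j\<in>{1..m}. a j \<noteq> 0" using m by (intro bexI[of _ m]) (auto simp: a_def)
        ultimately show ?thesis unfolding hnm by blast
      next
        case 2
        \<comment> \<open>Opposite fluxes through the boundary edges \<open>i\<close> and \<open>k\<close>.\<close>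
        define a where "a = (\<lambda>j. if j = k then S' i else if j = i then - S' k else 0)"
        have km: "k \<noteq> m" "i \<noteq> m" "k \<noteq> i" using 2 i mI by auto
        have "(\<Sum>j\<in>I. a j * S' j) = a i * S' i + (a k * S' k + (\<Sum>j\<in>I - {i} - {k}. a j * S' j))"
          using 2 fI by (subst sum.remove[OF fI i(1)], subst sum.remove[of _ k]) auto
        also have "(\<Sum>j\<in>I - {i} - {k}. a j * S' j) = 0" by (intro sum.neutral) (auto simp: a_def)
        finally have "a m = (\<Sum>j\<in>I. a j * S' j) + a m * S' m + 0 * c'" using km by (auto simp: a_def)
        moreover have "\<forall>j\<in>I. 0 = a j * S j" using i 2 by (auto simp: a_def)
        moreover have "0 = a m * S m + 0 * c" using km by (simp add: a_def)
        moreover have "\<exists>j\<in>{1..m}. a j \<noteq> 0" using S'0[of i] i 2 mI by (intro bexI[of _ k]) (auto simp: a_def I_def)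
        ultimately show ?thesis unfolding hnm by blast
      qed
    qed
  qed
qed

lemma D1_zero:
  assumes "\<And>x. x \<in> {0..pi} \<Longrightarrow> y x = 0" "x \<in> {0..pi}"
  shows "D1 y x = 0"
proof -
  have "((\<lambda>_. 0) has_vector_derivative 0) (at x within {0..pi})" by simp
  then have "(y has_vector_derivative 0) (at x within {0..pi})"
    by (rule has_vector_derivative_transform[OF assms(2), rotated]) (use assms(1) in auto)
  then show ?thesis unfolding D1_def using vector_derivative_within_cbox[of 0 pi x y 0] assms(2) by simp
qed

text \<open>
  Every solution on an edge is a combination of \<open>S\<close> and \<open>C\<close>, so an eigenfunction is the same as a
  nontrivial solution of the matching conditions, and its existence is decided by the
  determinant.
\<close>

theorem eigenvalues_eq_zeros:
  assumes m: "m \<ge> 2"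
    and p: "\<And>j. j \<in> {1..m} \<Longrightarrow> continuous_on {0..pi} (p j)"
    and q: "\<And>j. j \<in> {1..m} \<Longrightarrow> q j absolutely_integrable_on {0..pi}"
  shows "l \<in> eigenvalues m p q \<longleftrightarrow> char_fun m p q l = 0"
proof -
  define S where "S = (\<lambda>j. sol_S (p j) (q j) l pi)"
  define S' where "S' = (\<lambda>j. D1 (sol_S (p j) (q j) l) pi)"
  define c where "c = sol_C (p m) (q m) l pi"
  define c' where "c' = D1 (sol_C (p m) (q m) l) pi"
  have wr: "sol_C (p j) (q j) l pi * S' j - D1 (sol_C (p j) (q j) l) pi * S j = 1" if "j \<in> {1..m}" for j
    using ivp_wronskian[OF potential_abs_int[OF p[OF that] q[OF that]] sol_C_ivp[OF p[OF that] q[OF that]] sol_S_ivp[OF p[OF that] q[OF that]], of pi l]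
    by (simp add: S_def S'_def)
  have mm: "m \<in> {1..m}" using m by simp
  have init: "sol_S (p j) (q j) l 0 = 0" "D1 (sol_S (p j) (q j) l) 0 = 1" "sol_C (p j) (q j) l 0 = 1" "D1 (sol_C (p j) (q j) l) 0 = 0"
    if "j \<in> {1..m}" for j
    using ivp_init[OF sol_S_ivp[OF p[OF that] q[OF that]]] ivp_init[OF sol_C_ivp[OF p[OF that] q[OF that]]] by auto
  have sum_m: "(\<Sum>j=1..m. f j) = (\<Sum>j=1..m-1. f j) + f m" for f :: "nat \<Rightarrow> complex"
    using m by (cases m) auto
  have "l \<in> eigenvalues m p q \<longleftrightarrow> has_nontrivial_matching m S S' c c'"
  proof
    assume "l \<in> eigenvalues m p q"
    then obtain y where y: "solves_L m p q l y" and nt: "\<exists>j\<in>{1..m}. \<exists>x\<in>{0..pi}. y j x \<noteq> 0"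
      unfolding eigenvalues_def by blast
    have sol: "solves_eq (p j) (q j) l (y j)" if "j \<in> {1..m}" for j using y that by (simp add: solves_L_def)
    have y0: "y j 0 = 0" if "j \<in> {1..m-1}" for j using y that by (simp add: solves_L_def)
    note rep = solves_eq_representation[OF p q sol]
    define a where "a = (\<lambda>j. D1 (y j) 0)"
    define b where "b = y m 0"
    have yj: "y j x = a j * sol_S (p j) (q j) l x" "D1 (y j) x = a j * D1 (sol_S (p j) (q j) l) x" 
      if j: "j \<in> {1..m-1}" and x: "x \<in> {0..pi}" for j x
    proof -
      have j': "j \<in> {1..m}" using j by auto
      show "y j x = a j * sol_S (p j) (q j) l x" "D1 (y j) x = a j * D1 (sol_S (p j) (q j) l) x"
        using rep[OF j' j' j' x] y0[OF j] by (simp_all add: a_def)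
    qed
    have ym: "y m x = b * sol_C (p m) (q m) l x + a m * sol_S (p m) (q m) l x" 
         "D1 (y m) x = b * D1 (sol_C (p m) (q m) l) x + a m * D1 (sol_S (p m) (q m) l) x" if "x \<in> {0..pi}" for x
      using rep[OF mm mm mm that] by (simp_all add: a_def b_def)
    have bc: "y m 0 = y j pi" if "j \<in> {1..m}" for j using y that unfolding solves_L_def by blast
    have "b \<noteq> 0 \<or> (\<exists>j\<in>{1..m}. a j \<noteq> 0)"
    proof (rule ccontr)
      assume "\<not> (b \<noteq> 0 \<or> (\<exists>j\<in>{1..m}. a j \<noteq> 0))"
      then have z: "b = 0" "\<And>j. j \<in> {1..m} \<Longrightarrow> a j = 0" by auto
      obtain j x where jx: "j \<in> {1..m}" "x \<in> {0..pi}" "y j x \<noteq> 0" using nt by blast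
      show False
      proof (cases "j = m")
        case True
        then show False using jx z ym by simp
      next
        case False
        then have "j \<in> {1..m-1}" using jx by auto
        then show False using yj(1)[of j x] jx z by simp
      qed
    qed
    moreover have "\<forall>j\<in>{1..m-1}. b = a j * S j"
    proof
      fix j assume j: "j \<in> {1..m-1}"
      then have "j \<in> {1..m}" by auto
      from bc[OF this] show "b = a j * S j" using yj(1)[OF j, of pi] by (simp add: b_def S_def)
    qed
    moreover have "b = a m * S m + b * c" using bc[OF mm] ym(1)[of pi] by (simp add: b_def S_def c_def add.commute)
    moreover have "a m = (\<Sum>j=1..m-1. a j * S' j) + a m * S' m + b * c'"
    proof -
      have "a m = (\<Sum>j=1..m. D1 (y j) pi)" using y by (simp add: solves_L_def a_def)
      also have "\<dots> = (\<Sum>j=1..m-1. D1 (y j) pi) + D1 (y m) pi" by (rule sum_m)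
      also have "(\<Sum>j=1..m-1. D1 (y j) pi) = (\<Sum>j=1..m-1. a j * S' j)"
        by (intro sum.cong) (use yj(2) in \<open>auto simp: S'_def\<close>)
      finally show ?thesis using ym(2)[of pi] by (simp add: S'_def c'_def add_ac)
    qed
    ultimately show "has_nontrivial_matching m S S' c c'" unfolding has_nontrivial_matching_def by blast
  next
    assume "has_nontrivial_matching m S S' c c'"
    then obtain a b where ab: "b \<noteq> 0 \<or> (\<exists>j\<in>{1..m}. a j \<noteq> 0)" "\<And>j. j \<in> {1..m-1} \<Longrightarrow> b = a j * S j" "b = a m * S m + b * c"
        "a m = (\<Sum>j=1..m-1. a j * S' j) + a m * S' m + b * c'" unfolding has_nontrivial_matching_def by blast
    define y where "y = (\<lambda>j x. (if j = m then b else 0) * sol_C (p j) (q j) l x + a j * sol_S (p j) (q j) l x)"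
    have D1y: "D1 (y j) x = (if j = m then b else 0) * D1 (sol_C (p j) (q j) l) x + a j * D1 (sol_S (p j) (q j) l) x"
      if "j \<in> {1..m}" "x \<in> {0..pi}" for j x
      unfolding y_def by (rule solves_eq_lincomb(2)[OF p[OF that(1)] q[OF that(1)] that(2)])
    have "solves_L m p q l y"
      unfolding solves_L_def
    proof (intro conjI ballI)
      show "solves_eq (p j) (q j) l (y j)" if "j \<in> {1..m}" for j
        unfolding y_def by (rule solves_eq_lincomb(1)[OF p[OF that] q[OF that]])
      show "y j 0 = 0" if "j \<in> {1..m-1}" for j
      proof -
        have "j \<in> {1..m}" "j \<noteq> m" using that m by auto
        then show ?thesis using init(1) by (simp add: y_def)
      qed
      have ym0: "y m 0 = b" using init[OF mm] by (simp add: y_def)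
      show "y m 0 = y j pi" if j: "j \<in> {1..m}" for j
      proof (cases "j = m")
        case True
        then show ?thesis using ab(3) ym0 by (simp add: y_def S_def c_def add.commute)
      next
        case False
        then have "j \<in> {1..m-1}" using j by auto
        from ab(2)[OF this] show ?thesis using ym0 False by (simp add: y_def S_def)
      qed
      have "(\<Sum>j=1..m. D1 (y j) pi) = (\<Sum>j=1..m-1. D1 (y j) pi) + D1 (y m) pi" by (rule sum_m)
      also have "(\<Sum>j=1..m-1. D1 (y j) pi) = (\<Sum>j=1..m-1. a j * S' j)"
        by (intro sum.cong) (use D1y m in \<open>auto simp: S'_def\<close>)
      also have "D1 (y m) pi = b * c' + a m * S' m" using D1y[OF mm] by (simp add: S'_def c'_def)
      finally show "D1 (y m) 0 = (\<Sum>j=1..m. D1 (y j) pi)" using ab(4) D1y[OF mm] init[OF mm] by (simp add: algebra_simps)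
    qed
    moreover have "\<exists>j\<in>{1..m}. \<exists>x\<in>{0..pi}. y j x \<noteq> 0"
    proof (rule ccontr)
      assume "\<not> (\<exists>j\<in>{1..m}. \<exists>x\<in>{0..pi}. y j x \<noteq> 0)"
      then have z: "y j x = 0" if "j \<in> {1..m}" "x \<in> {0..pi}" for j x using that by blast
      have "b = 0" using z[OF mm, of 0] init[OF mm] by (simp add: y_def)
      moreover have "a j = 0" if j: "j \<in> {1..m}" for j
        using D1_zero[of "y j" 0] z[OF j] D1y[OF j, of 0] init[OF j] by simp
      ultimately show False using ab(1) by blast
    qed
    ultimately show "l \<in> eigenvalues m p q" unfolding eigenvalues_def by blast
  qed
  also have "\<dots> \<longleftrightarrow> char_fun m p q l = 0"
  proof -
    have "S' j \<noteq> 0" if "j \<in> {1..m-1}" "S j = 0" for j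
    proof -
      have "j \<in> {1..m}" using that by auto
      from wr[OF this] show ?thesis using that by auto
    qed
    from matching_iff_determinant[OF m _ this, where c = c and c' = c'] wr[OF mm]
    show ?thesis by (simp add: char_fun_def d_loop_def S_def S'_def c_def c'_def)
  qed
  finally show ?thesis .
qed

section \<open>Perturbation of the characteristic function\<close>

text \<open>
  In the next four lemmas \<open>e\<close> is the size \<open>exp (\<pi> |Im l|)\<close> of the trigonometric main terms and \<open>\<epsilon>\<close>
  the relative error \<open>O(1 / |l|)\<close>.  The constants depend on the number of factors only; their values are
  immaterial.
\<close>

lemma norm_prod_approx:
  fixes x y :: "'i \<Rightarrow> complex" and e \<epsilon> :: real
  assumes "finite I" "\<And>i. i \<in> I \<Longrightarrow> norm (x i) \<le> e" "\<And>i. i \<in> I \<Longrightarrow> norm (y i - x i) \<le> \<epsilon> * e" "0 \<le> \<epsilon>" "\<epsilon> \<le> 1" "0 \<le> e"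
  shows "norm (prod y I - prod x I) \<le> 2 ^ card I * \<epsilon> * e ^ card I" "norm (prod x I) \<le> e ^ card I"
proof -
  have px: "norm (prod x J) \<le> e ^ card J" if "J \<subseteq> I" for J
    using prod_mono[of J "\<lambda>i. norm (x i)" "\<lambda>_. e"] assms(2) that by (auto simp flip: prod_norm)
  then show "norm (prod x I) \<le> e ^ card I" by simp
  \<comment> \<open>The \<open>- 1\<close> makes the induction exact: \<open>2 (2\<^sup>k - 1) + 1 = 2\<^sup>k\<^sup>+\<^sup>1 - 1\<close>.\<close>
  have "norm (prod y J - prod x J) \<le> (2 ^ card J - 1) * \<epsilon> * e ^ card J" if "J \<subseteq> I" for J
    using finite_subset[OF that assms(1)] that
  proof (induction J rule: finite_induct)
    case (insert i J)
    have i: "norm (x i) \<le> e" "norm (y i - x i) \<le> \<epsilon> * e" using insert assms by auto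
    have "\<epsilon> * e \<le> e" using assms by (simp add: mult_left_le_one_le)
    then have "norm (y i) \<le> 2 * e" using i norm_triangle_sub[of "y i" "x i"] by linarith
    have "prod y (insert i J) - prod x (insert i J) = y i * (prod y J - prod x J) + (y i - x i) * prod x J"
      using insert by (simp add: algebra_simps)
    also have "norm \<dots> \<le> (2 * e) * ((2 ^ card J - 1) * \<epsilon> * e ^ card J) + (\<epsilon> * e) * e ^ card J"
      using insert i \<open>norm (y i) \<le> 2 * e\<close> px[of J] assms
      by (intro norm_triangle_mono) (auto simp: norm_mult intro!: mult_mono)
    also have "\<dots> = (2 ^ card (insert i J) - 1) * \<epsilon> * e ^ card (insert i J)"
      using insert by (simp add: algebra_simps)
    finally show ?case .
  qed simp
  from this[of I] have "norm (prod y I - prod x I) \<le> (2 ^ card I - 1) * (\<epsilon> * e ^ card I)" by (simp add: mult.assoc)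
  also have "\<dots> \<le> 2 ^ card I * (\<epsilon> * e ^ card I)" using assms by (intro mult_right_mono) auto
  finally show "norm (prod y I - prod x I) \<le> 2 ^ card I * \<epsilon> * e ^ card I" by (simp add: mult.assoc)
qed

lemma norm_symmetric_sum_approx:
  fixes s c s0 c0 :: "nat \<Rightarrow> complex" and e \<epsilon> :: real
  assumes I: "finite I" and b: "\<And>i. i \<in> I \<Longrightarrow> norm (s0 i) \<le> e" "\<And>i. i \<in> I \<Longrightarrow> norm (c0 i) \<le> e" 
    and d: "\<And>i. i \<in> I \<Longrightarrow> norm (s i - s0 i) \<le> \<epsilon> * e" "\<And>i. i \<in> I \<Longrightarrow> norm (c i - c0 i) \<le> \<epsilon> * e" 
    and "0 \<le> \<epsilon>" "\<epsilon> \<le> 1" "0 \<le> e"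
  shows "norm ((\<Sum>j\<in>I. c j * (\<Prod>k\<in>I-{j}. s k)) - (\<Sum>j\<in>I. c0 j * (\<Prod>k\<in>I-{j}. s0 k))) \<le> card I * 2 ^ card I * \<epsilon> * e ^ card I"
    "norm (\<Sum>j\<in>I. c0 j * (\<Prod>k\<in>I-{j}. s0 k)) \<le> card I * e ^ card I"
proof -
  \<comment> \<open>Each summand is again a product over all of \<open>I\<close>.\<close>
  have upd: "c j * (\<Prod>k\<in>I-{j}. s k) = (\<Prod>k\<in>I. if k = j then c j else s k)" if "j \<in> I" for j and c s :: "nat \<Rightarrow> complex"
    using I that by (subst prod.remove[OF I that]) (auto intro!: prod.cong)
  have 1: "norm (c j * (\<Prod>k\<in>I-{j}. s k) - c0 j * (\<Prod>k\<in>I-{j}. s0 k)) \<le> 2 ^ card I * \<epsilon> * e ^ card I" 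
       "norm (c0 j * (\<Prod>k\<in>I-{j}. s0 k)) \<le> e ^ card I" if "j \<in> I" for j
    unfolding upd[OF that] using norm_prod_approx[OF I, of "\<lambda>k. if k = j then c0 j else s0 k" e "\<lambda>k. if k = j then c j else s k" \<epsilon>] assms that by auto
  have "norm ((\<Sum>j\<in>I. c j * (\<Prod>k\<in>I-{j}. s k)) - (\<Sum>j\<in>I. c0 j * (\<Prod>k\<in>I-{j}. s0 k))) \<le> (\<Sum>j\<in>I. 2 ^ card I * \<epsilon> * e ^ card I :: real)"
    unfolding sum_subtractf[symmetric] by (rule sum_norm_le) (rule 1)
  then show "norm ((\<Sum>j\<in>I. c j * (\<Prod>k\<in>I-{j}. s k)) - (\<Sum>j\<in>I. c0 j * (\<Prod>k\<in>I-{j}. s0 k))) \<le> card I * 2 ^ card I * \<epsilon> * e ^ card I"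
    by (simp add: mult.assoc)
  have "norm (\<Sum>j\<in>I. c0 j * (\<Prod>k\<in>I-{j}. s0 k)) \<le> (\<Sum>j\<in>I. e ^ card I :: real)" by (rule sum_norm_le) (rule 1)
  then show "norm (\<Sum>j\<in>I. c0 j * (\<Prod>k\<in>I-{j}. s0 k)) \<le> card I * e ^ card I" by simp
qed

text \<open>
  First-order comparison of \<open>l ^ (m - 1) \<Delta>(l) = s\<^sub>m T + d W\<close> with its limit, for all large \<open>l\<close>;
  here \<open>P\<close> stands for \<open>W\<close> and \<open>k = m - 1\<close>.
\<close>

lemma char_approx_global:
  fixes sm sm0 T T0 d d0 P P0 :: complex and e \<epsilon> n :: real
  assumes "norm sm0 \<le> e" "norm (sm - sm0) \<le> \<epsilon> * e" "norm T0 \<le> n * e ^ k" "norm (T - T0) \<le> n * 2 ^ k * \<epsilon> * e ^ k"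
    and "norm d0 \<le> 4 * e" "norm (d - d0) \<le> 2 * \<epsilon> * e" "norm P0 \<le> e ^ k" "norm (P - P0) \<le> 2 ^ k * \<epsilon> * e ^ k"
    and "0 \<le> \<epsilon>" "\<epsilon> \<le> 1" "0 \<le> e" "0 \<le> n"
  shows "norm (sm * T + d * P - (sm0 * T0 + d0 * P0)) \<le> (3 * n + 8) * 2 ^ k * \<epsilon> * e ^ Suc k"
proof -
  have ee: "\<epsilon> * e \<le> e" using assms by (simp add: mult_left_le_one_le)
  have sm: "norm sm \<le> 2 * e" using norm_triangle_sub[of sm sm0] assms(1,2) ee by linarith
  have d: "norm d \<le> 6 * e" using norm_triangle_sub[of d d0] assms(5,6) ee by linarith
  have "sm * T + d * P - (sm0 * T0 + d0 * P0) = (sm * (T - T0) + (sm - sm0) * T0) + (d * (P - P0) + (d - d0) * P0)"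
    by (simp add: algebra_simps)
  also have "norm \<dots> \<le> ((2 * e) * (n * 2 ^ k * \<epsilon> * e ^ k) + (\<epsilon> * e) * (n * e ^ k)) + ((6 * e) * (2 ^ k * \<epsilon> * e ^ k) + (2 * \<epsilon> * e) * e ^ k)"
    by (intro norm_triangle_mono; unfold norm_mult; intro mult_mono sm d assms) (use assms in auto)
  also have "\<dots> = (2 * n * 2 ^ k + n * 1 + 6 * 2 ^ k + 2 * 1) * (\<epsilon> * e ^ Suc k)"
    by (simp add: algebra_simps)
  also have "\<dots> \<le> (2 * n * 2 ^ k + n * 2 ^ k + 6 * 2 ^ k + 2 * 2 ^ k) * (\<epsilon> * e ^ Suc k)"
    by (intro mult_right_mono add_mono mult_left_mono) (use assms in \<open>auto simp del: power_Suc\<close>)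
  also have "\<dots> = (3 * n + 8) * 2 ^ k * \<epsilon> * e ^ Suc k" by (simp add: algebra_simps)
  finally show ?thesis .
qed

text \<open>
  Refined comparison for bounded \<open>e\<close>.  In the application \<open>A = |sin (\<pi> l / 2)|\<close> and \<open>B = |E(l)|\<close> are
  the moduli of the two factors of the limit function.  The trigonometric values \<open>sm0\<close>, \<open>cm0 - 1\<close> and
  \<open>T0\<close> are \<open>O(A + B)\<close>.  As \<open>s\<^sub>m T\<close> and both summands of \<open>d\<close> are products of two quantities of this
  kind, each changed by \<open>O(\<epsilon>)\<close>, the error is \<open>O(\<epsilon> (A + B) + \<epsilon>\<^sup>2)\<close> instead of \<open>O(\<epsilon>)\<close>.  The form of \<open>d\<close>
  is the one given by the Wronskian identity, with \<open>t = - C\<^sub>m' / l\<close>, \<open>cm = S\<^sub>m'\<close> and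
  \<open>C' = C\<^sub>m\<close>.
\<close>

lemma char_approx_near_axis:
  fixes sm sm0 T T0 P P0 t cm cm0 C' :: complex and e \<epsilon> n \<kappa> A B :: real
  assumes sm: "norm sm0 \<le> e" "norm (sm - sm0) \<le> \<epsilon> * e" "norm (t - sm0) \<le> \<epsilon> * e" "norm (cm - cm0) \<le> \<epsilon> * e" "norm (C' - cm0) \<le> \<epsilon> * e"
    and T: "norm (T - T0) \<le> n * 2 ^ k * \<epsilon> * e ^ k" and P: "norm P0 \<le> e ^ k" "norm (P - P0) \<le> 2 ^ k * \<epsilon> * e ^ k"
    and \<kappa>: "norm sm0 \<le> \<kappa> * A" "norm (cm0 - 1) \<le> \<kappa> * A" "norm (cm0 - 1) \<le> 2 * e" "norm T0 \<le> \<kappa> * (A + B)"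
    and pos: "0 \<le> \<epsilon>" "\<epsilon> \<le> 1" "1 \<le> e" "0 \<le> n" "0 \<le> A" "0 \<le> B" "0 \<le> \<kappa>"
  defines "d \<equiv> - t * sm - (C' - 1) * (cm - 1)" and "d0 \<equiv> - sm0 * sm0 - (cm0 - 1) * (cm0 - 1)"
  shows "norm (sm * T + d * P - (sm0 * T0 + d0 * P0)) \<le> 
    (n * 2 ^ k + \<kappa> + \<kappa> * n * 2 ^ k + (2 + 4 * \<kappa>) * 2 ^ Suc k + 3 * \<kappa> * 2 ^ k) * e ^ (k + 2) * (\<epsilon> * (A + B) + \<epsilon>\<^sup>2)"
proof -
  define X where "X = \<epsilon> * (A + B) + \<epsilon>\<^sup>2"
  have e0: "e \<ge> 0" "e ^ j \<ge> 1" for j using pos by auto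
  have X: "\<epsilon> * A \<le> X" "\<epsilon> * (A + B) \<le> X" "\<epsilon>\<^sup>2 \<le> X" "X \<ge> 0" unfolding X_def using pos by (auto simp: algebra_simps intro: add_increasing2 add_increasing)
  have eps2: "norm ((x - x0) * (y - y0)) \<le> e\<^sup>2 * X" if "norm (x - x0) \<le> \<epsilon> * e" "norm (y - y0) \<le> \<epsilon> * e" for x x0 y y0 :: complex
  proof -
    have "norm ((x - x0) * (y - y0)) \<le> (\<epsilon> * e) * (\<epsilon> * e)" unfolding norm_mult using that pos by (intro mult_mono) auto
    also have "\<dots> = e\<^sup>2 * \<epsilon>\<^sup>2" by (simp add: power2_eq_square)
    also have "\<dots> \<le> e\<^sup>2 * X" using X by (intro mult_left_mono) auto
    finally show ?thesis .
  qed
  have epsA: "norm ((x - x0) * y) \<le> \<kappa> * e * X" if "norm (x - x0) \<le> \<epsilon> * e" "norm y \<le> \<kappa> * A \<or> norm y \<le> \<kappa> * (A + B)" for x x0 y :: complex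
  proof -
    have "norm y \<le> \<kappa> * (A + B)" using that(2) pos by (auto intro: order_trans simp: algebra_simps)
    then have "norm ((x - x0) * y) \<le> (\<epsilon> * e) * (\<kappa> * (A + B))" unfolding norm_mult using that pos by (intro mult_mono) auto
    also have "\<dots> = \<kappa> * e * (\<epsilon> * (A + B))" by simp
    also have "\<dots> \<le> \<kappa> * e * X" using X pos by (intro mult_left_mono) auto
    finally show ?thesis .
  qed
  have sq: "norm (x * y - z * z) \<le> e\<^sup>2 * X + 2 * (\<kappa> * e * X)" if "norm (x - z) \<le> \<epsilon> * e" "norm (y - z) \<le> \<epsilon> * e" "norm z \<le> \<kappa> * A" for x y z :: complex
  proof -
    have "x * y - z * z = (x - z) * (y - z) + ((x - z) * z + (y - z) * z)" by (simp add: algebra_simps)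
    also have "norm \<dots> \<le> e\<^sup>2 * X + (\<kappa> * e * X + \<kappa> * e * X)"
      using that by (intro norm_triangle_mono eps2 epsA) auto
    finally show ?thesis by (simp add: mult_ac)
  qed
  have d: "norm (d - d0) \<le> (2 + 4 * \<kappa>) * e\<^sup>2 * X"
  proof -
    have "d - d0 = - (t * sm - sm0 * sm0) - ((C' - 1) * (cm - 1) - (cm0 - 1) * (cm0 - 1))" by (simp add: d_def d0_def)
    also have "norm \<dots> \<le> norm (t * sm - sm0 * sm0) + norm ((C' - 1) * (cm - 1) - (cm0 - 1) * (cm0 - 1))"
      using norm_triangle_ineq4[of "- (t * sm - sm0 * sm0)" "(C' - 1) * (cm - 1) - (cm0 - 1) * (cm0 - 1)"] by (simp only: norm_minus_cancel)
    also have "\<dots> \<le> (e\<^sup>2 * X + 2 * (\<kappa> * e * X)) + (e\<^sup>2 * X + 2 * (\<kappa> * e * X))"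
      using sm \<kappa> by (intro add_mono sq) auto
    also have "\<dots> = (2 * e\<^sup>2 + 4 * \<kappa> * e) * X" by (simp add: algebra_simps)
    also have "\<dots> \<le> (2 * e\<^sup>2 + 4 * \<kappa> * e\<^sup>2) * X"
      using pos X e0 by (intro mult_right_mono add_left_mono mult_left_mono) (auto simp: power2_eq_square mult_le_cancel_right1)
    finally show ?thesis by (simp add: algebra_simps)
  qed
  have d0: "norm d0 \<le> 3 * \<kappa> * e * A"
  proof -
    have "norm d0 \<le> norm sm0 * norm sm0 + norm (cm0 - 1) * norm (cm0 - 1)"
      unfolding d0_def using norm_triangle_ineq4[of "- sm0 * sm0" "(cm0 - 1) * (cm0 - 1)"] by (simp add: norm_mult)
    also have "\<dots> \<le> e * (\<kappa> * A) + (2 * e) * (\<kappa> * A)" using sm \<kappa> pos by (intro add_mono mult_mono) auto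
    finally show ?thesis by (simp add: mult_ac)
  qed
  have Pb: "norm P \<le> 2 ^ Suc k * e ^ k"
  proof -
    have "norm P \<le> e ^ k + 2 ^ k * \<epsilon> * e ^ k" using norm_triangle_sub[of P P0] P by linarith
    also have "\<dots> \<le> 2 ^ k * e ^ k + 2 ^ k * 1 * e ^ k" using pos e0 by (intro add_mono mult_right_mono mult_left_mono) auto
    finally show ?thesis by (simp add: mult_ac)
  qed
  have pk: "e ^ j * X \<le> e ^ (k + 2) * X" if "j \<le> k + 2" for j using that pos X by (intro mult_right_mono power_increasing) auto
  have t1: "norm ((sm - sm0) * (T - T0)) \<le> n * 2 ^ k * (e ^ (k + 2) * X)"
  proof -
    have "norm ((sm - sm0) * (T - T0)) \<le> (\<epsilon> * e) * (n * 2 ^ k * \<epsilon> * e ^ k)"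
      unfolding norm_mult using sm T pos by (intro mult_mono) auto
    also have "\<dots> = n * 2 ^ k * (e ^ Suc k * \<epsilon>\<^sup>2)" by (simp add: power2_eq_square mult_ac)
    also have "\<dots> \<le> n * 2 ^ k * (e ^ Suc k * X)" using X pos by (intro mult_left_mono) auto
    also have "\<dots> \<le> n * 2 ^ k * (e ^ (k + 2) * X)" using pk[of "Suc k"] pos by (intro mult_left_mono) auto
    finally show ?thesis .
  qed
  have t2: "norm ((sm - sm0) * T0) \<le> \<kappa> * (e ^ (k + 2) * X)"
    using epsA[OF sm(2), of T0] \<kappa>(4) mult_left_mono[OF pk[of 1], of \<kappa>] pos by simp
  have t3: "norm (sm0 * (T - T0)) \<le> \<kappa> * n * 2 ^ k * (e ^ (k + 2) * X)"
  proof -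
    have "norm (sm0 * (T - T0)) \<le> (\<kappa> * A) * (n * 2 ^ k * \<epsilon> * e ^ k)"
      unfolding norm_mult using T \<kappa> pos by (intro mult_mono) auto
    also have "\<dots> = \<kappa> * n * 2 ^ k * (e ^ k * (\<epsilon> * A))" by (simp add: mult_ac)
    also have "\<dots> \<le> \<kappa> * n * 2 ^ k * (e ^ k * X)" using X pos by (intro mult_left_mono) auto
    also have "\<dots> \<le> \<kappa> * n * 2 ^ k * (e ^ (k + 2) * X)" using pk[of k] pos by (intro mult_left_mono) auto
    finally show ?thesis .
  qed
  have t4: "norm ((d - d0) * P) \<le> (2 + 4 * \<kappa>) * 2 ^ Suc k * (e ^ (k + 2) * X)"
  proof -
    have "norm ((d - d0) * P) \<le> ((2 + 4 * \<kappa>) * e\<^sup>2 * X) * (2 ^ Suc k * e ^ k)"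
      unfolding norm_mult using d Pb pos X by (intro mult_mono) auto
    also have "\<dots> = (2 + 4 * \<kappa>) * 2 ^ Suc k * (e ^ (k + 2) * X)" by (simp add: power_add power2_eq_square mult_ac)
    finally show ?thesis .
  qed
  have t5: "norm (d0 * (P - P0)) \<le> 3 * \<kappa> * 2 ^ k * (e ^ (k + 2) * X)"
  proof -
    have "norm (d0 * (P - P0)) \<le> (3 * \<kappa> * e * A) * (2 ^ k * \<epsilon> * e ^ k)"
      unfolding norm_mult using d0 P pos by (intro mult_mono) auto
    also have "\<dots> = 3 * \<kappa> * 2 ^ k * (e ^ Suc k * (\<epsilon> * A))" by (simp add: mult_ac)
    also have "\<dots> \<le> 3 * \<kappa> * 2 ^ k * (e ^ Suc k * X)" using X pos by (intro mult_left_mono) auto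
    also have "\<dots> \<le> 3 * \<kappa> * 2 ^ k * (e ^ (k + 2) * X)" using pk[of "Suc k"] pos by (intro mult_left_mono) auto
    finally show ?thesis .
  qed
  have "sm * T + d * P - (sm0 * T0 + d0 * P0) = (((sm - sm0) * (T - T0) + (sm - sm0) * T0) + sm0 * (T - T0)) + (d - d0) * P + d0 * (P - P0)"
    by (simp add: algebra_simps)
  also have "norm \<dots> \<le> n * 2 ^ k * (e ^ (k + 2) * X) + \<kappa> * (e ^ (k + 2) * X) + \<kappa> * n * 2 ^ k * (e ^ (k + 2) * X) +
      (2 + 4 * \<kappa>) * 2 ^ Suc k * (e ^ (k + 2) * X) + 3 * \<kappa> * 2 ^ k * (e ^ (k + 2) * X)"
    by (intro norm_triangle_mono t1 t2 t3 t4 t5)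
  also have "\<dots> = (n * 2 ^ k + \<kappa> + \<kappa> * n * 2 ^ k + (2 + 4 * \<kappa>) * 2 ^ Suc k + 3 * \<kappa> * 2 ^ k) * e ^ (k + 2) * X"
    by (simp only: distrib_right mult.assoc)
  finally show ?thesis by (simp add: X_def)
qed

section \<open>The zeros of the limit function\<close>

lemma Rolle_finite_set:
  fixes f f' :: "real \<Rightarrow> real"
  assumes der: "\<And>x. (f has_real_derivative f' x) (at x)"
    and "finite Z" "card Z = Suc n" "\<And>x. x \<in> Z \<Longrightarrow> f x = 0"
  shows "\<exists>B. finite B \<and> card B = n \<and> B \<inter> Z = {} \<and> (\<forall>x\<in>B. f' x = 0 \<and> Min Z < x \<and> x < Max Z)"
  using assms(2-4)
proof (induction n arbitrary: Z)
  case 0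
  then show ?case by (intro exI[of _ "{}"]) auto
next
  case (Suc n)
  define M where "M = Max Z"
  define Z' where "Z' = Z - {M}"
  have Zne: "Z \<noteq> {}" using Suc.prems by auto
  have M: "M \<in> Z" "\<And>x. x \<in> Z \<Longrightarrow> x \<le> M" using Suc.prems Zne by (auto simp: M_def)
  have Z': "finite Z'" "card Z' = Suc n" using Suc.prems M by (auto simp: Z'_def)
  then have Z'ne: "Z' \<noteq> {}" by auto
  obtain B where B: "finite B" "card B = n" "B \<inter> Z' = {}" "\<And>x. x \<in> B \<Longrightarrow> f' x = 0 \<and> Min Z' < x \<and> x < Max Z'"
    using Suc.IH[OF Z'] Suc.prems(3) by (auto simp: Z'_def)
  define M' where "M' = Max Z'"
  have M': "M' \<in> Z'" "\<And>x. x \<in> Z' \<Longrightarrow> x \<le> M'" using Z' Z'ne by (auto simp: M'_def)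
  have "M' < M" using M' M by (force simp: Z'_def)
  have "\<exists>z. M' < z \<and> z < M \<and> f' z = 0"
  proof (rule Rolle_deriv[OF \<open>M' < M\<close>, where f = f and f' = "\<lambda>x. (*) (f' x)", THEN exE])
    show "f M' = f M" using Suc.prems(3) M M' by (auto simp: Z'_def)
    show "continuous_on {M'..M} f" using der by (meson DERIV_isCont continuous_at_imp_continuous_on)
    show "(f has_derivative (*) (f' x)) (at x)" for x
      using der[of x] by (simp add: has_field_derivative_def)
  next
    fix z assume z: "M' < z \<and> z < M \<and> (*) (f' z) = (\<lambda>v. 0)"
    then have "f' z = 0" by (metis mult.right_neutral)
    then show ?thesis using z by blast
  qed
  then obtain z where z: "M' < z" "z < M" "f' z = 0" by blast
  have minle: "Min Z \<le> Min Z'" using Suc.prems(1) Z'ne by (intro Min_antimono) (auto simp: Z'_def)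
  have "Min Z' \<le> M'" using Z' M' by simp
  show ?case
  proof (intro exI[of _ "insert z B"] conjI ballI)
    show "finite (insert z B)" using B by simp
    have "z \<notin> B" using B(4)[of z] z by (auto simp: M'_def)
    then show "card (insert z B) = Suc n" using B by simp
    show "insert z B \<inter> Z = {}"
    proof -
      have "x \<notin> Z" if "x \<in> insert z B" for x
      proof -
        have "x \<noteq> M" "x \<notin> Z'"
          using that z B(3,4) M'(2)[of x] \<open>M' < M\<close> unfolding M'_def[symmetric] by fastforce+
        then show ?thesis by (simp add: Z'_def)
      qed
      then show ?thesis by blast
    qed
    fix x assume "x \<in> insert z B"
    then consider "x = z" | "x \<in> B" by blast
    then show "f' x = 0" "Min Z < x" "x < Max Z"
      by (cases; use z B(4)[of x] minle \<open>Min Z' \<le> M'\<close> \<open>M' < M\<close> in \<open>simp add: M_def M'_def\<close>)+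
  qed
qed

lemma frac_diff_Ints: "frac x = frac y \<Longrightarrow> x - y \<in> \<int>" for x y :: real
proof -
  assume "frac x = frac y"
  then have "x - y = of_int (\<lfloor>x\<rfloor> - \<lfloor>y\<rfloor>)" by (simp add: frac_def algebra_simps)
  then show ?thesis by (metis Ints_of_int)
qed

text \<open>
  The expression is, up to the factor \<open>\<pi>/2 (cos (\<pi> x / 2))\<^sup>3\<close>, the derivative of
  \<open>H(x) = (cos (\<pi> x / 2))\<^sup>4 \<Prod> sin (\<pi> (x - \<alpha>\<^sub>k))\<close>.  In \<open>[-1, 1]\<close> the function \<open>H\<close> vanishes at the two end
  points and at the two representatives of each \<open>\<alpha>\<^sub>k\<close> modulo \<open>1\<close>, and Rolle's theorem gives one zero of
  \<open>H'\<close> strictly inside each of the \<open>2 card I + 1\<close> gaps, where the cosine does not vanish.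
\<close>

lemma secular_zeros:
  fixes \<alpha> :: "nat \<Rightarrow> real"
  assumes I: "finite I" and \<alpha>0: "\<And>j. j \<in> I \<Longrightarrow> \<alpha> j \<notin> \<int>" and \<alpha>d: "\<And>j k. j \<in> I \<Longrightarrow> k \<in> I \<Longrightarrow> j \<noteq> k \<Longrightarrow> \<alpha> j - \<alpha> k \<notin> \<int>"
  shows "\<exists>B. finite B \<and> card B = 2 * card I + 1 \<and> (\<forall>x\<in>B. -1 < x \<and> x < 1 \<and> (\<forall>j\<in>I. x - \<alpha> j \<notin> \<int>) \<and>
     2 * cos (pi * x / 2) * (\<Sum>j\<in>I. cos (pi * (x - \<alpha> j)) * (\<Prod>k\<in>I-{j}. sin (pi * (x - \<alpha> k))))
       - 4 * sin (pi * x / 2) * (\<Prod>k\<in>I. sin (pi * (x - \<alpha> k))) = 0)"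
proof -
  define W where "W = (\<lambda>x. \<Prod>k\<in>I. sin (pi * (x - \<alpha> k)))"
  define T where "T = (\<lambda>x. \<Sum>j\<in>I. cos (pi * (x - \<alpha> j)) * (\<Prod>k\<in>I-{j}. sin (pi * (x - \<alpha> k))))"
  define E where "E = (\<lambda>x. 2 * cos (pi * x / 2) * T x - 4 * sin (pi * x / 2) * W x)"
  define H where "H = (\<lambda>x. cos (pi * x / 2) ^ 4 * W x)"
  have W': "(W has_real_derivative pi * T x) (at x)" for x
  proof -
    have "(W has_real_derivative (\<Sum>j\<in>I. (pi * cos (pi * (x - \<alpha> j))) * (\<Prod>k\<in>I-{j}. sin (pi * (x - \<alpha> k))))) (at x)"
      unfolding W_def by (rule has_field_derivative_prod) (auto intro!: derivative_eq_intros)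
    then show ?thesis by (simp add: T_def sum_distrib_left mult.assoc)
  qed
  have H': "(H has_real_derivative (pi / 2 * cos (pi * x / 2) ^ 3 * E x)) (at x)" for x
  proof -
    have c: "((\<lambda>x. cos (pi * x / 2)) has_real_derivative - sin (pi * x / 2) * (pi / 2)) (at x)"
      by (auto intro!: derivative_eq_intros)
    show ?thesis
      unfolding H_def using DERIV_mult[OF DERIV_power[OF c, of 4] W']
      by (rule DERIV_cong) (simp add: E_def algebra_simps power3_eq_cube power4_eq_xxxx)
  qed
  \<comment> \<open>The two representatives of \<open>\<alpha>\<^sub>j\<close> in \<open>(-1, 1)\<close> are \<open>frac (\<alpha> j)\<close> and \<open>frac (\<alpha> j) - 1\<close>.\<close>
  define Z where "Z = {-1, 1} \<union> (\<lambda>j. frac (\<alpha> j)) ` I \<union> (\<lambda>j. frac (\<alpha> j) - 1) ` I"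
  have fr: "0 < frac (\<alpha> j)" "frac (\<alpha> j) < 1" if "j \<in> I" for j
    using \<alpha>0[OF that] by (simp_all add: frac_gt_0_iff frac_lt_1)
  have inj: "inj_on (\<lambda>j. frac (\<alpha> j)) I"
    using \<alpha>d frac_diff_Ints by (meson inj_onI)
  have inj': "inj_on (\<lambda>j. frac (\<alpha> j) - 1) I"
    using inj by (auto simp: inj_on_def)
  have "card Z = card {-1, 1::real} + card ((\<lambda>j. frac (\<alpha> j)) ` I) + card ((\<lambda>j. frac (\<alpha> j) - 1) ` I)"
  proof -
    have "frac (\<alpha> j) \<noteq> frac (\<alpha> k) - 1" if "j \<in> I" "k \<in> I" for j k
      using fr[OF that(1)] fr[OF that(2)] by linarith
    then have d1: "({-1, 1} \<union> (\<lambda>j. frac (\<alpha> j)) ` I) \<inter> (\<lambda>j. frac (\<alpha> j) - 1) ` I = {}"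
    proof -
      assume d0: "\<And>j k. j \<in> I \<Longrightarrow> k \<in> I \<Longrightarrow> frac (\<alpha> j) \<noteq> frac (\<alpha> k) - 1"
      have "frac (\<alpha> j) - 1 \<noteq> 1 \<and> frac (\<alpha> j) - 1 \<noteq> -1" if "j \<in> I" for j using fr[OF that] by linarith
      then show ?thesis using d0 by force
    qed
    have d2: "{-1, 1} \<inter> (\<lambda>j. frac (\<alpha> j)) ` I = {}"
    proof -
      have "frac (\<alpha> j) \<noteq> 1 \<and> frac (\<alpha> j) \<noteq> -1" if "j \<in> I" for j using fr[OF that] by linarith
      then show ?thesis by force
    qed
    show ?thesis unfolding Z_def using I d1 d2 by (simp only: card_Un_disjoint finite_UnI finite_imageI finite.intros)
  qed
  also have "\<dots> = Suc (2 * card I + 1)" using card_image[OF inj] card_image[OF inj'] by simp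
  finally have cZ: "card Z = Suc (2 * card I + 1)" .
  have fZ: "finite Z" using I by (simp add: Z_def)
  have sin0: "sin (pi * y) = 0 \<longleftrightarrow> y \<in> \<int>" for y :: real using sin_times_pi_eq_0[of y] by (simp add: mult.commute)
  have Z0: "H x = 0" if xZ: "x \<in> Z" for x
  proof -
    consider "x = 1 \<or> x = -1" | j where "j \<in> I" "x = frac (\<alpha> j) \<or> x = frac (\<alpha> j) - 1" using xZ by (auto simp: Z_def)
    then show ?thesis
    proof cases
      case 1
      then show ?thesis by (auto simp: H_def)
    next
      case 2
      then have "x - \<alpha> j \<in> \<int>" by (auto simp: frac_def)
      then have "W x = 0" unfolding W_def using 2 I sin0 by (intro prod_zero) auto
      then show ?thesis by (simp add: H_def)
    qed
  qed
  have Zb: "-1 \<le> x \<and> x \<le> 1" if xZ: "x \<in> Z" for x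
  proof -
    consider "x = 1 \<or> x = -1" | j where "j \<in> I" "x = frac (\<alpha> j) \<or> x = frac (\<alpha> j) - 1" using xZ by (auto simp: Z_def)
    then show ?thesis
    proof cases
      case (2 j)
      then show ?thesis using fr[OF 2(1)] by linarith
    qed auto
  qed
  have "Min Z = -1" "Max Z = 1"
  proof -
    have "-1 \<in> Z" "1 \<in> Z" by (auto simp: Z_def)
    then show "Min Z = -1" "Max Z = 1" using fZ Zb by (auto intro: Min_eqI Max_eqI)
  qed
  then obtain B where B: "finite B" "card B = 2 * card I + 1" "B \<inter> Z = {}" "\<And>x. x \<in> B \<Longrightarrow> pi / 2 * cos (pi * x / 2) ^ 3 * E x = 0 \<and> -1 < x \<and> x < 1"
    using Rolle_finite_set[OF H' fZ cZ Z0] by auto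
  have "E x = 0 \<and> (\<forall>j\<in>I. x - \<alpha> j \<notin> \<int>)" if x: "x \<in> B" for x
  proof
    have "cos (pi * x / 2) > 0" using B(4)[OF x] mult_strict_left_mono[of "-1" x pi] mult_strict_left_mono[of x 1 pi] by (intro cos_gt_zero_pi) auto
    then show "E x = 0" using B(4)[OF x] by simp
    show "\<forall>j\<in>I. x - \<alpha> j \<notin> \<int>"
    proof (intro ballI notI)
      fix j assume j: "j \<in> I" "x - \<alpha> j \<in> \<int>"
      then have "\<lfloor>x\<rfloor> \<in> {-1, 0}" using B(4)[OF x] by (auto simp: floor_eq_iff) 
      have "frac (\<alpha> j) = frac x"
      proof -
        obtain n where "x - \<alpha> j = of_int n" using j(2) Ints_cases by blast
        then have "x = \<alpha> j + of_int n" by simp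
        then show ?thesis by (simp add: frac_def)
      qed
      moreover have "x = frac x \<or> x = frac x - 1" using \<open>\<lfloor>x\<rfloor> \<in> {-1, 0}\<close> by (auto simp: frac_def)
      ultimately have "x = frac (\<alpha> j) \<or> x = frac (\<alpha> j) - 1" by simp
      then have "x \<in> Z" unfolding Z_def using j(1) by blast
      then show False using B(3) x by blast
    qed
  qed
  then show ?thesis using B unfolding E_def T_def W_def by (intro exI[of _ B]) auto
qed

text \<open>
  Put \<open>z = exp (\<i> \<pi> l)\<close>.  Multiplied by \<open>exp (\<i> \<pi> l / 2) z ^ card I\<close>, both sides become polynomials in \<open>z\<close> of
  degree at most \<open>2 card I + 1\<close>.  They agree at the \<open>2 card I + 1\<close> distinct points \<open>z\<close> that belong to the
  zeros in \<open>B\<close> and, by the choice of \<open>c\<close>, at \<open>z = -1\<close>, that is at \<open>l = 1\<close>, where neither side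
  vanishes; hence they coincide.
\<close>

theorem secular_factorization:
  fixes \<alpha> :: "nat \<Rightarrow> real"
  assumes I: "finite I" and \<alpha>0: "\<And>j. j \<in> I \<Longrightarrow> \<alpha> j \<notin> \<int>" and \<alpha>d: "\<And>j k. j \<in> I \<Longrightarrow> k \<in> I \<Longrightarrow> j \<noteq> k \<Longrightarrow> \<alpha> j - \<alpha> k \<notin> \<int>"
  shows "\<exists>B c. finite B \<and> card B = 2 * card I + 1 \<and> (\<forall>x\<in>B. -1 < x \<and> x < 1 \<and> (\<forall>j\<in>I. x - \<alpha> j \<notin> \<int>)) \<and> c \<noteq> 0 \<and>
     (\<forall>l::complex. 2 * cos (pi * l / 2) * (\<Sum>j\<in>I. cos (pi * (l - \<alpha> j)) * (\<Prod>k\<in>I-{j}. sin (pi * (l - \<alpha> k))))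
       - 4 * sin (pi * l / 2) * (\<Prod>k\<in>I. sin (pi * (l - \<alpha> k))) = c * (\<Prod>x\<in>B. sin (pi * (l - of_real x) / 2)))"
proof -
  from secular_zeros[OF I \<alpha>0 \<alpha>d] obtain B where B0: "finite B \<and> card B = 2 * card I + 1 \<and> (\<forall>x\<in>B. -1 < x \<and> x < 1 \<and> (\<forall>j\<in>I. x - \<alpha> j \<notin> \<int>) \<and>
     2 * cos (pi * x / 2) * (\<Sum>j\<in>I. cos (pi * (x - \<alpha> j)) * (\<Prod>k\<in>I-{j}. sin (pi * (x - \<alpha> k))))
       - 4 * sin (pi * x / 2) * (\<Prod>k\<in>I. sin (pi * (x - \<alpha> k))) = 0)" by (rule exE) 
  have B: "finite B" "card B = 2 * card I + 1" "\<And>x. x \<in> B \<Longrightarrow> -1 < x \<and> x < 1 \<and> (\<forall>j\<in>I. x - \<alpha> j \<notin> \<int>)"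
    "\<And>x. x \<in> B \<Longrightarrow> 2 * cos (pi * x / 2) * (\<Sum>j\<in>I. cos (pi * (x - \<alpha> j)) * (\<Prod>k\<in>I-{j}. sin (pi * (x - \<alpha> k))))
       - 4 * sin (pi * x / 2) * (\<Prod>k\<in>I. sin (pi * (x - \<alpha> k))) = 0"
    using B0 by blast+
  define E :: "complex \<Rightarrow> complex" where "E = (\<lambda>l::complex. 2 * cos (pi * l / 2) * (\<Sum>j\<in>I. cos (pi * (l - \<alpha> j)) * (\<Prod>k\<in>I-{j}. sin (pi * (l - \<alpha> k))))
       - 4 * sin (pi * l / 2) * (\<Prod>k\<in>I. sin (pi * (l - \<alpha> k))))"
  have EB: "E (of_real x) = 0" if "x \<in> B" for x
  proof -
    have "E (of_real x) = of_real (2 * cos (pi * x / 2) * (\<Sum>j\<in>I. cos (pi * (x - \<alpha> j)) * (\<Prod>k\<in>I-{j}. sin (pi * (x - \<alpha> k))))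
       - 4 * sin (pi * x / 2) * (\<Prod>k\<in>I. sin (pi * (x - \<alpha> k))))"
      by (simp add: E_def sin_of_real[symmetric] cos_of_real[symmetric])
    then show ?thesis using B(4)[OF that] by simp
  qed
  \<comment> \<open>\<open>pS\<close>, \<open>pC\<close>, \<open>pQ\<close> represent \<open>z sin (\<pi> (l - \<alpha>))\<close>, \<open>z cos (\<pi> (l - \<alpha>))\<close> and \<open>h sin (\<pi> (l - x) / 2)\<close> with
    \<open>h\<^sup>2 = z\<close>; \<open>P\<close> and \<open>Q\<close> represent the two sides.\<close>
  define pS :: "nat \<Rightarrow> complex poly" where "pS = (\<lambda>j. [: - exp (\<i> * pi * \<alpha> j) / (2 * \<i>), 0, exp (- (\<i> * pi * \<alpha> j)) / (2 * \<i>) :])"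
  define pC :: "nat \<Rightarrow> complex poly" where "pC = (\<lambda>j. [: exp (\<i> * pi * \<alpha> j) / 2, 0, exp (- (\<i> * pi * \<alpha> j)) / 2 :])"
  define pQ :: "real \<Rightarrow> complex poly" where "pQ = (\<lambda>x. [: - exp (\<i> * pi * x / 2) / (2 * \<i>), exp (- (\<i> * pi * x / 2)) / (2 * \<i>) :])"
  define Q where "Q = (\<Prod>x\<in>B. pQ x)"
  define P where "P = 2 * [: 1/2, 1/2 :] * (\<Sum>j\<in>I. pC j * (\<Prod>k\<in>I-{j}. pS k)) - 4 * [: - 1 / (2 * \<i>), 1 / (2 * \<i>) :] * (\<Prod>k\<in>I. pS k)"
  define z where "z = (\<lambda>l::complex. exp (\<i> * pi * l))"
  define h where "h = (\<lambda>l::complex. exp (\<i> * pi * l / 2))"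
  have hz: "h l * h l = z l" for l
    unfolding h_def z_def exp_add[symmetric] by (rule arg_cong[where f = exp]) (simp add: field_simps)
  have hinv: "exp (- (\<i> * pi * l / 2)) * h l = 1" for l by (simp add: h_def flip: exp_add)
  have zinv: "exp (- (\<i> * pi * l)) * z l = 1" for l by (simp add: z_def flip: exp_add)
  have ez: "exp (\<i> * (complex_of_real pi * (l - complex_of_real a))) = exp (- (\<i> * complex_of_real pi * complex_of_real a)) * z l"
    "exp (- (\<i> * (complex_of_real pi * (l - complex_of_real a)))) = exp (\<i> * complex_of_real pi * complex_of_real a) * exp (- (\<i> * complex_of_real pi * l))" for l a
    unfolding z_def exp_add[symmetric] by (rule arg_cong[where f = exp], simp add: algebra_simps)+
  have eh: "exp (\<i> * (complex_of_real pi * (l - complex_of_real a) / 2)) = exp (- (\<i> * complex_of_real pi * complex_of_real a / 2)) * h l"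
    "exp (- (\<i> * (complex_of_real pi * (l - complex_of_real a) / 2))) = exp (\<i> * complex_of_real pi * complex_of_real a / 2) * exp (- (\<i> * complex_of_real pi * l / 2))" for l a
    unfolding h_def exp_add[symmetric] by (rule arg_cong[where f = exp], simp add: field_simps)+
  have S: "sin (pi * (l - \<alpha> k)) * z l = poly (pS k) (z l)" for l :: complex and k
  proof -
    have "sin (pi * (l - \<alpha> k)) = (exp (- (\<i> * pi * \<alpha> k)) * z l - exp (\<i> * pi * \<alpha> k) * exp (- (\<i> * pi * l))) / (2 * \<i>)"
      by (simp only: sin_exp_eq ez)
    then have "sin (pi * (l - \<alpha> k)) * z l = (exp (- (\<i> * pi * \<alpha> k)) * z l * z l - exp (\<i> * pi * \<alpha> k) * (exp (- (\<i> * pi * l)) * z l)) / (2 * \<i>)"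
      by (simp add: algebra_simps)
    then show ?thesis unfolding zinv by (simp add: pS_def field_simps)
  qed
  have C: "cos (pi * (l - \<alpha> k)) * z l = poly (pC k) (z l)" for l :: complex and k
  proof -
    have "cos (pi * (l - \<alpha> k)) = (exp (- (\<i> * pi * \<alpha> k)) * z l + exp (\<i> * pi * \<alpha> k) * exp (- (\<i> * pi * l))) / 2"
      by (simp only: cos_exp_eq ez)
    then have "cos (pi * (l - \<alpha> k)) * z l = (exp (- (\<i> * pi * \<alpha> k)) * z l * z l + exp (\<i> * pi * \<alpha> k) * (exp (- (\<i> * pi * l)) * z l)) / 2"
      by (simp add: algebra_simps)
    then show ?thesis unfolding zinv by (simp add: pC_def field_simps)
  qed
  have Sh: "sin (pi * (l - of_real x) / 2) * h l = poly (pQ x) (z l)" for l :: complex and x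
  proof -
    have "sin (pi * (l - of_real x) / 2) = (exp (- (\<i> * pi * x / 2)) * h l - exp (\<i> * pi * x / 2) * exp (- (\<i> * pi * l / 2))) / (2 * \<i>)"
      by (simp only: sin_exp_eq eh)
    then have "sin (pi * (l - of_real x) / 2) * h l = (exp (- (\<i> * pi * x / 2)) * (h l * h l) - exp (\<i> * pi * x / 2) * (exp (- (\<i> * pi * l / 2)) * h l)) / (2 * \<i>)"
      by (simp add: algebra_simps)
    then show ?thesis unfolding hinv hz by (simp add: pQ_def field_simps)
  qed
  have Ch0: "cos (pi * l / 2) * h l = poly [: 1/2, 1/2 :] (z l)" for l :: complex
  proof -
    have "cos (pi * l / 2) = (h l + exp (- (\<i> * pi * l / 2))) / 2"
      using eh[of l 0] by (simp add: cos_exp_eq)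
    then have "cos (pi * l / 2) * h l = (h l * h l + exp (- (\<i> * pi * l / 2)) * h l) / 2"
      by (simp add: algebra_simps)
    then show ?thesis unfolding hinv hz by (simp add: field_simps)
  qed
  have Sh0: "sin (pi * l / 2) * h l = poly [: - 1 / (2 * \<i>), 1 / (2 * \<i>) :] (z l)" for l :: complex
    using Sh[of l 0] by (simp add: pQ_def)
  have PE: "poly P (z l) = E l * (h l * z l ^ card I)" for l :: complex
  proof -
    have W: "(\<Prod>k\<in>J. poly (pS k) (z l)) = (\<Prod>k\<in>J. sin (pi * (l - \<alpha> k))) * z l ^ card J" if "finite J" for J
      unfolding S[symmetric] by (simp add: prod.distrib)
    have "(\<Sum>j\<in>I. poly (pC j) (z l) * (\<Prod>k\<in>I-{j}. poly (pS k) (z l))) = (\<Sum>j\<in>I. cos (pi * (l - \<alpha> j)) * (\<Prod>k\<in>I-{j}. sin (pi * (l - \<alpha> k)))) * z l ^ card I"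
      unfolding sum_distrib_right
    proof (rule sum.cong[OF refl])
      fix j assume j: "j \<in> I"
      then have "card I = Suc (card (I - {j}))" using I by (metis card.remove)
      then show "poly (pC j) (z l) * (\<Prod>k\<in>I-{j}. poly (pS k) (z l)) = cos (pi * (l - \<alpha> j)) * (\<Prod>k\<in>I-{j}. sin (pi * (l - \<alpha> k))) * z l ^ card I"
        using I by (simp add: W C[symmetric] mult_ac)
    qed
    then show ?thesis
      unfolding P_def E_def poly_diff poly_mult poly_sum poly_prod W[OF I] Ch0[symmetric] Sh0[symmetric] 
      by (simp add: algebra_simps)
  qed
  have QE: "poly Q (z l) = (\<Prod>x\<in>B. sin (pi * (l - of_real x) / 2)) * (h l * z l ^ card I)" for l :: complex
  proof -
    have "h l ^ card B = h l * z l ^ card I"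
      unfolding B(2) hz[symmetric] by (simp add: power_mult_distrib mult_2 power_add)
    then show ?thesis unfolding Q_def poly_prod Sh[symmetric] by (simp add: prod.distrib)
  qed
  have dS: "degree (\<Prod>k\<in>J. pS k) \<le> 2 * card J" if "finite J" for J
  proof -
    have "degree (\<Prod>k\<in>J. pS k) \<le> (\<Sum>k\<in>J. degree (pS k))" using degree_prod_sum_le[OF that, of pS] by (simp add: o_def)
    also have "\<dots> \<le> (\<Sum>k\<in>J. 2)" by (intro sum_mono) (simp add: pS_def)
    finally show ?thesis by simp
  qed
  have dP: "degree P \<le> 2 * card I + 1"
  proof -
    have d1: "degree (pC j * (\<Prod>k\<in>I-{j}. pS k)) \<le> 2 * card I" if "j \<in> I" for j
    proof -
      have "degree (pC j * (\<Prod>k\<in>I-{j}. pS k)) \<le> 2 + 2 * card (I - {j})"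
        using I dS by (intro degree_mult_le[THEN order_trans] add_mono) (auto simp: pC_def)
      also have "\<dots> = 2 * card I" using card.remove[OF I that] by simp
      finally show ?thesis .
    qed
    have d2: "degree (2 * [: 1/2, 1/2 :] * (\<Sum>j\<in>I. pC j * (\<Prod>k\<in>I-{j}. pS k))) \<le> 1 + 2 * card I"
    proof (intro degree_mult_le[THEN order_trans] add_mono)
      show "degree (\<Sum>j\<in>I. pC j * (\<Prod>k\<in>I-{j}. pS k)) \<le> 2 * card I" using d1 I by (intro degree_sum_le) auto
    qed (simp add: numeral_poly)
    have d3: "degree (4 * [: - 1 / (2 * \<i>), 1 / (2 * \<i>) :] * (\<Prod>k\<in>I. pS k)) \<le> 1 + 2 * card I"
      by (intro degree_mult_le[THEN order_trans] add_mono dS I) (simp add: numeral_poly)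
    show ?thesis unfolding P_def using d2 d3 by (intro degree_diff_le) auto
  qed
  have dQ: "degree Q \<le> 2 * card I + 1"
  proof -
    have "degree Q \<le> (\<Sum>x\<in>B. degree (pQ x))" using degree_prod_sum_le[OF B(1), of pQ] by (simp add: Q_def o_def)
    also have "\<dots> \<le> (\<Sum>x\<in>B. 1)" by (intro sum_mono) (simp add: pQ_def)
    finally show ?thesis using B(2) by simp
  qed
  have hz0: "h l * z l ^ card I \<noteq> 0" for l by (simp add: h_def z_def)
  have Q1: "(\<Prod>x\<in>B. sin (pi * (1 - complex_of_real x) / 2)) \<noteq> 0"
  proof -
    have "sin (pi * (1 - complex_of_real x) / 2) \<noteq> 0" if x: "x \<in> B" for x
    proof -
      have "sin (pi * (1 - complex_of_real x) / 2) = of_real (sin (pi * (1 - x) / 2))"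
        by (simp flip: sin_of_real)
      moreover have "sin (pi * (1 - x) / 2) > 0" using B(3)[OF x] mult_strict_left_mono[of "-1" x pi] mult_strict_left_mono[of x 1 pi] by (intro sin_gt_zero) (auto simp: algebra_simps)
      ultimately show ?thesis by (metis less_irrefl of_real_eq_0_iff)
    qed
    then show ?thesis using B(1) by simp
  qed
  have E1: "E 1 \<noteq> 0"
  proof -
    have "sin (pi * (1 - complex_of_real (\<alpha> k))) \<noteq> 0" if k: "k \<in> I" for k
    proof -
      have "1 - \<alpha> k \<notin> \<int>" using \<alpha>0[OF k] by (metis Ints_1 Ints_diff diff_diff_eq2 add_diff_cancel_left')
      then have "sin (pi * (1 - \<alpha> k)) \<noteq> 0" using sin_times_pi_eq_0[of "1 - \<alpha> k"] by (simp add: mult.commute)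
      moreover have "sin (pi * (1 - complex_of_real (\<alpha> k))) = of_real (sin (pi * (1 - \<alpha> k)))"
        by (simp flip: sin_of_real)
      ultimately show ?thesis by (metis of_real_eq_0_iff)
    qed
    moreover have "cos (complex_of_real pi / 2) = 0" "sin (complex_of_real pi / 2) = 1"
      by (metis cos_of_real cos_pi_half of_real_0 of_real_divide of_real_numeral, metis sin_of_real sin_pi_half of_real_1 of_real_divide of_real_numeral)
    ultimately show ?thesis using I by (simp add: E_def)
  qed
  define c where "c = E 1 / (\<Prod>x\<in>B. sin (pi * (1 - complex_of_real x) / 2))"
  have "P - smult c Q = 0"
  proof (rule ccontr)
    assume ne: "P - smult c Q \<noteq> 0"
    have "degree (P - smult c Q) \<le> 2 * card I + 1"
      using dP dQ degree_smult_le[of c Q] by (intro degree_diff_le) auto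
    moreover have "card {x. poly (P - smult c Q) x = 0} \<le> degree (P - smult c Q)"
      by (rule card_poly_roots_bound[OF ne])
    moreover have "2 * card I + 2 \<le> card {x. poly (P - smult c Q) x = 0}"
    proof -
      define R where "R = (\<lambda>x::real. z (of_real x)) ` insert 1 B"
      have "inj_on (\<lambda>x::real. z (of_real x)) (insert 1 B)"
      proof (rule inj_onI)
        fix x y :: real assume xy: "x \<in> insert 1 B" "y \<in> insert 1 B" "z (of_real x) = z (of_real y)"
        then have b: "-1 < x" "x \<le> 1" "-1 < y" "y \<le> 1" using B(3) by force+
        have "exp (\<i> * pi * of_real x) = exp (\<i> * pi * of_real y)" using xy(3) by (simp add: z_def)
        then obtain n :: int where "\<i> * pi * of_real x = \<i> * pi * of_real y + (of_int (2 * n) * pi) * \<i>"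
          unfolding exp_eq by auto
        then have "\<i> * pi * (complex_of_real (x - y - 2 * of_int n)) = 0" by (simp add: algebra_simps)
        then have "x - y - 2 * of_int n = 0" by (simp del: of_real_diff)
        moreover from this have "\<bar>2 * of_int n :: real\<bar> < 2" using b by (simp add: abs_if)
        then have "n = 0" by linarith
        ultimately show "x = y" by simp
      qed
      moreover have "1 \<notin> B" using B(3)[of 1] by auto
      ultimately have "card R = 2 * card I + 2"
        unfolding R_def using B(1,2) by (simp add: card_image)
      moreover have "R \<subseteq> {x. poly (P - smult c Q) x = 0}"
      proof
        fix w assume "w \<in> R"
        then obtain x where x: "x \<in> insert 1 B" "w = z (of_real x)" unfolding R_def by blast
        show "w \<in> {x. poly (P - smult c Q) x = 0}"
        proof (cases "x = 1")
          case True
          then show ?thesis using x(2) Q1 PE[of 1] QE[of 1] by (simp add: c_def)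
        next
          case False
          then have xB: "x \<in> B" using x by simp
          then have "(\<Prod>u\<in>B. sin (pi * (complex_of_real x - of_real u) / 2)) = 0" using B(1) by (intro prod_zero bexI[OF _ xB]) auto
          then show ?thesis using x(2) PE[of "of_real x"] QE[of "of_real x"] EB[OF xB] by simp
        qed
      qed
      moreover have "finite {x. poly (P - smult c Q) x = 0}" by (rule poly_roots_finite[OF ne])
      ultimately show ?thesis using card_mono by metis
    qed
    ultimately show False by linarith
  qed
  then have Peq: "P = smult c Q" by simp
  have "E l = c * (\<Prod>x\<in>B. sin (pi * (l - of_real x) / 2))" for l :: complex
  proof -
    have "E l * (h l * z l ^ card I) = c * (\<Prod>x\<in>B. sin (pi * (l - of_real x) / 2)) * (h l * z l ^ card I)"
    proof -
      have "E l * (h l * z l ^ card I) = poly P (z l)" by (rule PE[symmetric])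
      also have "\<dots> = c * poly Q (z l)" by (subst Peq) (rule poly_smult)
      also have "\<dots> = c * (\<Prod>x\<in>B. sin (pi * (l - of_real x) / 2)) * (h l * z l ^ card I)"
        by (simp only: QE mult.assoc)
      finally show ?thesis .
    qed
    then show ?thesis using hz0 mult_right_cancel by blast
  qed
  moreover have "c \<noteq> 0" using E1 Q1 by (simp add: c_def)
  ultimately show ?thesis using B(1-3) unfolding E_def by (intro exI[of _ B] exI[of _ c]) auto
qed

section \<open>Counting zeros\<close>

lemma abs_sin_ge_third: 
  fixes x :: real
  assumes "\<bar>x\<bar> \<le> pi / 2"
  shows "\<bar>x\<bar> / 3 \<le> \<bar>sin x\<bar>"
proof -
  have "\<bar>sin x - (\<Sum>k<3. sin_coeff k * x ^ k)\<bar> \<le> inverse (fact 3) * \<bar>x\<bar> ^ 3" by (rule Maclaurin_sin_bound)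
  then have b: "\<bar>sin x - x\<bar> \<le> \<bar>x\<bar> ^ 3 / 6" by (simp add: sin_coeff_def numeral_3_eq_3 field_simps)
  have "\<bar>x\<bar> \<le> 2" using assms pi_less_4 by linarith
  then have "\<bar>x\<bar> ^ 2 \<le> 2 ^ 2" by (intro power_mono) auto
  then have "\<bar>x\<bar> * \<bar>x\<bar> ^ 2 \<le> \<bar>x\<bar> * 4" by (intro mult_left_mono) auto
  then have "\<bar>x\<bar> ^ 3 \<le> \<bar>x\<bar> * 4" by (simp add: power3_eq_cube power2_eq_square)
  then show ?thesis using b by linarith
qed

text \<open>
  Both follow from \<open>|sin w|\<^sup>2 = (sinh (Im w))\<^sup>2 + (sin (Re w))\<^sup>2\<close>.
\<close>

lemma norm_sin_ge:
  fixes w :: complex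
  shows "\<bar>exp \<bar>Im w\<bar> - exp (- \<bar>Im w\<bar>)\<bar> / 2 \<le> norm (sin w)" "\<bar>Re w\<bar> \<le> pi / 2 \<Longrightarrow> norm w / 3 \<le> norm (sin w)"
proof -
  define x y where "x = Re w" and "y = Im w"
  define s where "s = (exp y - inverse (exp y)) / 2"
  have sq: "(norm (sin w))\<^sup>2 = s\<^sup>2 + (sin x)\<^sup>2"
  proof -
    have "exp (2 * y) = exp y ^ 2" by (simp add: exp_double)
    then show ?thesis
      unfolding norm_sin_squared x_def[symmetric] y_def[symmetric] s_def cos_double_sin
      by (simp add: field_simps power2_eq_square)
  qed
  have "s\<^sup>2 \<le> (norm (sin w))\<^sup>2" unfolding sq by simp
  then have "\<bar>s\<bar> \<le> norm (sin w)" using abs_le_square_iff[of s "norm (sin w)"] by simp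
  moreover have "\<bar>s\<bar> = \<bar>exp \<bar>y\<bar> - exp (- \<bar>y\<bar>)\<bar> / 2"
    by (cases "y \<ge> 0") (auto simp: s_def exp_minus abs_minus_commute)
  ultimately show "\<bar>exp \<bar>Im w\<bar> - exp (- \<bar>Im w\<bar>)\<bar> / 2 \<le> norm (sin w)" by (simp add: y_def)
  assume "\<bar>Re w\<bar> \<le> pi / 2"
  then have "\<bar>x\<bar> / 3 \<le> \<bar>sin x\<bar>" using abs_sin_ge_third by (simp add: x_def)
  then have 1: "(x / 3)\<^sup>2 \<le> (sin x)\<^sup>2" using abs_le_square_iff[of "x / 3" "sin x"] by simp
  have "\<bar>y\<bar> \<le> \<bar>s\<bar>" unfolding s_def by (rule real_le_abs_sinh)
  then have "\<bar>y / 3\<bar> \<le> \<bar>s\<bar>" by simp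
  then have 2: "(y / 3)\<^sup>2 \<le> s\<^sup>2" using abs_le_square_iff[of "y / 3" s] by simp
  have "(norm w / 3)\<^sup>2 = (x / 3)\<^sup>2 + (y / 3)\<^sup>2"
    by (simp add: x_def y_def cmod_power2 power_divide add_divide_distrib)
  also have "\<dots> \<le> (norm (sin w))\<^sup>2" unfolding sq using 1 2 by simp
  finally show "norm w / 3 \<le> norm (sin w)" by (rule power2_le_imp_le) simp
qed

lemma norm_sin_half_pi_shift:
  fixes z :: complex
  shows "norm (sin (of_real pi * (z - 2 * of_int n) / 2)) = norm (sin (of_real pi * z / 2))"
proof -
  have "cos (2 * (pi * (Re z - 2 * of_int n) / 2)) = cos (2 * (pi * Re z / 2))"
  proof -
    have "2 * (pi * (Re z - 2 * of_int n) / 2) = pi * Re z - 2 * pi * of_int n" by (simp add: right_diff_distrib)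
    then show ?thesis using cos_int_2pin[of n] sin_int_2pin[of n] by (simp only: cos_diff) simp
  qed
  then have "(norm (sin (of_real pi * (z - 2 * of_int n) / 2)))\<^sup>2 = (norm (sin (of_real pi * z / 2)))\<^sup>2"
    unfolding norm_sin_squared by simp
  then show ?thesis by (rule power2_eq_imp_eq) auto
qed

lemma norm_sin_ge_near:
  fixes z :: complex
  assumes "\<bar>Re z\<bar> \<le> 1"
  shows "norm z / 2 \<le> norm (sin (of_real pi * z / 2))"
proof -
  have "\<bar>Re (of_real pi * z / 2)\<bar> \<le> pi / 2" using assms mult_left_mono[OF assms, of pi] by (simp add: abs_mult)
  then have "norm (of_real pi * z / 2) / 3 \<le> norm (sin (of_real pi * z / 2))" by (rule norm_sin_ge)
  moreover have "norm (of_real pi * z / 2) / 3 = pi * norm z / 6" by (simp add: norm_mult norm_divide)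
  moreover have "3 * norm z \<le> pi * norm z" using pi_gt3 by (intro mult_right_mono) auto
  ultimately show ?thesis by linarith
qed

text \<open>
  Far from the real axis the exponential growth of the sine dominates.  Near the axis a shift by
  the period moves \<open>z\<close> to the strip \<open>|Re z| \<le> 1\<close>, where \<open>|sin (\<pi> z / 2)|\<close> is at least half of the
  distance to \<open>0\<close>.
\<close>

lemma norm_sin_ge_away:
  fixes z :: complex
  assumes "0 < \<delta>" "\<delta> \<le> 1" and away: "\<And>n::int. \<delta> \<le> norm (z - 2 * of_int n)"
  shows "\<delta> / 8 * exp (pi / 2 * \<bar>Im z\<bar>) \<le> norm (sin (of_real pi * z / 2))"
proof (cases "pi / 2 * \<bar>Im z\<bar> \<ge> 1")
  case True
  define y where "y = pi / 2 * \<bar>Im z\<bar>"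
  have "exp (2::real) \<ge> 1 + 2" by (rule exp_ge_add_one_self)
  then have "exp (-2::real) \<le> 1 / 2" by (simp add: exp_minus divide_simps)
  have "exp (- y) = exp y * exp (- 2 * y)" by (simp flip: exp_add)
  also have "\<dots> \<le> exp y * exp (-2)" using True by (intro mult_left_mono) (auto simp: y_def)
  also have "\<dots> \<le> exp y * (1 / 2)" using \<open>exp (-2) \<le> 1 / 2\<close> by (intro mult_left_mono) auto
  finally have "exp (- y) \<le> exp y / 2" by simp
  then have "exp y / 4 \<le> \<bar>exp y - exp (- y)\<bar> / 2" 
  proof -
    have "b / 4 \<le> \<bar>b - c\<bar> / 2" if "c \<le> b / 2" for b c :: real
    proof -
      have "b / 4 \<le> (b - c) / 2" using that by simp
      also have "\<dots> \<le> \<bar>b - c\<bar> / 2" by (intro divide_right_mono abs_ge_self) simp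
      finally show ?thesis .
    qed
    then show "exp (- y) \<le> exp y / 2 \<Longrightarrow> exp y / 4 \<le> \<bar>exp y - exp (- y)\<bar> / 2" by blast
  qed
  also have "\<dots> \<le> norm (sin (of_real pi * z / 2))"
  proof -
    have "\<bar>Im (of_real pi * z / 2)\<bar> = y" by (simp add: y_def abs_mult)
    then show ?thesis using norm_sin_ge(1)[of "of_real pi * z / 2"] by simp
  qed
  finally have "exp y / 4 \<le> norm (sin (of_real pi * z / 2))" .
  moreover have "\<delta> / 8 * exp y \<le> 1 / 4 * exp y" using assms by (intro mult_right_mono) auto
  ultimately show ?thesis unfolding y_def[symmetric] by linarith
next
  case False
  define n where "n = round (Re z / 2)"
  have "\<bar>of_int n - Re z / 2\<bar> \<le> 1 / 2" unfolding n_def by (rule of_int_round_abs_le)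
  then have "\<bar>Re (z - 2 * of_int n)\<bar> \<le> 1" unfolding abs_le_iff by simp
  from norm_sin_ge_near[OF this] have "\<delta> / 2 \<le> norm (sin (of_real pi * z / 2))"
    using away[of n] unfolding norm_sin_half_pi_shift by linarith
  moreover have "exp (pi / 2 * \<bar>Im z\<bar>) \<le> 4"
  proof -
    have "exp (pi / 2 * \<bar>Im z\<bar>) \<le> exp 1" using False by simp
    then show ?thesis using exp_le by linarith
  qed
  then have "\<delta> / 8 * exp (pi / 2 * \<bar>Im z\<bar>) \<le> \<delta> / 8 * 4" using assms by (intro mult_left_mono) auto
  ultimately show ?thesis by linarith
qed

lemma finite_zeros_ball:
  assumes "f holomorphic_on UNIV" "f a \<noteq> 0"
  shows "finite {z \<in> cball c r. f z = 0}"
proof -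
  define U where "U = ball c (\<bar>r\<bar> + dist c a + 2)"
  have aU: "a \<in> U" by (simp add: U_def)
  have sub: "cball c r \<subseteq> U"
  proof
    fix x assume "x \<in> cball c r"
    then have "dist c x \<le> r" by simp
    also have "r < \<bar>r\<bar> + dist c a + 2" using zero_le_dist[of c a] abs_ge_self[of r] by linarith
    finally show "x \<in> U" by (simp add: U_def)
  qed
  show ?thesis
  proof (cases "f constant_on U")
    case True
    then have "{z \<in> cball c r. f z = 0} = {}" using assms(2) aU sub unfolding constant_on_def by auto
    then show ?thesis by (simp only: finite.emptyI)
  next
    case False
    show ?thesis
      by (rule holomorphic_compact_finite_zeros[OF _ _ _ _ sub False]) (use assms(1) in \<open>auto simp: U_def intro: holomorphic_on_subset\<close>)
  qed
qed

text \<open>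
  Rouche's theorem on a circle, with the winding numbers evaluated so that it speaks of zeros in a disc.
\<close>

lemma rouche_count:
  assumes f: "f holomorphic_on UNIV" and g: "g holomorphic_on UNIV" and "0 < r"
    and less: "\<And>w. w \<in> sphere z r \<Longrightarrow> norm (f w - g w) < norm (g w)"
  shows "(\<Sum>p | p \<in> ball z r \<and> f p = 0. zorder f p) = (\<Sum>p | p \<in> ball z r \<and> g p = 0. zorder g p)"
proof -
  define a where "a = z + of_real r"
  have a: "a \<in> sphere z r" using \<open>0 < r\<close> by (simp add: a_def dist_norm)
  have nz: "g w \<noteq> 0 \<and> f w \<noteq> 0" if "w \<in> sphere z r" for w using less[OF that] by auto
  define s where "s = ball z (r + 1)"
  have fin: "finite {p \<in> s. f p = 0}" "finite {p \<in> s. g p = 0}"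
  proof -
    have "finite {p \<in> cball z (r + 1). f p = 0}" "finite {p \<in> cball z (r + 1). g p = 0}"
      using finite_zeros_ball[OF f] finite_zeros_ball[OF g] nz[OF a] by blast+
    moreover have "{p \<in> s. h p = 0} \<subseteq> {p \<in> cball z (r + 1). h p = 0}" for h :: "complex \<Rightarrow> complex"
      by (auto simp: s_def)
    ultimately show "finite {p \<in> s. f p = 0}" "finite {p \<in> s. g p = 0}"
      using finite_subset by blast+
  qed
  have R: "(\<Sum>p\<in>{p \<in> s. g p + (f p - g p) = 0}. winding_number (circlepath z r) p * zorder (\<lambda>p. g p + (f p - g p)) p)
     = (\<Sum>p\<in>{p \<in> s. g p = 0}. winding_number (circlepath z r) p * zorder g p)"
  proof (rule Rouche_theorem)
    show "\<forall>w\<in>path_image (circlepath z r). norm (f w - g w) < norm (g w)" using less \<open>0 < r\<close> by simp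
    show "\<forall>w. w \<notin> s \<longrightarrow> winding_number (circlepath z r) w = 0"
      using \<open>0 < r\<close> by (auto simp: s_def dist_norm intro!: winding_number_zero_outside[of _ "cball z r"])
    show "path_image (circlepath z r) \<subseteq> s" using \<open>0 < r\<close> by (auto simp: s_def dist_norm)
  qed (use fin f g in \<open>auto simp: s_def intro!: holomorphic_intros elim: holomorphic_on_subset\<close>)
  have conv: "(\<Sum>p\<in>{p \<in> s. h p = 0}. winding_number (circlepath z r) p * zorder h p) = of_int (\<Sum>p | p \<in> ball z r \<and> h p = 0. zorder h p)"
    if fin: "finite {p \<in> s. h p = 0}" and h0: "\<And>w. w \<in> sphere z r \<Longrightarrow> h w \<noteq> 0" for h
  proof -
    have "(\<Sum>p\<in>{p \<in> s. h p = 0}. winding_number (circlepath z r) p * zorder h p) = (\<Sum>p\<in>{p. p \<in> ball z r \<and> h p = 0}. of_int (zorder h p))"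
    proof (rule sum.mono_neutral_cong_right[OF fin])
      show "{p. p \<in> ball z r \<and> h p = 0} \<subseteq> {p \<in> s. h p = 0}" by (auto simp: s_def)
      show "\<forall>p\<in>{p \<in> s. h p = 0} - {p. p \<in> ball z r \<and> h p = 0}. winding_number (circlepath z r) p * of_int (zorder h p) = 0"
      proof
        fix p assume p: "p \<in> {p \<in> s. h p = 0} - {p. p \<in> ball z r \<and> h p = 0}"
        then have "p \<notin> cball z r" using h0[of p] by (auto simp: less_eq_real_def)
        then have "winding_number (circlepath z r) p = 0"
          using \<open>0 < r\<close> by (intro winding_number_zero_outside[of _ "cball z r"]) auto
        then show "winding_number (circlepath z r) p * of_int (zorder h p) = 0" by simp
      qed
      show "winding_number (circlepath z r) p * of_int (zorder h p) = of_int (zorder h p)" if "p \<in> {p. p \<in> ball z r \<and> h p = 0}" for p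
        using that winding_number_circlepath[of p z r] by (simp add: dist_norm norm_minus_commute)
    qed
    then show ?thesis by simp
  qed
  have "(\<lambda>p. g p + (f p - g p)) = f" by simp
  with R have "(\<Sum>p\<in>{p \<in> s. f p = 0}. winding_number (circlepath z r) p * zorder f p)
     = (\<Sum>p\<in>{p \<in> s. g p = 0}. winding_number (circlepath z r) p * zorder g p)" by simp
  moreover have "(\<Sum>p\<in>{p \<in> s. f p = 0}. winding_number (circlepath z r) p * zorder f p) = of_int (\<Sum>p | p \<in> ball z r \<and> f p = 0. zorder f p)"
    using conv[OF fin(1)] nz by blast
  moreover have "(\<Sum>p\<in>{p \<in> s. g p = 0}. winding_number (circlepath z r) p * zorder g p) = of_int (\<Sum>p | p \<in> ball z r \<and> g p = 0. zorder g p)"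
    using conv[OF fin(2)] nz by blast
  ultimately have "complex_of_int (\<Sum>p | p \<in> ball z r \<and> f p = 0. zorder f p) = of_int (\<Sum>p | p \<in> ball z r \<and> g p = 0. zorder g p)"
    by (simp only:)
  then show ?thesis by (simp only: of_int_eq_iff)
qed

text \<open>
  Turns a multiset with multiplicities \<open>w\<close> into a numbering by any index set of the right size.
\<close>

lemma exists_map_with_fibre_cards:
  fixes w :: "'b \<Rightarrow> nat"
  assumes "finite A" "finite B" "card A = (\<Sum>z\<in>B. w z)"
  shows "\<exists>f. (\<forall>a\<in>A. f a \<in> B) \<and> (\<forall>z\<in>B. card {a \<in> A. f a = z} = w z)"
proof -
  define S where "S = Sigma B (\<lambda>z. {..<w z})"
  have "finite S" "card S = card A" using assms by (simp_all add: S_def card_SigmaI)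
  then obtain h where h: "bij_betw h A S" using finite_same_card_bij[OF assms(1)] by metis
  show ?thesis
  proof (intro exI[of _ "fst \<circ> h"] conjI ballI)
    show "(fst \<circ> h) a \<in> B" if "a \<in> A" for a
      using bij_betwE[OF h] that by (auto simp: S_def)
    fix z assume z: "z \<in> B"
    have "bij_betw h {a \<in> A. (fst \<circ> h) a = z} ({z} \<times> {..<w z})"
    proof -
      have "h ` {a \<in> A. (fst \<circ> h) a = z} = {z} \<times> {..<w z}"
      proof
        show "h ` {a \<in> A. (fst \<circ> h) a = z} \<subseteq> {z} \<times> {..<w z}" using bij_betwE[OF h] by (force simp: S_def)
        show "{z} \<times> {..<w z} \<subseteq> h ` {a \<in> A. (fst \<circ> h) a = z}"
        proof
          fix s assume s: "s \<in> {z} \<times> {..<w z}"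
          then have "s \<in> S" using z by (auto simp: S_def)
          then obtain a where "a \<in> A" "h a = s" using bij_betw_imp_surj_on[OF h] by blast
          then show "s \<in> h ` {a \<in> A. (fst \<circ> h) a = z}" using s by (intro image_eqI[of _ _ a]) auto
        qed
      qed
      then show ?thesis using h by (auto simp: bij_betw_def inj_on_def)
    qed
    then have "card {a \<in> A. (fst \<circ> h) a = z} = card ({z} \<times> {..<w z})" by (rule bij_betw_same_card)
    then show "card {a \<in> A. (fst \<circ> h) a = z} = w z" by simp
  qed
qed

text \<open>
  Indices and zeros are both distributed over finite cells.  If in every cell the number of indices equals the
  number of zeros with multiplicity, a numbering can be chosen cell by cell; it then keeps each
  zero in the cell of its index.
\<close>

lemma exists_numbering_of_cells:
  fixes w :: "'z \<Rightarrow> nat" and \<kappa> :: "'i \<Rightarrow> 'c" and \<rho> :: "'z \<Rightarrow> 'c"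
  assumes fI: "\<And>c. finite {i \<in> I. \<kappa> i = c}" and fZ: "\<And>c. finite {z \<in> Z. \<rho> z = c}"
    and card: "\<And>c. card {i \<in> I. \<kappa> i = c} = (\<Sum>z | z \<in> Z \<and> \<rho> z = c. w z)" and w: "\<And>z. z \<in> Z \<Longrightarrow> w z > 0"
  shows "\<exists>lam. lam ` I = Z \<and> (\<forall>z\<in>Z. finite {i \<in> I. lam i = z} \<and> card {i \<in> I. lam i = z} = w z) \<and> (\<forall>i\<in>I. \<rho> (lam i) = \<kappa> i)"
proof -
  have "\<exists>f. (\<forall>a\<in>{i \<in> I. \<kappa> i = c}. f a \<in> {z \<in> Z. \<rho> z = c}) \<and> (\<forall>z\<in>{z \<in> Z. \<rho> z = c}. card {a \<in> {i \<in> I. \<kappa> i = c}. f a = z} = w z)" for c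
    using exists_map_with_fibre_cards[OF fI[of c] fZ[of c], of w] card[of c] by simp
  from choice[OF allI[OF this]] obtain f where f0: "\<forall>c. (\<forall>a\<in>{i \<in> I. \<kappa> i = c}. f c a \<in> {z \<in> Z. \<rho> z = c}) \<and>
     (\<forall>z\<in>{z \<in> Z. \<rho> z = c}. card {a \<in> {i \<in> I. \<kappa> i = c}. f c a = z} = w z)" by (rule exE)
  have f: "\<And>c a. a \<in> I \<Longrightarrow> \<kappa> a = c \<Longrightarrow> f c a \<in> Z \<and> \<rho> (f c a) = c"
     "\<And>c z. z \<in> Z \<Longrightarrow> \<rho> z = c \<Longrightarrow> card {a \<in> {i \<in> I. \<kappa> i = c}. f c a = z} = w z"
    using f0 by blast+
  define lam where "lam = (\<lambda>i. f (\<kappa> i) i)"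
  have fib: "{i \<in> I. lam i = z} = {a \<in> {i \<in> I. \<kappa> i = \<rho> z}. f (\<rho> z) a = z}" if "z \<in> Z" for z
    using f(1) by (auto simp: lam_def)
  have c: "finite {i \<in> I. lam i = z} \<and> card {i \<in> I. lam i = z} = w z" if "z \<in> Z" for z
    unfolding fib[OF that] using f(2)[OF that refl] finite_subset[OF _ fI[of "\<rho> z"], of "{a \<in> {i \<in> I. \<kappa> i = \<rho> z}. f (\<rho> z) a = z}"] by auto
  have "lam ` I = Z"
  proof
    show "lam ` I \<subseteq> Z" using f(1) by (auto simp: lam_def)
    show "Z \<subseteq> lam ` I"
    proof
      fix z assume z: "z \<in> Z"
      then have "{i \<in> I. lam i = z} \<noteq> {}" using c[OF z] w[OF z] by (metis card.empty less_irrefl)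
      then show "z \<in> lam ` I" by blast
    qed
  qed
  moreover have "\<rho> (lam i) = \<kappa> i" if "i \<in> I" for i using f(1)[OF that refl] by (simp add: lam_def)
  ultimately show ?thesis using c by blast
qed

lemma zorder_sin_half_pi:
  fixes p :: complex and b :: real
  shows "zorder (\<lambda>l. sin (of_real pi * (l - of_real b) / 2)) p = (if \<exists>n::int. p = of_real b + 2 * of_int n then 1 else 0)"
proof -
  let ?f = "\<lambda>l::complex. sin (of_real pi * (l - of_real b) / 2)"
  have an: "?f analytic_on {p}" by (intro analytic_intros) auto
  have zero: "?f p = 0 \<longleftrightarrow> (\<exists>n::int. p = of_real b + 2 * of_int n)"
  proof -
    have "?f p = 0 \<longleftrightarrow> (\<exists>n::int. of_real pi * (p - of_real b) / 2 = of_real (of_int n * pi))"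
      by (simp add: sin_eq_0)
    also have "\<dots> \<longleftrightarrow> (\<exists>n::int. p = of_real b + 2 * of_int n)"
    proof (intro ex_cong1)
      fix n :: int
      have "of_real pi * (p - of_real b) / 2 - of_real (of_int n * pi) = of_real pi / 2 * (p - (of_real b + 2 * of_int n))"
        by (simp add: field_simps)
      then show "of_real pi * (p - of_real b) / 2 = of_real (of_int n * pi) \<longleftrightarrow> p = of_real b + 2 * of_int n"
        unfolding eq_iff_diff_eq_0[of "of_real pi * (p - of_real b) / 2"] eq_iff_diff_eq_0[of p] by (simp only: mult_eq_0_iff divide_eq_0_iff) simp
    qed
    finally show ?thesis .
  qed
  show ?thesis
  proof (cases "?f p = 0")
    case False
    then show ?thesis using zorder_eq_0I[OF an False] zero by auto
  next
    case True
    have "(?f has_field_derivative of_real pi / 2 * cos (of_real pi * (p - of_real b) / 2)) (at p)"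
      by (auto intro!: derivative_eq_intros)
    then have "deriv ?f p = of_real pi / 2 * cos (of_real pi * (p - of_real b) / 2)" by (rule DERIV_imp_deriv)
    moreover have "cos (of_real pi * (p - of_real b) / 2) \<noteq> 0"
      using True sin_cos_squared_add[of "of_real pi * (p - of_real b) / 2"] by auto
    ultimately have "zorder ?f p = 1" 
      using True by (intro zorder_zero_eqI'[OF an]) auto
    then show ?thesis using True zero by auto
  qed
qed

section \<open>Entire functions close to a product of sines\<close>

lemma entire_eventually_nonzero:
  assumes "f holomorphic_on UNIV" "f a \<noteq> 0"
  shows "eventually (\<lambda>z. f z \<noteq> 0) (at p)"
  using non_zero_neighbour_alt[OF assms(1), of p a] assms(2) by (auto elim: eventually_mono)

text \<open>
  Model functions \<open>c \<Prod> sin (\<pi> (l - \<beta>\<^sub>k) / 2)\<close> with \<open>2 m\<close> factors.  Their zeros are the points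
  \<open>2 n + \<beta>\<^sub>k\<close>; those of \<open>E\<close> belong to \<open>k < 2 m\<close> and those of \<open>sin (\<pi> l / 2)\<close> to \<open>k = 2 m\<close>.  The
  radius \<open>\<delta>\<close> is chosen such that the discs around different zeros are disjoint and avoid the circles
  \<open>|l| = 2 N + 1\<close>.  Only \<open>\<beta>\<^sub>2\<^sub>m\<close> may coincide with another \<open>\<beta>\<^sub>k\<close>.
\<close>

locale sine_product =
  fixes m :: nat and \<beta> :: "nat \<Rightarrow> real" and c :: complex and \<delta> :: real
  assumes m2: "m \<ge> 2" and c0: "c \<noteq> 0" and \<delta>: "0 < \<delta>"
    and bound: "\<And>k. k \<in> {1..2*m} \<Longrightarrow> 2 * \<delta> \<le> 1 - \<bar>\<beta> k\<bar>"
    and separated: "\<And>j k. j \<in> {1..2*m} \<Longrightarrow> k \<in> {1..2*m} \<Longrightarrow> \<beta> j \<noteq> \<beta> k \<Longrightarrow> 2 * \<delta> \<le> \<bar>\<beta> j - \<beta> k\<bar>"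
    and inj: "inj_on \<beta> {1..2*m-1}" and last0: "\<beta> (2*m) = 0"
begin

definition pos :: "int \<Rightarrow> nat \<Rightarrow> real" where "pos n k = 2 * of_int n + \<beta> k"

definition fac :: "nat \<Rightarrow> complex \<Rightarrow> complex" where "fac k l = sin (of_real pi * (l - of_real (\<beta> k)) / 2)"

definition F :: "complex \<Rightarrow> complex" where "F l = c * (\<Prod>k=1..2*m. fac k l)"

definition away :: "complex \<Rightarrow> bool" where
  "away l \<longleftrightarrow> (\<forall>n. \<forall>k\<in>{1..2*m}. \<delta> \<le> norm (l - of_real (pos n k)))"

lemma \<delta>_le: "\<delta> \<le> 1 / 2"
  using bound[of 1] m2 by auto

lemma pos_eq_iff:
  assumes "k \<in> {1..2*m}" "k' \<in> {1..2*m}"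
  shows "pos n k = pos n' k' \<longleftrightarrow> n = n' \<and> \<beta> k = \<beta> k'"
proof
  assume "pos n k = pos n' k'"
  then have e: "2 * real_of_int (n - n') = \<beta> k' - \<beta> k" by (simp add: pos_def)
  have "\<bar>\<beta> k' - \<beta> k\<bar> < 2" using bound[OF assms(1)] bound[OF assms(2)] \<delta> by arith
  then have "\<bar>real_of_int (n - n')\<bar> < 1" using e unfolding abs_less_iff by auto
  then have "n - n' = 0" by linarith
  then show "n = n' \<and> \<beta> k = \<beta> k'" using e by simp
qed (simp add: pos_def)

lemma pos_separated:
  assumes k: "k \<in> {1..2*m}" "k' \<in> {1..2*m}" and ne: "pos n k \<noteq> pos n' k'"
  shows "2 * \<delta> \<le> \<bar>pos n k - pos n' k'\<bar>"
proof (cases "n = n'")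
  case True
  then show ?thesis using separated[OF k] ne by (auto simp: pos_def)
next
  case False
  then have "1 \<le> \<bar>n - n'\<bar>" by linarith
  then have "1 \<le> \<bar>real_of_int n - real_of_int n'\<bar>" by (metis of_int_1_le_iff of_int_abs of_int_diff)
  then show ?thesis using bound[OF k(1)] bound[OF k(2)] \<delta> unfolding pos_def by arith
qed

lemma pos_bounds:
  assumes k: "k \<in> {1..2*m}"
  shows "\<bar>n\<bar> \<le> int N \<Longrightarrow> \<bar>pos n k\<bar> \<le> 2 * real N + 1 - 2 * \<delta>" "int N < \<bar>n\<bar> \<Longrightarrow> 2 * real N + 1 + 2 * \<delta> \<le> \<bar>pos n k\<bar>"
    "2 * \<bar>real_of_int n\<bar> - 1 + 2 * \<delta> \<le> \<bar>pos n k\<bar>"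
proof -
  show a: "2 * \<bar>real_of_int n\<bar> - 1 + 2 * \<delta> \<le> \<bar>pos n k\<bar>" using bound[OF k] unfolding pos_def by arith
  show "\<bar>pos n k\<bar> \<le> 2 * real N + 1 - 2 * \<delta>" if "\<bar>n\<bar> \<le> int N"
  proof -
    have "\<bar>real_of_int n\<bar> \<le> real N" using that by linarith
    then show ?thesis using bound[OF k] unfolding pos_def by arith
  qed
  show "2 * real N + 1 + 2 * \<delta> \<le> \<bar>pos n k\<bar>" if "int N < \<bar>n\<bar>"
  proof -
    have "real N + 1 \<le> \<bar>real_of_int n\<bar>" using that by linarith
    then show ?thesis using a by linarith
  qed
qed

lemma norm_fac_away:
  assumes "\<And>n. \<delta> \<le> norm (l - of_real (pos n k))"
  shows "\<delta> / 8 * exp (pi / 2 * \<bar>Im l\<bar>) \<le> norm (fac k l)"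
proof -
  have "\<delta> \<le> norm ((l - of_real (\<beta> k)) - 2 * of_int n)" for n
    using assms[of n] by (simp add: pos_def algebra_simps)
  from norm_sin_ge_away[OF \<delta> _ this] show ?thesis using \<delta>_le by (simp add: fac_def)
qed

lemma norm_F_away:
  assumes "away l"
  shows "norm c * (\<delta> / 8) ^ (2 * m) * exp (m * pi * \<bar>Im l\<bar>) \<le> norm (F l)"
proof -
  have "(\<Prod>k=1..2*m. \<delta> / 8 * exp (pi / 2 * \<bar>Im l\<bar>)) \<le> (\<Prod>k=1..2*m. norm (fac k l))"
    using assms \<delta> by (intro prod_mono conjI norm_fac_away) (auto simp: away_def)
  moreover have "(\<Prod>k=1..2*m. \<delta> / 8 * exp (pi / 2 * \<bar>Im l\<bar>)) = (\<delta> / 8) ^ (2 * m) * exp (m * pi * \<bar>Im l\<bar>)"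
  proof -
    have "exp (pi / 2 * \<bar>Im l\<bar>) ^ (2 * m) = exp (m * pi * \<bar>Im l\<bar>)"
      by (simp flip: exp_of_nat_mult)
    then show ?thesis by (simp only: prod_constant card_atLeastAtMost power_mult_distrib) simp
  qed
  ultimately have "norm c * ((\<delta> / 8) ^ (2 * m) * exp (m * pi * \<bar>Im l\<bar>)) \<le> norm c * (\<Prod>k=1..2*m. norm (fac k l))"
    by (intro mult_left_mono) auto
  then show ?thesis by (simp add: F_def norm_mult prod_norm mult.assoc)
qed

lemma F_holomorphic: "F holomorphic_on S"
  unfolding F_def fac_def by (intro holomorphic_intros) auto

lemma fac_eq_0_iff: "fac k p = 0 \<longleftrightarrow> (\<exists>n. p = of_real (pos n k))"
proof -
  have "frequently (\<lambda>z. fac k z \<noteq> 0) (at p)"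
  proof -
    have "fac k holomorphic_on UNIV" unfolding fac_def by (intro holomorphic_intros) auto
    moreover have "fac k (of_real (\<beta> k + 1)) \<noteq> 0" by (simp add: fac_def sin_of_real[symmetric] flip: of_real_divide)
    ultimately show ?thesis by (intro eventually_frequently entire_eventually_nonzero) auto
  qed
  moreover have "fac k analytic_on {p}" unfolding fac_def by (intro analytic_intros) auto
  ultimately have "fac k p = 0 \<longleftrightarrow> zorder (fac k) p > 0" using zorder_pos_iff' by blast
  also have "\<dots> \<longleftrightarrow> (\<exists>n::int. p = of_real (\<beta> k) + 2 * of_int n)"
    using zorder_sin_half_pi[of "\<beta> k" p] by (simp add: fac_def[abs_def])
  also have "\<dots> \<longleftrightarrow> (\<exists>n. p = of_real (pos n k))" by (simp add: pos_def add.commute)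
  finally show ?thesis .
qed

lemma F_eq_0_iff: "F p = 0 \<longleftrightarrow> (\<exists>k\<in>{1..2*m}. \<exists>n. p = of_real (pos n k))"
  using c0 by (simp add: F_def fac_eq_0_iff)

lemma away_one: "away (of_real (2 * real N + 1))"
  unfolding away_def
proof (intro allI ballI)
  fix n k assume k: "k \<in> {1..2*m}"
  have "2 * \<delta> \<le> \<bar>2 * real N + 1 - pos n k\<bar>"
    using pos_bounds(1,2)[OF k, where n = n and N = N] \<delta> by (cases "\<bar>n\<bar> \<le> int N") arith+
  then show "\<delta> \<le> norm (complex_of_real (2 * real N + 1) - of_real (pos n k))"
    using \<delta> by (simp del: of_real_add of_real_mult flip: of_real_diff)
qed

lemma F_nonzero: "F (of_real (2 * real 0 + 1)) \<noteq> 0"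
proof -
  have "0 < norm c * (\<delta> / 8) ^ (2 * m) * exp (m * pi * \<bar>Im (complex_of_real (2 * real 0 + 1))\<bar>)" using c0 \<delta> by simp
  also have "\<dots> \<le> norm (F (of_real (2 * real 0 + 1)))" by (rule norm_F_away[OF away_one])
  finally show ?thesis by auto
qed

lemma zorder_F: "zorder F p = int (card {k \<in> {1..2*m}. \<exists>n. p = of_real (pos n k)})"
proof -
  have "zorder F p = zorder (\<lambda>l. \<Prod>k=1..2*m. fac k l) p"
    unfolding F_def[abs_def] by (rule zorder_cmult[OF c0])
  also have "\<dots> = (\<Sum>k=1..2*m. zorder (fac k) p)"
  proof (rule zorder_prod_analytic)
    show "fac k analytic_on {p}" for k unfolding fac_def by (intro analytic_intros) auto
    have "eventually (\<lambda>z. F z \<noteq> 0) (at p)" by (rule entire_eventually_nonzero[OF F_holomorphic F_nonzero])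
    then show "\<forall>\<^sub>F z in at p. (\<Prod>k=1..2*m. fac k z) \<noteq> 0" by (auto simp: F_def elim!: eventually_mono)
  qed
  also have "\<dots> = (\<Sum>k=1..2*m. if \<exists>n. p = of_real (pos n k) then 1 else 0)"
    by (intro sum.cong refl) (simp add: fac_def[abs_def] zorder_sin_half_pi pos_def add.commute)
  also have "\<dots> = int (card {k \<in> {1..2*m}. \<exists>n. p = of_real (pos n k)})"
    by (simp add: sum.If_cases Int_def)
  finally show ?thesis .
qed

lemma count_F:
  "(\<Sum>p | p \<in> ball z r \<and> F p = 0. zorder F p) = int (card {(n, k). k \<in> {1..2*m} \<and> complex_of_real (pos n k) \<in> ball z r})"
proof -
  define Zs where "Zs = {p. p \<in> ball z r \<and> F p = 0}"
  define A where "A = (\<lambda>p. {(n, k). k \<in> {1..2*m} \<and> complex_of_real (pos n k) = p})"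
  have "finite {p \<in> cball z r. F p = 0}" by (rule finite_zeros_ball[OF F_holomorphic F_nonzero])
  then have finZ: "finite Zs" by (rule finite_subset[rotated]) (auto simp: Zs_def)
  have A: "bij_betw snd (A p) {k \<in> {1..2*m}. \<exists>n. p = of_real (pos n k)}" for p
    unfolding bij_betw_def
  proof
    show "inj_on snd (A p)" using pos_eq_iff by (auto simp: inj_on_def A_def)
    show "snd ` A p = {k \<in> {1..2*m}. \<exists>n. p = of_real (pos n k)}" by (force simp: A_def image_iff)
  qed
  then have finA: "finite (A p)" for p using bij_betw_finite by fastforce
  have U: "{(n, k). k \<in> {1..2*m} \<and> complex_of_real (pos n k) \<in> ball z r} = (\<Union>p\<in>Zs. A p)"
  proof -
    have "F (of_real (pos n k)) = 0" if "k \<in> {1..2*m}" for n k using that unfolding F_eq_0_iff by blast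
    then show ?thesis by (auto simp: Zs_def A_def)
  qed
  have "card (\<Union>p\<in>Zs. A p) = (\<Sum>p\<in>Zs. card (A p))"
    by (rule card_UN_disjoint) (use finZ finA in \<open>auto simp: A_def\<close>)
  then have "int (card (\<Union>p\<in>Zs. A p)) = (\<Sum>p\<in>Zs. zorder F p)"
    using bij_betw_same_card[OF A] by (simp add: zorder_F)
  then show ?thesis unfolding U by (simp add: Zs_def)
qed

text \<open>
  Although the whole product may have a double zero, each of the two parts \<open>sin (\<pi> l / 2)\<close> and
  \<open>c \<Prod> fac k l\<close> over \<open>k < 2 m\<close> has simple zeros only, hence is bounded below by the distance to the
  zero.
\<close>

lemma near_zero_lower_bounds:
  assumes k0: "k0 \<in> {1..2*m}" and near: "norm (l - of_real (pos n0 k0)) < \<delta>"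
  shows "\<delta> / 8 * norm (l - of_real (pos n0 k0)) \<le> norm (fac (2*m) l)"
    and "norm c * (\<delta> / 8) ^ (2*m - 1) * norm (l - of_real (pos n0 k0)) \<le> norm (c * (\<Prod>k=1..2*m-1. fac k l))"
proof -
  define d where "d = norm (l - of_real (pos n0 k0))"
  define \<gamma> where "\<gamma> = \<delta> / 8"
  have d: "0 \<le> d" "d \<le> 1" "0 < \<gamma>" "\<gamma> \<le> 1 / 2" using near \<delta> \<delta>_le by (auto simp: d_def \<gamma>_def)
  have same: "\<gamma> * d \<le> norm (fac k l)" if "\<beta> k = \<beta> k0" for k
  proof -
    have "\<bar>Re (l - of_real (pos n0 k0))\<bar> \<le> 1" using abs_Re_le_cmod[of "l - of_real (pos n0 k0)"] d(2) unfolding d_def by linarith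
    then have "d / 2 \<le> norm (sin (of_real pi * (l - of_real (pos n0 k0)) / 2))" unfolding d_def by (rule norm_sin_ge_near)
    also have "l - of_real (pos n0 k0) = (l - of_real (\<beta> k)) - 2 * of_int n0" by (simp add: pos_def that)
    also have "norm (sin (of_real pi * \<dots> / 2)) = norm (fac k l)" unfolding fac_def by (rule norm_sin_half_pi_shift)
    finally show ?thesis using d mult_right_mono[OF d(4) d(1)] by simp
  qed
  have other: "\<gamma> \<le> norm (fac k l)" if k: "k \<in> {1..2*m}" "\<beta> k \<noteq> \<beta> k0" for k
  proof -
    have "\<delta> \<le> norm (l - of_real (pos n k))" for n
    proof -
      have "2 * \<delta> \<le> \<bar>pos n k - pos n0 k0\<bar>" using pos_separated[OF k(1) k0] pos_eq_iff[OF k(1) k0] k(2) by blast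
      also have "\<dots> = norm ((l - of_real (pos n0 k0)) - (l - of_real (pos n k)))" by (simp flip: of_real_diff)
      also have "\<dots> \<le> d + norm (l - of_real (pos n k))" unfolding d_def by (rule norm_triangle_ineq4)
      finally show ?thesis using near by (simp add: d_def)
    qed
    then have "\<gamma> * exp (pi / 2 * \<bar>Im l\<bar>) \<le> norm (fac k l)" unfolding \<gamma>_def by (rule norm_fac_away)
    moreover have "\<gamma> * 1 \<le> \<gamma> * exp (pi / 2 * \<bar>Im l\<bar>)" using d by (intro mult_left_mono) auto
    ultimately show ?thesis by simp
  qed
  have any: "\<gamma> * d \<le> norm (fac k l)" if "k \<in> {1..2*m}" for k
  proof (cases "\<beta> k = \<beta> k0")
    case False
    have "\<gamma> * d \<le> \<gamma> * 1" using d by (intro mult_left_mono) auto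
    then show ?thesis using other[OF that False] by simp
  qed (rule same)
  show "\<delta> / 8 * norm (l - of_real (pos n0 k0)) \<le> norm (fac (2*m) l)"
    using any[of "2*m"] m2 by (simp add: \<gamma>_def d_def)
  define I where "I = {1..2*m-1}"
  have I: "finite I" "card I = 2*m - 1" "1 \<in> I" "\<And>k. k \<in> I \<Longrightarrow> k \<in> {1..2*m}" using m2 by (auto simp: I_def)
  \<comment> \<open>At most one factor of the second part is small near the zero; \<open>k1\<close> is its index, if there is one.\<close>
  obtain k1 where k1: "k1 \<in> I" "\<And>k. k \<in> I - {k1} \<Longrightarrow> \<beta> k \<noteq> \<beta> k0"
  proof (cases "\<exists>k\<in>I. \<beta> k = \<beta> k0")
    case True
    then obtain k where "k \<in> I" "\<beta> k = \<beta> k0" by blast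
    then show thesis using that[of k] inj unfolding I_def[symmetric] inj_on_def by force
  next
    case False
    then show thesis using that[of 1] I by blast
  qed
  have "\<gamma> ^ (2*m - 1) * d = (\<gamma> * d) * \<gamma> ^ card (I - {k1})"
  proof -
    have "2 * m - 1 = Suc (card (I - {k1}))" using card.remove[OF I(1) k1(1)] I(2) by simp
    then show ?thesis by (simp add: mult_ac)
  qed
  also have "\<dots> \<le> norm (fac k1 l) * (\<Prod>k\<in>I-{k1}. norm (fac k l))"
  proof (rule mult_mono)
    show "\<gamma> * d \<le> norm (fac k1 l)" by (rule any[OF I(4)[OF k1(1)]])
    have "(\<Prod>k\<in>I-{k1}. \<gamma>) \<le> (\<Prod>k\<in>I-{k1}. norm (fac k l))"
      using other k1 I d by (intro prod_mono) auto
    then show "\<gamma> ^ card (I - {k1}) \<le> (\<Prod>k\<in>I-{k1}. norm (fac k l))" by simp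
  qed (use d in auto)
  also have "\<dots> = norm (\<Prod>k\<in>I. fac k l)" using prod.remove[OF I(1) k1(1), of "\<lambda>k. norm (fac k l)"] by (simp add: prod_norm)
  finally show "norm c * (\<delta> / 8) ^ (2*m - 1) * norm (l - of_real (pos n0 k0)) \<le> norm (c * (\<Prod>k=1..2*m-1. fac k l))"
    by (simp add: norm_mult I_def \<gamma>_def d_def mult.assoc mult_left_mono)
qed

lemma F_split: "F l = fac (2*m) l * (c * (\<Prod>k=1..2*m-1. fac k l))"
proof -
  have "{1..2*m} = insert (2*m) {1..2*m-1}" using m2 by auto
  then show ?thesis using m2 by (simp add: F_def)
qed

text \<open>
  The first error bound makes Rouche's theorem applicable wherever the product of sines has size
  \<open>exp (m \<pi> |Im l|)\<close>, that is away from its zeros.  It is used on the circle \<open>|l| = 2 N0 + 1\<close> and on the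
  circles of radius \<open>\<delta>\<close> around the zeros outside.  This gives a numbering with \<open>lam (n, k)\<close> within distance
  \<open>\<delta>\<close> of \<open>2 n + \<beta>\<^sub>k\<close> for large \<open>n\<close>; the second error bound improves the distance to \<open>O(1 / |n|)\<close>.
\<close>

theorem numbering_of_zeros:
  fixes \<Delta> :: "complex \<Rightarrow> complex" and C R :: real
  assumes hol: "\<Delta> holomorphic_on UNIV" and C: "C \<ge> 0"
    and glob: "\<And>l. norm l \<ge> R \<Longrightarrow> norm (l ^ (m - 1) * \<Delta> l - F l) \<le> C / norm l * exp (m * pi * \<bar>Im l\<bar>)"
    and near: "\<And>l. norm l \<ge> R \<Longrightarrow> \<bar>Im l\<bar> \<le> 1 \<Longrightarrow> norm (l ^ (m - 1) * \<Delta> l - F l) \<le>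
       C / norm l * (norm (fac (2*m) l) + norm (c * (\<Prod>k=1..2*m-1. fac k l))) + (C / norm l)\<^sup>2"
  shows "\<exists>lam C' (N0::nat). {l. \<Delta> l = 0} = lam ` index_set m \<and>
     (\<forall>\<mu>. \<Delta> \<mu> = 0 \<longrightarrow> finite {i \<in> index_set m. lam i = \<mu>} \<and> int (card {i \<in> index_set m. lam i = \<mu>}) = zorder \<Delta> \<mu>) \<and>
     (\<forall>n k. k \<in> {1..2*m} \<longrightarrow> int N0 < \<bar>n\<bar> \<longrightarrow> norm (lam (n, k) - of_real (pos n k)) \<le> C' / \<bar>real_of_int n\<bar>)"
proof -
  define K where "K = {1..2*m}"
  define D where "D = (\<lambda>l. l ^ (m - 1) * \<Delta> l)"
  define c1 where "c1 = norm c * (\<delta> / 8) ^ (2 * m)"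
  have c1: "c1 > 0" using c0 \<delta> by (simp add: c1_def)
  have holD: "D holomorphic_on UNIV" unfolding D_def by (intro holomorphic_intros hol)
  obtain N0 :: nat where N0: "max R (max 1 (C / c1)) < real N0" using reals_Archimedean2 by blast
  have large: "norm (D l - F l) < norm (F l)" if "away l" "real N0 \<le> norm l" for l
  proof -
    have "C / norm l < c1"
    proof -
      have "C < c1 * real N0" using N0 c1 by (simp add: field_simps)
      also have "\<dots> \<le> c1 * norm l" using that c1 by (intro mult_left_mono) auto
      moreover have "norm l > 0" using that N0 by linarith
      ultimately show ?thesis by (simp add: divide_less_eq)
    qed
    have "norm (D l - F l) \<le> C / norm l * exp (m * pi * \<bar>Im l\<bar>)" unfolding D_def by (rule glob) (use that N0 in linarith)
    also have "\<dots> < c1 * exp (m * pi * \<bar>Im l\<bar>)" using \<open>C / norm l < c1\<close> by (intro mult_strict_right_mono) auto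
    also have "\<dots> \<le> norm (F l)" unfolding c1_def by (rule norm_F_away[OF that(1)])
    finally show ?thesis .
  qed
  have D1: "D (of_real (2 * real N0 + 1)) \<noteq> 0"
    using large[OF away_one[of N0]] by (auto simp del: of_real_add of_real_mult)
  then have \<Delta>1: "\<Delta> (of_real (2 * real N0 + 1)) \<noteq> 0" by (auto simp: D_def)
  note ev\<Delta> = entire_eventually_nonzero[OF hol \<Delta>1] and evD = entire_eventually_nonzero[OF holD D1]
  have an\<Delta>: "\<Delta> analytic_on {p}" for p using hol analytic_on_open[of UNIV \<Delta>] analytic_on_subset by blast
  have zpos: "zorder \<Delta> p > 0 \<longleftrightarrow> \<Delta> p = 0" for p
    by (rule zorder_pos_iff'[OF an\<Delta>]) (rule eventually_frequently[OF _ ev\<Delta>], simp)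
  have z0: "\<Delta> p \<noteq> 0 \<Longrightarrow> zorder \<Delta> p = 0" for p by (rule zorder_eq_0I[OF an\<Delta>])
  have zD: "zorder D p = (if p = 0 then int (m - 1) else 0) + zorder \<Delta> p" for p
  proof -
    have "zorder D p = zorder (\<lambda>l. l ^ (m - 1)) p + zorder \<Delta> p"
      unfolding D_def by (rule zorder_times_analytic[OF _ an\<Delta>]) (use evD[of p] in \<open>auto simp: D_def intro!: analytic_intros\<close>)
    moreover have "zorder (\<lambda>l::complex. l ^ (m - 1)) p = (if p = 0 then int (m - 1) else 0)"
    proof (cases "p = 0")
      case True
      have "zorder (\<lambda>l::complex. l ^ (m - 1)) 0 = int (m - 1)"
        by (rule zorder_eqI[of UNIV _ "\<lambda>_. 1"]) auto
      then show ?thesis using True by simp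
    next
      case False
      then show ?thesis by (simp add: zorder_eq_0I analytic_intros)
    qed
    ultimately show ?thesis by simp
  qed
  have fin: "finite {z \<in> ball a r. \<Delta> z = 0}" for a r
    by (rule finite_subset[OF _ finite_zeros_ball[OF hol \<Delta>1, of a r]]) auto
  have finD: "finite {z. z \<in> ball a r \<and> D z = 0}" for a r
    by (rule finite_subset[OF _ finite_zeros_ball[OF holD D1, of a r]]) auto
  have count: "(\<Sum>p | p \<in> ball a r \<and> D p = 0. zorder D p) = int (card {(n, k). k \<in> K \<and> complex_of_real (pos n k) \<in> ball a r})"
    if "0 < r" "\<And>l. l \<in> sphere a r \<Longrightarrow> away l \<and> real N0 \<le> norm l" for a r
    unfolding K_def count_F[symmetric] using that large by (intro rouche_count holD F_holomorphic) auto
  \<comment> \<open>On the circle \<open>|l| = 2 N0 + 1\<close> the zero of \<open>l ^ (m - 1)\<close> at the origin is counted as well.\<close>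
  define \<rho>0 where "\<rho>0 = 2 * real N0 + 1"
  have big: "(\<Sum>p | p \<in> ball 0 \<rho>0 \<and> \<Delta> p = 0. zorder \<Delta> p) + int (m - 1) = int (card ({- int N0..int N0} \<times> K))"
  proof -
    have "away l \<and> real N0 \<le> norm l" if "l \<in> sphere 0 \<rho>0" for l
    proof
      have nl: "norm l = 2 * real N0 + 1" using that by (simp add: \<rho>0_def)
      then show "real N0 \<le> norm l" by simp
      show "away l"
        unfolding away_def
      proof (intro allI ballI)
        fix n k assume k: "k \<in> {1..2*m}"
        have "2 * \<delta> \<le> \<bar>norm l - \<bar>pos n k\<bar>\<bar>"
          unfolding nl using pos_bounds(1,2)[OF k, where n = n and N = N0] \<delta> by (cases "\<bar>n\<bar> \<le> int N0") arith+
        also have "\<dots> \<le> norm (l - of_real (pos n k))" using norm_triangle_ineq3[of l "of_real (pos n k)"] by simp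
        finally show "\<delta> \<le> norm (l - of_real (pos n k))" using \<delta> by linarith
      qed
    qed
    then have "(\<Sum>p | p \<in> ball 0 \<rho>0 \<and> D p = 0. zorder D p) = int (card {(n, k). k \<in> K \<and> complex_of_real (pos n k) \<in> ball 0 \<rho>0})"
      by (intro count) (auto simp: \<rho>0_def)
    also have "{(n, k). k \<in> K \<and> complex_of_real (pos n k) \<in> ball 0 \<rho>0} = {- int N0..int N0} \<times> K"
    proof -
      have "\<bar>pos n k\<bar> < \<rho>0 \<longleftrightarrow> \<bar>n\<bar> \<le> int N0" if "k \<in> K" for n k
        using pos_bounds(1,2)[where k = k and n = n and N = N0] that \<delta> unfolding K_def \<rho>0_def by (cases "\<bar>n\<bar> \<le> int N0") auto
      then show ?thesis by (auto simp: abs_le_iff)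
    qed
    finally have "(\<Sum>p | p \<in> ball 0 \<rho>0 \<and> D p = 0. zorder D p) = int (card ({- int N0..int N0} \<times> K))" .
    moreover have "(\<Sum>p | p \<in> ball 0 \<rho>0 \<and> D p = 0. zorder D p) =
        (\<Sum>p | p \<in> ball 0 \<rho>0 \<and> D p = 0. if p = 0 then int (m - 1) else 0) + (\<Sum>p | p \<in> ball 0 \<rho>0 \<and> D p = 0. zorder \<Delta> p)"
      unfolding zD by (rule sum.distrib)
    moreover have "(\<Sum>p | p \<in> ball 0 \<rho>0 \<and> D p = 0. if p = 0 then int (m - 1) else 0) = int (m - 1)"
    proof -
      have "D 0 = 0" using m2 by (simp add: D_def)
      then show ?thesis using finD[of 0 \<rho>0] by (subst sum.delta) (auto simp: \<rho>0_def)
    qed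
    moreover have "(\<Sum>p | p \<in> ball 0 \<rho>0 \<and> D p = 0. zorder \<Delta> p) = (\<Sum>p | p \<in> ball 0 \<rho>0 \<and> \<Delta> p = 0. zorder \<Delta> p)"
      by (rule sum.mono_neutral_right[OF finD]) (use z0 in \<open>auto simp: D_def\<close>)
    ultimately show ?thesis by simp
  qed
  have far: "norm l \<ge> \<rho>0 + \<delta>" if "k \<in> K" "int N0 < \<bar>n\<bar>" "norm (l - of_real (pos n k)) \<le> \<delta>" for l :: complex and n k
  proof -
    have "norm (complex_of_real (pos n k)) \<le> norm l + norm (l - of_real (pos n k))"
      using norm_triangle_ineq4[of l "l - of_real (pos n k)"] by simp
    then show ?thesis using pos_bounds(2)[where k = k and n = n and N = N0] that unfolding K_def \<rho>0_def by simp
  qed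
  \<comment> \<open>A small disc may contain two zeros: the pairs \<open>(n, k')\<close> with the same position are counted together.\<close>
  have small: "(\<Sum>p | p \<in> ball (of_real (pos n k)) \<delta> \<and> \<Delta> p = 0. zorder \<Delta> p) = int (card {(n', k'). k' \<in> K \<and> pos n' k' = pos n k})"
    if k: "k \<in> K" and n: "int N0 < \<bar>n\<bar>" for n k
  proof -
    let ?p = "complex_of_real (pos n k)"
    have sep: "\<delta> \<le> norm (l - of_real (pos n' k'))" if "norm (l - ?p) \<le> \<delta>" "k' \<in> K" "pos n' k' \<noteq> pos n k" for l :: complex and n' k'
    proof -
      have "2 * \<delta> \<le> \<bar>pos n' k' - pos n k\<bar>" using pos_separated[of k' k n' n] that k by (simp add: K_def)
      also have "\<dots> = norm ((l - ?p) - (l - of_real (pos n' k')))" by (simp flip: of_real_diff)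
      also have "\<dots> \<le> norm (l - ?p) + norm (l - of_real (pos n' k'))" by (rule norm_triangle_ineq4)
      finally show ?thesis using that by simp
    qed
    have "away l \<and> real N0 \<le> norm l" if "l \<in> sphere ?p \<delta>" for l
    proof
      have nl: "norm (l - ?p) = \<delta>" using that by (simp add: dist_norm norm_minus_commute)
      show "real N0 \<le> norm l" using far[OF k n, of l] nl \<delta> by (simp add: \<rho>0_def)
      show "away l" unfolding away_def
      proof (intro allI ballI)
        fix n' k' assume "k' \<in> {1..2*m}"
        then show "\<delta> \<le> norm (l - of_real (pos n' k'))"
          using sep[of l k' n'] nl by (cases "pos n' k' = pos n k") (auto simp: K_def)
      qed
    qed
    then have "(\<Sum>p | p \<in> ball ?p \<delta> \<and> D p = 0. zorder D p) = int (card {(n', k'). k' \<in> K \<and> complex_of_real (pos n' k') \<in> ball ?p \<delta>})"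
      by (intro count) (auto simp: \<delta>)
    also have "{(n', k'). k' \<in> K \<and> complex_of_real (pos n' k') \<in> ball ?p \<delta>} = {(n', k'). k' \<in> K \<and> pos n' k' = pos n k}"
    proof -
      have "complex_of_real (pos n' k') \<in> ball ?p \<delta> \<longleftrightarrow> pos n' k' = pos n k" if "k' \<in> K" for n' k'
      proof
        assume "complex_of_real (pos n' k') \<in> ball ?p \<delta>"
        then have "\<bar>pos n' k' - pos n k\<bar> < \<delta>" by (simp add: dist_norm norm_minus_commute flip: of_real_diff)
        then have "\<not> 2 * \<delta> \<le> \<bar>pos n' k' - pos n k\<bar>" using \<delta> by linarith
        then show "pos n' k' = pos n k" using pos_separated[of k' k n' n] that k by (auto simp: K_def)
      qed (simp add: \<delta>)
      then show ?thesis by auto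
    qed
    finally have "(\<Sum>p | p \<in> ball ?p \<delta> \<and> D p = 0. zorder D p) = int (card {(n', k'). k' \<in> K \<and> pos n' k' = pos n k})" .
    moreover have nz: "l \<noteq> 0" if "l \<in> ball ?p \<delta>" for l
      using far[OF k n, of l] that \<delta> by (auto simp: dist_norm norm_minus_commute \<rho>0_def)
    moreover have "(\<Sum>p | p \<in> ball ?p \<delta> \<and> D p = 0. zorder D p) = (\<Sum>p | p \<in> ball ?p \<delta> \<and> \<Delta> p = 0. zorder \<Delta> p)"
    proof (rule sum.cong)
      show "{p. p \<in> ball ?p \<delta> \<and> D p = 0} = {p. p \<in> ball ?p \<delta> \<and> \<Delta> p = 0}" using nz by (auto simp: D_def)
      fix p assume "p \<in> {p. p \<in> ball ?p \<delta> \<and> \<Delta> p = 0}"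
      then have "p \<noteq> 0" using nz by blast
      then show "zorder D p = zorder \<Delta> p" using zD[of p] by simp
    qed
    ultimately show ?thesis by simp
  qed
  \<comment> \<open>Cells: \<open>None\<close> is the large disc and \<open>Some p\<close> the small disc around \<open>p\<close>.  Every zero of
    \<open>\<Delta>\<close> lies in exactly one cell.\<close>
  define near_pos where "near_pos = (\<lambda>(l::complex) p. \<exists>n. \<exists>k\<in>K. int N0 < \<bar>n\<bar> \<and> p = pos n k \<and> norm (l - of_real p) < \<delta>)"
  have ex: "\<exists>p. near_pos l p" if "\<Delta> l = 0" "\<rho>0 \<le> norm l" for l
  proof -
    have "D l = 0" using that by (simp add: D_def)
    then have "\<not> away l" using large[of l] that by (auto simp: \<rho>0_def)
    then obtain n k where k: "k \<in> K" "norm (l - of_real (pos n k)) < \<delta>" unfolding away_def K_def by (meson not_le)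
    have "int N0 < \<bar>n\<bar>"
    proof (rule ccontr)
      assume "\<not> int N0 < \<bar>n\<bar>"
      then have "\<bar>pos n k\<bar> \<le> 2 * real N0 + 1 - 2 * \<delta>" using pos_bounds(1)[where k = k and n = n and N = N0] k by (simp add: K_def)
      moreover have "norm l \<le> norm (complex_of_real (pos n k)) + norm (l - of_real (pos n k))"
        by (metis norm_triangle_sub)
      ultimately show False using that k(2) \<delta> by (simp add: \<rho>0_def)
    qed
    then show ?thesis using k unfolding near_pos_def by blast
  qed
  have uniq: "p = p'" if np: "near_pos l p" "near_pos l p'" for l p p'
  proof (rule ccontr)
    assume ne: "p \<noteq> p'"
    obtain n k n' k' where "k \<in> K" "k' \<in> K" and p: "p = pos n k" "p' = pos n' k'" "norm (l - of_real p) < \<delta>" "norm (l - of_real p') < \<delta>"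
      using np unfolding near_pos_def by blast
    then have "2 * \<delta> \<le> \<bar>p - p'\<bar>" using pos_separated ne by (simp add: K_def)
    also have "\<dots> = norm ((l - of_real p') - (l - of_real p))" by (simp flip: of_real_diff)
    also have "\<dots> \<le> norm (l - of_real p') + norm (l - of_real p)" by (rule norm_triangle_ineq4)
    finally show False using p by linarith
  qed
  define \<rho> where "\<rho> = (\<lambda>l. if norm l < \<rho>0 then None else Some (THE p. near_pos l p))"
  define \<kappa> where "\<kappa> = (\<lambda>(n, k). if \<bar>n\<bar> \<le> int N0 then None else Some (pos n k))"
  have \<rho>Some: "\<rho> l = Some p \<longleftrightarrow> near_pos l p" if l0: "\<Delta> l = 0" for l p
  proof
    assume "\<rho> l = Some p"
    then have l: "\<rho>0 \<le> norm l" "p = (THE p. near_pos l p)" by (auto simp: \<rho>_def split: if_splits)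
    obtain p' where "near_pos l p'" using ex[OF l0 l(1)] by blast
    then show "near_pos l p" using l(2) uniq by (metis the_equality)
  next
    assume np: "near_pos l p"
    then have "\<not> norm l < \<rho>0" using far[of _ _ l] \<delta> unfolding near_pos_def by force
    moreover have "(THE p. near_pos l p) = p" using np uniq by blast
    ultimately show "\<rho> l = Some p" by (simp add: \<rho>_def)
  qed
  have \<rho>None: "\<rho> l = None \<longleftrightarrow> norm l < \<rho>0" for l by (auto simp: \<rho>_def)
  define Z where "Z = {l. \<Delta> l = 0}"
  define w where "w = (\<lambda>l. nat (zorder \<Delta> l))"
  have w: "int (w l) = zorder \<Delta> l" "w l > 0" if "l \<in> Z" for l using that zpos[of l] by (auto simp: Z_def w_def)
  have idx: "i \<in> index_set m" if "int N0 < \<bar>fst i\<bar>" "snd i \<in> K" for i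
    using that by (cases i) (auto simp: index_set_def K_def)
  have idxK: "snd i \<in> K" if "i \<in> index_set m" for i using that m2 by (auto simp: index_set_def K_def)
  have ZN: "{z \<in> Z. \<rho> z = None} = {p. p \<in> ball 0 \<rho>0 \<and> \<Delta> p = 0}" by (auto simp: Z_def \<rho>None)
  have IN: "{i \<in> index_set m. \<kappa> i = None} = ({- int N0..int N0} \<times> K) - ({0} \<times> {m+2..2*m})"
    using m2 by (auto simp: index_set_def \<kappa>_def K_def split: if_splits)
  have cell_S: "{z \<in> Z. \<rho> z = Some (pos n k)} = {p. p \<in> ball (of_real (pos n k)) \<delta> \<and> \<Delta> p = 0}"
     "{i \<in> index_set m. \<kappa> i = Some (pos n k)} = {(n', k'). k' \<in> K \<and> pos n' k' = pos n k}"
    if k: "k \<in> K" and n: "int N0 < \<bar>n\<bar>" for n k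
  proof -
    show "{z \<in> Z. \<rho> z = Some (pos n k)} = {p. p \<in> ball (of_real (pos n k)) \<delta> \<and> \<Delta> p = 0}"
      using \<rho>Some k n by (auto simp: Z_def near_pos_def dist_norm norm_minus_commute)
    show "{i \<in> index_set m. \<kappa> i = Some (pos n k)} = {(n', k'). k' \<in> K \<and> pos n' k' = pos n k}"
    proof (intro set_eqI iffI)
      fix i assume "i \<in> {i \<in> index_set m. \<kappa> i = Some (pos n k)}"
      then show "i \<in> {(n', k'). k' \<in> K \<and> pos n' k' = pos n k}" using idxK[of i] by (auto simp: \<kappa>_def split: if_splits)
    next
      fix i assume "i \<in> {(n', k'). k' \<in> K \<and> pos n' k' = pos n k}"
      then obtain n' k' where i: "i = (n', k')" "k' \<in> K" "pos n' k' = pos n k" by auto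
      then have "n' = n" using pos_eq_iff[of k' k n' n] k by (simp add: K_def)
      then show "i \<in> {i \<in> index_set m. \<kappa> i = Some (pos n k)}" using i n idx[of i] by (auto simp: \<kappa>_def)
    qed
  qed
  have cell_empty: "{z \<in> Z. \<rho> z = Some p} = {}" "{i \<in> index_set m. \<kappa> i = Some p} = {}"
    if "\<not> (\<exists>n. \<exists>k\<in>K. int N0 < \<bar>n\<bar> \<and> p = pos n k)" for p
  proof -
    show "{z \<in> Z. \<rho> z = Some p} = {}" using \<rho>Some that by (auto simp: Z_def near_pos_def)
    show "{i \<in> index_set m. \<kappa> i = Some p} = {}" using that idxK by (force simp: \<kappa>_def split: if_splits)
  qed
  have finS: "finite {(n', k'). k' \<in> K \<and> pos n' k' = pos n k}" if "k \<in> K" for n k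
  proof (rule finite_subset)
    show "{(n', k'). k' \<in> K \<and> pos n' k' = pos n k} \<subseteq> {n} \<times> K" using pos_eq_iff that by (auto simp: K_def)
  qed (simp add: K_def)
  have "\<exists>lam. lam ` index_set m = Z \<and> (\<forall>z\<in>Z. finite {i \<in> index_set m. lam i = z} \<and> card {i \<in> index_set m. lam i = z} = w z) \<and>
      (\<forall>i\<in>index_set m. \<rho> (lam i) = \<kappa> i)"
  proof (rule exists_numbering_of_cells)
    show "w z > 0" if "z \<in> Z" for z using w(2)[OF that] .
    show "finite {i \<in> index_set m. \<kappa> i = cc}" for cc
    proof (cases cc)
      case None
      then show ?thesis using IN by (simp add: K_def)
    next
      case (Some p)
      show ?thesis
      proof (cases "\<exists>n. \<exists>k\<in>K. int N0 < \<bar>n\<bar> \<and> p = pos n k")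
        case True
        then obtain n k where nk: "k \<in> K" "int N0 < \<bar>n\<bar>" "p = pos n k" by blast
        show ?thesis unfolding Some nk(3) cell_S(2)[OF nk(1,2)] by (rule finS[OF nk(1)])
      next
        case False
        show ?thesis unfolding Some cell_empty(2)[OF False] by simp
      qed
    qed
    show "finite {z \<in> Z. \<rho> z = cc}" for cc
    proof (cases cc)
      case None
      then show ?thesis using ZN fin[of 0 \<rho>0] by simp
    next
      case (Some p)
      show ?thesis
      proof (cases "\<exists>n. \<exists>k\<in>K. int N0 < \<bar>n\<bar> \<and> p = pos n k")
        case True
        then obtain n k where nk: "k \<in> K" "int N0 < \<bar>n\<bar>" "p = pos n k" by blast
        show ?thesis unfolding Some nk(3) cell_S(1)[OF nk(1,2)] using fin by simp
      next
        case False
        show ?thesis unfolding Some cell_empty(1)[OF False] by simp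
      qed
    qed
    show "card {i \<in> index_set m. \<kappa> i = cc} = (\<Sum>z | z \<in> Z \<and> \<rho> z = cc. w z)" for cc
    proof -
      have "int (card {i \<in> index_set m. \<kappa> i = cc}) = (\<Sum>z | z \<in> Z \<and> \<rho> z = cc. zorder \<Delta> z)"
      proof (cases cc)
        case None
        \<comment> \<open>The \<open>m - 1\<close> indices missing from the index set match the zero of \<open>l ^ (m - 1)\<close>.\<close>
        have "card ({0::int} \<times> {m+2..2*m}) = m - 1" by simp
        moreover have "card {i \<in> index_set m. \<kappa> i = None} = card ({- int N0..int N0} \<times> K) - card ({0::int} \<times> {m+2..2*m})"
          unfolding IN by (rule card_Diff_subset) (auto simp: K_def)
        moreover have "card ({0::int} \<times> {m+2..2*m}) \<le> card ({- int N0..int N0} \<times> K)"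
          by (rule card_mono) (auto simp: K_def)
        ultimately show ?thesis using big unfolding None ZN by linarith
      next
        case (Some p)
        show ?thesis
        proof (cases "\<exists>n. \<exists>k\<in>K. int N0 < \<bar>n\<bar> \<and> p = pos n k")
          case True
          then obtain n k where nk: "k \<in> K" "int N0 < \<bar>n\<bar>" "p = pos n k" by blast
          show ?thesis using small[OF nk(1,2)] cell_S[OF nk(1,2)] nk(3) Some by simp
        next
          case False
          show ?thesis unfolding Some cell_empty[OF False] by simp
        qed
      qed
      also have "\<dots> = (\<Sum>z | z \<in> Z \<and> \<rho> z = cc. int (w z))" by (rule sum.cong) (use w(1) in auto)
      finally show ?thesis by (simp only: of_nat_sum[symmetric] of_nat_eq_iff)
    qed
  qed
  then obtain lam where lam: "lam ` index_set m = Z" 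
     "\<And>z. z \<in> Z \<Longrightarrow> finite {i \<in> index_set m. lam i = z} \<and> card {i \<in> index_set m. lam i = z} = w z"
     "\<And>i. i \<in> index_set m \<Longrightarrow> \<rho> (lam i) = \<kappa> i" by blast
  define \<gamma>a where "\<gamma>a = \<delta> / 8"
  define \<gamma>b where "\<gamma>b = norm c * (\<delta> / 8) ^ (2*m - 1)"
  have \<gamma>: "\<gamma>a > 0" "\<gamma>b > 0" using \<delta> c0 by (auto simp: \<gamma>a_def \<gamma>b_def)
  define C' where "C' = 3 * C / \<gamma>a + 3 * C / \<gamma>b"
  have asym: "norm (lam (n, k) - of_real (pos n k)) \<le> C' / \<bar>real_of_int n\<bar>" if k: "k \<in> {1..2*m}" and n: "int N0 < \<bar>n\<bar>" for n k
  proof -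
    have kK: "k \<in> K" using k by (simp add: K_def)
    define l where "l = lam (n, k)"
    have i: "(n, k) \<in> index_set m" using idx[of "(n, k)"] n kK by simp
    have lZ: "\<Delta> l = 0" using lam(1) i by (auto simp: Z_def l_def)
    have "\<rho> l = Some (pos n k)" using lam(3)[OF i] n by (simp add: l_def \<kappa>_def)
    then have nr: "norm (l - of_real (pos n k)) < \<delta>" using \<rho>Some[OF lZ] unfolding near_pos_def by blast
    define d where "d = norm (l - of_real (pos n k))"
    define a b where "a = norm (fac (2*m) l)" and "b = norm (c * (\<Prod>k=1..2*m-1. fac k l))"
    have n1: "1 \<le> \<bar>real_of_int n\<bar>" using n by linarith
    have "norm (complex_of_real (pos n k)) \<le> norm l + d" unfolding d_def
      using norm_triangle_ineq4[of l "l - of_real (pos n k)"] by simp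
    then have ln: "\<bar>real_of_int n\<bar> \<le> norm l" using pos_bounds(3)[OF k, of n] nr n1 \<delta> unfolding d_def by simp
    define \<epsilon> where "\<epsilon> = C / norm l"
    have \<epsilon>: "0 \<le> \<epsilon>" "\<epsilon> \<le> C / \<bar>real_of_int n\<bar>" 
    proof -
      have "0 < norm l" "0 < \<bar>real_of_int n\<bar>" using ln n1 by linarith+
      then have "0 < norm l * \<bar>real_of_int n\<bar>" by (rule mult_pos_pos)
      then show "0 \<le> \<epsilon>" "\<epsilon> \<le> C / \<bar>real_of_int n\<bar>" using C ln unfolding \<epsilon>_def by (simp, intro divide_left_mono)
    qed
    have "norm l \<ge> R" using far[OF kK n, of l] nr N0 \<delta> by (simp add: \<rho>0_def)
    moreover have "\<bar>Im l\<bar> \<le> 1" using abs_Im_le_cmod[of "l - of_real (pos n k)"] nr \<delta>_le by simp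
    ultimately have "norm (l ^ (m - 1) * \<Delta> l - F l) \<le> \<epsilon> * (a + b) + \<epsilon>\<^sup>2" unfolding \<epsilon>_def a_def b_def by (rule near)
    then have ab: "a * b \<le> \<epsilon> * (a + b) + \<epsilon>\<^sup>2" by (simp add: lZ F_split norm_mult a_def b_def)
    \<comment> \<open>The inequality says \<open>(a - \<epsilon>) (b - \<epsilon>) \<le> 2 \<epsilon>\<^sup>2\<close>.\<close>
    have "a \<le> 3 * \<epsilon> \<or> b \<le> 3 * \<epsilon>"
    proof (rule ccontr)
      assume "\<not> (a \<le> 3 * \<epsilon> \<or> b \<le> 3 * \<epsilon>)"
      then have "2 * \<epsilon> < a - \<epsilon>" "2 * \<epsilon> < b - \<epsilon>" by auto
      then have "(2 * \<epsilon>) * (2 * \<epsilon>) < (a - \<epsilon>) * (b - \<epsilon>)" using \<epsilon> by (intro mult_strict_mono') auto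
      moreover have "(2 * \<epsilon>) * (2 * \<epsilon>) = 4 * \<epsilon>\<^sup>2" by (simp add: power2_eq_square)
      moreover have "(a - \<epsilon>) * (b - \<epsilon>) = a * b - \<epsilon> * (a + b) + \<epsilon>\<^sup>2" by (simp add: algebra_simps power2_eq_square)
      ultimately show False using ab zero_le_power2[of \<epsilon>] by linarith
    qed
    moreover have "\<gamma>a * d \<le> a" "\<gamma>b * d \<le> b"
      using near_zero_lower_bounds[OF k nr] by (simp_all add: \<gamma>a_def \<gamma>b_def d_def a_def b_def)
    ultimately have "\<gamma>a * d \<le> 3 * \<epsilon> \<or> \<gamma>b * d \<le> 3 * \<epsilon>" by linarith
    then have "d \<le> 3 * \<epsilon> / \<gamma>a \<or> d \<le> 3 * \<epsilon> / \<gamma>b" using \<gamma> by (simp add: pos_le_divide_eq mult.commute)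
    then have "d \<le> 3 * \<epsilon> / \<gamma>a + 3 * \<epsilon> / \<gamma>b" using \<gamma> \<epsilon> by (auto intro: add_increasing add_increasing2)
    also have "\<dots> \<le> 3 * (C / \<bar>real_of_int n\<bar>) / \<gamma>a + 3 * (C / \<bar>real_of_int n\<bar>) / \<gamma>b"
      using \<gamma> \<epsilon> by (intro add_mono divide_right_mono mult_left_mono) auto
    also have "\<dots> = C' / \<bar>real_of_int n\<bar>" by (simp add: C'_def add_divide_distrib mult.commute)
    finally show ?thesis by (simp add: d_def l_def)
  qed
  show ?thesis
    by (rule exI[of _ lam], rule exI[of _ C'], rule exI[of _ N0]) (use lam w asym in \<open>auto simp: Z_def\<close>)
qed

end

section \<open>Asymptotics of the characteristic function and of the eigenvalues\<close>

lemma of_real_Ints_iff: "complex_of_real x \<in> \<int> \<longleftrightarrow> x \<in> \<int>"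
proof
  assume "complex_of_real x \<in> \<int>"
  then obtain n where "complex_of_real x = of_int n" by (auto elim: Ints_cases)
  then have "x = of_int n" by (metis Re_complex_of_real Re_complex_of_real of_real_of_int_eq)
  then show "x \<in> \<int>" by simp
next
  assume "x \<in> \<int>"
  then show "complex_of_real x \<in> \<int>" by (auto elim!: Ints_cases)
qed

lemma exists_separation:
  fixes \<beta> :: "nat \<Rightarrow> real"
  assumes "finite K" "\<And>k. k \<in> K \<Longrightarrow> \<bar>\<beta> k\<bar> < 1"
  shows "\<exists>\<delta>>0. (\<forall>k\<in>K. 2 * \<delta> \<le> 1 - \<bar>\<beta> k\<bar>) \<and> (\<forall>j\<in>K. \<forall>k\<in>K. \<beta> j \<noteq> \<beta> k \<longrightarrow> 2 * \<delta> \<le> \<bar>\<beta> j - \<beta> k\<bar>)"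
proof -
  define S where "S = insert 1 ((\<lambda>k. 1 - \<bar>\<beta> k\<bar>) ` K \<union> (\<lambda>(j, k). \<bar>\<beta> j - \<beta> k\<bar>) ` {(j, k). j \<in> K \<and> k \<in> K \<and> \<beta> j \<noteq> \<beta> k})"
  have "finite {(j, k). j \<in> K \<and> k \<in> K \<and> \<beta> j \<noteq> \<beta> k}"
    by (rule finite_subset[of _ "K \<times> K"]) (use assms(1) in auto)
  then have fS: "finite S" using assms(1) by (simp add: S_def)
  have ne: "S \<noteq> {}" by (simp add: S_def)
  have pos: "\<And>s. s \<in> S \<Longrightarrow> s > 0" using assms(2) by (auto simp: S_def)
  show ?thesis
  proof (intro exI[of _ "Min S / 2"] conjI ballI impI)
    show "Min S / 2 > 0" using pos Min_in[OF fS ne] by simp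
    show "2 * (Min S / 2) \<le> 1 - \<bar>\<beta> k\<bar>" if "k \<in> K" for k
      using Min_le[OF fS, of "1 - \<bar>\<beta> k\<bar>"] that by (simp add: S_def)
    show "2 * (Min S / 2) \<le> \<bar>\<beta> j - \<beta> k\<bar>" if "j \<in> K" "k \<in> K" "\<beta> j \<noteq> \<beta> k" for j k
    proof -
      have "\<bar>\<beta> j - \<beta> k\<bar> \<in> S" unfolding S_def using that by (intro insertI2 UnI2 image_eqI[of _ _ "(j, k)"]) auto
      from Min_le[OF fS this] show ?thesis by simp
    qed
  qed
qed

lemma char_fun_holomorphic:
  assumes "m \<ge> 1" and "\<And>j. j \<in> {1..m} \<Longrightarrow> continuous_on {0..pi} (p j)"
    and "\<And>j. j \<in> {1..m} \<Longrightarrow> q j absolutely_integrable_on {0..pi}"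
  shows "char_fun m p q holomorphic_on UNIV"
  unfolding char_fun_def d_loop_def
  by (intro holomorphic_intros sol_holomorphic assms) (use \<open>m \<ge> 1\<close> in auto)

text \<open>
  One factor \<open>l\<close> for each \<open>S\<close>: both kinds of summands of the characteristic function contain exactly \<open>m - 1\<close>
  of them.
\<close>

lemma scaled_char_fun:
  assumes m: "m \<ge> 2"
  shows "l ^ (m - 1) * char_fun m p q l =
     (l * sol_S (p m) (q m) l pi) * (\<Sum>j\<in>{1..m-1}. D1 (sol_S (p j) (q j) l) pi * (\<Prod>k\<in>{1..m-1}-{j}. l * sol_S (p k) (q k) l pi))
     + d_loop (p m) (q m) l * (\<Prod>k\<in>{1..m-1}. l * sol_S (p k) (q k) l pi)"
proof -
  have 1: "(\<Prod>k\<in>{1..m-1}. l * sol_S (p k) (q k) l pi) = l ^ (m - 1) * (\<Prod>k=1..m-1. sol_S (p k) (q k) l pi)"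
    by (simp add: prod.distrib)
  have 2: "(l * sol_S (p m) (q m) l pi) * (D1 (sol_S (p j) (q j) l) pi * (\<Prod>k\<in>{1..m-1}-{j}. l * sol_S (p k) (q k) l pi))
     = l ^ (m - 1) * (D1 (sol_S (p j) (q j) l) pi * (\<Prod>k\<in>{1..m}-{j}. sol_S (p k) (q k) l pi))" if j: "j \<in> {1..m-1}" for j
  proof -
    define J where "J = {1..m-1} - {j}"
    have e: "{1..m} - {j} = insert m J" "finite J" "m \<notin> J" using j m by (auto simp: J_def)
    have "m - 1 = Suc (card J)" using card.remove[of "{1..m-1}" j] j by (simp add: J_def)
    then have lm: "l ^ (m - 1) = l * l ^ card J" by simp
    show ?thesis unfolding J_def[symmetric] e(1) lm using e(2,3) by (simp add: prod.distrib mult_ac)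
  qed
  have 3: "(l * sol_S (p m) (q m) l pi) * (\<Sum>j\<in>{1..m-1}. D1 (sol_S (p j) (q j) l) pi * (\<Prod>k\<in>{1..m-1}-{j}. l * sol_S (p k) (q k) l pi))
     = l ^ (m - 1) * (\<Sum>j\<in>{1..m-1}. D1 (sol_S (p j) (q j) l) pi * (\<Prod>k\<in>{1..m}-{j}. sol_S (p k) (q k) l pi))"
    unfolding sum_distrib_left by (intro sum.cong refl 2)
  show ?thesis unfolding 3 1 by (simp add: char_fun_def distrib_left mult.left_commute)
qed

text \<open>
  The limits of the two sums in \<open>scaled_char_fun\<close>: \<open>limit_prod\<close> is \<open>W\<close>, \<open>limit_sum\<close> is \<open>T = W' / \<pi>\<close>, and
  \<open>secular\<close> is \<open>E = 2 cos (\<pi> l / 2) T - 4 sin (\<pi> l / 2) W\<close>.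
\<close>

definition limit_sum :: "nat \<Rightarrow> (nat \<Rightarrow> real) \<Rightarrow> complex \<Rightarrow> complex" where
  "limit_sum m \<alpha> l = (\<Sum>j\<in>{1..m-1}. cos (of_real pi * (l - of_real (\<alpha> j))) * (\<Prod>k\<in>{1..m-1}-{j}. sin (of_real pi * (l - of_real (\<alpha> k)))))"

definition limit_prod :: "nat \<Rightarrow> (nat \<Rightarrow> real) \<Rightarrow> complex \<Rightarrow> complex" where
  "limit_prod m \<alpha> l = (\<Prod>k\<in>{1..m-1}. sin (of_real pi * (l - of_real (\<alpha> k))))"

definition secular :: "nat \<Rightarrow> (nat \<Rightarrow> real) \<Rightarrow> complex \<Rightarrow> complex" where
  "secular m \<alpha> l = 2 * cos (of_real pi * l / 2) * limit_sum m \<alpha> l - 4 * sin (of_real pi * l / 2) * limit_prod m \<alpha> l"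

context
  fixes m :: nat and p q :: "nat \<Rightarrow> real \<Rightarrow> complex" and \<alpha> :: "nat \<Rightarrow> real"
  assumes m: "m \<ge> 2"
    and ac: "\<And>j. j \<in> {1..m} \<Longrightarrow> abs_cont_on 0 pi (p j)"
    and q: "\<And>j. j \<in> {1..m} \<Longrightarrow> q j absolutely_integrable_on {0..pi}"
    and alpha: "\<And>j. j \<in> {1..m} \<Longrightarrow> alpha p j = of_real (\<alpha> j)" and alpha_m: "\<alpha> m = 0"
begin

lemma secular_times_sin:
  "sin (of_real pi * l / 2) * secular m \<alpha> l = sin (of_real pi * l) * limit_sum m \<alpha> l + (2 * cos (of_real pi * l) - 2) * limit_prod m \<alpha> l"
proof -
  have s: "sin (of_real pi * l) = 2 * sin (of_real pi * l / 2) * cos (of_real pi * l / 2)" using sin_double[of "of_real pi * l / 2"] by simp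
  have c: "cos (of_real pi * l) = 1 - 2 * sin (of_real pi * l / 2) ^ 2" using cos_double_sin[of "of_real pi * l / 2"] by simp
  show ?thesis unfolding secular_def s c by (simp add: algebra_simps power2_eq_square)
qed

lemma uniform_edge_asymptotics:
  "\<exists>C R. C \<ge> 0 \<and> R \<ge> 1 \<and> (\<forall>j\<in>{1..m}. \<forall>l. norm l \<ge> R \<longrightarrow> 
     norm (l * sol_S (p j) (q j) l pi - sin (of_real pi * (l - of_real (\<alpha> j)))) \<le> C / norm l * exp (pi * \<bar>Im l\<bar>) \<and>
     norm (D1 (sol_S (p j) (q j) l) pi - cos (of_real pi * (l - of_real (\<alpha> j)))) \<le> C / norm l * exp (pi * \<bar>Im l\<bar>) \<and>
     norm (sol_C (p j) (q j) l pi - cos (of_real pi * (l - of_real (\<alpha> j)))) \<le> C / norm l * exp (pi * \<bar>Im l\<bar>) \<and>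
     norm (D1 (sol_C (p j) (q j) l) pi / l + sin (of_real pi * (l - of_real (\<alpha> j)))) \<le> C / norm l * exp (pi * \<bar>Im l\<bar>))"
proof -
  define P where "P = (\<lambda>j C R. C \<ge> 0 \<and> R \<ge> 1 \<and> (\<forall>l. norm l \<ge> R \<longrightarrow> 
     norm (l * sol_S (p j) (q j) l pi - sin (of_real pi * (l - of_real (\<alpha> j)))) \<le> C / norm l * exp (pi * \<bar>Im l\<bar>) \<and>
     norm (D1 (sol_S (p j) (q j) l) pi - cos (of_real pi * (l - of_real (\<alpha> j)))) \<le> C / norm l * exp (pi * \<bar>Im l\<bar>) \<and>
     norm (sol_C (p j) (q j) l pi - cos (of_real pi * (l - of_real (\<alpha> j)))) \<le> C / norm l * exp (pi * \<bar>Im l\<bar>) \<and>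
     norm (D1 (sol_C (p j) (q j) l) pi / l + sin (of_real pi * (l - of_real (\<alpha> j)))) \<le> C / norm l * exp (pi * \<bar>Im l\<bar>)))"
  have "\<exists>C R. P j C R" if j: "j \<in> {1..m}" for j
  proof -
    have "integral {0..pi} (p j) = of_real pi * of_real (\<alpha> j)" using alpha[OF j] by (simp add: alpha_def field_simps)
    then have "l * of_real pi - integral {0..pi} (p j) = of_real pi * (l - of_real (\<alpha> j))" for l by (simp add: algebra_simps)
    then show ?thesis using edge_asymptotics[OF ac[OF j] q[OF j]] unfolding P_def by simp
  qed
  then obtain C R where CR: "\<And>j. j \<in> {1..m} \<Longrightarrow> P j (C j) (R j)" by metis
  have C0: "0 \<le> C j" and R0: "1 \<le> R j" if "j \<in> {1..m}" for j using CR[OF that] by (auto simp: P_def)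
  have le: "C j \<le> sum C {1..m}" "R j \<le> sum R {1..m}" if "j \<in> {1..m}" for j
    using that C0 R0 by (auto intro!: member_le_sum intro: order_trans[of 0 1])
  have "P j (sum C {1..m}) (sum R {1..m})" if j: "j \<in> {1..m}" for j
    unfolding P_def
  proof (intro conjI allI impI)
    show "0 \<le> sum C {1..m}" "1 \<le> sum R {1..m}" using C0[OF j] R0[OF j] le[OF j] by linarith+
    fix l :: complex assume "sum R {1..m} \<le> norm l"
    then have l: "R j \<le> norm l" "1 \<le> norm l" using le[OF j] R0[OF j] by linarith+
    have mono: "C j / norm l * exp (pi * \<bar>Im l\<bar>) \<le> sum C {1..m} / norm l * exp (pi * \<bar>Im l\<bar>)"
      using le[OF j] l by (intro mult_right_mono divide_right_mono) auto
    show "norm (l * sol_S (p j) (q j) l pi - sin (of_real pi * (l - of_real (\<alpha> j)))) \<le> sum C {1..m} / norm l * exp (pi * \<bar>Im l\<bar>)"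
     "norm (D1 (sol_S (p j) (q j) l) pi - cos (of_real pi * (l - of_real (\<alpha> j)))) \<le> sum C {1..m} / norm l * exp (pi * \<bar>Im l\<bar>)"
     "norm (sol_C (p j) (q j) l pi - cos (of_real pi * (l - of_real (\<alpha> j)))) \<le> sum C {1..m} / norm l * exp (pi * \<bar>Im l\<bar>)"
     "norm (D1 (sol_C (p j) (q j) l) pi / l + sin (of_real pi * (l - of_real (\<alpha> j)))) \<le> sum C {1..m} / norm l * exp (pi * \<bar>Im l\<bar>)"
      using CR[OF j] l(1) mono unfolding P_def by (blast intro: order_trans)+
  qed
  moreover have "1 \<in> {1..m}" using m by simp
  ultimately show ?thesis unfolding P_def by (intro exI[of _ "sum C {1..m}"] exI[of _ "sum R {1..m}"]) blast
qed

text \<open>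
  Insert the edge asymptotics into the two perturbation estimates.  For the estimate near the real axis
  it remains to see that \<open>sin (\<pi> l)\<close>, \<open>cos (\<pi> l) - 1\<close> and \<open>T\<close> are bounded by a multiple of \<open>|sin (\<pi> l / 2)| + |E|\<close>.
  The first two contain the factor \<open>sin (\<pi> l / 2)\<close>.  For \<open>T\<close>, either \<open>|sin (\<pi> l / 2)| \<ge> 1/2\<close>, or
  \<open>cos (\<pi> l / 2)\<close> is bounded below and \<open>2 cos (\<pi> l / 2) T = E + 4 sin (\<pi> l / 2) W\<close>.
\<close>

lemma char_fun_approximation:
  "\<exists>C R. C \<ge> 0 \<and> (\<forall>l. norm l \<ge> R \<longrightarrow> 
     norm (l ^ (m - 1) * char_fun m p q l - sin (of_real pi * l / 2) * secular m \<alpha> l) \<le> C / norm l * exp (m * pi * \<bar>Im l\<bar>) \<and>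
     (\<bar>Im l\<bar> \<le> 1 \<longrightarrow> norm (l ^ (m - 1) * char_fun m p q l - sin (of_real pi * l / 2) * secular m \<alpha> l)
        \<le> C / norm l * (norm (sin (of_real pi * l / 2)) + norm (secular m \<alpha> l)) + (C / norm l)\<^sup>2))"
proof -
  obtain C0 R where C0: "C0 \<ge> 0" and R: "R \<ge> 1" and asy: "\<And>j l. j \<in> {1..m} \<Longrightarrow> norm l \<ge> R \<Longrightarrow>
     norm (l * sol_S (p j) (q j) l pi - sin (of_real pi * (l - of_real (\<alpha> j)))) \<le> C0 / norm l * exp (pi * \<bar>Im l\<bar>) \<and>
     norm (D1 (sol_S (p j) (q j) l) pi - cos (of_real pi * (l - of_real (\<alpha> j)))) \<le> C0 / norm l * exp (pi * \<bar>Im l\<bar>) \<and>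
     norm (sol_C (p j) (q j) l pi - cos (of_real pi * (l - of_real (\<alpha> j)))) \<le> C0 / norm l * exp (pi * \<bar>Im l\<bar>) \<and>
     norm (D1 (sol_C (p j) (q j) l) pi / l + sin (of_real pi * (l - of_real (\<alpha> j)))) \<le> C0 / norm l * exp (pi * \<bar>Im l\<bar>)"
    using uniform_edge_asymptotics by blast
  define I where "I = {1..m-1}"
  define k where "k = m - 1"
  have I: "finite I" "card I = k" "\<And>j. j \<in> I \<Longrightarrow> j \<in> {1..m}" and k: "Suc k = m" and mm: "m \<in> {1..m}"
    using m by (auto simp: I_def k_def)
  define G where "G = exp (pi::real)"
  have G1: "G \<ge> 1" by (simp add: G_def)
  then have Gk: "G ^ k \<ge> 1" by simp
  define n where "n = real k"
  \<comment> \<open>\<open>G\<close> bounds \<open>exp (\<pi> |Im l|)\<close> in the strip \<open>|Im l| \<le> 1\<close>; \<open>\<kappa>\<close> collects all constants that occur there.\<close>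
  define \<kappa> where "\<kappa> = 2 * G + 2 * n * G ^ k + 4 * G ^ k + 1"
  have \<kappa>: "\<kappa> \<ge> 1" "\<kappa> \<ge> 2 * G" "\<kappa> \<ge> 2 * n * G ^ k" "\<kappa> \<ge> 4 * G ^ k" using G1 Gk by (auto simp: \<kappa>_def n_def)
  define K1 where "K1 = (3 * n + 8) * 2 ^ k"
  define K2 where "K2 = (n * 2 ^ k + \<kappa> + \<kappa> * n * 2 ^ k + (2 + 4 * \<kappa>) * 2 ^ Suc k + 3 * \<kappa> * 2 ^ k) * G ^ (k + 2)"
  have K0: "K1 \<ge> 0" "K2 \<ge> 0" using \<kappa> G1 by (auto simp: K1_def K2_def n_def)
  define C where "C = (K1 + K2 + 1) * C0"
  show ?thesis
  proof (rule exI[of _ C], rule exI[of _ "max R C0"], intro conjI allI impI)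
    show "C \<ge> 0" using K0 C0 by (simp add: C_def)
    fix l :: complex assume "max R C0 \<le> norm l"
    then have l: "R \<le> norm l" "C0 \<le> norm l" "1 \<le> norm l" using R by auto
    then have l0: "l \<noteq> 0" "norm l > 0" by auto
    define \<epsilon> where "\<epsilon> = C0 / norm l"
    have \<epsilon>: "0 \<le> \<epsilon>" "\<epsilon> \<le> 1" using C0 l l0 by (auto simp: \<epsilon>_def divide_le_eq)
    have CK: "K1 * \<epsilon> \<le> C / norm l" "K2 * \<epsilon> \<le> C / norm l" "K2 * \<epsilon>\<^sup>2 \<le> (C / norm l)\<^sup>2"
    proof -
      have e: "C / norm l = (K1 + K2 + 1) * \<epsilon>" by (simp add: C_def \<epsilon>_def)
      show "K1 * \<epsilon> \<le> C / norm l" "K2 * \<epsilon> \<le> C / norm l" unfolding e using K0 \<epsilon> by (auto intro!: mult_right_mono)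
      have "1 * (K1 + K2 + 1) \<le> (K1 + K2 + 1) * (K1 + K2 + 1)" using K0 by (intro mult_right_mono) auto
      moreover have "K2 \<le> 1 * (K1 + K2 + 1)" using K0 by simp
      ultimately have "K2 \<le> (K1 + K2 + 1)\<^sup>2" unfolding power2_eq_square by linarith
      then show "K2 * \<epsilon>\<^sup>2 \<le> (C / norm l)\<^sup>2" unfolding e power_mult_distrib by (intro mult_right_mono) auto
    qed
    define s s0 c c0 where "s = (\<lambda>j. l * sol_S (p j) (q j) l pi)" and "s0 = (\<lambda>j. sin (of_real pi * (l - of_real (\<alpha> j))))"
      and "c = (\<lambda>j. D1 (sol_S (p j) (q j) l) pi)" and "c0 = (\<lambda>j. cos (of_real pi * (l - of_real (\<alpha> j))))"
    define Cm where "Cm = sol_C (p m) (q m) l pi"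
    define t where "t = - (D1 (sol_C (p m) (q m) l) pi / l)"
    define T where "T = (\<Sum>j\<in>I. c j * (\<Prod>k\<in>I-{j}. s k))"
    define W where "W = (\<Prod>k\<in>I. s k)"
    define d where "d = d_loop (p m) (q m) l"
    have D: "l ^ (m - 1) * char_fun m p q l = s m * T + d * W"
      unfolding scaled_char_fun[OF m] by (simp add: s_def c_def T_def W_def d_def I_def)
    have T0: "limit_sum m \<alpha> l = (\<Sum>j\<in>I. c0 j * (\<Prod>k\<in>I-{j}. s0 k))" and W0: "limit_prod m \<alpha> l = (\<Prod>k\<in>I. s0 k)"
      by (simp_all add: limit_sum_def limit_prod_def I_def s0_def c0_def)
    have D0: "sin (of_real pi * l / 2) * secular m \<alpha> l = s0 m * limit_sum m \<alpha> l + (2 * c0 m - 2) * limit_prod m \<alpha> l"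
      unfolding secular_times_sin by (simp add: s0_def c0_def alpha_m)
    define e where "e = exp (pi * \<bar>Im l\<bar>)"
    have e1: "e \<ge> 1" by (simp add: e_def)
    have sc0: "norm (s0 j) \<le> e" "norm (c0 j) \<le> e" for j
    proof -
      have "\<bar>Im (of_real pi * (l - of_real (\<alpha> j)))\<bar> = pi * \<bar>Im l\<bar>" by (simp add: abs_mult)
      then show "norm (s0 j) \<le> e" "norm (c0 j) \<le> e" using norm_sin_cos_le[of "of_real pi * (l - of_real (\<alpha> j))"] by (simp_all add: s0_def c0_def e_def)
    qed
    have diffs: "norm (s j - s0 j) \<le> \<epsilon> * e" "norm (c j - c0 j) \<le> \<epsilon> * e" if "j \<in> {1..m}" for j
      using asy[OF that l(1)] by (simp_all add: s_def s0_def c_def c0_def \<epsilon>_def e_def)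
    have diffm: "norm (Cm - c0 m) \<le> \<epsilon> * e" "norm (t - s0 m) \<le> \<epsilon> * e"
      using asy[OF mm l(1)] norm_minus_commute[of t "s0 m"] by (simp_all add: Cm_def c0_def s0_def t_def \<epsilon>_def e_def add.commute)
    have dd: "d = c m + Cm - 2" by (simp add: d_def d_loop_def c_def Cm_def)
    have "norm (s m * T + d * W - (s0 m * limit_sum m \<alpha> l + (2 * c0 m - 2) * limit_prod m \<alpha> l)) \<le> (3 * n + 8) * 2 ^ k * \<epsilon> * e ^ Suc k"
    proof (rule char_approx_global)
      show "norm (limit_sum m \<alpha> l) \<le> n * e ^ k" "norm (T - limit_sum m \<alpha> l) \<le> n * 2 ^ k * \<epsilon> * e ^ k"
        unfolding T0 T_def n_def using norm_symmetric_sum_approx[of I s0 e c0 s \<epsilon> c] I sc0 diffs \<epsilon> e1 by auto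
      show "norm (limit_prod m \<alpha> l) \<le> e ^ k" "norm (W - limit_prod m \<alpha> l) \<le> 2 ^ k * \<epsilon> * e ^ k"
        unfolding W0 W_def using norm_prod_approx[of I s0 e s \<epsilon>] I sc0 diffs \<epsilon> e1 by auto
      have "norm (2 * c0 m - 2) \<le> norm (2 * c0 m) + norm (2::complex)" by (rule norm_triangle_ineq4)
      then show "norm (2 * c0 m - 2) \<le> 4 * e" using sc0(2)[of m] e1 by (simp add: norm_mult)
      have "d - (2 * c0 m - 2) = (c m - c0 m) + (Cm - c0 m)" by (simp add: dd)
      also have "norm \<dots> \<le> \<epsilon> * e + \<epsilon> * e" by (intro norm_triangle_mono diffs diffm mm)
      finally show "norm (d - (2 * c0 m - 2)) \<le> 2 * \<epsilon> * e" by simp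
    qed (use sc0 diffs mm \<epsilon> e1 in \<open>auto simp: n_def\<close>)
    also have "\<dots> = K1 * \<epsilon> * e ^ m" by (simp add: K1_def k)
    also have "\<dots> \<le> C / norm l * e ^ m" using CK(1) e1 by (intro mult_right_mono) auto
    also have "e ^ m = exp (m * pi * \<bar>Im l\<bar>)" by (simp add: e_def mult.assoc flip: exp_of_nat_mult)
    finally show "norm (l ^ (m - 1) * char_fun m p q l - sin (of_real pi * l / 2) * secular m \<alpha> l) \<le> C / norm l * exp (m * pi * \<bar>Im l\<bar>)"
      unfolding D D0 .
    assume Iml: "\<bar>Im l\<bar> \<le> 1"
    have eG: "e \<le> G" using Iml mult_left_mono[OF Iml, of pi] by (simp add: e_def G_def)
    have \<epsilon>G: "\<epsilon> * e \<le> \<epsilon> * G" using \<epsilon> eG by (intro mult_left_mono) auto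
    define A B where "A = norm (sin (of_real pi * l / 2))" and "B = norm (secular m \<alpha> l)"
    have AB0: "A \<ge> 0" "B \<ge> 0" by (auto simp: A_def B_def)
    have half: "norm (sin (of_real pi * l / 2)) \<le> G" "norm (cos (of_real pi * l / 2)) \<le> G"
    proof -
      have "exp \<bar>Im (of_real pi * l / 2)\<bar> \<le> e" by (simp add: e_def abs_mult)
      then show "norm (sin (of_real pi * l / 2)) \<le> G" "norm (cos (of_real pi * l / 2)) \<le> G"
        using norm_sin_cos_le[of "of_real pi * l / 2"] eG by linarith+
    qed
    have sm0: "s0 m = 2 * sin (of_real pi * l / 2) * cos (of_real pi * l / 2)" 
      using sin_double[of "of_real pi * l / 2"] by (simp add: s0_def alpha_m)
    have cm0: "c0 m - 1 = - 2 * sin (of_real pi * l / 2) * sin (of_real pi * l / 2)" 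
      using cos_double_sin[of "of_real pi * l / 2"] by (simp add: c0_def alpha_m power2_eq_square)
    have two: "norm (2 * x * y) \<le> \<kappa> * A" if "norm x = A" "norm y \<le> G" for x y :: complex
    proof -
      have "norm (2 * x * y) \<le> 2 * A * G" using that AB0 by (simp add: norm_mult mult_left_mono)
      also have "\<dots> = (2 * G) * A" by simp
      also have "\<dots> \<le> \<kappa> * A" using \<kappa> AB0 by (intro mult_right_mono) auto
      finally show ?thesis .
    qed
    have sG: "norm (s0 j) \<le> G" "norm (c0 j) \<le> G" for j using sc0[of j] eG by linarith+
    have dG: "norm (s j - s0 j) \<le> \<epsilon> * G" "norm (c j - c0 j) \<le> \<epsilon> * G" if "j \<in> {1..m}" for j
      using diffs[OF that] \<epsilon>G by linarith+
    have W0b: "norm (limit_prod m \<alpha> l) \<le> G ^ k" "norm (W - limit_prod m \<alpha> l) \<le> 2 ^ k * \<epsilon> * G ^ k"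
      unfolding W0 W_def using norm_prod_approx[of I s0 G s \<epsilon>] I sG dG \<epsilon> G1 by auto
    have T0b: "norm (limit_sum m \<alpha> l) \<le> n * G ^ k" "norm (T - limit_sum m \<alpha> l) \<le> n * 2 ^ k * \<epsilon> * G ^ k"
      unfolding T0 T_def n_def using norm_symmetric_sum_approx[of I s0 G c0 s \<epsilon> c] I sG dG \<epsilon> G1 by auto
    have T0AB: "norm (limit_sum m \<alpha> l) \<le> \<kappa> * (A + B)"
    proof (cases "A \<ge> 1 / 2")
      case True
      have "norm (limit_sum m \<alpha> l) \<le> (2 * n * G ^ k) * (1 / 2)" using T0b(1) by simp
      also have "\<dots> \<le> \<kappa> * (A + B)" using True AB0 \<kappa> G1 by (intro mult_mono) (auto simp: n_def)
      finally show ?thesis .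
    next
      case False
      have "1 = (cos (of_real pi * l / 2))\<^sup>2 + (sin (of_real pi * l / 2))\<^sup>2" by simp
      then have "1 \<le> (norm (cos (of_real pi * l / 2)))\<^sup>2 + A\<^sup>2"
        unfolding A_def by (metis norm_one norm_power norm_triangle_ineq)
      moreover have "A\<^sup>2 \<le> (1 / 2)\<^sup>2" using False AB0 by (intro power_mono) auto
      ultimately have "(1 / 2)\<^sup>2 \<le> (norm (cos (of_real pi * l / 2)))\<^sup>2" by (simp add: power2_eq_square)
      then have ch: "1 / 2 \<le> norm (cos (of_real pi * l / 2))" by (rule power2_le_imp_le) simp
      have "2 * cos (of_real pi * l / 2) * limit_sum m \<alpha> l = secular m \<alpha> l + 4 * sin (of_real pi * l / 2) * limit_prod m \<alpha> l" by (simp add: secular_def)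
      then have "norm (2 * cos (of_real pi * l / 2) * limit_sum m \<alpha> l) \<le> B + 4 * A * norm (limit_prod m \<alpha> l)"
        using norm_triangle_ineq[of "secular m \<alpha> l" "4 * sin (of_real pi * l / 2) * limit_prod m \<alpha> l"] by (simp add: B_def A_def norm_mult)
      moreover have "4 * A * norm (limit_prod m \<alpha> l) \<le> 4 * A * G ^ k" using W0b(1) AB0 by (intro mult_left_mono) auto
      moreover have "norm (limit_sum m \<alpha> l) \<le> norm (2 * cos (of_real pi * l / 2) * limit_sum m \<alpha> l)"
        using mult_right_mono[OF ch, of "norm (limit_sum m \<alpha> l)"] by (simp add: norm_mult)
      ultimately have "norm (limit_sum m \<alpha> l) \<le> 1 * B + (4 * G ^ k) * A" by (simp add: mult_ac)
      also have "\<dots> \<le> \<kappa> * B + \<kappa> * A" using \<kappa> AB0 by (intro add_mono mult_right_mono) auto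
      finally show ?thesis by (simp add: algebra_simps)
    qed
    \<comment> \<open>The Wronskian identity.\<close>
    have dW: "d = - t * s m - (Cm - 1) * (c m - 1)"
    proof -
      have cp: "continuous_on {0..pi} (p m)" by (rule abs_cont_on_imp_continuous[OF ac[OF mm]])
      have "Cm * c m - D1 (sol_C (p m) (q m) l) pi * sol_S (p m) (q m) l pi = 1"
        using ivp_wronskian[OF potential_abs_int[OF cp q[OF mm]] sol_C_ivp[OF cp q[OF mm]] sol_S_ivp[OF cp q[OF mm]], of pi l]
        by (simp add: Cm_def c_def)
      moreover have "- t * s m = D1 (sol_C (p m) (q m) l) pi * sol_S (p m) (q m) l pi" using l0 by (simp add: t_def s_def)
      ultimately show ?thesis by (simp add: dd algebra_simps)
    qed
    have d0: "2 * c0 m - 2 = - s0 m * s0 m - (c0 m - 1) * (c0 m - 1)"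
    proof -
      have "s0 m * s0 m + c0 m * c0 m = 1" using sin_cos_squared_add3[of "of_real pi * (l - of_real (\<alpha> m))"] by (simp add: s0_def c0_def add.commute)
      then show ?thesis by (simp add: algebra_simps)
    qed
    have "norm (s m * T + d * W - (s0 m * limit_sum m \<alpha> l + (2 * c0 m - 2) * limit_prod m \<alpha> l)) \<le> 
      (n * 2 ^ k + \<kappa> + \<kappa> * n * 2 ^ k + (2 + 4 * \<kappa>) * 2 ^ Suc k + 3 * \<kappa> * 2 ^ k) * G ^ (k + 2) * (\<epsilon> * (A + B) + \<epsilon>\<^sup>2)"
      unfolding dW d0
    proof (rule char_approx_near_axis)
      show "norm (s0 m) \<le> \<kappa> * A" unfolding sm0 by (rule two) (auto simp: A_def half)
      show "norm (c0 m - 1) \<le> \<kappa> * A" unfolding cm0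
        using two[of "- sin (of_real pi * l / 2)" "sin (of_real pi * l / 2)"] half by (simp add: A_def)
      have "norm (c0 m - 1) \<le> norm (c0 m) + norm (1::complex)" by (rule norm_triangle_ineq4)
      then show "norm (c0 m - 1) \<le> 2 * G" using sc0(2)[of m] eG G1 by simp
    qed (use sc0(1)[of m] diffs[OF mm] diffm eG \<epsilon>G \<epsilon> G1 W0b T0b T0AB AB0 \<kappa> in \<open>auto simp: n_def\<close>)
    also have "\<dots> = K2 * (\<epsilon> * (A + B) + \<epsilon>\<^sup>2)" by (simp add: K2_def)
    also have "\<dots> = K2 * \<epsilon> * (A + B) + K2 * \<epsilon>\<^sup>2" by (simp add: algebra_simps)
    also have "\<dots> \<le> C / norm l * (A + B) + (C / norm l)\<^sup>2"
      using CK AB0 by (intro add_mono mult_right_mono) auto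
    finally show "norm (l ^ (m - 1) * char_fun m p q l - sin (of_real pi * l / 2) * secular m \<alpha> l)
        \<le> C / norm l * (norm (sin (of_real pi * l / 2)) + norm (secular m \<alpha> l)) + (C / norm l)\<^sup>2"
      unfolding D D0 A_def B_def .
  qed
qed

end

theorem theorem1:
  fixes m :: nat and p q :: "nat \<Rightarrow> real \<Rightarrow> complex"
  assumes "m \<ge> 2"
    and "\<And>j. j \<in> {1..m} \<Longrightarrow> abs_cont_on 0 pi (p j)"
    and "\<And>j. j \<in> {1..m} \<Longrightarrow> q j absolutely_integrable_on {0..pi}"
    and "\<And>j. j \<in> {1..m} \<Longrightarrow> alpha p j \<in> \<real>"
    and "\<And>j k. j \<in> {1..m} \<Longrightarrow> k \<in> {1..m} \<Longrightarrow> j \<noteq> k \<Longrightarrow> \<not> cong_mod (alpha p j) (alpha p k) 1"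
    and "alpha p m = 0"
  shows "countable (eigenvalues m p q) \<and>
    (\<exists>(lam :: int \<times> nat \<Rightarrow> complex) (\<beta> :: nat \<Rightarrow> real).
       eigenvalues m p q = lam ` index_set m \<and>
       (\<forall>\<mu>\<in>eigenvalues m p q.
          finite {i \<in> index_set m. lam i = \<mu>} \<and>
          int (card {i \<in> index_set m. lam i = \<mu>}) = zorder (char_fun m p q) \<mu>) \<and>
       (\<forall>k\<in>{1..2*m}.
          (\<lambda>n. norm (lam (n, k) - (2 * of_int n + of_real (\<beta> k))))
            \<in> O[filtercomap (\<lambda>n::int. \<bar>n\<bar>) at_top](\<lambda>n. 1 / real_of_int \<bar>n\<bar>)) \<and>
       (\<forall>k\<in>{1..2*m-1}. \<beta> k \<in> {-1<..<1}) \<and>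
       inj_on \<beta> {1..2*m-1} \<and>
       \<beta> (2*m) = 0 \<and>
       (\<forall>k\<in>{1..2*m}. \<forall>j\<in>{1..m-1}. \<not> cong_mod (of_real (\<beta> k)) (alpha p j) 1))"
proof -
  note m = assms(1) and ac = assms(2) and q = assms(3)
  define \<alpha> where "\<alpha> = (\<lambda>j. Re (alpha p j))"
  have al: "alpha p j = of_real (\<alpha> j)" if "j \<in> {1..m}" for j
    using assms(4)[OF that] by (simp add: \<alpha>_def of_real_Re)
  have am: "\<alpha> m = 0" using assms(6) by (simp add: \<alpha>_def)
  have cont: "continuous_on {0..pi} (p j)" if "j \<in> {1..m}" for j by (rule abs_cont_on_imp_continuous[OF ac[OF that]])
  define I where "I = {1..m-1}"
  have I: "finite I" "card I = m - 1" "\<And>j. j \<in> I \<Longrightarrow> j \<in> {1..m} \<and> j \<noteq> m" and mm: "m \<in> {1..m}" using m by (auto simp: I_def)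
  have nc: "\<alpha> j - \<alpha> k \<notin> \<int>" if "j \<in> {1..m}" "k \<in> {1..m}" "j \<noteq> k" for j k
    using assms(5)[OF that] of_real_Ints_iff[of "\<alpha> j - \<alpha> k"] by (simp add: cong_mod_def al[OF that(1)] al[OF that(2)])
  have \<alpha>0: "\<alpha> j \<notin> \<int>" if "j \<in> I" for j using nc[of j m] I(3)[OF that] mm am by simp
  have \<alpha>d: "\<alpha> j - \<alpha> k \<notin> \<int>" if "j \<in> I" "k \<in> I" "j \<noteq> k" for j k using nc[of j k] I(3) that by blast
  have "\<exists>B c. finite B \<and> card B = 2 * card I + 1 \<and>
      (\<forall>x\<in>B. -1 < x \<and> x < 1 \<and> (\<forall>j\<in>I. x - \<alpha> j \<notin> \<int>)) \<and> c \<noteq> 0 \<and>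
      (\<forall>l. secular m \<alpha> l = c * (\<Prod>x\<in>B. sin (of_real pi * (l - of_real x) / 2)))"
    unfolding secular_def limit_sum_def limit_prod_def I_def[symmetric]
    by (rule secular_factorization[OF I(1) \<alpha>0 \<alpha>d])
  then obtain B c where Bc: "finite B \<and> card B = 2 * card I + 1 \<and>
      (\<forall>x\<in>B. -1 < x \<and> x < 1 \<and> (\<forall>j\<in>I. x - \<alpha> j \<notin> \<int>)) \<and> c \<noteq> 0 \<and>
      (\<forall>l. secular m \<alpha> l = c * (\<Prod>x\<in>B. sin (of_real pi * (l - of_real x) / 2)))"
    by (elim exE)
  then have B: "finite B" "\<And>x. x \<in> B \<Longrightarrow> -1 < x \<and> x < 1 \<and> (\<forall>j\<in>I. x - \<alpha> j \<notin> \<int>)" and c: "c \<noteq> 0"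
     and fact: "\<And>l. secular m \<alpha> l = c * (\<Prod>x\<in>B. sin (of_real pi * (l - of_real x) / 2))" by blast+
  have cardB: "card B = 2 * m - 1" using Bc I m by simp
  obtain h where h: "bij_betw h {1..2*m-1} B" using ex_bij_betw_nat_finite_1[OF B(1)] cardB by auto
  define \<beta> where "\<beta> = (\<lambda>k. if k = 2 * m then 0 else h k)"
  have \<beta>h: "\<beta> k = h k" if "k \<in> {1..2*m-1}" for k using that by (auto simp: \<beta>_def)
  have \<beta>B: "\<beta> k \<in> B" if "k \<in> {1..2*m-1}" for k using bij_betwE[OF h] \<beta>h[OF that] that by auto
  have last: "\<beta> (2*m) = 0" by (simp add: \<beta>_def)
  have inj: "inj_on \<beta> {1..2*m-1}" using h \<beta>h by (auto simp: bij_betw_def inj_on_def)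
  have split: "k = 2 * m \<or> k \<in> {1..2*m-1}" if "k \<in> {1..2*m}" for k using that by auto
  have lt1: "\<bar>\<beta> k\<bar> < 1" if "k \<in> {1..2*m}" for k
    using split[OF that] last B(2)[OF \<beta>B[of k]] by (auto simp: abs_less_iff)
  obtain \<delta> where \<delta>: "\<delta> > 0" "\<forall>k\<in>{1..2*m}. 2 * \<delta> \<le> 1 - \<bar>\<beta> k\<bar>" "\<forall>j\<in>{1..2*m}. \<forall>k\<in>{1..2*m}. \<beta> j \<noteq> \<beta> k \<longrightarrow> 2 * \<delta> \<le> \<bar>\<beta> j - \<beta> k\<bar>"
    using exists_separation[of "{1..2*m}" \<beta>] lt1 by auto
  interpret sine_product m \<beta> c \<delta>
    by unfold_locales (use m c \<delta> inj last in auto)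
  have sec: "c * (\<Prod>k=1..2*m-1. fac k l) = secular m \<alpha> l" for l
  proof -
    have "(\<Prod>k=1..2*m-1. fac k l) = (\<Prod>k=1..2*m-1. sin (of_real pi * (l - of_real (h k)) / 2))"
      by (intro prod.cong refl) (simp add: fac_def \<beta>h)
    also have "\<dots> = (\<Prod>x\<in>B. sin (of_real pi * (l - of_real x) / 2))" by (rule prod.reindex_bij_betw[OF h])
    finally show ?thesis by (simp add: fact)
  qed
  have fac2m: "fac (2*m) l = sin (of_real pi * l / 2)" for l by (simp add: fac_def last)
  have F: "F l = sin (of_real pi * l / 2) * secular m \<alpha> l" for l unfolding F_split sec fac2m ..
  have "\<exists>C R. C \<ge> 0 \<and> (\<forall>l. norm l \<ge> R \<longrightarrow>
     norm (l ^ (m - 1) * char_fun m p q l - F l) \<le> C / norm l * exp (m * pi * \<bar>Im l\<bar>) \<and>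
     (\<bar>Im l\<bar> \<le> 1 \<longrightarrow> norm (l ^ (m - 1) * char_fun m p q l - F l)
        \<le> C / norm l * (norm (fac (2*m) l) + norm (c * (\<Prod>k=1..2*m-1. fac k l))) + (C / norm l)\<^sup>2))"
    unfolding F sec fac2m by (rule char_fun_approximation[OF m ac q al am])
  then obtain C R where CR: "C \<ge> 0 \<and> (\<forall>l. norm l \<ge> R \<longrightarrow>
     norm (l ^ (m - 1) * char_fun m p q l - F l) \<le> C / norm l * exp (m * pi * \<bar>Im l\<bar>) \<and>
     (\<bar>Im l\<bar> \<le> 1 \<longrightarrow> norm (l ^ (m - 1) * char_fun m p q l - F l)
        \<le> C / norm l * (norm (fac (2*m) l) + norm (c * (\<Prod>k=1..2*m-1. fac k l))) + (C / norm l)\<^sup>2))"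
    by (elim exE)
  have hol: "char_fun m p q holomorphic_on UNIV" by (rule char_fun_holomorphic[OF _ cont q]) (use m in auto)
  have "\<exists>lam C' (N0::nat). {l. char_fun m p q l = 0} = lam ` index_set m \<and>
     (\<forall>\<mu>. char_fun m p q \<mu> = 0 \<longrightarrow> finite {i \<in> index_set m. lam i = \<mu>} \<and> int (card {i \<in> index_set m. lam i = \<mu>}) = zorder (char_fun m p q) \<mu>) \<and>
     (\<forall>n k. k \<in> {1..2*m} \<longrightarrow> int N0 < \<bar>n\<bar> \<longrightarrow> norm (lam (n, k) - of_real (pos n k)) \<le> C' / \<bar>real_of_int n\<bar>)"
    by (rule numbering_of_zeros[OF hol, of C R]) (use CR in blast)+
  then obtain lam C' and N0 :: nat where lam: "{l. char_fun m p q l = 0} = lam ` index_set m"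
     "\<And>\<mu>. char_fun m p q \<mu> = 0 \<Longrightarrow> finite {i \<in> index_set m. lam i = \<mu>} \<and> int (card {i \<in> index_set m. lam i = \<mu>}) = zorder (char_fun m p q) \<mu>"
     and asym: "\<And>n k. k \<in> {1..2*m} \<Longrightarrow> int N0 < \<bar>n\<bar> \<Longrightarrow> norm (lam (n, k) - of_real (pos n k)) \<le> C' / \<bar>real_of_int n\<bar>"
    by blast
  have ev: "eigenvalues m p q = {l. char_fun m p q l = 0}"
  proof (rule set_eqI)
    show "l \<in> eigenvalues m p q \<longleftrightarrow> l \<in> {l. char_fun m p q l = 0}" for l
      unfolding mem_Collect_eq by (rule eigenvalues_eq_zeros[OF m cont q])
  qed
  have bigo: "(\<lambda>n. norm (lam (n, k) - (2 * of_int n + of_real (\<beta> k)))) \<in> O[filtercomap (\<lambda>n::int. \<bar>n\<bar>) at_top](\<lambda>n. 1 / real_of_int \<bar>n\<bar>)"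
    if k: "k \<in> {1..2*m}" for k
  proof (rule bigoI[of _ C'])
    have "norm (norm (lam (n, k) - (2 * of_int n + of_real (\<beta> k)))) \<le> C' * norm (1 / real_of_int \<bar>n\<bar>)" if "int N0 + 1 \<le> \<bar>n\<bar>" for n
      using asym[OF k, of n] that by (simp add: pos_def)
    then show "\<forall>\<^sub>F n in filtercomap (\<lambda>n::int. \<bar>n\<bar>) at_top. norm (norm (lam (n, k) - (2 * of_int n + of_real (\<beta> k)))) \<le> C' * norm (1 / real_of_int \<bar>n\<bar>)"
      unfolding eventually_filtercomap_at_top_linorder by blast
  qed
  have ncong: "\<not> cong_mod (of_real (\<beta> k)) (alpha p j) 1" if k: "k \<in> {1..2*m}" and j: "j \<in> {1..m-1}" for k j
  proof -
    have jI: "j \<in> I" using j by (simp add: I_def)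
    have "\<beta> k - \<alpha> j \<notin> \<int>"
    proof (cases "k = 2 * m")
      case True
      then show ?thesis using \<alpha>0[OF jI] last by simp
    next
      case False
      then show ?thesis using split[OF k] B(2)[OF \<beta>B[of k]] jI by blast
    qed
    then show ?thesis using of_real_Ints_iff[of "\<beta> k - \<alpha> j"] al[of j] I(3)[OF jI] by (simp add: cong_mod_def)
  qed
  have "countable (eigenvalues m p q)" unfolding ev lam(1) by (intro countable_image countableI_type)
  moreover have "\<beta> k \<in> {-1<..<1}" if "k \<in> {1..2*m-1}" for k
  proof -
    have "k \<in> {1..2*m}" using that by auto
    from lt1[OF this] show ?thesis by (simp add: abs_less_iff)
  qed
  ultimately show ?thesis
    using lam bigo inj last ncong unfolding ev by (intro conjI exI[of _ lam] exI[of _ \<beta>]) auto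
qed

end
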